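(* For $k\ge1$ let $d_k=\sqrt2\,\pi k=k\,d_1$, and let $\ell_k>0$, $\sigma_k>0$ and the smooth branch $d\in(d_k,d_k+\ell_k)\mapsto\Psi_{k,d}$ be those provided, for each $k$, by the bifurcation theorem recalled in the context. Then: 1. For $k=1$ and $d\in(d_1,d_1+\ell_1)$, the function $\Psi_{1,d}$ has a single zero in the strip $\mathbb R\times(0,d)$, which is a vortex of degree $-1$ located at $(0,d/2)$. Moreover $R\Psi_{1,d}=\Psi_{1,d}$. 2. For every $k\ge1$ and $d\in(d_k,d_k+\ell_k)$, the function $\Psi_{k,d}$ has exactly $k$ vortices in $\mathbb R\times(0,d)$, located on the line $x=0$ at the ordinates $$y_j=\frac{d\,(2j+1)}{2k},\qquad 0\le j<k,$$ and with degree $(-1)^{j+1}$. 3. When $d\in(d_k,d_k+\min\{k\ell_1,\ell_k\})$, the solution $\Psi_{k,d}$ is equal to $\Psi_{1,d/k}$ in $\mathbb R\times(0,d/k)$ and is the restriction to the strip $\mathbb R\times(0,d)$ of the function $\Upsilon_{1,d/k}$.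
   Context: Notation. $S_0(x)=\tanh(x/\sqrt2)$ and $\chi_0(x)=1/\cosh(x/\sqrt2)$. For a width $d>0$, $\mathcal X$ is the set of $\psi:\mathbb R\times(0,d)\to\mathbb C$ with $\psi(-x,y)=-\overline{\psi(x,y)}$, $\nabla\psi\in L^2$ and $1-|\psi|^2\in L^2$ on $\mathbb R\times(0,d)$. For $\sigma>0$, $W^{2,\infty}_\sigma$ is the space of bounded functions on $\mathbb R\times(0,d)$ whose first and second derivatives $\phi$ satisfy $\phi(x,y)e^{\sigma|x|}\in L^\infty$, with its natural norm. Bifurcation theorem (providing $\ell_k,\sigma_k,\Psi_{k,d}$). For every $k\ge1$ there exist $\ell_k,\sigma_k>0$ and a smooth branch $d\mapsto\Psi_{k,d}$ from $(d_k,d_k+\ell_k)$ to $\mathcal X\cap W^{2,\infty}_{\sigma_k}$ (smoothness being understood after rescaling $y$ to a fixed strip) of solutions of $\Delta\Psi+\Psi(1-|\Psi|^2)=0$ in $\mathbb R\times(0,d)$, $\partial_n\Psi=0$ on $\mathbb R\times\{0,d\}$, such that: for $|d-d_k|<\ell_k$, $S_0$, $\Psi_{k,d}$ and $\overline{\Psi_{k,d}}$ (the last two only when $d>d_k$) are the only solutions in a neighbourhood of $S_0$ in $\mathcal X\cap W^{2,\infty}_{\sigma_k}$; and, as $d\searrow d_k$, in $W^{2,\infty}(\mathbb R\times(0,d))$, $$\Psi_{k,d}(x,y)=S_0(x)+i\Lambda\sqrt{\tfrac{d-d_k}{d_k}}\,\chi_0(x)\cos\big(\tfrac{\pi ky}{d}\big)+\mathcal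 O(d-d_k)$$ for a universal number $\Lambda>0$. The numbers $\ell_k$ are existential constants, understood to be chosen sufficiently small. Reflection. For $\Psi:\mathbb R\times(0,d)\to\mathbb C$, $R\Psi(x,y)=\overline{\Psi(x,d-y)}$. Extension. If $\Psi$ is a solution of the Neumann problem $\Delta\Psi+\Psi(1-|\Psi|^2)=0$ in $\mathbb R\times(0,d)$, $\partial_n\Psi=0$ on $\mathbb R\times\{0,d\}$, with $R\Psi=\Psi$, it extends to a solution $\Upsilon$ of $\Delta\Upsilon+\Upsilon(1-|\Upsilon|^2)=0$ on $\mathbb R^2$ by even reflection across the lines $y=jd$, which amounts to: for $j\in\mathbb Z$ and $(x,y)\in\mathbb R\times(0,d)$, $\Upsilon(x,y+jd)=\Psi(x,y)$ if $j$ is even and $\Upsilon(x,y+jd)=\overline{\Psi(x,y)}$ if $j$ is odd. $\Upsilon_{1,d/k}$ denotes the extension obtained in this way from $\Psi=\Psi_{1,d/k}$ on the strip of width $d/k$. A vortex is an isolated zero; its degree is the winding number of $\Psi/|\Psi|$ on a small positively oriented circle around it. *)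

theory Defs
  imports "HOL-Complex_Analysis.Winding_Numbers" "HOL-Probability.Essential_Supremum"
begin

type_synonym plane = "real \<times> real"

definition strip :: "real \<Rightarrow> plane set" where
  "strip d = UNIV \<times> {0<..<d}"

definition closed_strip :: "real \<Rightarrow> plane set" where
  "closed_strip d = UNIV \<times> {0..d}"

text \<open>Classical partial derivatives. The directions used are the elements \<open>(1,0)\<close> and \<open>(0,1)\<close>
  of \<open>Basis\<close>.\<close>

definition partial :: "plane \<Rightarrow> (plane \<Rightarrow> 'a::real_normed_vector) \<Rightarrow> plane \<Rightarrow> 'a" where
  "partial v f p = frechet_derivative f (at p) v"

definition C1_on :: "plane set \<Rightarrow> (plane \<Rightarrow> 'a::real_normed_vector) \<Rightarrow> bool" where
  "C1_on \<Omega> f \<longleftrightarrow> (\<forall>p\<in>\<Omega>. f differentiable (at p)) \<and> (\<forall>v\<in>Basis. continuous_on \<Omega> (partial v f))"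

definition C2_on :: "plane set \<Rightarrow> (plane \<Rightarrow> 'a::real_normed_vector) \<Rightarrow> bool" where
  "C2_on \<Omega> f \<longleftrightarrow> (\<forall>p\<in>\<Omega>. f differentiable (at p)) \<and> (\<forall>v\<in>Basis. C1_on \<Omega> (partial v f))"

definition laplacian :: "(plane \<Rightarrow> 'a::real_normed_vector) \<Rightarrow> plane \<Rightarrow> 'a" where
  "laplacian f p = (\<Sum>v\<in>Basis. partial v (partial v f) p)"

text \<open>Weak derivatives. As in Gilbarg--Trudinger, a first-order weak derivative is tested against
  compactly supported \<open>C\<^sup>1\<close> functions. \<open>weak_partial\<close> selects a representative, which is unique
  almost everywhere in \<open>\<Omega>\<close>, and is only meaningful when \<open>has_weak_partial\<close> holds for some \<open>g\<close>.\<close>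

definition test_function :: "plane set \<Rightarrow> (plane \<Rightarrow> real) \<Rightarrow> bool" where
  "test_function \<Omega> \<phi> \<longleftrightarrow>
     C1_on UNIV \<phi> \<and> (\<exists>K. compact K \<and> K \<subseteq> \<Omega> \<and> (\<forall>p. p \<notin> K \<longrightarrow> \<phi> p = 0))"

definition locally_integrable_on :: "(plane \<Rightarrow> complex) \<Rightarrow> plane set \<Rightarrow> bool" where
  "locally_integrable_on f \<Omega> \<longleftrightarrow> (\<forall>K. compact K \<and> K \<subseteq> \<Omega> \<longrightarrow> f absolutely_integrable_on K)"

definition has_weak_partial ::
  "plane \<Rightarrow> plane set \<Rightarrow> (plane \<Rightarrow> complex) \<Rightarrow> (plane \<Rightarrow> complex) \<Rightarrow> bool" where
  "has_weak_partial v \<Omega> f g \<longleftrightarrow>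
     locally_integrable_on f \<Omega> \<and> locally_integrable_on g \<Omega> \<and>
     (\<forall>\<phi>. test_function \<Omega> \<phi> \<longrightarrow>
        integral \<Omega> (\<lambda>p. partial v \<phi> p *\<^sub>R f p) = - integral \<Omega> (\<lambda>p. \<phi> p *\<^sub>R g p))"

definition weak_partial :: "plane \<Rightarrow> plane set \<Rightarrow> (plane \<Rightarrow> complex) \<Rightarrow> plane \<Rightarrow> complex" where
  "weak_partial v \<Omega> f = (SOME g. has_weak_partial v \<Omega> f g)"

definition L2_on :: "plane set \<Rightarrow> (plane \<Rightarrow> complex) \<Rightarrow> bool" where
  "L2_on \<Omega> f \<longleftrightarrow> f \<in> borel_measurable (lebesgue_on \<Omega>) \<and> (\<lambda>p. (cmod (f p))\<^sup>2) integrable_on \<Omega>"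

definition Linf_norm :: "plane set \<Rightarrow> (plane \<Rightarrow> complex) \<Rightarrow> ennreal" where
  "Linf_norm \<Omega> f = esssup (lebesgue_on \<Omega>) (\<lambda>p. ennreal (cmod (f p)))"

definition X_space :: "real \<Rightarrow> (plane \<Rightarrow> complex) set" where
  "X_space d = {\<psi>.
     (\<forall>x y. (x, y) \<in> strip d \<longrightarrow> \<psi> (-x, y) = - cnj (\<psi> (x, y))) \<and>
     (\<forall>v\<in>Basis. \<exists>g. has_weak_partial v (strip d) \<psi> g \<and> L2_on (strip d) g) \<and>
     L2_on (strip d) (\<lambda>p. complex_of_real (1 - (cmod (\<psi> p))\<^sup>2))}"

text \<open>The weight is on the first and second derivatives only, not on the function itself.
  The parameter \<open>\<sigma> = 0\<close> gives the norm of the unweighted \<open>W\<^sup>2\<^sup>,\<^sup>\<infinity>\<close> on the strip.\<close>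

definition weighted :: "real \<Rightarrow> (plane \<Rightarrow> complex) \<Rightarrow> plane \<Rightarrow> complex" where
  "weighted \<sigma> f = (\<lambda>(x, y). exp (\<sigma> * \<bar>x\<bar>) *\<^sub>R f (x, y))"

definition W2inf_norm :: "real \<Rightarrow> real \<Rightarrow> (plane \<Rightarrow> complex) \<Rightarrow> ennreal" where
  "W2inf_norm \<sigma> d f =
     Linf_norm (strip d) f
     + (\<Sum>v\<in>Basis. Linf_norm (strip d) (weighted \<sigma> (weak_partial v (strip d) f)))
     + (\<Sum>v\<in>Basis. \<Sum>w\<in>Basis.
          Linf_norm (strip d) (weighted \<sigma> (weak_partial w (strip d) (weak_partial v (strip d) f))))"

text \<open>Elements of the Sobolev space are represented by their continuous representative.\<close>

definition W2inf :: "real \<Rightarrow> real \<Rightarrow> (plane \<Rightarrow> complex) set" where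
  "W2inf \<sigma> d = {f.
     continuous_on (strip d) f \<and>
     (\<forall>v\<in>Basis. (\<exists>g. has_weak_partial v (strip d) f g) \<and>
        (\<forall>w\<in>Basis. \<exists>h. has_weak_partial w (strip d) (weak_partial v (strip d) f) h)) \<and>
     W2inf_norm \<sigma> d f < \<infinity>}"

definition GL_solution :: "plane set \<Rightarrow> (plane \<Rightarrow> complex) \<Rightarrow> bool" where
  "GL_solution \<Omega> \<psi> \<longleftrightarrow>
     C2_on \<Omega> \<psi> \<and>
     (\<forall>p\<in>\<Omega>. laplacian \<psi> p + \<psi> p * complex_of_real (1 - (cmod (\<psi> p))\<^sup>2) = 0)"

definition extends_to_closed_strip :: "real \<Rightarrow> (plane \<Rightarrow> complex) \<Rightarrow> bool" where
  "extends_to_closed_strip d f \<longleftrightarrow>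
     (\<exists>g. continuous_on (closed_strip d) g \<and> (\<forall>p\<in>strip d. g p = f p))"

text \<open>Solutions are classical up to the boundary. As \<open>\<psi>\<close> only matters on the open strip, the
  boundary condition is expressed by the limit of the normal derivative.\<close>

definition neumann_solution :: "real \<Rightarrow> (plane \<Rightarrow> complex) \<Rightarrow> bool" where
  "neumann_solution d \<psi> \<longleftrightarrow>
     GL_solution (strip d) \<psi> \<and>
     (\<forall>v\<in>Basis. extends_to_closed_strip d (partial v \<psi>) \<and>
        (\<forall>w\<in>Basis. extends_to_closed_strip d (partial w (partial v \<psi>)))) \<and>
     (\<forall>x. \<forall>b\<in>{0, d}. (partial (0, 1) \<psi> \<longlongrightarrow> 0) (at (x, b) within strip d))"

definition S0 :: "plane \<Rightarrow> complex" where
  "S0 = (\<lambda>(x, y). complex_of_real (tanh (x / sqrt 2)))"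

definition chi0 :: "real \<Rightarrow> real" where
  "chi0 x = 1 / cosh (x / sqrt 2)"

definition dcrit :: "nat \<Rightarrow> real" where
  "dcrit k = sqrt 2 * pi * real k"

definition leading_part :: "real \<Rightarrow> nat \<Rightarrow> real \<Rightarrow> plane \<Rightarrow> complex" where
  "leading_part \<Lambda> k d = (\<lambda>(x, y). S0 (x, y) +
     \<i> * complex_of_real (\<Lambda> * sqrt ((d - dcrit k) / dcrit k) * chi0 x * cos (pi * real k * y / d)))"

text \<open>Smoothness of a family of functions on strips of varying width, as a curve in the normed
  space on the strip of width \<open>1\<close>: \<open>D n\<close> is the \<open>n\<close>-th derivative of the rescaled curve.\<close>

definition rescale :: "real \<Rightarrow> (plane \<Rightarrow> complex) \<Rightarrow> plane \<Rightarrow> complex" where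
  "rescale d f = (\<lambda>(x, y). f (x, d * y))"

definition smooth_branch :: "real \<Rightarrow> real set \<Rightarrow> (real \<Rightarrow> plane \<Rightarrow> complex) \<Rightarrow> bool" where
  "smooth_branch \<sigma> I \<Psi> \<longleftrightarrow>
     (\<exists>D :: nat \<Rightarrow> real \<Rightarrow> plane \<Rightarrow> complex.
        (\<forall>d\<in>I. D 0 d = rescale d (\<Psi> d)) \<and>
        (\<forall>n. \<forall>d\<in>I. D n d \<in> W2inf \<sigma> 1 \<and>
           ((\<lambda>h. W2inf_norm \<sigma> 1 (\<lambda>p. (D n (d + h) p - D n d p) /\<^sub>R h - D (Suc n) d p)) \<longlongrightarrow> 0) (at 0)))"

definition admissible_solution :: "real \<Rightarrow> real \<Rightarrow> (plane \<Rightarrow> complex) \<Rightarrow> bool" where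
  "admissible_solution \<sigma> d \<psi> \<longleftrightarrow> \<psi> \<in> X_space d \<inter> W2inf \<sigma> d \<and> neumann_solution d \<psi>"

text \<open>The properties of \<open>l\<^sub>k\<close>, \<open>\<sigma>\<^sub>k\<close> and of the branch supplied by the bifurcation theorem. The
  neighbourhood of \<open>S\<^sub>0\<close> is a ball whose radius does not depend on \<open>d\<close>; a function is identified
  with its restriction to the strip.\<close>

definition bifurcation_branch ::
  "real \<Rightarrow> nat \<Rightarrow> real \<Rightarrow> real \<Rightarrow> (real \<Rightarrow> plane \<Rightarrow> complex) \<Rightarrow> bool" where
  "bifurcation_branch \<Lambda> k l \<sigma> \<Psi> \<longleftrightarrow>
     0 < l \<and> 0 < \<sigma> \<and>
     (\<forall>d\<in>{dcrit k<..<dcrit k + l}. admissible_solution \<sigma> d (\<Psi> d)) \<and>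
     smooth_branch \<sigma> {dcrit k<..<dcrit k + l} \<Psi> \<and>
     (\<exists>r>0. \<forall>d. 0 < d \<and> \<bar>d - dcrit k\<bar> < l \<longrightarrow>
        (\<forall>\<psi>. admissible_solution \<sigma> d \<psi> \<and> W2inf_norm \<sigma> d (\<lambda>p. \<psi> p - S0 p) < ennreal r \<longleftrightarrow>
           (\<forall>p\<in>strip d. \<psi> p = S0 p) \<or>
           dcrit k < d \<and>
             ((\<forall>p\<in>strip d. \<psi> p = \<Psi> d p) \<or> (\<forall>p\<in>strip d. \<psi> p = cnj (\<Psi> d p))))) \<and>
     (\<exists>C. \<forall>\<^sub>F d in at_right (dcrit k).
        W2inf_norm 0 d (\<lambda>p. \<Psi> d p - leading_part \<Lambda> k d p) \<le> ennreal (C * (d - dcrit k)))"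

definition reflection :: "real \<Rightarrow> (plane \<Rightarrow> complex) \<Rightarrow> plane \<Rightarrow> complex" where
  "reflection d \<psi> = (\<lambda>(x, y). cnj (\<psi> (x, d - y)))"

text \<open>The values on the lines \<open>y = j d\<close> are determined by the continuity of \<open>\<Upsilon>\<close>.\<close>

definition is_extension :: "real \<Rightarrow> (plane \<Rightarrow> complex) \<Rightarrow> (plane \<Rightarrow> complex) \<Rightarrow> bool" where
  "is_extension d \<Psi> \<Upsilon> \<longleftrightarrow>
     GL_solution UNIV \<Upsilon> \<and>
     (\<forall>j::int. \<forall>x y. (x, y) \<in> strip d \<longrightarrow>
        \<Upsilon> (x, y + of_int j * d) = (if even j then \<Psi> (x, y) else cnj (\<Psi> (x, y))))"

definition vortex :: "(plane \<Rightarrow> complex) \<Rightarrow> plane \<Rightarrow> bool" where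
  "vortex \<psi> z \<longleftrightarrow> \<psi> z = 0 \<and> (\<forall>\<^sub>F p in at z. \<psi> p \<noteq> 0)"

definition has_degree :: "(plane \<Rightarrow> complex) \<Rightarrow> plane \<Rightarrow> int \<Rightarrow> bool" where
  "has_degree \<psi> z n \<longleftrightarrow>
     (\<forall>\<^sub>F r in at_right 0.
        winding_number (\<lambda>t. sgn (\<psi> (z + r *\<^sub>R (cos (2 * pi * t), sin (2 * pi * t))))) 0 = of_int n)"

end

theory Submission
  imports Defs
begin

text \<open>The solution \<open>\<Psi>\<^sub>1\<close> on the strip of width \<open>d / k\<close> is invariant under \<open>R\<close>: \<open>R \<Psi>\<^sub>1\<close> is a
  solution equally close to \<open>S\<^sub>0\<close>, and the asymptotic expansion rules out the other two solutions
  that the local uniqueness allows. Its even extension \<open>\<Upsilon>\<close>, restricted to the strip of width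
  \<open>d\<close>, is therefore a Neumann solution there, and the local uniqueness identifies it with \<open>\<Psi>\<^sub>k\<close>, provided that it
  is close to \<open>S\<^sub>0\<close> for the weight \<open>\<sigma>\<^sub>k\<close>, which may exceed \<open>\<sigma>\<^sub>1\<close>. Two facts give this closeness.
  The invariance makes the imaginary part of \<open>\<Upsilon>\<close> change sign under \<open>y \<mapsto> y + d / k\<close>, and a
  comparison argument for difference quotients then yields decay of the derivatives, uniformly in \<open>d\<close>, at every
  rate below \<open>1 / \<surd>2\<close>. On the other hand \<open>\<sigma>\<^sub>k < 1 / \<surd>2\<close>, because the first order term
  \<open>\<chi>\<^sub>0(x) cos (\<pi>ky/d)\<close> of the expansion forces a slower decay of \<open>\<Psi>\<^sub>k\<close>. Interpolating between
  this decay and the unweighted closeness gives the smallness. The zeros of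
  \<open>\<Upsilon>\<close> at \<open>(0, (2j + 1) d / (2k))\<close> come from the symmetries; the \<open>C\<^sup>1\<close> expansion shows that there are
  no others and determines the degrees.\<close>

subsection \<open>Partial derivatives in the plane\<close>

text \<open>The lengths may be shrunk, so everything is proved only for \<open>d\<close> close to
  \<open>dcrit k\<close> from the right. Far from x = 0 the imaginary part nearly solves the Laplace
  equation, whose mode cos (pi k y / d) decays like exp (- pi k x / d), and pi k / d increases to 1
  / sqrt 2 as \<open>d\<close> decreases to \<open>dcrit k\<close>: this is the origin of the rate.
  For k = 1 the invariance makes the imaginary part vanish on a line in each period; this excludes
  the slower behaviour independent of y and makes cos (a y) with a < pi / d usable in a barrier. The
  real part has a potential close to -2 and merely inherits the rate of its source. Solutions are
  only C^2, so the equation cannot be differentiated twice; symmetric differences satisfy exact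
  identities of the same shape as the differentiated equations, with bounds proportional to the
  steps. The constants of the decay estimate are explicit in data independent of \<open>d\<close>.
  The weight of the first branch serves only to know that the solution has limits at infinity; its
  rate and constant do not enter the result.\<close>

lemma Basis_plane: "(Basis :: plane set) = {(1, 0), (0, 1)}"
  by (auto simp: Basis_prod_def)

lemma sum_Basis_plane: "(\<Sum>v\<in>Basis. g (v :: plane)) = g (1, 0) + g (0, 1)"
  by (simp add: Basis_plane)

lemma partial_eq:
  assumes "(f has_derivative f') (at p)"
  shows "partial v f p = f' v"
  unfolding partial_def using frechet_derivative_at[OF assms] by simp

lemma has_derivative_partial:
  assumes "f differentiable at p"
  shows "(f has_derivative (\<lambda>h. fst h *\<^sub>R partial (1, 0) f p + snd h *\<^sub>R partial (0, 1) f p)) (at p)"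
proof -
  obtain f' where f': "(f has_derivative f') (at p)"
    using assms by (auto simp: differentiable_def)
  then interpret bounded_linear f' by (rule has_derivative_bounded_linear)
  have "f' h = fst h *\<^sub>R f' (1, 0) + snd h *\<^sub>R f' (0, 1)" for h
  proof -
    have "f' (fst h *\<^sub>R (1, 0) + snd h *\<^sub>R (0, 1)) = fst h *\<^sub>R f' (1, 0) + snd h *\<^sub>R f' (0, 1)"
      by (simp only: add scaleR)
    then show ?thesis by simp
  qed
  then have "f' = (\<lambda>h. fst h *\<^sub>R partial (1, 0) f p + snd h *\<^sub>R partial (0, 1) f p)"
    unfolding partial_eq[OF f'] by (intro ext)
  with f' show ?thesis by simp
qed

lemma partial_has_vector_derivative:
  assumes "f differentiable at p"
  shows "((\<lambda>t. f (p + t *\<^sub>R v)) has_vector_derivative partial v f p) (at 0)"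
proof -
  obtain f' where f': "(f has_derivative f') (at p)"
    using assms by (auto simp: differentiable_def)
  have "((\<lambda>t. f (p + t *\<^sub>R v)) has_derivative (\<lambda>t. f' (t *\<^sub>R v))) (at 0)"
    by (rule has_derivative_compose[of "\<lambda>t. p + t *\<^sub>R v" _ 0 UNIV f])
      (auto intro!: derivative_eq_intros simp: f')
  moreover have "f' (t *\<^sub>R v) = t *\<^sub>R partial v f p" for t
    using linear_cmul[OF has_derivative_linear[OF f']] partial_eq[OF f'] by simp
  ultimately show ?thesis by (simp add: has_vector_derivative_def)
qed

lemma has_vector_derivative_fst:
  assumes "f differentiable at (x, y)"
  shows "((\<lambda>t. f (t, y)) has_vector_derivative partial (1, 0) f (x, y)) (at x within S)"
proof -
  have "((\<lambda>t. (t, y)) has_derivative (\<lambda>h. (h, 0))) (at x)"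
    by (rule has_derivative_Pair[OF has_derivative_ident has_derivative_const])
  from has_derivative_compose[OF this has_derivative_partial[OF assms]]
  have "((\<lambda>t. f (t, y)) has_derivative (\<lambda>h. h *\<^sub>R partial (1, 0) f (x, y))) (at x)"
    by simp
  then show ?thesis
    unfolding has_vector_derivative_def by (rule has_derivative_at_withinI)
qed

lemma has_vector_derivative_snd:
  assumes "f differentiable at (x, y)"
  shows "((\<lambda>t. f (x, t)) has_vector_derivative partial (0, 1) f (x, y)) (at y within S)"
proof -
  have "((\<lambda>t. (x, t)) has_derivative (\<lambda>h. (0, h))) (at y)"
    by (rule has_derivative_Pair[OF has_derivative_const has_derivative_ident])
  from has_derivative_compose[OF this has_derivative_partial[OF assms]]
  have "((\<lambda>t. f (x, t)) has_derivative (\<lambda>h. h *\<^sub>R partial (0, 1) f (x, y))) (at y)"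
    by simp
  then show ?thesis
    unfolding has_vector_derivative_def by (rule has_derivative_at_withinI)
qed

lemma partial_cong:
  assumes "open S" "p \<in> S" "\<And>q. q \<in> S \<Longrightarrow> f q = g q"
  shows "partial v f p = partial v g p" "f differentiable at p \<longleftrightarrow> g differentiable at p"
proof -
  have "(f has_derivative D) (at p) = (g has_derivative D) (at p)" for D
    using assms has_derivative_transform_within_open[of f D p UNIV S g]
      has_derivative_transform_within_open[of g D p UNIV S f] by auto
  then show "partial v f p = partial v g p" "f differentiable at p \<longleftrightarrow> g differentiable at p"
    by (auto simp: partial_def frechet_derivative_def differentiable_def)
qed

lemma C1_on_cong:
  assumes "open S" "\<And>q. q \<in> S \<Longrightarrow> f q = g q" "C1_on S f"
  shows "C1_on S g"
proof -
  have "continuous_on S (partial v g) \<longleftrightarrow> continuous_on S (partial v f)" for v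
    by (intro continuous_on_cong refl partial_cong(1)[OF assms(1)]) (simp_all add: assms(2))
  moreover have "f differentiable at q \<longleftrightarrow> g differentiable at q" if "q \<in> S" for q
    by (rule partial_cong(2)[OF assms(1) that assms(2)])
  ultimately show ?thesis
    using assms(3) unfolding C1_on_def by blast
qed

lemma C2_on_cong:
  assumes "open S" "\<And>q. q \<in> S \<Longrightarrow> f q = g q" "C2_on S f"
  shows "C2_on S g"
proof -
  have "C1_on S (partial v g)" if "v \<in> Basis" for v
  proof (rule C1_on_cong[OF assms(1)])
    show "partial v f q = partial v g q" if "q \<in> S" for q
      by (rule partial_cong(1)[OF assms(1) that assms(2)])
    show "C1_on S (partial v f)" using assms(3) that by (simp add: C2_on_def)
  qed
  moreover have "f differentiable at q \<longleftrightarrow> g differentiable at q" if "q \<in> S" for q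
    by (rule partial_cong(2)[OF assms(1) that assms(2)])
  ultimately show ?thesis
    using assms(3) unfolding C2_on_def by blast
qed

lemma C1_on_subset: "C1_on T f \<Longrightarrow> S \<subseteq> T \<Longrightarrow> C1_on S f"
  by (auto simp: C1_on_def intro: continuous_on_subset)

lemma C2_on_subset: "C2_on T f \<Longrightarrow> S \<subseteq> T \<Longrightarrow> C2_on S f"
  by (auto simp: C2_on_def intro: C1_on_subset)

lemma C1_on_differentiable: "C1_on S f \<Longrightarrow> p \<in> S \<Longrightarrow> f differentiable at p"
  by (simp add: C1_on_def)

lemma C2_on_differentiable: "C2_on S f \<Longrightarrow> p \<in> S \<Longrightarrow> f differentiable at p"
  by (simp add: C2_on_def)

lemma C2_on_C1_partial: "C2_on S f \<Longrightarrow> v \<in> Basis \<Longrightarrow> C1_on S (partial v f)"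
  by (simp add: C2_on_def)

lemma C1_on_continuous: "C1_on S f \<Longrightarrow> continuous_on S f"
  by (simp add: C1_on_def continuous_at_imp_continuous_on differentiable_imp_continuous_within)

lemma C2_on_C1: "C2_on S f \<Longrightarrow> C1_on S f"
  unfolding C1_on_def[of S f] by (simp add: C2_on_def C1_on_continuous)

lemma C2_on_continuous: "C2_on S f \<Longrightarrow> continuous_on S f"
  using C2_on_C1 C1_on_continuous by blast

lemma C1_on_continuous_partial: "C1_on S f \<Longrightarrow> v \<in> Basis \<Longrightarrow> continuous_on S (partial v f)"
  by (simp add: C1_on_def)

lemma partial_linear:
  assumes "bounded_linear L" "f differentiable at p"
  shows "partial v (\<lambda>p. L (f p)) p = L (partial v f p)" "(\<lambda>p. L (f p)) differentiable at p"
proof -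
  obtain f' where f': "(f has_derivative f') (at p)"
    using assms by (auto simp: differentiable_def)
  have *: "((\<lambda>p. L (f p)) has_derivative (\<lambda>h. L (f' h))) (at p)"
    using assms(1) f' by (rule bounded_linear.has_derivative)
  show "partial v (\<lambda>p. L (f p)) p = L (partial v f p)"
    using partial_eq[OF *] partial_eq[OF f'] by simp
  show "(\<lambda>p. L (f p)) differentiable at p" using * by (auto simp: differentiable_def)
qed

lemma partial_add:
  assumes "f differentiable at p" "g differentiable at p"
  shows "partial v (\<lambda>p. f p + g p) p = partial v f p + partial v g p"
    "(\<lambda>p. f p + g p) differentiable at p"
proof -
  obtain f' g' where f': "(f has_derivative f') (at p)" and g': "(g has_derivative g') (at p)"
    using assms by (auto simp: differentiable_def)
  have *: "((\<lambda>p. f p + g p) has_derivative (\<lambda>h. f' h + g' h)) (at p)"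
    using f' g' by (rule has_derivative_add)
  show "partial v (\<lambda>p. f p + g p) p = partial v f p + partial v g p"
    using partial_eq[OF *] partial_eq[OF f'] partial_eq[OF g'] by simp
  show "(\<lambda>p. f p + g p) differentiable at p" using * by (auto simp: differentiable_def)
qed

lemma partial_minus:
  assumes "f differentiable at p"
  shows "partial v (\<lambda>p. - f p) p = - partial v f p"
  using partial_linear(1)[OF bounded_linear_minus[OF bounded_linear_ident] assms] by simp

lemma partial_diff:
  assumes "f differentiable at p" "g differentiable at p"
  shows "partial v (\<lambda>p. f p - g p) p = partial v f p - partial v g p"
    "(\<lambda>p. f p - g p) differentiable at p"
  using partial_add[OF assms(1) differentiable_minus[OF assms(2)]] partial_minus[OF assms(2)] by simp_all

lemma partial_const: "partial v (\<lambda>p. c) p = 0"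
  using partial_eq[OF has_derivative_const[of c]] by simp

lemma C1_on_linear:
  assumes "bounded_linear L" "C1_on S f"
  shows "C1_on S (\<lambda>p. L (f p))"
proof -
  have "continuous_on S (\<lambda>p. L (partial v f p))" if "v \<in> Basis" for v
    using bounded_linear.continuous_on[OF assms(1)] assms(2) that by (auto simp: C1_on_def)
  then show ?thesis
    using assms partial_linear[OF assms(1)] by (auto simp: C1_on_def cong: continuous_on_cong)
qed

lemma C1_on_add:
  assumes "C1_on S f" "C1_on S g"
  shows "C1_on S (\<lambda>p. f p + g p)"
proof -
  have "continuous_on S (\<lambda>p. partial v f p + partial v g p)" if "v \<in> Basis" for v
    using assms that by (auto simp: C1_on_def intro!: continuous_intros)
  then show ?thesis
    using assms partial_add[of f _ g] by (auto simp: C1_on_def cong: continuous_on_cong)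
qed

lemma C1_on_minus: "C1_on S f \<Longrightarrow> C1_on S (\<lambda>p. - f p)"
  by (rule C1_on_linear[OF bounded_linear_minus[OF bounded_linear_ident]])

lemma C1_on_diff: "C1_on S f \<Longrightarrow> C1_on S g \<Longrightarrow> C1_on S (\<lambda>p. f p - g p)"
  using C1_on_add[of S f "\<lambda>p. - g p"] C1_on_minus[of S g] by simp

lemma C2_on_linear:
  assumes "bounded_linear L" "open S" "C2_on S f"
  shows "C2_on S (\<lambda>p. L (f p))"
proof -
  have "C1_on S (partial v (\<lambda>p. L (f p)))" if "v \<in> Basis" for v
    using C1_on_cong[OF assms(2) _ C1_on_linear[OF assms(1) C2_on_C1_partial[OF assms(3) that]]]
      partial_linear(1)[OF assms(1)] assms(3) by (auto simp: C2_on_def)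
  then show ?thesis
    using assms partial_linear(2)[OF assms(1)] by (auto simp: C2_on_def)
qed

lemma C2_on_add:
  assumes "open S" "C2_on S f" "C2_on S g"
  shows "C2_on S (\<lambda>p. f p + g p)"
proof -
  have "C1_on S (partial v (\<lambda>p. f p + g p))" if "v \<in> Basis" for v
    using C1_on_cong[OF assms(1) _ C1_on_add[OF C2_on_C1_partial[OF assms(2) that] C2_on_C1_partial[OF assms(3) that]]]
      partial_add(1)[of f _ g] assms by (auto simp: C2_on_def)
  then show ?thesis
    using assms partial_add(2)[of f _ g] by (auto simp: C2_on_def)
qed

lemma C2_on_minus: "open S \<Longrightarrow> C2_on S f \<Longrightarrow> C2_on S (\<lambda>p. - f p)"
  by (rule C2_on_linear[OF bounded_linear_minus[OF bounded_linear_ident]])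

lemma C2_on_diff: "open S \<Longrightarrow> C2_on S f \<Longrightarrow> C2_on S g \<Longrightarrow> C2_on S (\<lambda>p. f p - g p)"
  using C2_on_add[of S f "\<lambda>p. - g p"] C2_on_minus[of S g] by simp

lemma partial2_linear:
  assumes "bounded_linear L" "open S" "C2_on S f" "p \<in> S" "v \<in> Basis"
  shows "partial w (partial v (\<lambda>p. L (f p))) p = L (partial w (partial v f) p)"
proof -
  have "partial w (partial v (\<lambda>p. L (f p))) p = partial w (\<lambda>p. L (partial v f p)) p"
    using assms(3) by (intro partial_cong(1)[OF assms(2,4)] partial_linear(1)[OF assms(1)])
      (auto simp: C2_on_def)
  also have "\<dots> = L (partial w (partial v f) p)"
    using assms by (intro partial_linear(1)) (auto simp: C2_on_def C1_on_def)
  finally show ?thesis .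
qed

lemma partial2_add:
  assumes "open S" "C2_on S f" "C2_on S g" "p \<in> S" "v \<in> Basis"
  shows "partial w (partial v (\<lambda>p. f p + g p)) p = partial w (partial v f) p + partial w (partial v g) p"
proof -
  have "partial w (partial v (\<lambda>p. f p + g p)) p = partial w (\<lambda>p. partial v f p + partial v g p) p"
    using assms by (intro partial_cong(1)[OF assms(1,4)] partial_add(1)) (auto simp: C2_on_def)
  also have "\<dots> = partial w (partial v f) p + partial w (partial v g) p"
    using assms by (intro partial_add(1)) (auto simp: C2_on_def C1_on_def)
  finally show ?thesis .
qed

lemma partial2_diff:
  assumes "open S" "C2_on S f" "C2_on S g" "p \<in> S" "v \<in> Basis"
  shows "partial w (partial v (\<lambda>p. f p - g p)) p = partial w (partial v f) p - partial w (partial v g) p"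
  using partial2_add[OF assms(1,2) C2_on_minus[OF assms(1,3)] assms(4,5)]
    partial2_linear[OF bounded_linear_minus[OF bounded_linear_ident] assms(1,3-5)] by simp

lemma laplacian_linear:
  assumes "bounded_linear L" "open S" "C2_on S f" "p \<in> S"
  shows "laplacian (\<lambda>p. L (f p)) p = L (laplacian f p)"
proof -
  have add: "L (x + y) = L x + L y" for x y
    using assms(1) by (simp add: bounded_linear.linear linear_add)
  show ?thesis
    using partial2_linear[OF assms] by (simp add: laplacian_def sum_Basis_plane add Basis_plane)
qed

lemma laplacian_diff:
  assumes "open S" "C2_on S f" "C2_on S g" "p \<in> S"
  shows "laplacian (\<lambda>p. f p - g p) p = laplacian f p - laplacian g p"
  using partial2_diff[OF assms] by (simp add: laplacian_def sum_Basis_plane Basis_plane)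

section \<open>Composition with axis-parallel affine maps\<close>

definition diag_map :: "real \<Rightarrow> real \<Rightarrow> plane \<Rightarrow> plane \<Rightarrow> plane" where
  "diag_map s t c p = (fst c + s * fst p, snd c + t * snd p)"

lemma continuous_on_diag_map: "continuous_on S (diag_map s t c)"
  unfolding diag_map_def by (intro continuous_intros)

lemma open_vimage_diag_map: "open S \<Longrightarrow> open (diag_map s t c -` S)"
  using continuous_on_diag_map[of UNIV] by (simp add: open_vimage)

lemma partial_diag_map:
  assumes "f differentiable at (diag_map s t c p)"
  shows "partial (1, 0) (\<lambda>p. f (diag_map s t c p)) p = s *\<^sub>R partial (1, 0) f (diag_map s t c p)"
    "partial (0, 1) (\<lambda>p. f (diag_map s t c p)) p = t *\<^sub>R partial (0, 1) f (diag_map s t c p)"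
    "(\<lambda>p. f (diag_map s t c p)) differentiable at p"
proof -
  have D: "(diag_map s t c has_derivative (\<lambda>h. (s * fst h, t * snd h))) (at p)"
    unfolding diag_map_def[abs_def] by (auto intro!: derivative_eq_intros)
  have *: "((\<lambda>p. f (diag_map s t c p)) has_derivative (\<lambda>h. (s * fst h) *\<^sub>R partial (1, 0) f (diag_map s t c p)
      + (t * snd h) *\<^sub>R partial (0, 1) f (diag_map s t c p))) (at p)"
    using has_derivative_compose[OF D has_derivative_partial[OF assms]] by simp
  show "partial (1, 0) (\<lambda>p. f (diag_map s t c p)) p = s *\<^sub>R partial (1, 0) f (diag_map s t c p)"
    "partial (0, 1) (\<lambda>p. f (diag_map s t c p)) p = t *\<^sub>R partial (0, 1) f (diag_map s t c p)"
    using partial_eq[OF *] by simp_all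
  show "(\<lambda>p. f (diag_map s t c p)) differentiable at p" using * by (auto simp: differentiable_def)
qed

lemma C1_on_scaleR: "C1_on S f \<Longrightarrow> C1_on S (\<lambda>p. r *\<^sub>R f p)"
  by (rule C1_on_linear[OF bounded_linear_scaleR_right])

lemma C1_on_diag_map:
  assumes "C1_on T f" "\<And>p. p \<in> S \<Longrightarrow> diag_map s t c p \<in> T"
  shows "C1_on S (\<lambda>p. f (diag_map s t c p))"
proof -
  have *: "continuous_on S (\<lambda>p. g (diag_map s t c p))" if "continuous_on T g" for g :: "plane \<Rightarrow> 'a"
    by (rule continuous_on_compose2[OF that continuous_on_diag_map]) (use assms(2) in blast)
  have "continuous_on S (\<lambda>p. s *\<^sub>R partial (1, 0) f (diag_map s t c p))"
    "continuous_on S (\<lambda>p. t *\<^sub>R partial (0, 1) f (diag_map s t c p))"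
    using assms(1) by (auto intro!: continuous_intros * simp: C1_on_def Basis_plane)
  then show ?thesis
    using assms partial_diag_map[of f s t c] by (auto simp: C1_on_def Basis_plane cong: continuous_on_cong)
qed

lemma C2_on_diag_map:
  assumes "open S" "C2_on T f" "\<And>p. p \<in> S \<Longrightarrow> diag_map s t c p \<in> T"
  shows "C2_on S (\<lambda>p. f (diag_map s t c p))"
proof -
  have d: "f differentiable at (diag_map s t c p)" if "p \<in> S" for p
    using assms that by (auto simp: C2_on_def)
  have "C1_on S (partial (1, 0) (\<lambda>p. f (diag_map s t c p)))"
    by (rule C1_on_cong[OF assms(1) _ C1_on_scaleR[OF C1_on_diag_map[OF C2_on_C1_partial[OF assms(2), of "(1, 0)"] assms(3)], where r=s]])
      (auto simp: partial_diag_map d Basis_plane)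
  moreover have "C1_on S (partial (0, 1) (\<lambda>p. f (diag_map s t c p)))"
    by (rule C1_on_cong[OF assms(1) _ C1_on_scaleR[OF C1_on_diag_map[OF C2_on_C1_partial[OF assms(2), of "(0, 1)"] assms(3)], where r=t]])
      (auto simp: partial_diag_map d Basis_plane)
  ultimately show ?thesis
    using partial_diag_map(3)[OF d] by (auto simp: C2_on_def Basis_plane)
qed

lemma partial2_diag_map:
  fixes f :: "plane \<Rightarrow> 'a::real_normed_vector"
  assumes "open T" "C2_on T f" "diag_map s t c p \<in> T"
  shows "partial (1, 0) (partial (1, 0) (\<lambda>p. f (diag_map s t c p))) p = s\<^sup>2 *\<^sub>R partial (1, 0) (partial (1, 0) f) (diag_map s t c p)"
    "partial (0, 1) (partial (1, 0) (\<lambda>p. f (diag_map s t c p))) p = (s * t) *\<^sub>R partial (0, 1) (partial (1, 0) f) (diag_map s t c p)"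
    "partial (1, 0) (partial (0, 1) (\<lambda>p. f (diag_map s t c p))) p = (s * t) *\<^sub>R partial (1, 0) (partial (0, 1) f) (diag_map s t c p)"
    "partial (0, 1) (partial (0, 1) (\<lambda>p. f (diag_map s t c p))) p = t\<^sup>2 *\<^sub>R partial (0, 1) (partial (0, 1) f) (diag_map s t c p)"
proof -
  define S where "S = diag_map s t c -` T"
  have S: "open S" "p \<in> S" using assms open_vimage_diag_map by (auto simp: S_def)
  have d: "f differentiable at (diag_map s t c q)" if "q \<in> S" for q
    using assms that by (auto simp: C2_on_def S_def)
  have d': "partial v f differentiable at (diag_map s t c p)" if "v \<in> Basis" for v
    using assms that by (auto simp: C2_on_def C1_on_def)
  have "partial w (partial (1, 0) (\<lambda>p. f (diag_map s t c p))) p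
      = partial w (\<lambda>p. s *\<^sub>R partial (1, 0) f (diag_map s t c p)) p" for w
    using d by (intro partial_cong(1)[OF S]) (simp add: partial_diag_map)
  moreover have "partial w (\<lambda>p. s *\<^sub>R partial (1, 0) f (diag_map s t c p)) p
      = s *\<^sub>R partial w (\<lambda>p. partial (1, 0) f (diag_map s t c p)) p" for w
    by (intro partial_linear(1)[OF bounded_linear_scaleR_right] partial_diag_map(3) d') (simp add: Basis_plane)
  moreover have "partial w (partial (0, 1) (\<lambda>p. f (diag_map s t c p))) p
      = partial w (\<lambda>p. t *\<^sub>R partial (0, 1) f (diag_map s t c p)) p" for w
    using d by (intro partial_cong(1)[OF S]) (simp add: partial_diag_map)
  moreover have "partial w (\<lambda>p. t *\<^sub>R partial (0, 1) f (diag_map s t c p)) p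
      = t *\<^sub>R partial w (\<lambda>p. partial (0, 1) f (diag_map s t c p)) p" for w
    by (intro partial_linear(1)[OF bounded_linear_scaleR_right] partial_diag_map(3) d') (simp add: Basis_plane)
  ultimately show "partial (1, 0) (partial (1, 0) (\<lambda>p. f (diag_map s t c p))) p = s\<^sup>2 *\<^sub>R partial (1, 0) (partial (1, 0) f) (diag_map s t c p)"
    "partial (0, 1) (partial (1, 0) (\<lambda>p. f (diag_map s t c p))) p = (s * t) *\<^sub>R partial (0, 1) (partial (1, 0) f) (diag_map s t c p)"
    "partial (1, 0) (partial (0, 1) (\<lambda>p. f (diag_map s t c p))) p = (s * t) *\<^sub>R partial (1, 0) (partial (0, 1) f) (diag_map s t c p)"
    "partial (0, 1) (partial (0, 1) (\<lambda>p. f (diag_map s t c p))) p = t\<^sup>2 *\<^sub>R partial (0, 1) (partial (0, 1) f) (diag_map s t c p)"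
    using d' by (simp_all add: partial_diag_map Basis_plane power2_eq_square mult.commute)
qed

lemma laplacian_diag_map:
  assumes "open T" "C2_on T f" "diag_map s t c p \<in> T" "\<bar>s\<bar> = 1" "\<bar>t\<bar> = 1"
  shows "laplacian (\<lambda>p. f (diag_map s t c p)) p = laplacian f (diag_map s t c p)"
proof -
  have "s\<^sup>2 = 1" "t\<^sup>2 = 1" using assms(4,5) by (metis one_power2 power2_abs)+
  then show ?thesis
    using partial2_diag_map[OF assms(1-3)] by (simp add: laplacian_def sum_Basis_plane)
qed

section \<open>Differentiability from partial derivatives; products of functions of one
  variable\<close>

lemma has_derivative_of_partials:
  fixes f :: "plane \<Rightarrow> 'a::real_normed_vector"
  assumes "\<And>x y. ((\<lambda>t. f (t, y)) has_vector_derivative f1 (x, y)) (at x)"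
    and "\<And>x y. ((\<lambda>t. f (x, t)) has_vector_derivative f2 (x, y)) (at y)"
    and "continuous_on UNIV f2"
  shows "(f has_derivative (\<lambda>h. fst h *\<^sub>R f1 p + snd h *\<^sub>R f2 p)) (at p)"
proof -
  obtain x y where p: "p = (x, y)" by (cases p)
  have "((\<lambda>(x, y). f (x, y)) has_derivative
      (\<lambda>(tx, ty). tx *\<^sub>R f1 (x, y) + blinfun_scaleR_left (f2 (x, y)) ty)) (at (x, y) within UNIV \<times> UNIV)"
  proof (rule has_derivative_partialsI[where fy="\<lambda>x y. blinfun_scaleR_left (f2 (x, y))"])
    show "((\<lambda>x. f (x, y)) has_derivative (\<lambda>tx. tx *\<^sub>R f1 (x, y))) (at x within UNIV)"
      using assms(1)[of y x] by (simp add: has_vector_derivative_def)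
    show "((\<lambda>y. f (x, y)) has_derivative blinfun_apply (blinfun_scaleR_left (f2 (x, y)))) (at y within UNIV)" for x y
      using assms(2)[of x y] by (simp add: has_vector_derivative_def)
    have "continuous (at (x, y)) (\<lambda>p. blinfun_scaleR_left (f2 p))"
      using assms(3) by (auto intro!: bounded_linear.continuous[OF bounded_linear_blinfun_scaleR_left] simp: continuous_on_eq_continuous_at)
    then show "continuous (at (x, y) within UNIV \<times> UNIV) (\<lambda>(x, y). blinfun_scaleR_left (f2 (x, y)))"
      by (simp add: case_prod_beta')
  qed auto
  then show ?thesis by (simp add: p case_prod_beta')
qed

lemma C1_on_of_has_derivative:
  assumes "\<And>p. (f has_derivative (\<lambda>h. fst h *\<^sub>R f1 p + snd h *\<^sub>R f2 p)) (at p)"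
    and "continuous_on UNIV f1" "continuous_on UNIV f2"
  shows "C1_on UNIV f" "partial (1, 0) f = f1" "partial (0, 1) f = f2"
proof -
  show 1: "partial (1, 0) f = f1" "partial (0, 1) f = f2"
    using partial_eq[OF assms(1)] by auto
  show "C1_on UNIV f"
    using assms 1 by (auto simp: C1_on_def Basis_plane differentiable_def)
qed

lemma partial_separable:
  fixes \<alpha> \<beta> :: "real \<Rightarrow> real"
  assumes "\<And>x. (\<alpha> has_real_derivative \<alpha>' x) (at x)" "\<And>x. (\<beta> has_real_derivative \<beta>' x) (at x)"
    and "continuous_on UNIV \<alpha>'" "continuous_on UNIV \<beta>'"
  shows "partial (1, 0) (\<lambda>p. \<alpha> (fst p) * \<beta> (snd p)) = (\<lambda>p. \<alpha>' (fst p) * \<beta> (snd p))"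
    and "partial (0, 1) (\<lambda>p. \<alpha> (fst p) * \<beta> (snd p)) = (\<lambda>p. \<alpha> (fst p) * \<beta>' (snd p))"
    and "C1_on UNIV (\<lambda>p. \<alpha> (fst p) * \<beta> (snd p))"
proof -
  have c: "continuous_on UNIV \<alpha>" "continuous_on UNIV \<beta>"
    using DERIV_isCont[OF assms(1)] DERIV_isCont[OF assms(2)] by (auto simp: continuous_on_eq_continuous_at)
  have *: "((\<lambda>p. \<alpha> (fst p) * \<beta> (snd p)) has_derivative
      (\<lambda>h. fst h *\<^sub>R (\<alpha>' (fst p) * \<beta> (snd p)) + snd h *\<^sub>R (\<alpha> (fst p) * \<beta>' (snd p)))) (at p)" for p
  proof -
    have 1: "((\<lambda>p. \<alpha> (fst p)) has_derivative (\<lambda>h. \<alpha>' (fst p) * fst h)) (at p)"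
      using has_derivative_compose[of fst fst p UNIV \<alpha>, OF has_derivative_fst[OF has_derivative_ident]]
        assms(1)[of "fst p"] by (simp add: has_field_derivative_def)
    have 2: "((\<lambda>p. \<beta> (snd p)) has_derivative (\<lambda>h. \<beta>' (snd p) * snd h)) (at p)"
      using has_derivative_compose[of snd snd p UNIV \<beta>, OF has_derivative_snd[OF has_derivative_ident]]
        assms(2)[of "snd p"] by (simp add: has_field_derivative_def)
    show ?thesis
      by (rule has_derivative_eq_rhs[OF has_derivative_mult[OF 1 2]]) (auto simp: algebra_simps)
  qed
  have c': "continuous_on UNIV (\<lambda>p::plane. \<alpha>' (fst p) * \<beta> (snd p))"
    "continuous_on UNIV (\<lambda>p::plane. \<alpha> (fst p) * \<beta>' (snd p))"
    by (intro continuous_intros continuous_on_compose2[OF assms(3)] continuous_on_compose2[OF assms(4)]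
      continuous_on_compose2[OF c(1)] continuous_on_compose2[OF c(2)]; simp)+
  show "partial (1, 0) (\<lambda>p. \<alpha> (fst p) * \<beta> (snd p)) = (\<lambda>p. \<alpha>' (fst p) * \<beta> (snd p))"
    "partial (0, 1) (\<lambda>p. \<alpha> (fst p) * \<beta> (snd p)) = (\<lambda>p. \<alpha> (fst p) * \<beta>' (snd p))"
    "C1_on UNIV (\<lambda>p. \<alpha> (fst p) * \<beta> (snd p))"
    using C1_on_of_has_derivative[OF *] c' by simp_all
qed

lemma C2_on_separable:
  fixes \<alpha> \<beta> :: "real \<Rightarrow> real"
  assumes "\<And>x. (\<alpha> has_real_derivative \<alpha>' x) (at x)" "\<And>x. (\<beta> has_real_derivative \<beta>' x) (at x)"
    and "\<And>x. (\<alpha>' has_real_derivative \<alpha>'' x) (at x)" "\<And>x. (\<beta>' has_real_derivative \<beta>'' x) (at x)"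
    and "continuous_on UNIV \<alpha>''" "continuous_on UNIV \<beta>''"
  shows "C2_on UNIV (\<lambda>p. \<alpha> (fst p) * \<beta> (snd p))"
    and "partial (1, 0) (\<lambda>p. \<alpha> (fst p) * \<beta> (snd p)) = (\<lambda>p. \<alpha>' (fst p) * \<beta> (snd p))"
    and "partial (0, 1) (\<lambda>p. \<alpha> (fst p) * \<beta> (snd p)) = (\<lambda>p. \<alpha> (fst p) * \<beta>' (snd p))"
    and "partial (1, 0) (partial (1, 0) (\<lambda>p. \<alpha> (fst p) * \<beta> (snd p))) = (\<lambda>p. \<alpha>'' (fst p) * \<beta> (snd p))"
    and "partial (0, 1) (partial (1, 0) (\<lambda>p. \<alpha> (fst p) * \<beta> (snd p))) = (\<lambda>p. \<alpha>' (fst p) * \<beta>' (snd p))"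
    and "partial (1, 0) (partial (0, 1) (\<lambda>p. \<alpha> (fst p) * \<beta> (snd p))) = (\<lambda>p. \<alpha>' (fst p) * \<beta>' (snd p))"
    and "partial (0, 1) (partial (0, 1) (\<lambda>p. \<alpha> (fst p) * \<beta> (snd p))) = (\<lambda>p. \<alpha> (fst p) * \<beta>'' (snd p))"
proof -
  have c: "continuous_on UNIV \<alpha>'" "continuous_on UNIV \<beta>'"
    using DERIV_isCont[OF assms(3)] DERIV_isCont[OF assms(4)] by (auto simp: continuous_on_eq_continuous_at)
  note 0 = partial_separable[OF assms(1,2) c]
  note 1 = partial_separable[OF assms(3) assms(2) assms(5) c(2)]
  note 2 = partial_separable[OF assms(1) assms(4) c(1) assms(6)]
  show "C2_on UNIV (\<lambda>p. \<alpha> (fst p) * \<beta> (snd p))"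
    using 0 1 2 by (auto simp: C2_on_def Basis_plane C1_on_def)
  show "partial (1, 0) (\<lambda>p. \<alpha> (fst p) * \<beta> (snd p)) = (\<lambda>p. \<alpha>' (fst p) * \<beta> (snd p))"
    and "partial (0, 1) (\<lambda>p. \<alpha> (fst p) * \<beta> (snd p)) = (\<lambda>p. \<alpha> (fst p) * \<beta>' (snd p))"
    and "partial (1, 0) (partial (1, 0) (\<lambda>p. \<alpha> (fst p) * \<beta> (snd p))) = (\<lambda>p. \<alpha>'' (fst p) * \<beta> (snd p))"
    and "partial (0, 1) (partial (1, 0) (\<lambda>p. \<alpha> (fst p) * \<beta> (snd p))) = (\<lambda>p. \<alpha>' (fst p) * \<beta>' (snd p))"
    and "partial (1, 0) (partial (0, 1) (\<lambda>p. \<alpha> (fst p) * \<beta> (snd p))) = (\<lambda>p. \<alpha>' (fst p) * \<beta>' (snd p))"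
    and "partial (0, 1) (partial (0, 1) (\<lambda>p. \<alpha> (fst p) * \<beta> (snd p))) = (\<lambda>p. \<alpha> (fst p) * \<beta>'' (snd p))"
    using 0 1 2 by simp_all
qed

lemma open_strip: "open (strip d)"
  unfolding strip_def by (intro open_Times) auto

lemma mem_strip: "p \<in> strip d \<longleftrightarrow> 0 < snd p \<and> snd p < d"
  by (cases p) (auto simp: strip_def)

lemma mem_closed_strip: "p \<in> closed_strip d \<longleftrightarrow> 0 \<le> snd p \<and> snd p \<le> d"
  by (cases p) (auto simp: closed_strip_def)

subsection \<open>Weak derivatives\<close>

lemma absolutely_integrable_continuous_compact:
  fixes f :: "'a::euclidean_space \<Rightarrow> 'b::euclidean_space"
  assumes "compact K" "continuous_on K f"
  shows "f absolutely_integrable_on K"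
proof -
  have i: "integrable lborel (\<lambda>x. indicator K x *\<^sub>R f x)"
    using borel_integrable_compact[OF assms] .
  then have "integrable lebesgue (\<lambda>x. indicator K x *\<^sub>R f x)"
    by (subst integrable_completion) (auto dest: borel_measurable_integrable)
  then show ?thesis by (simp add: set_integrable_def)
qed

lemma partial_eq_0_off:
  assumes "closed K" "\<And>p. p \<notin> K \<Longrightarrow> f p = 0" "p \<notin> K"
  shows "partial v f p = 0"
  using partial_cong(1)[of "- K" p f "\<lambda>_. 0" v] assms by (simp add: open_Compl partial_const)

text \<open>By Fubini on a square containing the support, the inner integral in the direction
  \<open>v\<close> is an increment of \<open>F\<close> between two boundary points, hence
  zero.\<close>

lemma integral_partial_compact_support:
  fixes F :: "plane \<Rightarrow> complex"
  assumes F: "C1_on UNIV F" and K: "compact K" "\<And>p. p \<notin> K \<Longrightarrow> F p = 0" and v: "v \<in> Basis"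
  shows "(partial v F has_integral 0) UNIV"
proof -
  obtain B where B: "\<And>p. p \<in> K \<Longrightarrow> norm p \<le> B"
    using compact_imp_bounded[OF K(1)] by (auto simp: bounded_iff)
  define M where "M = \<bar>B\<bar> + 1"
  have out: "p \<notin> K" if "M \<le> \<bar>fst p\<bar> \<or> M \<le> \<bar>snd p\<bar>" for p
    using B[of p] that norm_fst_le[of "fst p" "snd p"] norm_snd_le[of "snd p" "fst p"] by (auto simp: M_def)
  have z: "partial v F p = 0" if "p \<notin> cbox (-M, -M) (M, M)" for p
  proof -
    have "p \<notin> K" by (rule out) (use that in \<open>cases p; auto simp: cbox_Pair_eq abs_le_iff\<close>)
    then show ?thesis using partial_eq_0_off[OF compact_imp_closed[OF K(1)]] K(2) by blast
  qed
  have c: "continuous_on UNIV (partial v F)" using F v by (simp add: C1_on_def)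
  have d: "F differentiable at p" for p by (rule C1_on_differentiable[OF F]) simp
  have M: "-M \<le> M" by (simp add: M_def)
  have "integral (cbox (-M, -M) (M, M)) (partial v F) = 0"
  proof (cases "v = (1, 0)")
    case True
    have "integral (cbox (-M) M) (\<lambda>x. partial v F (x, y)) = 0" for y
    proof -
      have "((\<lambda>x. partial v F (x, y)) has_integral (F (M, y) - F (-M, y))) {-M..M}"
        by (rule fundamental_theorem_of_calculus[OF M]) (use True d in \<open>auto intro!: has_vector_derivative_fst\<close>)
      moreover have "F (M, y) = 0" "F (-M, y) = 0" using M by (auto intro!: K(2) out)
      ultimately show ?thesis by (simp add: integral_unique)
    qed
    then have "integral (cbox (-M) M) (\<lambda>y. integral (cbox (-M) M) (\<lambda>x. partial v F (x, y))) = 0" by simp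
    moreover have "integral (cbox (-M, -M) (M, M)) (partial v F)
        = integral (cbox (-M) M) (\<lambda>x. integral (cbox (-M) M) (\<lambda>y. partial v F (x, y)))"
      by (intro integral_prod_continuous continuous_on_subset[OF c]) simp
    moreover have "\<dots> = integral (cbox (-M) M) (\<lambda>y. integral (cbox (-M) M) (\<lambda>x. partial v F (x, y)))"
      by (intro integral_swap_continuous) (use continuous_on_subset[OF c] in \<open>simp add: case_prod_beta'\<close>)
    ultimately show ?thesis by simp
  next
    case False
    then have v: "v = (0, 1)" using v by (auto simp: Basis_plane)
    have "integral (cbox (-M) M) (\<lambda>y. partial v F (x, y)) = 0" for x
    proof -
      have "((\<lambda>y. partial v F (x, y)) has_integral (F (x, M) - F (x, -M))) {-M..M}"
        by (rule fundamental_theorem_of_calculus[OF M]) (use v d in \<open>auto intro!: has_vector_derivative_snd\<close>)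
      moreover have "F (x, M) = 0" "F (x, -M) = 0" using M by (auto intro!: K(2) out)
      ultimately show ?thesis by (simp add: integral_unique)
    qed
    moreover have "integral (cbox (-M, -M) (M, M)) (partial v F)
        = integral (cbox (-M) M) (\<lambda>x. integral (cbox (-M) M) (\<lambda>y. partial v F (x, y)))"
      by (intro integral_prod_continuous continuous_on_subset[OF c]) simp
    ultimately show ?thesis by simp
  qed
  moreover have "partial v F integrable_on cbox (-M, -M) (M, M)"
    by (intro integrable_continuous continuous_on_subset[OF c]) simp
  ultimately have "(partial v F has_integral 0) (cbox (-M, -M) (M, M))"
    by (metis integrable_integral)
  then show ?thesis
    by (rule has_integral_on_superset) (use z in auto)
qed

lemma partial_scaleR:
  fixes f :: "plane \<Rightarrow> 'a::real_normed_vector"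
  assumes "\<phi> differentiable at p" "f differentiable at p"
  shows "partial v (\<lambda>p. \<phi> p *\<^sub>R f p) p = partial v \<phi> p *\<^sub>R f p + \<phi> p *\<^sub>R partial v f p"
    "(\<lambda>p. \<phi> p *\<^sub>R f p) differentiable at p"
proof -
  obtain \<phi>' f' where \<phi>': "(\<phi> has_derivative \<phi>') (at p)" and f': "(f has_derivative f') (at p)"
    using assms by (auto simp: differentiable_def)
  note * = has_derivative_scaleR[OF \<phi>' f']
  show "partial v (\<lambda>p. \<phi> p *\<^sub>R f p) p = partial v \<phi> p *\<^sub>R f p + \<phi> p *\<^sub>R partial v f p"
    using partial_eq[OF *] partial_eq[OF f'] partial_eq[OF \<phi>'] by simp
  show "(\<lambda>p. \<phi> p *\<^sub>R f p) differentiable at p" using * by (auto simp: differentiable_def)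
qed

lemma integrable_continuous_compact_support:
  fixes h :: "plane \<Rightarrow> complex"
  assumes "continuous_on \<Omega> h" "compact K" "K \<subseteq> \<Omega>" "\<And>p. p \<notin> K \<Longrightarrow> h p = 0"
  shows "h integrable_on \<Omega>"
proof -
  have "h absolutely_integrable_on K"
    by (intro absolutely_integrable_continuous_compact assms continuous_on_subset[OF assms(1)])
  then have "h integrable_on K" by (simp add: absolutely_integrable_on_def)
  then show ?thesis using assms by (blast intro: integrable_on_superset)
qed

text \<open>Integration by parts without boundary terms: a test function times \<open>f\<close> is
  C^1 on the whole plane with compact support, so the integral of its partial derivative
  vanishes.\<close>

lemma has_weak_partial_C1:
  assumes \<Omega>: "open \<Omega>" and f: "C1_on \<Omega> f" and v: "v \<in> Basis"
  shows "has_weak_partial v \<Omega> f (partial v f)"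
proof -
  have cf: "continuous_on \<Omega> f" using C1_on_continuous[OF f] .
  have cp: "continuous_on \<Omega> (partial v f)" using f v by (simp add: C1_on_def)
  have loc: "locally_integrable_on g \<Omega>" if "continuous_on \<Omega> g" for g
    unfolding locally_integrable_on_def
    by (auto intro!: absolutely_integrable_continuous_compact continuous_on_subset[OF that])
  have "integral \<Omega> (\<lambda>p. partial v \<phi> p *\<^sub>R f p) = - integral \<Omega> (\<lambda>p. \<phi> p *\<^sub>R partial v f p)"
    if \<phi>: "test_function \<Omega> \<phi>" for \<phi>
  proof -
    obtain K where K: "compact K" "K \<subseteq> \<Omega>" "\<And>p. p \<notin> K \<Longrightarrow> \<phi> p = 0" and \<phi>1: "C1_on UNIV \<phi>"
      using \<phi> by (auto simp: test_function_def)
    have K0: "partial w \<phi> p = 0" if "p \<notin> K" for w p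
      using partial_eq_0_off[OF compact_imp_closed[OF K(1)]] K(3) that by blast
    have c\<phi>: "continuous_on S \<phi>" and cp\<phi>: "w \<in> Basis \<Longrightarrow> continuous_on S (partial w \<phi>)" for S w
      using C1_on_continuous[OF \<phi>1] \<phi>1 continuous_on_subset[of UNIV _ S] by (auto simp: C1_on_def)
    define F where "F p = \<phi> p *\<^sub>R f p" for p
    have F0: "F p = 0" if "p \<notin> K" for p using K(3)[OF that] by (simp add: F_def)
    have FP: "partial w F p = partial w \<phi> p *\<^sub>R f p + \<phi> p *\<^sub>R partial w f p" "F differentiable at p"
      if "p \<in> \<Omega>" for w p
      using partial_scaleR[of \<phi> p f] C1_on_differentiable[OF f that] C1_on_differentiable[OF \<phi>1, of p]
      unfolding F_def[abs_def] by blast+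
    \<comment> \<open>Regularity of \<open>F\<close> is checked on the two open sets
      \<open>\<Omega>\<close> and \<open>- K\<close>, which cover the plane; on the second one
      \<open>F\<close> is zero.\<close>
    have oK: "open (- K)" using K(1) by (simp add: compact_imp_closed open_Compl)
    have FK: "partial w F p = 0" "F differentiable at p" if "p \<notin> K" for w p
      using partial_cong[OF oK _ F0, of p] that by (auto simp: partial_const)
    have U: "\<Omega> \<union> - K = UNIV" using K(2) by auto
    have "continuous_on UNIV (partial w F)" if w: "w \<in> Basis" for w
    proof -
      have "continuous_on \<Omega> (partial w f)" using f w by (simp add: C1_on_def)
      then have "continuous_on \<Omega> (\<lambda>p. partial w \<phi> p *\<^sub>R f p + \<phi> p *\<^sub>R partial w f p)"
        using w by (intro continuous_intros cf c\<phi> cp\<phi>)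
      then have "continuous_on \<Omega> (partial w F)" by (simp add: FP cong: continuous_on_cong)
      moreover have "continuous_on (- K) (partial w F)"
        by (rule continuous_on_eq[OF continuous_on_const[of _ 0]]) (use FK(1) in auto)
      ultimately have "continuous_on (\<Omega> \<union> - K) (partial w F)" using \<Omega> oK by (intro continuous_on_open_Un)
      then show ?thesis by (simp add: U)
    qed
    moreover have "F differentiable at p" for p using FP FK U by blast
    ultimately have "C1_on UNIV F" by (simp add: C1_on_def)
    then have "(partial v F has_integral 0) UNIV"
      using F0 v by (rule integral_partial_compact_support[OF _ K(1)])
    moreover have "(\<lambda>p. if p \<in> \<Omega> then partial v F p else 0) = partial v F"
      by (rule ext) (metis FK(1) K(2) subsetD)
    ultimately have "(partial v F has_integral 0) \<Omega>"
      by (metis has_integral_restrict_UNIV)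
    then have 1: "((\<lambda>p. partial v \<phi> p *\<^sub>R f p + \<phi> p *\<^sub>R partial v f p) has_integral 0) \<Omega>"
      by (rule has_integral_eq[rotated]) (simp add: FP)
    have i: "(\<lambda>p. partial v \<phi> p *\<^sub>R f p) integrable_on \<Omega>" "(\<lambda>p. \<phi> p *\<^sub>R partial v f p) integrable_on \<Omega>"
      by (rule integrable_continuous_compact_support[OF _ K(1,2)];
          use v in \<open>auto intro!: continuous_intros cf cp c\<phi> cp\<phi> simp: K0 K(3)\<close>)+
    have "integral \<Omega> (\<lambda>p. partial v \<phi> p *\<^sub>R f p) + integral \<Omega> (\<lambda>p. \<phi> p *\<^sub>R partial v f p) = 0"
      using integral_add[OF i] integral_unique[OF 1] by simp
    then show ?thesis by (simp add: eq_neg_iff_add_eq_0)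
  qed
  with loc[OF cf] loc[OF cp] show ?thesis by (simp add: has_weak_partial_def)
qed

section \<open>The fundamental lemma of the calculus of variations\<close>

definition bump :: "real \<Rightarrow> real \<Rightarrow> real \<Rightarrow> real" where
  "bump a b t = (max 0 ((t - a) * (b - t)))\<^sup>2"

text \<open>Squaring removes the corner of the positive part. The result is once continuously
  differentiable, which is all that \<open>test_function\<close> asks for.\<close>

lemma bump_has_real_derivative:
  "(bump a b has_real_derivative 2 * max 0 ((t - a) * (b - t)) * (a + b - 2 * t)) (at t)"
proof -
  have sq: "((\<lambda>s::real. (max 0 s)\<^sup>2) has_real_derivative 2 * max 0 s) (at s)" for s
  proof -
    consider "s > 0" | "s < 0" | "s = 0" by linarith
    then show ?thesis
    proof cases
      case 1
      have "((\<lambda>s::real. s\<^sup>2) has_real_derivative 2 * max 0 s) (at s)"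
        using 1 by (auto intro!: derivative_eq_intros)
      then show ?thesis
        by (rule has_field_derivative_transform_within_open[of _ _ _ "{0<..}"]) (use 1 in auto)
    next
      case 2
      have "((\<lambda>s::real. 0) has_real_derivative 2 * max 0 s) (at s)"
        using 2 by (auto intro!: derivative_eq_intros)
      then show ?thesis
        by (rule has_field_derivative_transform_within_open[of _ _ _ "{..<0}"]) (use 2 in auto)
    next
      case 3
      have "((\<lambda>h. ((max 0 (0 + h))\<^sup>2 - (max 0 0)\<^sup>2) / h) \<longlongrightarrow> (0::real)) (at 0)"
      proof (rule Lim_null_comparison)
        show "\<forall>\<^sub>F h::real in at 0. norm (((max 0 (0 + h))\<^sup>2 - (max 0 0)\<^sup>2) / h) \<le> \<bar>h\<bar>"
          by (auto intro!: eventuallyI simp: max_def power2_eq_square)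
        show "((\<lambda>h::real. \<bar>h\<bar>) \<longlongrightarrow> 0) (at 0)"
          by (auto intro!: tendsto_eq_intros)
      qed
      then show ?thesis using 3 by (simp add: DERIV_def)
    qed
  qed
  have "((\<lambda>t. (t - a) * (b - t)) has_real_derivative (a + b - 2 * t)) (at t)"
    by (auto intro!: derivative_eq_intros simp: algebra_simps)
  from DERIV_chain2[OF sq this] show ?thesis by (simp add: bump_def[abs_def] mult.commute)
qed

lemma bump_nonneg: "0 \<le> bump a b t" by (simp add: bump_def)

lemma bump_pos_iff:
  assumes "a < b"
  shows "0 < bump a b t \<longleftrightarrow> a < t \<and> t < b"
proof -
  have *: "0 < (max 0 s)\<^sup>2 \<longleftrightarrow> 0 < s" for s :: real by (simp add: max_def less_le)
  show ?thesis unfolding bump_def * zero_less_mult_iff using assms by auto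
qed

lemma mem_box_plane:
  fixes a b p :: plane
  shows "p \<in> box a b \<longleftrightarrow> fst a < fst p \<and> fst p < fst b \<and> snd a < snd p \<and> snd p < snd b"
    and "p \<in> cbox a b \<longleftrightarrow> fst a \<le> fst p \<and> fst p \<le> fst b \<and> snd a \<le> snd p \<and> snd p \<le> snd b"
  unfolding mem_box Basis_plane by (auto simp: inner_prod_def)

lemma C1_on_exp_bump:
  "C1_on UNIV (\<lambda>p. 1 - exp (- (c * (bump a b (fst p) * bump a' b' (snd p)))))"
proof -
  define r where "r p = bump a b (fst p) * bump a' b' (snd p)" for p :: plane
  have c: "continuous_on UNIV (\<lambda>t. 2 * max 0 ((t - a) * (b - t)) * (a + b - 2 * t))" for a b :: real
    by (intro continuous_intros)
  have r: "C1_on UNIV r"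
    using partial_separable(3)[OF bump_has_real_derivative bump_has_real_derivative c c]
    by (simp add: r_def[abs_def])
  have d: "((\<lambda>p. 1 - exp (- (c * r p))) has_derivative
     (\<lambda>h. fst h *\<^sub>R (exp (- (c * r p)) * c * partial (1, 0) r p) +
          snd h *\<^sub>R (exp (- (c * r p)) * c * partial (0, 1) r p))) (at p)" for p
  proof -
    have "(r has_derivative (\<lambda>h. fst h *\<^sub>R partial (1, 0) r p + snd h *\<^sub>R partial (0, 1) r p)) (at p)"
      by (intro has_derivative_partial C1_on_differentiable[OF r]) simp
    then show ?thesis
      by (auto intro!: derivative_eq_intros simp: algebra_simps fun_eq_iff)
  qed
  have cr: "continuous_on UNIV r" "continuous_on UNIV (partial (1, 0) r)" "continuous_on UNIV (partial (0, 1) r)"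
    using r C1_on_continuous[OF r] by (auto simp: C1_on_def Basis_plane)
  have "C1_on UNIV (\<lambda>p. 1 - exp (- (c * r p)))"
    by (rule C1_on_of_has_derivative(1)[OF d]) (intro continuous_intros cr)+
  then show ?thesis by (simp add: r_def)
qed

text \<open>With \<open>r\<close> positive exactly on the open box, the functions
  \<open>1 - exp (- n r)\<close> are test functions that increase to the indicator of the box, and
  dominated convergence applies.\<close>

lemma integral_box_eq_0:
  fixes q :: "plane \<Rightarrow> complex"
  assumes q: "locally_integrable_on q \<Omega>"
    and 0: "\<And>\<phi>. test_function \<Omega> \<phi> \<Longrightarrow> integral \<Omega> (\<lambda>p. \<phi> p *\<^sub>R q p) = 0"
    and B: "cbox a b \<subseteq> \<Omega>"
  shows "integral (cbox a b) q = 0"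
proof -
  define r where "r p = bump (fst a) (fst b) (fst p) * bump (snd a) (snd b) (snd p)" for p :: plane
  define \<phi> where "\<phi> n p = 1 - exp (- (real n * r p))" for n p
  have r0: "0 \<le> r p" for p by (simp add: r_def bump_nonneg)

  show ?thesis
  proof (cases "box a b = {}")
    case True
    then show ?thesis by (intro integral_null) (simp add: content_eq_0_interior interior_cbox)
  next
    case False
    then have ab: "fst a < fst b" "snd a < snd b"
      by (auto simp: set_eq_iff mem_box_plane)
    have rb: "p \<in> box a b \<Longrightarrow> r p > 0" for p
      by (auto simp: r_def mem_box_plane bump_pos_iff ab intro!: mult_pos_pos)
    have out: "r p = 0" if "p \<notin> box a b" for p
    proof -
      have "\<not> r p > 0"
        using that bump_nonneg[of "fst a" "fst b" "fst p"]
        by (auto simp: r_def mem_box_plane zero_less_mult_iff bump_pos_iff ab)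
      with r0[of p] show ?thesis by simp
    qed
    have out': "\<phi> n p = 0" if "p \<notin> cbox a b" for n p
      using out[of p] that box_subset_cbox[of a b] by (auto simp: \<phi>_def)
    have t: "test_function \<Omega> (\<phi> n)" for n
      unfolding test_function_def
    proof
      show "C1_on UNIV (\<phi> n)"
        using C1_on_exp_bump by (simp add: \<phi>_def[abs_def] r_def[abs_def])
      show "\<exists>K. compact K \<and> K \<subseteq> \<Omega> \<and> (\<forall>p. p \<notin> K \<longrightarrow> \<phi> n p = 0)"
        using B out' by (intro exI[of _ "cbox a b"]) auto
    qed
    have qi: "q absolutely_integrable_on cbox a b"
      using q B by (auto simp: locally_integrable_on_def)
    have \<phi>c: "continuous_on S (\<phi> n)" for n S
      using t[of n] C1_on_continuous continuous_on_subset[of UNIV "\<phi> n" S] by (auto simp: test_function_def)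
    have \<phi>1: "\<bar>\<phi> n p\<bar> \<le> 1" for n p using r0[of p] by (simp add: \<phi>_def)
    have i: "(\<lambda>p. \<phi> n p *\<^sub>R q p) integrable_on cbox a b" for n
    proof -
      have "bounded (\<phi> n ` cbox a b)" unfolding bounded_iff using \<phi>1 by (metis imageE real_norm_def)
      moreover have "\<phi> n \<in> borel_measurable (lebesgue_on (cbox a b))"
        by (rule continuous_imp_measurable_on_sets_lebesgue[OF \<phi>c]) simp
      moreover have "bilinear ((*\<^sub>R) :: real \<Rightarrow> complex \<Rightarrow> complex)"
        by (auto simp: bilinear_def linear_iff algebra_simps)
      ultimately have "(\<lambda>p. \<phi> n p *\<^sub>R q p) absolutely_integrable_on cbox a b"
        using absolutely_integrable_bounded_measurable_product[of "(*\<^sub>R)" "\<phi> n" "cbox a b" q] qi by auto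
      then show ?thesis by (simp add: absolutely_integrable_on_def)
    qed
    have z: "integral (cbox a b) (\<lambda>p. \<phi> n p *\<^sub>R q p) = 0" for n
    proof -
      have "((\<lambda>p. \<phi> n p *\<^sub>R q p) has_integral integral (cbox a b) (\<lambda>p. \<phi> n p *\<^sub>R q p)) \<Omega>"
        using integrable_integral[OF i[of n]] by (rule has_integral_on_superset) (use B out' in auto)
      with 0[OF t[of n]] show ?thesis by (simp add: integral_unique)
    qed
    have "(\<lambda>n. integral (cbox a b) (\<lambda>p. \<phi> n p *\<^sub>R q p)) \<longlonglongrightarrow>
        integral (cbox a b) (\<lambda>p. if p \<in> box a b then q p else 0)"
    proof (rule dominated_convergence(2)[OF i, of "\<lambda>p. norm (q p)"])
      show "(\<lambda>p. norm (q p)) integrable_on cbox a b" using qi by (simp add: absolutely_integrable_on_def)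
      show "norm (\<phi> n p *\<^sub>R q p) \<le> norm (q p)" for n p
        using \<phi>1[of n p] by (simp add: mult_left_le_one_le)
      show "(\<lambda>n. \<phi> n p *\<^sub>R q p) \<longlonglongrightarrow> (if p \<in> box a b then q p else 0)" if "p \<in> cbox a b" for p
      proof (cases "p \<in> box a b")
        case True
        have "(\<lambda>n. \<phi> n p) \<longlonglongrightarrow> 1 - 0"
          unfolding \<phi>_def
          by (intro tendsto_intros filterlim_compose[OF exp_at_bot]
            filterlim_compose[OF filterlim_uminus_at_bot_at_top]
            filterlim_at_top_mult_tendsto_pos[OF tendsto_const rb[OF True]] filterlim_real_sequentially)
        then have "(\<lambda>n. \<phi> n p *\<^sub>R q p) \<longlonglongrightarrow> (1 - 0) *\<^sub>R q p" by (intro tendsto_intros)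
        then show ?thesis using True by simp
      next
        case False
        then show ?thesis using out[OF False] by (simp add: \<phi>_def)
      qed
    qed
    then have "integral (cbox a b) (\<lambda>p. if p \<in> box a b then q p else 0) = 0"
      by (simp add: z LIMSEQ_const_iff)
    moreover have "integral (cbox a b) (\<lambda>p. if p \<in> box a b then q p else 0) = integral (cbox a b) q"
      by (rule integral_spike[OF negligible_frontier_interval]) auto
    ultimately show ?thesis by simp
  qed
qed

text \<open>The integrals over all small boxes vanish, so Lebesgue differentiation gives the value
  zero at almost every point of a box inside \<open>\<Omega>\<close>; countably many such boxes
  cover \<open>\<Omega>\<close>.\<close>

lemma locally_integrable_ae_0:
  fixes q :: "plane \<Rightarrow> complex"
  assumes \<Omega>: "open \<Omega>" and q: "locally_integrable_on q \<Omega>"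
    and 0: "\<And>\<phi>. test_function \<Omega> \<phi> \<Longrightarrow> integral \<Omega> (\<lambda>p. \<phi> p *\<^sub>R q p) = 0"
  shows "negligible {p \<in> \<Omega>. q p \<noteq> 0}"
proof -
  have box: "negligible {p \<in> cbox a b. q p \<noteq> 0}" if B: "cbox a b \<subseteq> \<Omega>" for a b
  proof -
    define q' where "q' p = (if p \<in> cbox a b then q p else 0)" for p
    have qi: "q absolutely_integrable_on cbox a b"
      using q B by (auto simp: locally_integrable_on_def)
    have "q integrable_on cbox a b" using qi by (simp add: absolutely_integrable_on_def)
    then have "q' integrable_on UNIV" by (simp add: q'_def[abs_def] integrable_restrict_UNIV)
    then have i: "q' integrable_on cbox c e" for c e
      by (rule integrable_on_subcbox) simp
    have z: "integral (cbox c e) q' = 0" for c e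
    proof -
      obtain c' e' where ce: "cbox c e \<inter> cbox a b = cbox c' e'"
        using Int_interval[of c e a b] by auto
      have "integral (cbox c e) q' = integral (cbox c e \<inter> cbox a b) q"
        unfolding q'_def[abs_def]
        by (simp only: Henstock_Kurzweil_Integration.integral_restrict_Int Int_commute)
      then show ?thesis using integral_box_eq_0[OF q 0, of c' e'] B ce by auto
    qed
    obtain N where N: "negligible N"
       "\<And>x e. \<lbrakk>x \<notin> N; 0 < e\<rbrakk> \<Longrightarrow> \<exists>d>0. \<forall>h. 0 < h \<and> h < d \<longrightarrow>
           norm (integral (cbox x (x + h *\<^sub>R One)) q' /\<^sub>R h ^ DIM(plane) - q' x) < e"
      using integrable_ccontinuous_explicit[of q', OF i] by blast
    have "q' x = 0" if x: "x \<notin> N" for x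
    proof (rule ccontr)
      assume "q' x \<noteq> 0"
      then have "0 < norm (q' x)" by simp
      from N(2)[OF x this, unfolded z] obtain d :: real where d: "0 < d"
        "\<forall>h. 0 < h \<and> h < d \<longrightarrow> norm (0 /\<^sub>R h ^ DIM(plane) - q' x) < norm (q' x)" by blast
      from d(2)[rule_format, of "d / 2"] d(1) show False by simp
    qed
    then have "{p \<in> cbox a b. q p \<noteq> 0} \<subseteq> N"
      unfolding q'_def by (metis (mono_tags, lifting) mem_Collect_eq subsetI)
    then show ?thesis using N(1) negligible_subset by blast
  qed
  obtain D where D: "countable D" "D \<subseteq> Pow \<Omega>" "\<And>X. X \<in> D \<Longrightarrow> \<exists>a b. X = cbox a b" "\<Union>D = \<Omega>"
    using open_countable_Union_open_cbox[OF \<Omega>] by blast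
  have "negligible {p \<in> X. q p \<noteq> 0}" if "X \<in> D" for X
    using D(2) D(3)[OF that] that box by blast
  then have "negligible (\<Union>((\<lambda>X. {p \<in> X. q p \<noteq> 0}) ` D))"
    using D(1) by (intro negligible_countable_Union) auto
  moreover have "{p \<in> \<Omega>. q p \<noteq> 0} = \<Union>((\<lambda>X. {p \<in> X. q p \<noteq> 0}) ` D)"
    unfolding D(4)[symmetric] by blast
  ultimately show ?thesis by simp
qed

lemma integrable_test_times:
  assumes "open \<Omega>" "locally_integrable_on g \<Omega>" "test_function \<Omega> \<phi>"
  shows "(\<lambda>p. \<phi> p *\<^sub>R g p) integrable_on \<Omega>"
proof -
  obtain K where K: "compact K" "K \<subseteq> \<Omega>" "\<And>p. p \<notin> K \<Longrightarrow> \<phi> p = 0" and \<phi>1: "C1_on UNIV \<phi>"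
    using assms(3) by (auto simp: test_function_def)
  have \<phi>c: "continuous_on K \<phi>" using C1_on_continuous[OF \<phi>1] continuous_on_subset by blast
  have Ks: "K \<in> sets lebesgue" using K(1) by (simp add: compact_imp_closed lmeasurable_compact fmeasurableD)
  have "bounded (\<phi> ` K)" using compact_imp_bounded[OF compact_continuous_image[OF \<phi>c K(1)]] .
  moreover have "\<phi> \<in> borel_measurable (lebesgue_on K)"
    by (rule continuous_imp_measurable_on_sets_lebesgue[OF \<phi>c Ks])
  moreover have "bilinear ((*\<^sub>R) :: real \<Rightarrow> complex \<Rightarrow> complex)"
    by (auto simp: bilinear_def linear_iff algebra_simps)
  moreover have "g absolutely_integrable_on K" using assms(2) K by (simp add: locally_integrable_on_def)
  ultimately have "(\<lambda>p. \<phi> p *\<^sub>R g p) absolutely_integrable_on K"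
    using absolutely_integrable_bounded_measurable_product[of "(*\<^sub>R)" \<phi> K g] Ks by auto
  then have "(\<lambda>p. \<phi> p *\<^sub>R g p) integrable_on K" by (simp add: absolutely_integrable_on_def)
  then show ?thesis by (rule integrable_on_superset) (simp_all add: K)
qed

lemma has_weak_partial_unique:
  assumes \<Omega>: "open \<Omega>" and "has_weak_partial v \<Omega> f g" "has_weak_partial v \<Omega> f h"
  shows "negligible {p \<in> \<Omega>. g p \<noteq> h p}"
proof -
  have gi: "locally_integrable_on g \<Omega>" and hi: "locally_integrable_on h \<Omega>"
    using assms by (auto simp: has_weak_partial_def)
  have "locally_integrable_on (\<lambda>p. g p - h p) \<Omega>"
    using gi hi by (auto simp: locally_integrable_on_def intro: set_integral_diff(1))
  moreover have "integral \<Omega> (\<lambda>p. \<phi> p *\<^sub>R (g p - h p)) = 0" if "test_function \<Omega> \<phi>" for \<phi>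
  proof -
    have "integral \<Omega> (\<lambda>p. \<phi> p *\<^sub>R g p) = integral \<Omega> (\<lambda>p. \<phi> p *\<^sub>R h p)"
      using assms(2,3) that by (simp add: has_weak_partial_def)
    then show ?thesis
      using integral_diff[OF integrable_test_times[OF \<Omega> gi that] integrable_test_times[OF \<Omega> hi that]]
      by (simp add: scaleR_diff_right)
  qed
  ultimately have "negligible {p \<in> \<Omega>. g p - h p \<noteq> 0}" by (rule locally_integrable_ae_0[OF \<Omega>])
  then show ?thesis by simp
qed

subsection \<open>The Sobolev norm of a classical function\<close>

lemma AE_lebesgue_on_open_iff:
  assumes "open \<Omega>"
  shows "(AE p in lebesgue_on \<Omega>. P p) \<longleftrightarrow> negligible {p \<in> \<Omega>. \<not> P p}"
proof -
  have s: "\<Omega> \<inter> space lebesgue \<in> sets lebesgue" using assms by auto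
  have eq: "{x \<in> space lebesgue. \<not> (x \<in> \<Omega> \<longrightarrow> P x)} = {p \<in> \<Omega>. \<not> P p}" by auto
  have "(AE p in lebesgue_on \<Omega>. P p) \<longleftrightarrow> (AE p in lebesgue. p \<in> \<Omega> \<longrightarrow> P p)"
    by (rule AE_restrict_space_iff[OF s])
  also have "\<dots> \<longleftrightarrow> {p \<in> \<Omega>. \<not> P p} \<in> null_sets lebesgue"
    unfolding eventually_ae_filter eq by (meson completion.complete2 order_refl)
  finally show ?thesis by (simp only: negligible_iff_null_sets)
qed

text \<open>A nonempty open set is not negligible, so a continuous representative cannot exceed the
  essential supremum anywhere.\<close>

lemma Linf_norm_eq_SUP:
  fixes F G :: "plane \<Rightarrow> complex"
  assumes \<Omega>: "open \<Omega>" and F: "continuous_on \<Omega> F" and FG: "negligible {p \<in> \<Omega>. G p \<noteq> F p}"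
  shows "Linf_norm \<Omega> G = (SUP p\<in>\<Omega>. ennreal (cmod (F p)))"
proof -
  have sets: "\<Omega> \<in> sets lebesgue" using \<Omega> by auto
  have Fm: "F \<in> borel_measurable (lebesgue_on \<Omega>)"
    by (rule continuous_imp_measurable_on_sets_lebesgue[OF F sets])
  have "AE x in lebesgue. (if x \<in> \<Omega> then F x else 0) = (if x \<in> \<Omega> then G x else 0)"
    using FG by (intro AE_I'[of "{p \<in> \<Omega>. G p \<noteq> F p}"]) (auto simp: negligible_iff_null_sets)
  from borel_measurable_AE[OF borel_measurable_if_I[OF Fm sets] this]
  have Gm: "G \<in> borel_measurable (lebesgue_on \<Omega>)" by (rule borel_measurable_if_D)
  then have gm: "(\<lambda>p. ennreal (cmod (G p))) \<in> borel_measurable (lebesgue_on \<Omega>)" by measurable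
  let ?S = "SUP p\<in>\<Omega>. ennreal (cmod (F p))"
  have "negligible {p \<in> \<Omega>. \<not> ennreal (cmod (G p)) \<le> ?S}"
  proof (rule negligible_subset[OF FG])
    show "{p \<in> \<Omega>. \<not> ennreal (cmod (G p)) \<le> ?S} \<subseteq> {p \<in> \<Omega>. G p \<noteq> F p}"
      by (auto intro: SUP_upper)
  qed
  then have "AE p in lebesgue_on \<Omega>. ennreal (cmod (G p)) \<le> ?S"
    by (simp only: AE_lebesgue_on_open_iff[OF \<Omega>])
  from esssup_I[OF gm this] have le: "Linf_norm \<Omega> G \<le> ?S" by (simp add: Linf_norm_def)
  have "?S \<le> Linf_norm \<Omega> G"
  proof (rule SUP_least, rule ccontr)
    fix p assume p: "p \<in> \<Omega>" and "\<not> ennreal (cmod (F p)) \<le> Linf_norm \<Omega> G"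
    then have less: "Linf_norm \<Omega> G < ennreal (cmod (F p))" by simp
    then obtain r where r: "Linf_norm \<Omega> G = ennreal r" "0 \<le> r"
      by (cases "Linf_norm \<Omega> G") auto
    define U where "U = {q \<in> \<Omega>. r < cmod (F q)}"
    have "open U"
      unfolding U_def using continuous_on_open_vimage[OF \<Omega>, THEN iffD1, OF continuous_on_norm[OF F], rule_format, of "{r<..}"]
      by (simp add: vimage_def Int_def conj_commute)
    moreover have "p \<in> U" using p less r by (simp add: U_def ennreal_less_iff)
    ultimately have "\<not> negligible U" using open_not_negligible by blast
    moreover have "negligible {q \<in> \<Omega>. \<not> ennreal (cmod (G q)) \<le> ennreal r}"
      using esssup_AE[of "\<lambda>p. ennreal (cmod (G p))" "lebesgue_on \<Omega>"] r(1)
      by (simp only: AE_lebesgue_on_open_iff[OF \<Omega>] Linf_norm_def)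
    then have "negligible ({q \<in> \<Omega>. \<not> ennreal (cmod (G q)) \<le> ennreal r} \<union> {p \<in> \<Omega>. G p \<noteq> F p})"
      using FG by (rule negligible_Un)
    then have "negligible U"
      by (rule negligible_subset) (use r(2) in \<open>auto simp: U_def\<close>)
    ultimately show False by blast
  qed
  with le show ?thesis by (rule antisym)
qed

lemma weak_partial_C1:
  assumes "open \<Omega>" "C1_on \<Omega> f" "v \<in> Basis"
  shows "has_weak_partial v \<Omega> f (weak_partial v \<Omega> f)"
    and "negligible {p \<in> \<Omega>. weak_partial v \<Omega> f p \<noteq> partial v f p}"
proof -
  show 1: "has_weak_partial v \<Omega> f (weak_partial v \<Omega> f)"
    unfolding weak_partial_def by (rule someI[of "has_weak_partial v \<Omega> f", OF has_weak_partial_C1[OF assms]])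
  show "negligible {p \<in> \<Omega>. weak_partial v \<Omega> f p \<noteq> partial v f p}"
    by (rule has_weak_partial_unique[OF assms(1) 1 has_weak_partial_C1[OF assms]])
qed

text \<open>Needed for second derivatives: \<open>weak_partial\<close> selects an arbitrary
  representative, so the second differentiation acts on a function that agrees with the classical
  derivative only almost everywhere.\<close>

lemma has_weak_partial_ae_cong:
  assumes "has_weak_partial v \<Omega> f g" "locally_integrable_on f' \<Omega>" "negligible {p \<in> \<Omega>. f' p \<noteq> f p}"
  shows "has_weak_partial v \<Omega> f' g"
proof -
  have "integral \<Omega> (\<lambda>p. partial v \<phi> p *\<^sub>R f p) = integral \<Omega> (\<lambda>p. partial v \<phi> p *\<^sub>R f' p)" for \<phi>
    by (rule integral_spike[OF assms(3)]) simp
  then show ?thesis using assms(1,2) by (simp add: has_weak_partial_def)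
qed

lemma weak_partial2_C2:
  assumes "open \<Omega>" "C2_on \<Omega> f" "v \<in> Basis" "w \<in> Basis"
  shows "has_weak_partial w \<Omega> (weak_partial v \<Omega> f) (partial w (partial v f))"
    and "negligible {p \<in> \<Omega>. weak_partial w \<Omega> (weak_partial v \<Omega> f) p \<noteq> partial w (partial v f) p}"
proof -
  note 1 = weak_partial_C1[OF assms(1) C2_on_C1[OF assms(2)] assms(3)]
  note 2 = has_weak_partial_C1[OF assms(1) C2_on_C1_partial[OF assms(2,3)] assms(4)]
  have "locally_integrable_on (weak_partial v \<Omega> f) \<Omega>" using 1(1) by (simp add: has_weak_partial_def)
  from has_weak_partial_ae_cong[OF 2 this 1(2)]
  show 3: "has_weak_partial w \<Omega> (weak_partial v \<Omega> f) (partial w (partial v f))" .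
  show "negligible {p \<in> \<Omega>. weak_partial w \<Omega> (weak_partial v \<Omega> f) p \<noteq> partial w (partial v f) p}"
    using has_weak_partial_unique[OF assms(1) _ 3] someI[of "has_weak_partial w \<Omega> (weak_partial v \<Omega> f)", OF 3]
    unfolding weak_partial_def[of w] by blast
qed

lemma cmod_weighted: "cmod (weighted \<sigma> f p) = exp (\<sigma> * \<bar>fst p\<bar>) * cmod (f p)"
  by (cases p) (simp add: weighted_def)

lemma Linf_norm_weighted:
  assumes "open \<Omega>" "continuous_on \<Omega> F" "negligible {p \<in> \<Omega>. G p \<noteq> F p}"
  shows "Linf_norm \<Omega> (weighted \<sigma> G) = (SUP p\<in>\<Omega>. ennreal (exp (\<sigma> * \<bar>fst p\<bar>) * cmod (F p)))"
proof -
  have "continuous_on \<Omega> (weighted \<sigma> F)"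
    using assms(2) by (auto simp: weighted_def case_prod_beta' intro!: continuous_intros)
  moreover have "negligible {p \<in> \<Omega>. weighted \<sigma> G p \<noteq> weighted \<sigma> F p}"
    by (rule negligible_subset[OF assms(3)]) (auto simp: weighted_def)
  ultimately show ?thesis
    using Linf_norm_eq_SUP[OF assms(1), of "weighted \<sigma> F" "weighted \<sigma> G"] by (simp add: cmod_weighted)
qed

lemma W2inf_norm_C2:
  assumes "C2_on (strip d) f"
  shows "W2inf_norm \<sigma> d f =
     (SUP p\<in>strip d. ennreal (cmod (f p)))
     + (\<Sum>v\<in>Basis. SUP p\<in>strip d. ennreal (exp (\<sigma> * \<bar>fst p\<bar>) * cmod (partial v f p)))
     + (\<Sum>v\<in>Basis. \<Sum>w\<in>Basis. SUP p\<in>strip d. ennreal (exp (\<sigma> * \<bar>fst p\<bar>) * cmod (partial w (partial v f) p)))"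
proof -
  have c1: "continuous_on (strip d) (partial v f)" if "v \<in> Basis" for v
    using C1_on_continuous[OF C2_on_C1_partial[OF assms that]] .
  have c2: "continuous_on (strip d) (partial w (partial v f))" if "v \<in> Basis" "w \<in> Basis" for v w
    using C1_on_continuous_partial[OF C2_on_C1_partial[OF assms that(1)] that(2)] .
  show ?thesis
    unfolding W2inf_norm_def
    by (intro arg_cong2[where f="(+)"] sum.cong refl Linf_norm_eq_SUP Linf_norm_weighted open_strip
        C2_on_continuous[OF assms] c1 c2 weak_partial_C1(2) C2_on_C1[OF assms] weak_partial2_C2(2) assms)
      simp_all
qed

lemma W2inf_C2_iff:
  assumes "C2_on (strip d) f"
  shows "f \<in> W2inf \<sigma> d \<longleftrightarrow> W2inf_norm \<sigma> d f < \<infinity>"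
  using weak_partial_C1(1)[OF open_strip C2_on_C1[OF assms]] weak_partial2_C2(1)[OF open_strip assms]
    C2_on_continuous[OF assms] unfolding W2inf_def by blast

text \<open>Bounds each of the seven suprema of \<open>W2inf_norm_C2\<close> instead of their sum,
  with a real constant, so that the norm can be handled pointwise.\<close>

definition wbound :: "real \<Rightarrow> real \<Rightarrow> (plane \<Rightarrow> complex) \<Rightarrow> real \<Rightarrow> bool" where
  "wbound \<sigma> d f c \<longleftrightarrow> (\<forall>p\<in>strip d. cmod (f p) \<le> c \<and>
     (\<forall>v\<in>Basis. exp (\<sigma> * \<bar>fst p\<bar>) * cmod (partial v f p) \<le> c \<and>
       (\<forall>w\<in>Basis. exp (\<sigma> * \<bar>fst p\<bar>) * cmod (partial w (partial v f) p) \<le> c)))"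

lemma wbound_of_W2inf_norm:
  assumes C2: "C2_on (strip d) f" and le: "W2inf_norm \<sigma> d f \<le> ennreal c" and c: "0 \<le> c"
  shows "wbound \<sigma> d f c"
proof -
  let ?A = "SUP p\<in>strip d. ennreal (cmod (f p))"
  let ?B = "\<lambda>v. SUP p\<in>strip d. ennreal (exp (\<sigma> * \<bar>fst p\<bar>) * cmod (partial v f p))"
  let ?C = "\<lambda>v w. SUP p\<in>strip d. ennreal (exp (\<sigma> * \<bar>fst p\<bar>) * cmod (partial w (partial v f) p))"
  have le': "?A + (\<Sum>v\<in>Basis. ?B v) + (\<Sum>v\<in>Basis. \<Sum>w\<in>Basis. ?C v w) \<le> ennreal c"
    using le by (simp add: W2inf_norm_C2[OF C2])
  have A: "?A \<le> ennreal c"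
    by (rule order_trans[OF _ le']) (simp add: add.assoc)
  have B: "?B v \<le> ennreal c" if "v \<in> Basis" for v
  proof -
    have "?B v \<le> (\<Sum>v\<in>Basis. ?B v)" by (rule member_le_sum[OF that]) auto
    also have "\<dots> \<le> ?A + (\<Sum>v\<in>Basis. ?B v) + (\<Sum>v\<in>Basis. \<Sum>w\<in>Basis. ?C v w)"
      by (simp add: add.assoc add.left_commute[of ?A])
    also note le'
    finally show ?thesis .
  qed
  have C: "?C v w \<le> ennreal c" if "v \<in> Basis" "w \<in> Basis" for v w
  proof -
    have "?C v w \<le> (\<Sum>w\<in>Basis. ?C v w)" by (rule member_le_sum[OF that(2)]) auto
    also have "\<dots> \<le> (\<Sum>v\<in>Basis. \<Sum>w\<in>Basis. ?C v w)"
      by (rule member_le_sum[OF that(1), of "\<lambda>v. \<Sum>w\<in>Basis. ?C v w"]) auto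
    also have "\<dots> \<le> ?A + (\<Sum>v\<in>Basis. ?B v) + (\<Sum>v\<in>Basis. \<Sum>w\<in>Basis. ?C v w)"
      by simp
    also note le'
    finally show ?thesis .
  qed
  show ?thesis
    unfolding wbound_def using A B C c by (auto simp: SUP_le_iff ennreal_le_iff)
qed

text \<open>The factor 7 counts the function, its two first and its four second derivatives.\<close>

lemma W2inf_norm_le_of_wbound:
  assumes C2: "C2_on (strip d) f" and b: "wbound \<sigma> d f c" and c: "0 \<le> c"
  shows "W2inf_norm \<sigma> d f \<le> ennreal (7 * c)"
proof -
  have "(SUP p\<in>strip d. ennreal (cmod (f p))) \<le> ennreal c"
    using b c by (auto simp: wbound_def intro!: SUP_least ennreal_leI)
  moreover have "(SUP p\<in>strip d. ennreal (exp (\<sigma> * \<bar>fst p\<bar>) * cmod (partial v f p))) \<le> ennreal c" if "v \<in> Basis" for v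
    using b c that by (auto simp: wbound_def intro!: SUP_least ennreal_leI)
  moreover have "(SUP p\<in>strip d. ennreal (exp (\<sigma> * \<bar>fst p\<bar>) * cmod (partial w (partial v f) p))) \<le> ennreal c"
    if "v \<in> Basis" "w \<in> Basis" for v w
    using b c that by (auto simp: wbound_def intro!: SUP_least ennreal_leI)
  ultimately have "W2inf_norm \<sigma> d f \<le> ennreal c + (\<Sum>v\<in>(Basis::plane set). ennreal c) + (\<Sum>v\<in>(Basis::plane set). \<Sum>w\<in>(Basis::plane set). ennreal c)"
    unfolding W2inf_norm_C2[OF C2] by (intro add_mono sum_mono)
  also have "\<dots> = ennreal (7 * c)"
  proof -
    have "2 * ennreal x = ennreal (2 * x)" if "0 \<le> x" for x
      using that by (simp add: ennreal_mult')
    then show ?thesis using c by (simp add: Basis_plane flip: ennreal_plus)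
  qed
  finally show ?thesis .
qed

subsection \<open>Even extension of Neumann solutions\<close>

text \<open>A converse of the fundamental theorem that presupposes no differentiability of
  \<open>F\<close>. It recovers derivatives on the lines where only integrated identities are
  available.\<close>

lemma has_vector_derivative_of_has_integral:
  fixes F g :: "real \<Rightarrow> 'a::banach"
  assumes g: "continuous_on UNIV g" and F: "\<And>a b. a \<le> b \<Longrightarrow> (g has_integral F b - F a) {a..b}"
  shows "(F has_vector_derivative g t) (at t)"
proof -
  have "((\<lambda>u. integral {t - 1..u} g) has_vector_derivative g t) (at t within {t - 1..t + 1})"
    by (rule integral_has_vector_derivative) (auto intro: continuous_on_subset[OF g])
  then have "((\<lambda>u. integral {t - 1..u} g) has_vector_derivative g t) (at t)"
    by (simp add: at_within_Icc_at)
  then have "((\<lambda>u. F (t - 1) + integral {t - 1..u} g) has_vector_derivative 0 + g t) (at t)"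
    by (intro derivative_intros)
  then have "((\<lambda>u. F (t - 1) + integral {t - 1..u} g) has_vector_derivative g t) (at t)" by simp
  then show ?thesis
  proof (rule has_vector_derivative_transform_within_open[where S="{t - 1<..}"])
    show "F (t - 1) + integral {t - 1..u} g = F u" if "u \<in> {t - 1<..}" for u
      using integral_unique[OF F[of "t - 1" u]] that by simp
  qed auto
qed

lemma finite_sin_zeros:
  assumes "0 < d"
  shows "finite {t \<in> {a..b}. sin (pi * t / d) = 0}"
proof (rule finite_subset)
  show "{t \<in> {a..b}. sin (pi * t / d) = 0} \<subseteq> (\<lambda>i. of_int i * d) ` {\<lfloor>a / d\<rfloor>..\<lceil>b / d\<rceil>}"
  proof
    fix t assume t: "t \<in> {t \<in> {a..b}. sin (pi * t / d) = 0}"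
    then obtain i :: int where i: "pi * t / d = of_int i * pi" by (auto simp: sin_zero_iff_int2)
    then have ti: "t = of_int i * d" using assms by (simp add: field_simps)
    then have "a / d \<le> of_int i" "of_int i \<le> b / d" using t assms by (auto simp: field_simps)
    then have "\<lfloor>a / d\<rfloor> \<le> i" "i \<le> \<lceil>b / d\<rceil>" by linarith+
    then show "t \<in> (\<lambda>i. of_int i * d) ` {\<lfloor>a / d\<rfloor>..\<lceil>b / d\<rceil>}" using ti by auto
  qed
qed simp

text \<open>The zeros of the sine encode the lines y in dZ. Their complement is dense: a zero
  \<open>t\<close> is the limit of \<open>t + d / (n + 2)\<close>, where the sine does not
  vanish.\<close>

lemma continuous_zero_of_sin_nonzero:
  fixes G :: "real \<Rightarrow> 'a::real_normed_vector"
  assumes "0 < d" "continuous_on UNIV G" "\<And>t. sin (pi * t / d) \<noteq> 0 \<Longrightarrow> G t = 0"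
  shows "G t = 0"
proof (cases "sin (pi * t / d) = 0")
  case True
  have "(\<lambda>n. t + d / (real n + 2)) \<longlonglongrightarrow> t + 0"
    using LIMSEQ_ignore_initial_segment[OF lim_const_over_n[of d], of 2]
    by (intro tendsto_add tendsto_const) (simp add: add.commute)
  moreover have "isCont G (t + 0)" using assms(2) by (simp add: continuous_on_eq_continuous_at)
  ultimately have "(\<lambda>n. G (t + d / (real n + 2))) \<longlonglongrightarrow> G (t + 0)"
    by (rule isCont_tendsto_compose[rotated])
  moreover have "G (t + d / (real n + 2)) = 0" for n
  proof (rule assms(3))
    have "pi * (t + d / (real n + 2)) / d = pi * t / d + pi / (real n + 2)"
      using assms(1) by (simp add: field_simps)
    then have "sin (pi * (t + d / (real n + 2)) / d) = cos (pi * t / d) * sin (pi / (real n + 2))"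
      by (simp add: sin_add True)
    moreover have "cos (pi * t / d) \<noteq> 0"
      using sin_cos_squared_add[of "pi * t / d"] True by auto
    moreover have "sin (pi / (real n + 2)) > 0"
      by (rule sin_gt_zero) (auto simp: field_simps add_pos_nonneg)
    ultimately show "sin (pi * (t + d / (real n + 2)) / d) \<noteq> 0" by simp
  qed
  ultimately show ?thesis by (simp add: LIMSEQ_const_iff)
qed (use assms(3) in simp)

text \<open>A function with partial derivatives off the lines \<open>y \<in> d\<int>\<close> that extend continuously
  is continuously differentiable: integrate across the lines.\<close>

lemma C1_across_lines:
  fixes f f1 f2 :: "plane \<Rightarrow> complex"
  assumes d: "0 < d"
    and f: "continuous_on UNIV f" and f1: "continuous_on UNIV f1" and f2: "continuous_on UNIV f2"
    and df: "\<And>p. sin (pi * snd p / d) \<noteq> 0 \<Longrightarrow>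
      f differentiable at p \<and> partial (1, 0) f p = f1 p \<and> partial (0, 1) f p = f2 p"
  shows "C1_on UNIV f" "partial (1, 0) f = f1" "partial (0, 1) f = f2"
proof -
  have c1: "continuous_on S (\<lambda>t. h (t, y))" and c2: "continuous_on S (\<lambda>t. h (x, t))"
    if "continuous_on UNIV h" for h :: "plane \<Rightarrow> complex" and S x y
    by (rule continuous_on_compose2[OF that]; auto intro!: continuous_intros)+
  \<comment> \<open>Along a horizontal segment off the lines this is the fundamental theorem; on the
    lines it follows by continuity in \<open>y\<close>.\<close>
  have i1: "((\<lambda>t. f1 (t, y)) has_integral f (b, y) - f (a, y)) {a..b}" if ab: "a \<le> b" for a b y
  proof -
    define G where "G y = integral (cbox a b) (\<lambda>t. f1 (t, y)) - (f (b, y) - f (a, y))" for y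
    have "continuous_on (UNIV \<times> cbox a b) (\<lambda>(y, t). f1 (t, y))"
      unfolding case_prod_beta' by (rule continuous_on_compose2[OF f1]) (auto intro!: continuous_intros)
    then have "continuous_on UNIV G"
      unfolding G_def by (intro continuous_intros integral_continuous_on_param c2[OF f])
    moreover have "G y = 0" if y: "sin (pi * y / d) \<noteq> 0" for y
    proof -
      have "((\<lambda>t. f1 (t, y)) has_integral f (b, y) - f (a, y)) {a..b}"
      proof (rule fundamental_theorem_of_calculus[OF ab])
        fix x
        have "((\<lambda>t. f (t, y)) has_vector_derivative partial (1, 0) f (x, y)) (at x within {a..b})"
          by (rule has_vector_derivative_fst) (use df[of "(x, y)"] y in simp)
        then show "((\<lambda>t. f (t, y)) has_vector_derivative f1 (x, y)) (at x within {a..b})"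
          using df[of "(x, y)"] y by simp
      qed
      then show ?thesis by (simp add: G_def integral_unique)
    qed
    ultimately have "G y = 0" using continuous_zero_of_sin_nonzero[OF d] by blast
    moreover have "(\<lambda>t. f1 (t, y)) integrable_on {a..b}"
      by (rule integrable_continuous_real[OF c1[OF f1]])
    ultimately show ?thesis by (simp add: G_def has_integral_integrable_integral)
  qed
  have i2: "((\<lambda>t. f2 (x, t)) has_integral f (x, b) - f (x, a)) {a..b}" if ab: "a \<le> b" for a b x
  proof (rule fundamental_theorem_of_calculus_interior_strong[OF finite_sin_zeros[OF d, of a b] ab])
    fix y assume "y \<in> {a<..<b} - {t \<in> {a..b}. sin (pi * t / d) = 0}"
    then have y: "sin (pi * y / d) \<noteq> 0" by auto
    have "((\<lambda>t. f (x, t)) has_vector_derivative partial (0, 1) f (x, y)) (at y)"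
      by (rule has_vector_derivative_snd) (use df[of "(x, y)"] y in simp)
    then show "((\<lambda>t. f (x, t)) has_vector_derivative f2 (x, y)) (at y)"
      using df[of "(x, y)"] y by simp
  qed (rule c2[OF f])
  have "(f has_derivative (\<lambda>h. fst h *\<^sub>R f1 p + snd h *\<^sub>R f2 p)) (at p)" for p
  proof (rule has_derivative_of_partials[OF _ _ f2])
    show "((\<lambda>t. f (t, y)) has_vector_derivative f1 (x, y)) (at x)" for x y
      by (rule has_vector_derivative_of_has_integral[where F="\<lambda>t. f (t, y)" and g="\<lambda>t. f1 (t, y)"])
        (use c1[OF f1] i1 in auto)
    show "((\<lambda>t. f (x, t)) has_vector_derivative f2 (x, y)) (at y)" for x y
      by (rule has_vector_derivative_of_has_integral[where F="\<lambda>t. f (x, t)" and g="\<lambda>t. f2 (x, t)"])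
        (use c2[OF f2] i2 in auto)
  qed
  from C1_on_of_has_derivative[OF this f1 f2]
  show "C1_on UNIV f" "partial (1, 0) f = f1" "partial (0, 1) f = f2" by auto
qed

text \<open>The distance from \<open>y\<close> to \<open>2d\<int>\<close>.\<close>

definition tent :: "real \<Rightarrow> real \<Rightarrow> real" where
  "tent d y = d / pi * arccos (cos (pi * y / d))"

lemma tent_bounds: "0 < d \<Longrightarrow> 0 \<le> tent d y \<and> tent d y \<le> d"
  using arccos_lbound[of "cos (pi * y / d)"] arccos_ubound[of "cos (pi * y / d)"]
  by (auto simp: tent_def field_simps)

lemma tent_id: "0 < d \<Longrightarrow> 0 \<le> y \<Longrightarrow> y \<le> d \<Longrightarrow> tent d y = y"
  by (simp add: tent_def arccos_cos field_simps)

lemma tent_minus: "tent d (- y) = tent d y"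
  by (simp add: tent_def)

lemma tent_periodic: "0 < d \<Longrightarrow> tent d (y + 2 * d * of_int m) = tent d y"
proof -
  assume "0 < d"
  then have "pi * (y + 2 * d * of_int m) / d = pi * y / d + 2 * pi * of_int m" by (simp add: field_simps)
  then show ?thesis using sin_int_2pin[of m] cos_int_2pin[of m] by (simp add: tent_def cos_add)
qed

lemma continuous_on_tent: "0 < d \<Longrightarrow> continuous_on S (tent d)"
  unfolding tent_def by (intro continuous_intros) auto

lemma sin_zero_tent: "0 < d \<Longrightarrow> sin (pi * y / d) = 0 \<Longrightarrow> tent d y = 0 \<or> tent d y = d"
proof -
  assume d: "0 < d" and s: "sin (pi * y / d) = 0"
  then have "(cos (pi * y / d))\<^sup>2 = 1" using sin_cos_squared_add[of "pi * y / d"] by auto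
  then have "cos (pi * y / d) = 1 \<or> cos (pi * y / d) = -1" by (simp add: power2_eq_1_iff)
  then show ?thesis using d by (auto simp: tent_def)
qed

text \<open>Off the lines the fold is locally affine of slope \<open>s\<close>, and this slope is
  the sign of the sine. Even and odd extensions are therefore locally compositions with one and the
  same affine map.\<close>

lemma tent_local:
  assumes d: "0 < d" and y: "sin (pi * y / d) \<noteq> 0"
  obtains s c where "s = 1 \<or> s = (-1::real)" "0 < c + s * y" "c + s * y < d"
    "\<And>t. 0 < c + s * t \<Longrightarrow> c + s * t < d \<Longrightarrow> tent d t = c + s * t \<and> sgn (sin (pi * t / d)) = s"
proof -
  define m where "m = round (y / (2 * d))"
  define z where "z = y - 2 * d * of_int m"
  have "\<bar>of_int m - y / (2 * d)\<bar> \<le> 1/2" unfolding m_def by (rule of_int_round_abs_le)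
  then have zd: "\<bar>z\<bar> \<le> d" using d by (simp add: z_def field_simps abs_le_iff)
  have per: "sin (pi * (t + 2 * d * of_int m) / d) = sin (pi * t / d)" for t
  proof -
    have "pi * (t + 2 * d * of_int m) / d = pi * t / d + 2 * pi * of_int m" using d by (simp add: field_simps)
    then show ?thesis using sin_int_2pin[of m] cos_int_2pin[of m] by (simp add: sin_add)
  qed
  have sz: "sin (pi * z / d) \<noteq> 0" using y per[of z] by (simp add: z_def)
  have z: "z \<noteq> 0" "\<bar>z\<bar> \<noteq> d"
    using sz d by (auto simp: abs_if split: if_splits)
  define s :: real where "s = sgn z"
  have s: "s = 1 \<or> s = -1" "s * z = \<bar>z\<bar>" "s * s = 1" using z by (auto simp: s_def sgn_if)
  define c where "c = - s * (2 * d * of_int m)"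
  have cs: "c + s * t = s * (t - 2 * d * of_int m)" for t by (simp add: c_def algebra_simps)
  show thesis
  proof (rule that[of s c])
    show "s = 1 \<or> s = -1" by fact
    have "c + s * y = \<bar>z\<bar>" unfolding cs s(2)[symmetric] by (simp only: z_def)
    then show "0 < c + s * y" "c + s * y < d" using z zd by simp_all
    show "tent d t = c + s * t \<and> sgn (sin (pi * t / d)) = s" if "0 < c + s * t" "c + s * t < d" for t
    proof -
      define w where "w = c + s * t"
      have tw: "t = s * w + 2 * d * of_int m"
        using s(1) unfolding w_def cs by auto
      have w: "0 < w" "w < d" using that by (auto simp: w_def)
      have "tent d t = tent d (s * w)" unfolding tw using tent_periodic[OF d] by simp
      also have "\<dots> = w" using s(1) w tent_minus[of d w] tent_id[OF d, of w] by auto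
      finally have 1: "tent d t = w" .
      have "sin (pi * w / d) > 0" using w d by (intro sin_gt_zero) (auto simp: field_simps)
      moreover have "sin (pi * t / d) = sin (pi * (s * w) / d)" unfolding tw per ..
      ultimately have "sgn (sin (pi * t / d)) = s" using s(1) by auto
      with 1 show ?thesis by (simp add: w_def)
    qed
  qed
qed

definition even_ext :: "real \<Rightarrow> (plane \<Rightarrow> complex) \<Rightarrow> plane \<Rightarrow> complex" where
  "even_ext d h p = h (fst p, tent d (snd p))"

text \<open>The sign of the sine is the slope of \<open>tent d\<close>, so the y-derivative of an
  even extension is the odd extension of the y-derivative.\<close>

definition odd_ext :: "real \<Rightarrow> (plane \<Rightarrow> complex) \<Rightarrow> plane \<Rightarrow> complex" where
  "odd_ext d h p = sgn (sin (pi * snd p / d)) *\<^sub>R h (fst p, tent d (snd p))"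

lemma continuous_on_even_ext:
  assumes "0 < d" "continuous_on (closed_strip d) h"
  shows "continuous_on UNIV (even_ext d h)"
  unfolding even_ext_def
  by (rule continuous_on_compose2[OF assms(2)])
    (use tent_bounds[OF assms(1)] in \<open>auto intro!: continuous_intros continuous_on_compose2[OF continuous_on_tent[OF assms(1), of UNIV]] simp: mem_closed_strip\<close>)

lemma isCont_of_continuous_on_UNIV: "continuous_on UNIV f \<Longrightarrow> isCont f p"
  using continuous_on_eq_continuous_at[OF open_UNIV, of f] by blast

text \<open>The sign jumps only where the fold meets the boundary of the strip, and there
  \<open>h\<close> vanishes.\<close>

lemma continuous_on_odd_ext:
  assumes d: "0 < d" and h: "continuous_on (closed_strip d) h"
    and 0: "\<And>x. h (x, 0) = 0" "\<And>x. h (x, d) = 0"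
  shows "continuous_on UNIV (odd_ext d h)"
proof -
  note c = continuous_on_even_ext[OF d h]
  have "isCont (odd_ext d h) p" for p
  proof (cases "sin (pi * snd p / d) = 0")
    case True
    then have z: "even_ext d h p = 0" "odd_ext d h p = 0"
      using sin_zero_tent[OF d True] 0 by (auto simp: even_ext_def odd_ext_def)
    have "((\<lambda>q. norm (even_ext d h q)) \<longlongrightarrow> norm (even_ext d h p)) (at p)"
      using isCont_of_continuous_on_UNIV[OF c] unfolding isCont_def by (rule tendsto_norm)
    then have "((\<lambda>q. norm (even_ext d h q)) \<longlongrightarrow> 0) (at p)" by (simp add: z)
    then have "(odd_ext d h \<longlongrightarrow> 0) (at p)"
      by (rule Lim_null_comparison[rotated])
        (auto intro!: eventuallyI simp: odd_ext_def even_ext_def abs_sgn_eq)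
    then show ?thesis by (simp add: isCont_def z)
  next
    case False
    have "isCont (\<lambda>q. sgn (sin (pi * snd q / d)) *\<^sub>R even_ext d h q) p"
      using False by (intro continuous_intros isCont_of_continuous_on_UNIV[OF c]) auto
    then show ?thesis by (simp add: odd_ext_def[abs_def] even_ext_def)
  qed
  then show ?thesis by (simp add: continuous_on_eq_continuous_at)
qed

lemma ext_local:
  assumes d: "0 < d" and y: "sin (pi * snd p / d) \<noteq> 0"
    and h: "\<And>q. q \<in> strip d \<Longrightarrow> h differentiable at q"
    and h1: "\<And>q. q \<in> strip d \<Longrightarrow> h1 q = partial (1, 0) h q"
    and h2: "\<And>q. q \<in> strip d \<Longrightarrow> h2 q = partial (0, 1) h q"
  shows "even_ext d h differentiable at p \<and> partial (1, 0) (even_ext d h) p = even_ext d h1 p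
      \<and> partial (0, 1) (even_ext d h) p = odd_ext d h2 p"
    "odd_ext d h differentiable at p \<and> partial (1, 0) (odd_ext d h) p = odd_ext d h1 p
      \<and> partial (0, 1) (odd_ext d h) p = even_ext d h2 p"
proof -
  obtain s c where sc: "s = 1 \<or> s = (-1::real)" "0 < c + s * snd p" "c + s * snd p < d"
    "\<And>t. 0 < c + s * t \<Longrightarrow> c + s * t < d \<Longrightarrow> tent d t = c + s * t \<and> sgn (sin (pi * t / d)) = s"
    using tent_local[OF d y] by blast
  define U where "U = diag_map 1 s (0, c) -` strip d"
  have U: "open U" unfolding U_def by (rule open_vimage_diag_map[OF open_strip])
  have mU: "q \<in> U \<longleftrightarrow> 0 < c + s * snd q \<and> c + s * snd q < d" for q
    by (simp add: U_def mem_strip diag_map_def)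
  have pU: "p \<in> U" using sc by (simp add: mU)
  have pS: "diag_map 1 s (0, c) p \<in> strip d" using pU by (simp add: U_def)
  have e: "even_ext d k q = k (diag_map 1 s (0, c) q)" and o: "odd_ext d k q = s *\<^sub>R k (diag_map 1 s (0, c) q)"
    if "q \<in> U" for q k
    using that sc(4)[of "snd q"] by (auto simp: mU even_ext_def odd_ext_def diag_map_def)
  note D = partial_diag_map[OF h[OF pS]]
  have ss: "s * s = 1" using sc(1) by auto
  show "even_ext d h differentiable at p \<and> partial (1, 0) (even_ext d h) p = even_ext d h1 p
      \<and> partial (0, 1) (even_ext d h) p = odd_ext d h2 p"
    using partial_cong[OF U pU e[where k=h]] D by (simp add: e[OF pU] o[OF pU] h1[OF pS] h2[OF pS])
  note L = partial_linear[OF bounded_linear_scaleR_right[of s] D(3)]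
  show "odd_ext d h differentiable at p \<and> partial (1, 0) (odd_ext d h) p = odd_ext d h1 p
      \<and> partial (0, 1) (odd_ext d h) p = even_ext d h2 p"
    using partial_cong[OF U pU o[where k=h]] L D(1,2) by (simp add: e[OF pU] o[OF pU] h1[OF pS] h2[OF pS] ss)
qed

section \<open>Boundary values of Neumann solutions\<close>

lemma closure_strip: "0 < d \<Longrightarrow> closure (strip d) = closed_strip d"
  by (simp add: strip_def closed_strip_def closure_Times)

lemma closed_strip_zero:
  fixes G :: "plane \<Rightarrow> complex"
  assumes "0 < d" "continuous_on (closed_strip d) G" "\<And>p. p \<in> strip d \<Longrightarrow> G p = 0" "p \<in> closed_strip d"
  shows "G p = 0"
  using continuous_constant_on_closure[of "strip d" G 0 p] assms by (simp add: closure_strip)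

lemma boundary_islimpt_strip:
  assumes "0 < d" "b = 0 \<or> b = d"
  shows "(x, b) islimpt strip d"
proof -
  have "(x, b) \<in> closure (strip d)" "(x, b) \<notin> strip d"
    using assms by (auto simp: closure_strip mem_closed_strip mem_strip)
  then show ?thesis by (simp add: closure_def)
qed

text \<open>Meant for \<open>k\<close> a mixed second derivative and \<open>H\<close> the normal
  derivative. Integrals of \<open>k\<close> along horizontal segments are increments of
  \<open>H\<close>; the identity passes to the boundary, where \<open>H\<close> vanishes, so
  \<open>k\<close> has zero integral over every boundary segment.\<close>

lemma boundary_zero:
  fixes k H :: "plane \<Rightarrow> complex"
  assumes d: "0 < d" and k: "continuous_on (closed_strip d) k" and H: "continuous_on (closed_strip d) H"
    and H0: "\<And>x b. b \<in> {0, d} \<Longrightarrow> H (x, b) = 0"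
    and int: "\<And>a b t. a \<le> b \<Longrightarrow> 0 < t \<Longrightarrow> t < d \<Longrightarrow> integral {a..b} (\<lambda>x. k (x, t)) = H (b, t) - H (a, t)"
    and c: "c \<in> {0, d}"
  shows "k (x, c) = 0"
proof -
  have kc: "continuous_on S (\<lambda>x. k (x, t))" if "t \<in> {0..d}" for S t
    by (rule continuous_on_compose2[OF k]) (use that in \<open>auto intro!: continuous_intros simp: mem_closed_strip\<close>)
  have Hc: "continuous_on {0..d} (\<lambda>t. H (x, t))" for x
    by (rule continuous_on_compose2[OF H]) (auto intro!: continuous_intros simp: mem_closed_strip)
  have i: "((\<lambda>x. k (x, c)) has_integral 0 - 0) {a..b}" if ab: "a \<le> b" for a b
  proof -
    define G where "G t = integral (cbox a b) (\<lambda>x. k (x, t)) - (H (b, t) - H (a, t))" for t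
    have "continuous_on ({0..d} \<times> cbox a b) (\<lambda>(t, x). k (x, t))"
      unfolding case_prod_beta' by (rule continuous_on_compose2[OF k]) (auto intro!: continuous_intros simp: mem_closed_strip)
    then have "continuous_on {0..d} G"
      unfolding G_def by (intro continuous_intros integral_continuous_on_param Hc)
    moreover have "G t = 0" if "t \<in> {0<..<d}" for t using int[OF ab] that by (simp add: G_def)
    ultimately have "G c = 0"
      using continuous_constant_on_closure[of "{0<..<d}" G 0 c] c d by auto
    then have "integral {a..b} (\<lambda>x. k (x, c)) = 0" using H0[OF c] by (simp add: G_def)
    moreover have "(\<lambda>x. k (x, c)) integrable_on {a..b}"
      using c d by (intro integrable_continuous_real kc) auto
    ultimately show ?thesis by (simp add: has_integral_integrable_integral)
  qed
  have "continuous_on UNIV (\<lambda>x. k (x, c))" using c d by (intro kc) auto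
  from has_vector_derivative_of_has_integral[OF this, of "\<lambda>_. 0", OF i]
  have "((\<lambda>_. 0) has_vector_derivative k (x, c)) (at x)" .
  then show ?thesis using vector_derivative_unique_at[OF _ has_vector_derivative_const] by blast
qed

text \<open>A Neumann solution comes with continuous extensions of its derivatives only; the
  extension of the function itself is recovered by integrating vertically from the middle line of
  the strip.\<close>

lemma extend_from_partial:
  fixes \<psi> h :: "plane \<Rightarrow> complex"
  assumes d: "0 < d" and \<psi>: "\<And>p. p \<in> strip d \<Longrightarrow> \<psi> differentiable at p"
    and h: "continuous_on (closed_strip d) h" and eq: "\<And>p. p \<in> strip d \<Longrightarrow> h p = partial (0, 1) \<psi> p"
  shows "\<exists>g. continuous_on (closed_strip d) g \<and> (\<forall>p\<in>strip d. g p = \<psi> p)"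
proof -
  define l where "l p s = (fst p, d / 2 + s * (snd p - d / 2))" for p :: plane and s :: real
  have l: "l p s \<in> closed_strip d" if "p \<in> closed_strip d" "s \<in> {0..1}" for p s
  proof -
    have "0 \<le> snd p" "snd p \<le> d" using that(1) by (auto simp: mem_closed_strip)
    then have "\<bar>snd p - d / 2\<bar> \<le> d / 2" by linarith
    then have "\<bar>s * (snd p - d / 2)\<bar> \<le> 1 * (d / 2)"
      unfolding abs_mult using that(2) by (intro mult_mono) auto
    then show ?thesis by (auto simp: l_def mem_closed_strip abs_le_iff)
  qed
  have l': "l p s \<in> strip d" if "p \<in> strip d" "s \<in> {0..1}" for p s
  proof -
    have 1: "\<bar>s * (snd p - d / 2)\<bar> \<le> 1 * \<bar>snd p - d / 2\<bar>"
      unfolding abs_mult using that by (intro mult_mono) auto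
    have "0 < snd p" "snd p < d" using that(1) by (auto simp: mem_strip)
    then have "1 * \<bar>snd p - d / 2\<bar> < d / 2" by (simp only: abs_less_iff mult_1) linarith
    with 1 have "\<bar>s * (snd p - d / 2)\<bar> < d / 2" by (rule le_less_trans)
    then show ?thesis by (auto simp: l_def mem_strip abs_less_iff)
  qed
  define g where "g p = \<psi> (fst p, d / 2) + (snd p - d / 2) *\<^sub>R integral (cbox 0 1) (\<lambda>s. h (l p s))" for p
  have "continuous_on UNIV (\<lambda>x. \<psi> (x, d / 2))"
  proof -
    have "isCont (\<lambda>x. \<psi> (x, d / 2)) x" for x
      by (rule has_vector_derivative_continuous[OF has_vector_derivative_fst[OF \<psi>]]) (use d in \<open>simp add: mem_strip\<close>)
    then show ?thesis by (simp add: continuous_on_eq_continuous_at)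
  qed
  then have "continuous_on (closed_strip d) (\<lambda>p. \<psi> (fst p, d / 2))"
    by (rule continuous_on_compose2) (auto intro!: continuous_intros)
  moreover have "continuous_on (closed_strip d \<times> cbox 0 1) (\<lambda>(p, s). h (l p s))"
    unfolding case_prod_beta'
  proof (rule continuous_on_compose2[OF h])
    show "continuous_on (closed_strip d \<times> cbox 0 1) (\<lambda>z. l (fst z) (snd z))"
      unfolding l_def by (intro continuous_intros)
    show "(\<lambda>z. l (fst z) (snd z)) ` (closed_strip d \<times> cbox 0 1) \<subseteq> closed_strip d"
      using l by (auto simp del: split_paired_All)
  qed
  ultimately have "continuous_on (closed_strip d) g"
    unfolding g_def by (intro continuous_intros integral_continuous_on_param)
  moreover have "g p = \<psi> p" if p: "p \<in> strip d" for p
  proof -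
    have "((\<lambda>s. (snd p - d / 2) *\<^sub>R h (l p s)) has_integral \<psi> (l p 1) - \<psi> (l p 0)) {0..1}"
    proof (rule fundamental_theorem_of_calculus)
      fix s :: real assume s: "s \<in> {0..1}"
      have "((\<lambda>t. \<psi> (fst p, t)) has_vector_derivative partial (0, 1) \<psi> (l p s)) (at (d / 2 + s * (snd p - d / 2)))"
        using has_vector_derivative_snd[OF \<psi>[OF l'[OF p s, unfolded l_def]], of UNIV] by (simp add: l_def)
      moreover have "((\<lambda>s. d / 2 + s * (snd p - d / 2)) has_real_derivative (snd p - d / 2)) (at s within {0..1})"
        by (auto intro!: derivative_eq_intros)
      ultimately have "((\<lambda>t. \<psi> (fst p, t)) \<circ> (\<lambda>s. d / 2 + s * (snd p - d / 2)) has_vector_derivative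
          (snd p - d / 2) *\<^sub>R partial (0, 1) \<psi> (l p s)) (at s within {0..1})"
        by (intro vector_diff_chain_within) (auto simp: has_real_derivative_iff_has_vector_derivative intro: has_vector_derivative_at_within)
      then show "((\<lambda>s. \<psi> (l p s)) has_vector_derivative (snd p - d / 2) *\<^sub>R h (l p s)) (at s within {0..1})"
        by (simp add: o_def l_def[abs_def] eq[OF l'[OF p s, unfolded l_def]])
    qed simp
    from integral_unique[OF this] show ?thesis by (simp add: g_def l_def)
  qed
  ultimately show ?thesis by blast
qed

text \<open>Both orders of differentiation are treated without symmetry of second derivatives: one
  by the fundamental theorem, the other by differentiating under the integral and uniqueness of the
  derivative.\<close>

lemma integral_mixed_partial:
  fixes \<psi> :: "plane \<Rightarrow> complex"
  assumes C2: "C2_on (strip d) \<psi>" and ab: "a \<le> b" and t: "0 < t" "t < d"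
  shows "integral {a..b} (\<lambda>x. partial (0, 1) (partial (1, 0) \<psi>) (x, t)) = partial (0, 1) \<psi> (b, t) - partial (0, 1) \<psi> (a, t)"
    and "integral {a..b} (\<lambda>x. partial (1, 0) (partial (0, 1) \<psi>) (x, t)) = partial (0, 1) \<psi> (b, t) - partial (0, 1) \<psi> (a, t)"
proof -
  have B: "(1, 0) \<in> (Basis :: plane set)" "(0, 1) \<in> (Basis :: plane set)" by (auto simp: Basis_plane)
  note C1 = C2_on_C1_partial[OF C2 B(1)] C2_on_C1_partial[OF C2 B(2)]
  have S: "(x, s) \<in> strip d" if "s \<in> {0<..<d}" for x s using that by (simp add: mem_strip)
  have "((\<lambda>x. partial (1, 0) (partial (0, 1) \<psi>) (x, t)) has_integral partial (0, 1) \<psi> (b, t) - partial (0, 1) \<psi> (a, t)) {a..b}"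
    by (rule fundamental_theorem_of_calculus[OF ab has_vector_derivative_fst[OF C1_on_differentiable[OF C1(2) S]]]) (use t in auto)
  then show "integral {a..b} (\<lambda>x. partial (1, 0) (partial (0, 1) \<psi>) (x, t)) = partial (0, 1) \<psi> (b, t) - partial (0, 1) \<psi> (a, t)"
    by (rule integral_unique)
  have cx: "continuous_on {a..b} (\<lambda>x. partial (1, 0) \<psi> (x, s))" if "s \<in> {0<..<d}" for s
    by (rule continuous_on_compose2[OF C1_on_continuous[OF C1(1)]]) (use that S in \<open>auto intro!: continuous_intros\<close>)
  have L: "((\<lambda>s. integral (cbox a b) (\<lambda>x. partial (1, 0) \<psi> (x, s))) has_vector_derivative
      integral (cbox a b) (\<lambda>x. partial (0, 1) (partial (1, 0) \<psi>) (x, t))) (at t within {0<..<d})"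
  proof (rule leibniz_rule_vector_derivative)
    show "((\<lambda>s. partial (1, 0) \<psi> (x, s)) has_vector_derivative partial (0, 1) (partial (1, 0) \<psi>) (x, s)) (at s within {0<..<d})"
      if "s \<in> {0<..<d}" for x s
      by (rule has_vector_derivative_snd[OF C1_on_differentiable[OF C1(1) S[OF that]]])
    show "(\<lambda>x. partial (1, 0) \<psi> (x, s)) integrable_on cbox a b" if "s \<in> {0<..<d}" for s
      using integrable_continuous_real[OF cx[OF that]] by simp
    show "continuous_on ({0<..<d} \<times> cbox a b) (\<lambda>(s, x). partial (0, 1) (partial (1, 0) \<psi>) (x, s))"
      unfolding case_prod_beta'
      by (rule continuous_on_compose2[OF C1_on_continuous_partial[OF C1(1) B(2)]])
        (auto intro!: continuous_intros simp: mem_strip)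
  qed (use t in auto)
  have I: "\<psi> (b, s) - \<psi> (a, s) = integral (cbox a b) (\<lambda>x. partial (1, 0) \<psi> (x, s))" if "s \<in> {0<..<d}" for s
  proof -
    have "((\<lambda>x. partial (1, 0) \<psi> (x, s)) has_integral \<psi> (b, s) - \<psi> (a, s)) {a..b}"
      by (rule fundamental_theorem_of_calculus[OF ab has_vector_derivative_fst[OF C2_on_differentiable[OF C2 S[OF that]]]])
    then show ?thesis by (simp add: integral_unique)
  qed
  have "((\<lambda>s. \<psi> (b, s) - \<psi> (a, s)) has_vector_derivative
      integral (cbox a b) (\<lambda>x. partial (0, 1) (partial (1, 0) \<psi>) (x, t))) (at t within {0<..<d})"
    by (rule has_vector_derivative_transform[OF _ I L]) (use t in simp_all)
  then have 1: "((\<lambda>s. \<psi> (b, s) - \<psi> (a, s)) has_vector_derivative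
      integral (cbox a b) (\<lambda>x. partial (0, 1) (partial (1, 0) \<psi>) (x, t))) (at t)"
    using t by (simp add: at_within_open[of t "{0<..<d}"])
  have 2: "((\<lambda>s. \<psi> (b, s) - \<psi> (a, s)) has_vector_derivative
      partial (0, 1) \<psi> (b, t) - partial (0, 1) \<psi> (a, t)) (at t)"
    using t by (intro has_vector_derivative_diff has_vector_derivative_snd C2_on_differentiable[OF C2 S]) auto
  show "integral {a..b} (\<lambda>x. partial (0, 1) (partial (1, 0) \<psi>) (x, t)) = partial (0, 1) \<psi> (b, t) - partial (0, 1) \<psi> (a, t)"
    using vector_derivative_unique_at[OF 1 2] by simp
qed

lemma neumann_normal_zero:
  assumes d: "0 < d" and N: "neumann_solution d \<psi>" and h: "continuous_on (closed_strip d) h"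
    and eq: "\<And>p. p \<in> strip d \<Longrightarrow> h p = partial (0, 1) \<psi> p" and b: "b \<in> {0, d}"
  shows "h (x, b) = 0"
proof -
  have lim: "(partial (0, 1) \<psi> \<longlongrightarrow> 0) (at (x, b) within strip d)"
    using N b by (auto simp: neumann_solution_def)
  have "(h \<longlongrightarrow> h (x, b)) (at (x, b) within closed_strip d)"
    using h b d by (auto simp: continuous_on_def mem_closed_strip)
  then have "(h \<longlongrightarrow> h (x, b)) (at (x, b) within strip d)"
    by (rule tendsto_within_subset) (auto simp: strip_def closed_strip_def)
  then have "(partial (0, 1) \<psi> \<longlongrightarrow> h (x, b)) (at (x, b) within strip d)"
    by (rule Lim_transform_eventually) (auto simp: eventually_at_filter eq intro!: always_eventually)
  moreover have "at (x, b) within strip d \<noteq> bot"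
    using boundary_islimpt_strip[OF d, of b x] b by (auto simp: trivial_limit_within)
  ultimately show ?thesis using tendsto_unique lim by blast
qed

text \<open>Each derivative in y exchanges even and odd extensions. The odd ones are continuous
  because the normal derivative vanishes on the boundary and, by \<open>boundary_zero\<close>, so do
  both mixed derivatives.\<close>

theorem neumann_extension:
  assumes d: "0 < d" and N: "neumann_solution d \<psi>"
  obtains \<Upsilon> where "C2_on UNIV \<Upsilon>" "GL_solution UNIV \<Upsilon>" "\<And>p. p \<in> strip d \<Longrightarrow> \<Upsilon> p = \<psi> p"
    "\<And>x y. \<Upsilon> (x, - y) = \<Upsilon> (x, y)" "\<And>x y m. \<Upsilon> (x, y + 2 * d * of_int m) = \<Upsilon> (x, y)"
proof -
  have B: "(1, 0) \<in> (Basis :: plane set)" "(0, 1) \<in> (Basis :: plane set)" by (auto simp: Basis_plane)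
  have GL: "GL_solution (strip d) \<psi>"
    and E: "\<And>v. v \<in> Basis \<Longrightarrow> extends_to_closed_strip d (partial v \<psi>)"
    and E2: "\<And>v w. v \<in> Basis \<Longrightarrow> w \<in> Basis \<Longrightarrow> extends_to_closed_strip d (partial w (partial v \<psi>))"
    using N unfolding neumann_solution_def by blast+
  have C2: "C2_on (strip d) \<psi>" using GL by (simp add: GL_solution_def)
  note C1 = C2_on_C1_partial[OF C2 B(1)] C2_on_C1_partial[OF C2 B(2)]
  obtain h1 where h1: "continuous_on (closed_strip d) h1" "\<And>p. p \<in> strip d \<Longrightarrow> h1 p = partial (1, 0) \<psi> p"
    using E[OF B(1)] unfolding extends_to_closed_strip_def by blast
  obtain h2 where h2: "continuous_on (closed_strip d) h2" "\<And>p. p \<in> strip d \<Longrightarrow> h2 p = partial (0, 1) \<psi> p"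
    using E[OF B(2)] unfolding extends_to_closed_strip_def by blast
  obtain h11 where h11: "continuous_on (closed_strip d) h11" "\<And>p. p \<in> strip d \<Longrightarrow> h11 p = partial (1, 0) (partial (1, 0) \<psi>) p"
    using E2[OF B(1) B(1)] unfolding extends_to_closed_strip_def by blast
  obtain h21 where h21: "continuous_on (closed_strip d) h21" "\<And>p. p \<in> strip d \<Longrightarrow> h21 p = partial (0, 1) (partial (1, 0) \<psi>) p"
    using E2[OF B(1) B(2)] unfolding extends_to_closed_strip_def by blast
  obtain h12 where h12: "continuous_on (closed_strip d) h12" "\<And>p. p \<in> strip d \<Longrightarrow> h12 p = partial (1, 0) (partial (0, 1) \<psi>) p"
    using E2[OF B(2) B(1)] unfolding extends_to_closed_strip_def by blast
  obtain h22 where h22: "continuous_on (closed_strip d) h22" "\<And>p. p \<in> strip d \<Longrightarrow> h22 p = partial (0, 1) (partial (0, 1) \<psi>) p"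
    using E2[OF B(2) B(2)] unfolding extends_to_closed_strip_def by blast
  obtain g where g: "continuous_on (closed_strip d) g" "\<And>p. p \<in> strip d \<Longrightarrow> g p = \<psi> p"
    using extend_from_partial[OF d C2_on_differentiable[OF C2] h2] by blast
  have h20: "h2 (x, b) = 0" if "b \<in> {0, d}" for x b
    by (rule neumann_normal_zero[OF d N h2 that])
  have S: "(x, t) \<in> strip d" if "0 < t" "t < d" for x t using that by (simp add: mem_strip)
  have h210: "h21 (x, b) = 0" if "b \<in> {0, d}" for x b
    by (rule boundary_zero[OF d h21(1) h2(1) h20 _ that])
      (simp_all add: S h2(2) h21(2) integral_mixed_partial[OF C2])
  have h120: "h12 (x, b) = 0" if "b \<in> {0, d}" for x b
    by (rule boundary_zero[OF d h12(1) h2(1) h20 _ that])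
      (simp_all add: S h2(2) h12(2) integral_mixed_partial[OF C2])
  define \<Upsilon> where "\<Upsilon> = even_ext d g"
  note c = continuous_on_even_ext[OF d] continuous_on_odd_ext[OF d]
  have pg: "partial v g q = partial v \<psi> q" "g differentiable at q" if "q \<in> strip d" for v q
    using partial_cong[of "strip d" q g \<psi>, OF open_strip that g(2)] C2_on_differentiable[OF C2 that] by blast+
  have ph1: "partial v h1 q = partial v (partial (1, 0) \<psi>) q" "h1 differentiable at q" if "q \<in> strip d" for v q
    using partial_cong[of "strip d" q h1 "partial (1, 0) \<psi>", OF open_strip that h1(2)]
      C1_on_differentiable[OF C1(1) that] by blast+
  have ph2: "partial v h2 q = partial v (partial (0, 1) \<psi>) q" "h2 differentiable at q" if "q \<in> strip d" for v q
    using partial_cong[of "strip d" q h2 "partial (0, 1) \<psi>", OF open_strip that h2(2)]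
      C1_on_differentiable[OF C1(2) that] by blast+
  have o2: "continuous_on UNIV (odd_ext d h2)" "continuous_on UNIV (odd_ext d h21)" "continuous_on UNIV (odd_ext d h12)"
    using h20 h210 h120 by (intro c(2) h2(1) h21(1) h12(1); simp)+
  have L0: "C1_on UNIV \<Upsilon>" "partial (1, 0) \<Upsilon> = even_ext d h1" "partial (0, 1) \<Upsilon> = odd_ext d h2"
    unfolding \<Upsilon>_def
    by (rule C1_across_lines[OF d c(1)[OF g(1)] c(1)[OF h1(1)] o2(1)],
        rule ext_local(1)[OF d], simp_all add: pg h1(2) h2(2))+
  have L1: "C1_on UNIV (even_ext d h1)" "partial (1, 0) (even_ext d h1) = even_ext d h11"
    "partial (0, 1) (even_ext d h1) = odd_ext d h21"
    by (rule C1_across_lines[OF d c(1)[OF h1(1)] c(1)[OF h11(1)] o2(2)],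
        rule ext_local(1)[OF d], simp_all add: ph1 h11(2) h21(2))+
  have L2: "C1_on UNIV (odd_ext d h2)" "partial (1, 0) (odd_ext d h2) = odd_ext d h12"
    "partial (0, 1) (odd_ext d h2) = even_ext d h22"
    by (rule C1_across_lines[OF d o2(1) o2(3) c(1)[OF h22(1)]],
        rule ext_local(2)[OF d], simp_all add: ph2 h12(2) h22(2))+
  have C2': "C2_on UNIV \<Upsilon>"
    using L0 L1(1) L2(1) C1_on_differentiable[OF L0(1)] unfolding C2_on_def Basis_plane by simp
  \<comment> \<open>By continuity the equation holds on the closed strip, hence at every point onto
    which the plane is folded.\<close>
  have eq: "h11 p + h22 p + g p * complex_of_real (1 - (cmod (g p))\<^sup>2) = 0" if "p \<in> closed_strip d" for p
  proof (rule closed_strip_zero[OF d _ _ that])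
    show "continuous_on (closed_strip d) (\<lambda>p. h11 p + h22 p + g p * complex_of_real (1 - (cmod (g p))\<^sup>2))"
      by (intro continuous_intros h11 h22 g)
    show "h11 p + h22 p + g p * complex_of_real (1 - (cmod (g p))\<^sup>2) = 0" if "p \<in> strip d" for p
      using GL that by (simp add: GL_solution_def laplacian_def sum_Basis_plane h11(2) h22(2) g(2))
  qed
  have "laplacian \<Upsilon> p + \<Upsilon> p * complex_of_real (1 - (cmod (\<Upsilon> p))\<^sup>2) = 0" for p
    using eq[of "(fst p, tent d (snd p))"] tent_bounds[OF d, of "snd p"]
    unfolding laplacian_def sum_Basis_plane L0 L1 L2 by (simp add: even_ext_def \<Upsilon>_def mem_closed_strip)
  then have "GL_solution UNIV \<Upsilon>" using C2' by (simp add: GL_solution_def)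
  moreover have "\<Upsilon> p = \<psi> p" if "p \<in> strip d" for p
    using that g(2)[OF that] by (simp add: \<Upsilon>_def even_ext_def mem_strip tent_id[OF d])
  moreover have "\<Upsilon> (x, - y) = \<Upsilon> (x, y)" "\<Upsilon> (x, y + 2 * d * of_int m) = \<Upsilon> (x, y)" for x y m
    by (simp_all add: \<Upsilon>_def even_ext_def tent_minus tent_periodic[OF d])
  ultimately show thesis using C2' that by blast
qed

subsection \<open>Comparison on half-strips\<close>

lemma second_derivative_at_max:
  fixes f :: "real \<Rightarrow> real"
  assumes "\<And>t. (f has_real_derivative f' t) (at t)" "(f' has_real_derivative l) (at s)"
    and "0 < e" "\<And>t. \<bar>t - s\<bar> < e \<Longrightarrow> f t \<le> f s"
  shows "l \<le> 0"
proof (rule ccontr)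
  assume "\<not> l \<le> 0"
  then obtain d where d: "d > 0" "\<And>h. h > 0 \<Longrightarrow> h < d \<Longrightarrow> f' s < f' (s + h)"
    using DERIV_pos_inc_right[OF assms(2)] by auto
  have "f' s = 0"
    using DERIV_local_max[OF assms(1) assms(3)] assms(4) by (simp add: abs_minus_commute)
  define h where "h = min d e / 2"
  have h: "0 < h" "h < d" "h < e" using d(1) assms(3) by (auto simp: h_def min_def)
  obtain z where z: "s < z" "z < s + h" "f (s + h) - f s = (s + h - s) * f' z"
    using MVT2[of s "s + h" f f'] assms(1) h by auto
  have "0 < f' z" using d(2)[of "z - s"] z h \<open>f' s = 0\<close> by auto
  then have "f s < f (s + h)" using z(3) h by (simp add: algebra_simps)
  moreover have "f (s + h) \<le> f s" using assms(4)[of "s + h"] h by simp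
  ultimately show False by simp
qed

lemma laplacian_at_max:
  fixes z :: "plane \<Rightarrow> real"
  assumes z: "C2_on UNIV z" and S: "p \<in> interior S" and max: "\<And>q. q \<in> S \<Longrightarrow> z q \<le> z p"
  shows "laplacian z p \<le> 0"
proof -
  obtain x y where p: "p = (x, y)" by (cases p)
  obtain e where e: "e > 0" "ball p e \<subseteq> S" using S by (auto simp: mem_interior)
  have B: "(1, 0) \<in> (Basis :: plane set)" "(0, 1) \<in> (Basis :: plane set)" by (auto simp: Basis_plane)
  note d = C2_on_differentiable[OF z UNIV_I]
  note d1 = C1_on_differentiable[OF C2_on_C1_partial[OF z B(1)] UNIV_I]
  note d2 = C1_on_differentiable[OF C2_on_C1_partial[OF z B(2)] UNIV_I]
  have "partial (1, 0) (partial (1, 0) z) p \<le> 0"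
  proof (rule second_derivative_at_max[OF _ _ e(1)])
    show "((\<lambda>t. z (t, y)) has_real_derivative partial (1, 0) z (t, y)) (at t)" for t
      using has_vector_derivative_fst[OF d] by (simp add: has_real_derivative_iff_has_vector_derivative)
    show "((\<lambda>t. partial (1, 0) z (t, y)) has_real_derivative partial (1, 0) (partial (1, 0) z) p) (at x)"
      using has_vector_derivative_fst[OF d1] by (simp add: has_real_derivative_iff_has_vector_derivative p)
    show "z (t, y) \<le> z (x, y)" if "\<bar>t - x\<bar> < e" for t
      using max[of "(t, y)"] e(2) that by (auto simp: p dist_Pair_Pair dist_real_def abs_minus_commute subset_iff)
  qed
  moreover have "partial (0, 1) (partial (0, 1) z) p \<le> 0"
  proof (rule second_derivative_at_max[OF _ _ e(1)])
    show "((\<lambda>t. z (x, t)) has_real_derivative partial (0, 1) z (x, t)) (at t)" for t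
      using has_vector_derivative_snd[OF d] by (simp add: has_real_derivative_iff_has_vector_derivative)
    show "((\<lambda>t. partial (0, 1) z (x, t)) has_real_derivative partial (0, 1) (partial (0, 1) z) p) (at y)"
      using has_vector_derivative_snd[OF d2] by (simp add: has_real_derivative_iff_has_vector_derivative p)
    show "z (x, t) \<le> z (x, y)" if "\<bar>t - y\<bar> < e" for t
      using max[of "(x, t)"] e(2) that by (auto simp: p dist_Pair_Pair dist_real_def abs_minus_commute subset_iff)
  qed
  ultimately show ?thesis by (simp add: laplacian_def sum_Basis_plane)
qed

text \<open>At an interior point where \<open>m * B\<close> touches \<open>z\<close> from above, the
  Laplacian of \<open>z\<close> is at most that of \<open>m * B\<close>. The margin
  \<open>\<kappa>\<close> by which \<open>B\<close> is a strict supersolution must then be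
  compensated by the source.\<close>

lemma comparison_at_max:
  fixes z B :: "plane \<Rightarrow> real"
  assumes z: "C2_on UNIV z" and B: "C2_on UNIV B" and p: "p \<in> interior S" and m: "0 < m"
    and touch: "z p = m * B p" and le: "\<And>q. q \<in> S \<Longrightarrow> z q \<le> m * B q" and Bp: "0 < B p"
    and sup: "laplacian B p + c * B p \<le> - \<kappa> * B p" and eq: "\<bar>laplacian z p + c * z p\<bar> \<le> K * B p"
    and \<kappa>: "0 < \<kappa>"
  shows "m \<le> K / \<kappa>"
proof -
  have mB: "C2_on UNIV (\<lambda>p. m * B p)"
    by (rule C2_on_linear[OF bounded_linear_mult_right open_UNIV B])
  have "laplacian (\<lambda>p. z p - m * B p) p \<le> 0"
    using le touch by (intro laplacian_at_max[OF C2_on_diff[OF open_UNIV z mB] p]) fastforce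
  then have "laplacian z p \<le> m * laplacian B p"
    using laplacian_diff[OF open_UNIV z mB UNIV_I, of p]
      laplacian_linear[OF bounded_linear_mult_right open_UNIV B UNIV_I, of m p] by simp
  moreover have "- (c * (m * B p)) - K * B p \<le> laplacian z p" using eq touch by simp
  ultimately have "m * (- (laplacian B p + c * B p)) \<le> K * B p" by (simp add: algebra_simps)
  moreover have "m * (\<kappa> * B p) \<le> m * (- (laplacian B p + c * B p))"
    using sup m by (intro mult_left_mono) auto
  ultimately have "(m * \<kappa>) * B p \<le> K * B p" by (simp add: mult.assoc)
  then have "m * \<kappa> \<le> K" using Bp by simp
  then show ?thesis using \<kappa> by (simp add: field_simps)
qed

text \<open>The cosine contributes \<open>- a\<^sup>2\<close> to the Laplacian, which pays for the
  growth \<open>\<tau>\<^sup>2\<close> of the exponential; it must stay positive on the section of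
  the domain. The periodic case is \<open>a = 0\<close>.\<close>

definition barrier :: "real \<Rightarrow> real \<Rightarrow> real \<Rightarrow> real \<Rightarrow> plane \<Rightarrow> real" where
  "barrier \<tau> a s \<eta> = (\<lambda>p. (exp (- \<tau> * fst p) + \<eta>) * cos (a * (snd p - s)))"

lemma barrier_C2:
  shows "C2_on UNIV (barrier \<tau> a s \<eta>)"
    "laplacian (barrier \<tau> a s \<eta>) p =
      \<tau>\<^sup>2 * exp (- \<tau> * fst p) * cos (a * (snd p - s)) - a\<^sup>2 * barrier \<tau> a s \<eta> p"
proof -
  have 1: "((\<lambda>x. exp (- \<tau> * x) + \<eta>) has_real_derivative - \<tau> * exp (- \<tau> * x)) (at x)" for x
    by (auto intro!: derivative_eq_intros)
  have 2: "((\<lambda>x. - \<tau> * exp (- \<tau> * x)) has_real_derivative \<tau>\<^sup>2 * exp (- \<tau> * x)) (at x)" for x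
    by (auto intro!: derivative_eq_intros simp: power2_eq_square)
  have 3: "((\<lambda>y. cos (a * (y - s))) has_real_derivative - a * sin (a * (y - s))) (at y)" for y
    by (auto intro!: derivative_eq_intros)
  have 4: "((\<lambda>y. - a * sin (a * (y - s))) has_real_derivative - a\<^sup>2 * cos (a * (y - s))) (at y)" for y
    by (auto intro!: derivative_eq_intros simp: power2_eq_square)
  have 5: "continuous_on UNIV (\<lambda>x. \<tau>\<^sup>2 * exp (- \<tau> * x))" "continuous_on UNIV (\<lambda>y. - a\<^sup>2 * cos (a * (y - s)))"
    by (intro continuous_intros)+
  note D = C2_on_separable[OF 1 3 2 4 5]
  show "C2_on UNIV (barrier \<tau> a s \<eta>)" using D(1) by (simp add: barrier_def)
  show "laplacian (barrier \<tau> a s \<eta>) p =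
      \<tau>\<^sup>2 * exp (- \<tau> * fst p) * cos (a * (snd p - s)) - a\<^sup>2 * barrier \<tau> a s \<eta> p"
    unfolding laplacian_def sum_Basis_plane barrier_def D(4,7) by (simp add: algebra_simps)
qed

text \<open>The term \<open>\<eta>\<close> of the barrier absorbs the unknown rate at which \<open>z\<close> tends to \<open>0\<close>.\<close>

lemma half_plane_upper_bound:
  fixes z c :: "plane \<Rightarrow> real"
  assumes z: "C2_on UNIV z" and c0: "0 < c0" "\<And>y. y \<in> Y \<Longrightarrow> c0 \<le> cos (a * (y - s))"
    and attain: "\<And>\<eta> X'. 0 < \<eta> \<Longrightarrow> X \<le> X' \<Longrightarrow> \<exists>p\<in>{X..X'} \<times> Y. \<forall>q\<in>{X..X'} \<times> Y.
      z q / barrier \<tau> a s \<eta> q \<le> z p / barrier \<tau> a s \<eta> p"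
    and bdry: "\<And>x y. y \<in> Y \<Longrightarrow> y \<notin> interior Y \<Longrightarrow> z (x, y) \<le> 0"
    and lim: "\<And>e. 0 < e \<Longrightarrow> \<exists>N. \<forall>x\<ge>N. \<forall>y. \<bar>z (x, y)\<bar> \<le> e"
    and eq: "\<And>p. X < fst p \<Longrightarrow> \<bar>laplacian z p + c p * z p\<bar> \<le> Q * exp (- \<tau> * fst p)"
    and c: "\<And>p. X < fst p \<Longrightarrow> \<tau>\<^sup>2 - a\<^sup>2 + c p \<le> - \<kappa>" and \<kappa>: "0 < \<kappa>"
    and init: "\<And>y. z (X, y) \<le> Q0" and Q: "0 \<le> Q" "0 \<le> Q0"
    and x: "X \<le> x" and y: "y \<in> Y"
  shows "z (x, y) \<le> max (Q0 * exp (\<tau> * X) / c0) (Q / (\<kappa> * c0)) * exp (- \<tau> * x)"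
proof -
  \<comment> \<open>The first entry is what the values on the line x = \<open>X\<close> force, the
    second what the source forces through \<open>comparison_at_max\<close>.\<close>
  define K where "K = max (Q0 * exp (\<tau> * X) / c0) (Q / (\<kappa> * c0))"
  have K0: "0 \<le> K" using Q c0(1) by (simp add: K_def le_max_iff_disj)
  have main: "z (x, y) \<le> (K + \<eta>) * (exp (- \<tau> * x) + \<eta>)" if \<eta>: "0 < \<eta>" for \<eta>
  proof (rule ccontr)
    let ?B = "barrier \<tau> a s \<eta>"
    let ?m = "K + \<eta>"
    have m: "0 < ?m" using K0 \<eta> by simp
    assume contr: "\<not> z (x, y) \<le> ?m * (exp (- \<tau> * x) + \<eta>)"
    have Bge: "c0 * exp (- \<tau> * fst q) \<le> ?B q" "c0 * \<eta> \<le> ?B q" "0 < ?B q" if "snd q \<in> Y" for q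
    proof -
      have c: "c0 \<le> cos (a * (snd q - s))" using c0(2) that .
      have "exp (- \<tau> * fst q) * c0 \<le> ?B q" "\<eta> * c0 \<le> ?B q"
        unfolding barrier_def using c c0(1) \<eta> by (intro mult_mono; simp)+
      then show "c0 * exp (- \<tau> * fst q) \<le> ?B q" "c0 * \<eta> \<le> ?B q" by (simp_all add: mult.commute)
      moreover have "0 < c0 * \<eta>" using c0(1) \<eta> by simp
      ultimately show "0 < ?B q" by linarith
    qed
    have "0 < ?m * \<eta> * c0" using m \<eta> c0(1) by simp
    then obtain N where N: "\<And>x y. x \<ge> N \<Longrightarrow> \<bar>z (x, y)\<bar> \<le> ?m * \<eta> * c0" using lim by meson
    \<comment> \<open>Beyond \<open>N\<close> the function is below \<open>?m * \<eta> * c0\<close>,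
      hence below \<open>?m\<close> times the barrier, so a violation cannot be attained on the
      right edge of the truncated domain.\<close>
    define X' where "X' = max N x"
    have "X \<le> X'" using x by (simp add: X'_def)
    \<comment> \<open>That the quotient attains its maximum is a hypothesis because \<open>Y\<close>
      need not be compact: in the periodic case it is the whole line.\<close>
    from attain[OF \<eta> this] obtain p where p: "p \<in> {X..X'} \<times> Y"
      and pmax': "\<forall>q\<in>{X..X'} \<times> Y. z q / ?B q \<le> z p / ?B p" by (rule bexE)
    note pmax = pmax'[rule_format]
    define M where "M = z p / ?B p"
    have pY: "snd p \<in> Y" "X \<le> fst p" "fst p \<le> X'" using p by auto
    note Bp = Bge[OF pY(1)]
    have zp: "z p = M * ?B p" using Bp(3) by (simp add: M_def)
    have le: "z q \<le> M * ?B q" if "q \<in> {X..X'} \<times> Y" for q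
      using pmax[OF that] Bge(3)[of q] that unfolding M_def[symmetric] by (auto simp: divide_le_eq)
    have "?B (x, y) \<le> (exp (- \<tau> * x) + \<eta>) * 1"
      unfolding barrier_def using \<eta> c0(1) c0(2)[OF y] by (intro mult_mono) auto
    then have "?m * ?B (x, y) \<le> ?m * (exp (- \<tau> * x) + \<eta>)" using m by simp
    also have "\<dots> < z (x, y)" using contr by simp
    also have "\<dots> \<le> M * ?B (x, y)" using le[of "(x, y)"] x y by (simp add: X'_def)
    finally have mM: "?m < M" using Bge(3)[of "(x, y)"] y by simp
    have gt: "?m * ?B p < z p" using mM Bp(3) by (simp add: zp)
    have "fst p \<noteq> X"
    proof
      assume pX: "fst p = X"
      have "Q0 * exp (\<tau> * X) / c0 \<le> ?m" using \<eta> by (simp add: K_def)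
      then have "(Q0 * exp (\<tau> * X) / c0) * (c0 * exp (- \<tau> * X)) \<le> ?m * ?B p"
        using Bp(1) m c0(1) unfolding pX by (intro mult_mono) auto
      moreover have "(Q0 * exp (\<tau> * X) / c0) * (c0 * exp (- \<tau> * X)) = Q0"
        using c0(1) by (simp add: exp_minus field_simps)
      moreover have "z p \<le> Q0" using init[of "snd p"] by (simp flip: pX)
      ultimately show False using gt by simp
    qed
    moreover have "fst p \<noteq> X'"
    proof
      assume pX: "fst p = X'"
      have "N \<le> fst p" by (simp add: pX X'_def)
      from N[OF this, of "snd p"] have "z p \<le> ?m * \<eta> * c0" by simp
      also have "\<dots> \<le> ?m * ?B p" using Bp(2) m by (simp add: mult.commute mult.left_commute)
      finally show False using gt by simp
    qed
    moreover have "snd p \<in> interior Y"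
    proof (rule ccontr)
      assume "snd p \<notin> interior Y"
      then have "z p \<le> 0" using bdry[OF pY(1), of "fst p"] by simp
      then show False using gt m Bp(3) by (meson less_le_trans mult_pos_pos not_less_iff_gr_or_eq)
    qed
    ultimately have pi: "p \<in> interior ({X..X'} \<times> Y)"
      using pY by (cases p) (auto simp: interior_Times)
    have Xp: "X < fst p" using pY(2) \<open>fst p \<noteq> X\<close> by simp
    have "M \<le> (Q / c0) / \<kappa>"
    proof (rule comparison_at_max[OF z barrier_C2(1) pi _ zp le Bp(3) _ _ \<kappa>, of "c p"])
      show "0 < M" using m mM by simp
      have cs: "0 \<le> cos (a * (snd p - s))" using c0 pY(1) by (meson less_eq_real_def order_trans)
      have "\<tau>\<^sup>2 - a\<^sup>2 + c p + \<kappa> \<le> 0" "c p - a\<^sup>2 + \<kappa> \<le> 0"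
        using c[OF Xp] zero_le_power2[of \<tau>] by linarith+
      then have "(\<tau>\<^sup>2 - a\<^sup>2 + c p + \<kappa>) * exp (- \<tau> * fst p) \<le> 0" "(c p - a\<^sup>2 + \<kappa>) * \<eta> \<le> 0"
        using \<eta> by (auto intro!: mult_nonpos_nonneg)
      then have "((\<tau>\<^sup>2 - a\<^sup>2 + c p + \<kappa>) * exp (- \<tau> * fst p) + (c p - a\<^sup>2 + \<kappa>) * \<eta>) * cos (a * (snd p - s)) \<le> 0"
        using cs by (intro mult_nonpos_nonneg) auto
      then show "laplacian ?B p + c p * ?B p \<le> - \<kappa> * ?B p"
        unfolding barrier_C2(2) by (simp add: barrier_def algebra_simps)
      have "Q * exp (- \<tau> * fst p) = Q / c0 * (c0 * exp (- \<tau> * fst p))" using c0(1) by simp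
      also have "\<dots> \<le> Q / c0 * ?B p" using Q c0(1) Bp(1) by (intro mult_left_mono) auto
      finally show "\<bar>laplacian z p + c p * z p\<bar> \<le> Q / c0 * ?B p" using eq[OF Xp] by linarith
    qed
    also have "\<dots> \<le> K" by (simp add: K_def mult.commute)
    finally show False using mM \<eta> by simp
  qed
  have "((\<lambda>\<eta>. (K + \<eta>) * (exp (- \<tau> * x) + \<eta>)) \<longlongrightarrow> (K + 0) * (exp (- \<tau> * x) + 0)) (at_right 0)"
    by (intro tendsto_intros)
  then have "z (x, y) \<le> (K + 0) * (exp (- \<tau> * x) + 0)"
  proof (rule tendsto_lowerbound)
    show "\<forall>\<^sub>F \<eta> in at_right 0. z (x, y) \<le> (K + \<eta>) * (exp (- \<tau> * x) + \<eta>)"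
      using eventually_at_right_less[of "0::real"] by (rule eventually_mono) (rule main)
  qed simp
  then show ?thesis by (simp add: K_def)
qed

lemma int_periodic:
  fixes f :: "real \<Rightarrow> 'a"
  assumes "\<And>y. f (y + P) = f y"
  shows "f (y + of_int k * P) = f y"
proof (induction k rule: int_induct[where k=0])
  case (step1 i)
  then show ?case using assms[of "y + of_int i * P"] by (simp add: algebra_simps)
next
  case (step2 i)
  then show ?case using assms[of "y + of_int (i - 1) * P"] by (simp add: algebra_simps)
qed simp

lemma reduce_mod_period:
  assumes "0 < (P::real)"
  obtains k :: int where "s \<le> y + of_int k * P" "y + of_int k * P \<le> s + P"
proof -
  define k where "k = - \<lfloor>(y - s) / P\<rfloor>"
  have "- of_int k \<le> (y - s) / P" "(y - s) / P < - of_int k + 1"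
    unfolding k_def by linarith+
  then have "s \<le> y + of_int k * P" "y + of_int k * P \<le> s + P"
    using assms by (auto simp: field_simps)
  then show thesis by (rule that)
qed

text \<open>The absolute value has period \<open>2 * b\<close> and vanishes at height
  \<open>s + b\<close>, so one strip with zero boundary values represents the half-plane. The upper
  bound is applied to \<open>z\<close> and to \<open>- z\<close>.\<close>

lemma half_plane_decay_dirichlet:
  fixes z c :: "plane \<Rightarrow> real"
  assumes z: "C2_on UNIV z" and b: "0 < b" and c0: "0 < c0" "\<And>t. \<bar>t\<bar> \<le> b \<Longrightarrow> c0 \<le> cos (a * t)"
    and per: "\<And>x y. \<bar>z (x, y + 2 * b)\<bar> = \<bar>z (x, y)\<bar>" and zero: "\<And>x. z (x, s + b) = 0"
    and lim: "\<And>e. 0 < e \<Longrightarrow> \<exists>N. \<forall>x\<ge>N. \<forall>y. \<bar>z (x, y)\<bar> \<le> e"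
    and eq: "\<And>p. X < fst p \<Longrightarrow> \<bar>laplacian z p + c p * z p\<bar> \<le> Q * exp (- \<tau> * fst p)"
    and c: "\<And>p. X < fst p \<Longrightarrow> \<tau>\<^sup>2 - a\<^sup>2 + c p \<le> - \<kappa>" and \<kappa>: "0 < \<kappa>"
    and init: "\<And>y. \<bar>z (X, y)\<bar> \<le> Q0" and Q: "0 \<le> Q" "0 \<le> Q0"
    and x: "X \<le> x"
  shows "\<bar>z (x, y)\<bar> \<le> max (Q0 * exp (\<tau> * X) / c0) (Q / (\<kappa> * c0)) * exp (- \<tau> * x)"
proof -
  define Y where "Y = {s - b..s + b}"
  have cY: "c0 \<le> cos (a * (y - s))" if "y \<in> Y" for y
    using that by (intro c0(2)) (auto simp: Y_def abs_le_iff)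
  have attain: "\<exists>p\<in>{X..X'} \<times> Y. \<forall>q\<in>{X..X'} \<times> Y. f q / barrier \<tau> a s \<eta> q \<le> f p / barrier \<tau> a s \<eta> p"
    if "0 < \<eta>" "X \<le> X'" "continuous_on UNIV f" for f \<eta> X'
  proof (rule continuous_attains_sup)
    show "compact ({X..X'} \<times> Y)" by (auto simp: Y_def intro: compact_Times)
    show "{X..X'} \<times> Y \<noteq> {}" using that b by (auto simp: Y_def)
    have "barrier \<tau> a s \<eta> q \<noteq> 0" if "q \<in> {X..X'} \<times> Y" for q
    proof -
      have "0 < cos (a * (snd q - s))" using cY[of "snd q"] c0(1) that by auto
      then show ?thesis using \<open>0 < \<eta>\<close> by (simp add: barrier_def add_pos_pos less_imp_neq[symmetric])
    qed
    then show "continuous_on ({X..X'} \<times> Y) (\<lambda>q. f q / barrier \<tau> a s \<eta> q)"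
      by (intro continuous_on_divide continuous_on_subset[OF that(3)]
          continuous_on_subset[OF C2_on_continuous[OF barrier_C2(1)]]) auto
  qed
  have zero': "z (x, y) = 0" if "y \<in> Y" "y \<notin> interior Y" for x y
  proof -
    have "y = s - b \<or> y = s + b" using that by (auto simp: Y_def)
    moreover have "z (x, s - b) = 0" using per[of x "s - b"] zero[of x] by (simp add: add.commute)
    ultimately show ?thesis using zero by auto
  qed
  have neg: "C2_on UNIV (\<lambda>p. - z p)" by (rule C2_on_minus[OF open_UNIV z])
  have lapneg: "laplacian (\<lambda>p. - z p) p = - laplacian z p" for p
    by (rule laplacian_linear[OF bounded_linear_minus[OF bounded_linear_ident] open_UNIV z UNIV_I])
  let ?K = "max (Q0 * exp (\<tau> * X) / c0) (Q / (\<kappa> * c0)) * exp (- \<tau> * x)"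
  have bound: "\<bar>z (x, y)\<bar> \<le> ?K" if y: "y \<in> Y" for y
  proof -
    have "z (x, y) \<le> ?K"
      using init by (intro half_plane_upper_bound[OF z c0(1) cY attain _ lim eq c \<kappa> _ Q x y])
        (auto simp: zero' C2_on_continuous[OF z] abs_le_iff)
    moreover have "(\<lambda>p. - z p) (x, y) \<le> ?K"
    proof (rule half_plane_upper_bound[OF neg c0(1) cY attain _ _ _ c \<kappa> _ Q x y])
      show "\<bar>laplacian (\<lambda>p. - z p) p + c p * - z p\<bar> \<le> Q * exp (- \<tau> * fst p)" if "X < fst p" for p
        using eq[OF that] by (simp add: lapneg abs_le_iff)
    qed (use init lim in \<open>auto simp: zero' C2_on_continuous[OF neg] abs_le_iff\<close>)
    ultimately show ?thesis by (simp add: abs_le_iff)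
  qed
  obtain k :: int where k: "s - b \<le> y + of_int k * (2 * b)" "y + of_int k * (2 * b) \<le> s - b + 2 * b"
    using reduce_mod_period[of "2 * b" "s - b" y] b by auto
  have "\<bar>z (x, y + of_int k * (2 * b))\<bar> = \<bar>z (x, y)\<bar>"
    using per by (rule int_periodic)
  then show ?thesis using bound[of "y + of_int k * (2 * b)"] k by (simp add: Y_def)
qed

text \<open>Without zeros on a line the cosine is useless, so \<open>a = 0\<close> and the decay
  must come from the potential alone. The barrier then does not depend on y, and a maximum over one
  period is a maximum over the half-plane.\<close>

lemma half_plane_decay_periodic:
  fixes z c :: "plane \<Rightarrow> real"
  assumes z: "C2_on UNIV z" and P: "0 < P"
    and per: "\<And>x y. z (x, y + P) = z (x, y)"
    and lim: "\<And>e. 0 < e \<Longrightarrow> \<exists>N. \<forall>x\<ge>N. \<forall>y. \<bar>z (x, y)\<bar> \<le> e"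
    and eq: "\<And>p. X < fst p \<Longrightarrow> \<bar>laplacian z p + c p * z p\<bar> \<le> Q * exp (- \<tau> * fst p)"
    and c: "\<And>p. X < fst p \<Longrightarrow> \<tau>\<^sup>2 + c p \<le> - \<kappa>" and \<kappa>: "0 < \<kappa>"
    and init: "\<And>y. \<bar>z (X, y)\<bar> \<le> Q0" and Q: "0 \<le> Q" "0 \<le> Q0"
    and x: "X \<le> x"
  shows "\<bar>z (x, y)\<bar> \<le> max (Q0 * exp (\<tau> * X)) (Q / \<kappa>) * exp (- \<tau> * x)"
proof -
  have attain: "\<exists>p\<in>{X..X'} \<times> UNIV. \<forall>q\<in>{X..X'} \<times> UNIV. f q / barrier \<tau> 0 0 \<eta> q \<le> f p / barrier \<tau> 0 0 \<eta> p"
    if "0 < \<eta>" "X \<le> X'" "continuous_on UNIV f" and perf: "\<And>x y. f (x, y + P) = f (x, y)" for f \<eta> X'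
  proof -
    have "\<exists>p\<in>{X..X'} \<times> {0..P}. \<forall>q\<in>{X..X'} \<times> {0..P}. f q / barrier \<tau> 0 0 \<eta> q \<le> f p / barrier \<tau> 0 0 \<eta> p"
    proof (rule continuous_attains_sup)
      show "compact ({X..X'} \<times> {0..P})" by (auto intro: compact_Times)
      show "{X..X'} \<times> {0..P} \<noteq> {}" using that P by auto
      have "barrier \<tau> 0 0 \<eta> q \<noteq> 0" for q
        using \<open>0 < \<eta>\<close> by (simp add: barrier_def add_pos_pos less_imp_neq[symmetric])
      then show "continuous_on ({X..X'} \<times> {0..P}) (\<lambda>q. f q / barrier \<tau> 0 0 \<eta> q)"
        by (intro continuous_on_divide continuous_on_subset[OF that(3)]
          continuous_on_subset[OF C2_on_continuous[OF barrier_C2(1)]]) auto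
    qed
    then obtain p where p: "p \<in> {X..X'} \<times> {0..P}"
      "\<And>q. q \<in> {X..X'} \<times> {0..P} \<Longrightarrow> f q / barrier \<tau> 0 0 \<eta> q \<le> f p / barrier \<tau> 0 0 \<eta> p" by blast
    have "f (x, y) / barrier \<tau> 0 0 \<eta> (x, y) \<le> f p / barrier \<tau> 0 0 \<eta> p" if "x \<in> {X..X'}" for x y
    proof -
      obtain k :: int where k: "0 \<le> y + of_int k * P" "y + of_int k * P \<le> 0 + P"
        using reduce_mod_period[OF P, of 0 y] by auto
      have "f (x, y + of_int k * P) = f (x, y)" using perf by (rule int_periodic)
      then show ?thesis using p(2)[of "(x, y + of_int k * P)"] k that by (simp add: barrier_def)
    qed
    then show ?thesis using p(1) by (intro bexI[of _ p]) auto
  qed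
  have neg: "C2_on UNIV (\<lambda>p. - z p)" by (rule C2_on_minus[OF open_UNIV z])
  have lapneg: "laplacian (\<lambda>p. - z p) p = - laplacian z p" for p
    by (rule laplacian_linear[OF bounded_linear_minus[OF bounded_linear_ident] open_UNIV z UNIV_I])
  let ?K = "max (Q0 * exp (\<tau> * X) / 1) (Q / (\<kappa> * 1)) * exp (- \<tau> * x)"
  have "z (x, y) \<le> ?K"
    by (rule half_plane_upper_bound[where Y=UNIV and a=0 and s=0 and c=c and z=z])
      (use z attain[OF _ _ C2_on_continuous[OF z] per] lim eq c \<kappa> init Q x in \<open>auto simp: abs_le_iff\<close>)
  moreover have "(\<lambda>p. - z p) (x, y) \<le> ?K"
  proof (rule half_plane_upper_bound[where Y=UNIV and a=0 and s=0 and c=c])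
    show "\<bar>laplacian (\<lambda>p. - z p) p + c p * - z p\<bar> \<le> Q * exp (- \<tau> * fst p)" if "X < fst p" for p
      using eq[OF that] by (simp add: lapneg abs_le_iff)
    show "\<exists>p\<in>{X..X'} \<times> UNIV. \<forall>q\<in>{X..X'} \<times> UNIV. - z q / barrier \<tau> 0 0 \<eta> q \<le> - z p / barrier \<tau> 0 0 \<eta> p"
      if "0 < \<eta>" "X \<le> X'" for \<eta> X'
      using attain[OF that C2_on_continuous[OF neg]] per by simp
  qed (use neg lim c \<kappa> init Q x in \<open>auto simp: abs_le_iff\<close>)
  ultimately show ?thesis by (simp add: abs_le_iff)
qed

subsection \<open>Exponential decay of the derivatives\<close>

text \<open>Symmetric rather than one-sided: together with \<open>avg\<close> the product rule
  \<open>dif_mult\<close> is then exact and symmetric in its factors, and parity in y is preserved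
  up to a sign.\<close>

definition dif :: "plane \<Rightarrow> (plane \<Rightarrow> real) \<Rightarrow> plane \<Rightarrow> real" where
  "dif e f p = f (p + e) - f (p - e)"

definition avg :: "plane \<Rightarrow> (plane \<Rightarrow> real) \<Rightarrow> plane \<Rightarrow> real" where
  "avg e f p = (f (p + e) + f (p - e)) / 2"

lemma shift_diag_map: "p + e = diag_map 1 1 e p" "p - e = diag_map 1 1 (- e) p" for p e :: plane
  by (simp_all add: diag_map_def prod_eq_iff)

lemma C2_shift:
  assumes "C2_on UNIV f"
  shows "C2_on UNIV (\<lambda>p. f (p + e))" "C2_on UNIV (\<lambda>p. f (p - e))"
  unfolding shift_diag_map by (rule C2_on_diag_map[OF open_UNIV assms UNIV_I])+

lemma partial_shift:
  assumes "f differentiable at (p + e)" "v \<in> Basis"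
  shows "partial v (\<lambda>p. f (p + e)) p = partial v f (p + e)" "(\<lambda>p. f (p + e)) differentiable at p"
  using partial_diag_map[of f 1 1 e p] assms by (auto simp: shift_diag_map(1) Basis_plane)

lemma C2_dif: "C2_on UNIV f \<Longrightarrow> C2_on UNIV (dif e f)"
  unfolding dif_def[abs_def] by (intro C2_on_diff open_UNIV C2_shift)

lemma laplacian_dif:
  assumes "C2_on UNIV f"
  shows "laplacian (dif e f) p = dif e (laplacian f) p"
proof -
  have "laplacian (dif e f) p = laplacian (\<lambda>p. f (p + e)) p - laplacian (\<lambda>p. f (p - e)) p"
    unfolding dif_def[abs_def] by (rule laplacian_diff[OF open_UNIV C2_shift[OF assms] UNIV_I])
  also have "\<dots> = dif e (laplacian f) p"
    unfolding shift_diag_map dif_def by (simp add: laplacian_diag_map[OF open_UNIV assms UNIV_I])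
  finally show ?thesis .
qed

lemma partial_dif:
  assumes "\<And>p. f differentiable at p" "v \<in> Basis"
  shows "partial v (dif e f) p = dif e (partial v f) p" "dif e f differentiable at p"
  unfolding dif_def[abs_def]
  using partial_shift[of f p e] partial_shift[of f p "- e"] assms
    partial_diff[of "\<lambda>p. f (p + e)" p "\<lambda>p. f (p - e)"] by simp_all

lemma has_real_derivative_line:
  fixes f :: "plane \<Rightarrow> real"
  assumes "\<And>p. f differentiable at p"
  shows "((\<lambda>t. f (p + t *\<^sub>R v)) has_real_derivative partial v f (p + t *\<^sub>R v)) (at t)"
proof -
  have "((\<lambda>s. f (p + t *\<^sub>R v + s *\<^sub>R v)) has_real_derivative partial v f (p + t *\<^sub>R v)) (at 0)"
    using partial_has_vector_derivative[OF assms] by (simp add: has_real_derivative_iff_has_vector_derivative)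
  then have "((\<lambda>s. (\<lambda>t. f (p + t *\<^sub>R v)) (s + t)) has_real_derivative partial v f (p + t *\<^sub>R v)) (at 0)"
    by (simp add: algebra_simps)
  then show ?thesis using DERIV_shift[of "\<lambda>t. f (p + t *\<^sub>R v)" "partial v f (p + t *\<^sub>R v)" 0 t] by simp
qed

lemma dif_le:
  assumes f: "\<And>p. f differentiable at p" and M: "\<And>p. \<bar>partial v f p\<bar> \<le> M" and h: "0 < h"
  shows "\<bar>dif (h *\<^sub>R v) f p\<bar> \<le> 2 * h * M"
proof -
  obtain z where "f (p + h *\<^sub>R v) - f (p + (- h) *\<^sub>R v) = (h - - h) * partial v f (p + z *\<^sub>R v)"
    using MVT2[of "- h" h "\<lambda>t. f (p + t *\<^sub>R v)" "\<lambda>t. partial v f (p + t *\<^sub>R v)"] h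
      has_real_derivative_line[of f, OF f] by auto
  then have "\<bar>dif (h *\<^sub>R v) f p\<bar> = 2 * h * \<bar>partial v f (p + z *\<^sub>R v)\<bar>"
    using h by (simp add: dif_def abs_mult)
  also have "\<dots> \<le> 2 * h * M" using h M by (intro mult_left_mono) auto
  finally show ?thesis .
qed

lemma partial_le_of_dif_le:
  assumes f: "\<And>p. f differentiable at p"
    and K: "\<And>h. 0 < h \<Longrightarrow> h \<le> 1 \<Longrightarrow> \<bar>dif (h *\<^sub>R v) f p\<bar> \<le> K * h"
  shows "\<bar>partial v f p\<bar> \<le> K"
proof -
  have 1: "((\<lambda>h. f (p + h *\<^sub>R v)) has_real_derivative partial v f p) (at 0)"
    using has_real_derivative_line[of f p v 0, OF f] by simp
  have 2: "((\<lambda>h. f (p + (- h) *\<^sub>R v)) has_real_derivative partial v f p * - 1) (at 0)"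
    by (rule DERIV_chain2[where g="\<lambda>h. - h" and f="\<lambda>t. f (p + t *\<^sub>R v)"])
      (use 1 in \<open>auto intro!: derivative_eq_intros\<close>)
  have "((\<lambda>h. f (p + h *\<^sub>R v) - f (p + (- h) *\<^sub>R v)) has_real_derivative partial v f p - partial v f p * - 1) (at 0)"
    by (rule DERIV_diff[OF 1 2])
  then have "((\<lambda>h. dif (h *\<^sub>R v) f p / h) \<longlongrightarrow> 2 * partial v f p) (at 0)"
    by (simp add: DERIV_def dif_def)
  then have "((\<lambda>h. \<bar>dif (h *\<^sub>R v) f p / h\<bar>) \<longlongrightarrow> \<bar>2 * partial v f p\<bar>) (at_right 0)"
    by (intro tendsto_rabs) (rule filterlim_mono[OF _ order_refl at_le], auto)
  moreover have "\<forall>\<^sub>F h in at_right 0. \<bar>dif (h *\<^sub>R v) f p / h\<bar> \<le> K"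
    unfolding eventually_at_right_field
    by (rule exI[of _ 1]) (use K in \<open>auto simp: abs_divide divide_le_eq\<close>)
  ultimately have "\<bar>2 * partial v f p\<bar> \<le> K"
    by (rule tendsto_upperbound) simp
  then show ?thesis by (simp add: abs_mult)
qed

lemma dif_mult: "dif e (\<lambda>p. f p * g p) p = dif e f p * avg e g p + avg e f p * dif e g p"
  by (simp add: dif_def avg_def field_simps)

lemma dif_add: "dif e (\<lambda>p. f p + g p) p = dif e f p + dif e g p"
  by (simp add: dif_def)

lemma dif_uminus: "dif e (\<lambda>p. - f p) p = - dif e f p"
  by (simp add: dif_def)

lemma avg_dif_commute: "avg e (dif e' f) = dif e' (avg e f)"
  by (rule ext) (simp add: dif_def avg_def field_simps)

text \<open>The exact discrete form of the linearised equation
  \<open>\<Delta>\<phi> + (w - 2 f\<^sup>2) \<phi> = 2 f g \<gamma>\<close>. Since \<open>w\<close>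
  is symmetric in \<open>f\<close> and \<open>g\<close>, it serves for the real and for the
  imaginary part, with the roles exchanged.\<close>

lemma gl_dif_eq:
  fixes f g w :: "plane \<Rightarrow> real"
  assumes f: "C2_on UNIV f" and eq: "\<And>p. laplacian f p = - (f p * w p)" and w: "w = (\<lambda>p. 1 - (f p)\<^sup>2 - (g p)\<^sup>2)"
  shows "dif e w p = - (2 * avg e f p * dif e f p + 2 * avg e g p * dif e g p)"
    and "laplacian (dif e f) p + (avg e w p - 2 * (avg e f p)\<^sup>2) * dif e f p
      = 2 * avg e f p * avg e g p * dif e g p"
proof -
  show w': "dif e w p = - (2 * avg e f p * dif e f p + 2 * avg e g p * dif e g p)"
    by (simp add: w dif_def avg_def power2_eq_square field_simps)
  have "laplacian f = (\<lambda>p. - (f p * w p))" by (rule ext) (rule eq)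
  then have "laplacian (dif e f) p = - (dif e f p * avg e w p + avg e f p * dif e w p)"
    using laplacian_dif[OF f, of e p] by (simp add: dif_uminus dif_mult)
  then show "laplacian (dif e f) p + (avg e w p - 2 * (avg e f p)\<^sup>2) * dif e f p
      = 2 * avg e f p * avg e g p * dif e g p"
    unfolding w' by (simp add: power2_eq_square algebra_simps)
qed

text \<open>On the left is the same operator as for first differences, with iterated averages. On
  the right are products of lower differences and one coupling to the second difference of
  \<open>g\<close>.\<close>

lemma gl_dif_dif_eq:
  fixes f g w :: "plane \<Rightarrow> real"
  assumes f: "C2_on UNIV f" and eq: "\<And>p. laplacian f p = - (f p * w p)" and w: "w = (\<lambda>p. 1 - (f p)\<^sup>2 - (g p)\<^sup>2)"
  shows "laplacian (dif e (dif e' f)) p + (avg e (avg e' w) p - 2 * (avg e (avg e' f) p)\<^sup>2) * dif e (dif e' f) p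
    = - (avg e (dif e' f) p * avg e' (dif e w) p) - avg e' (dif e f) p * avg e (dif e' w) p
      + avg e (avg e' f) p * (2 * avg e (dif e' f) p * avg e' (dif e f) p
        + 2 * dif e (dif e' g) p * avg e (avg e' g) p + 2 * avg e (dif e' g) p * avg e' (dif e g) p)"
proof -
  have lf: "laplacian f = (\<lambda>p. - (f p * w p))" by (rule ext) (rule eq)
  have m: "dif e (dif e' (\<lambda>p. k p * l p)) p = dif e (dif e' k) p * avg e (avg e' l) p
      + avg e (dif e' k) p * avg e' (dif e l) p + avg e' (dif e k) p * avg e (dif e' l) p
      + avg e (avg e' k) p * dif e (dif e' l) p" for k l
  proof -
    have "dif e' (\<lambda>p. k p * l p) = (\<lambda>p. dif e' k p * avg e' l p + avg e' k p * dif e' l p)"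
      by (rule ext) (rule dif_mult)
    then show ?thesis by (simp add: dif_add dif_mult avg_dif_commute)
  qed
  have w2: "dif e (dif e' w) p = - (dif e (dif e' (\<lambda>p. f p * f p)) p + dif e (dif e' (\<lambda>p. g p * g p)) p)"
    by (simp add: w dif_def power2_eq_square)
  have "laplacian (dif e' f) = (\<lambda>p. - dif e' (\<lambda>p. f p * w p) p)"
    by (rule ext) (simp add: laplacian_dif[OF f] lf dif_uminus)
  then have "laplacian (dif e (dif e' f)) p = - dif e (dif e' (\<lambda>p. f p * w p)) p"
    using laplacian_dif[OF C2_dif[OF f], of e e' p] by (simp add: dif_uminus)
  then show ?thesis unfolding m w2 by (simp add: power2_eq_square algebra_simps)
qed

text \<open>\<open>u\<close> and \<open>v\<close> are the real and imaginary parts.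
  \<open>2 * b\<close> is the antiperiod of \<open>v\<close>, and \<open>c0\<close> bounds the
  cosine of the barrier from below on the half-width \<open>b\<close>. Beyond \<open>X\<close> the
  defect \<open>w\<close> is at most \<open>\<theta>\<close>, and \<open>\<kappa>\<close> is the
  margin left in the two comparisons. The number 81 / 50 is twice the square of 9 / 10: the
  linearised equation for \<open>u\<close> has the extra potential \<open>- 2 u\<^sup>2\<close>, and
  \<open>u\<close> is at least 9 / 10 there.\<close>

locale gl_decay =
  fixes u v w :: "plane \<Rightarrow> real" and b \<tau> a c0 X M \<kappa> \<theta> :: real
  assumes w_def: "w = (\<lambda>p. 1 - (u p)\<^sup>2 - (v p)\<^sup>2)"
    and C2u: "C2_on UNIV u" and C2v: "C2_on UNIV v"
    and equ: "\<And>p. laplacian u p = - (u p * w p)" and eqv: "\<And>p. laplacian v p = - (v p * w p)"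
    and b: "0 < b" and \<tau>: "0 < \<tau>" and X: "0 \<le> X" and \<kappa>: "0 < \<kappa>"
    and c0: "0 < c0" "\<And>t. \<bar>t\<bar> \<le> b \<Longrightarrow> c0 \<le> cos (a * t)"
    and \<kappa>1: "\<tau>\<^sup>2 - a\<^sup>2 + \<theta> \<le> - \<kappa>" and \<kappa>2: "\<tau>\<^sup>2 + \<theta> - 81 / 50 \<le> - \<kappa>"
    and v_even: "\<And>x y. v (x, - y) = v (x, y)"
    and v_anti: "\<And>x y. v (x, y + 2 * b) = - v (x, y)" and u_per: "\<And>x y. u (x, y + 2 * b) = u (x, y)"
    and Mu: "\<And>p i. i \<in> Basis \<Longrightarrow> \<bar>partial i u p\<bar> \<le> M" and Mv: "\<And>p i. i \<in> Basis \<Longrightarrow> \<bar>partial i v p\<bar> \<le> M"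
    and Mu2: "\<And>p i j. i \<in> Basis \<Longrightarrow> j \<in> Basis \<Longrightarrow> \<bar>partial i (partial j u) p\<bar> \<le> M"
    and Mv2: "\<And>p i j. i \<in> Basis \<Longrightarrow> j \<in> Basis \<Longrightarrow> \<bar>partial i (partial j v) p\<bar> \<le> M"
    and far: "\<And>p. X \<le> fst p \<Longrightarrow> \<bar>w p\<bar> \<le> \<theta>" "\<And>p. X \<le> fst p \<Longrightarrow> 9 / 10 \<le> u p"
      "\<And>p. X \<le> fst p \<Longrightarrow> u p \<le> 2" "\<And>p. X \<le> fst p \<Longrightarrow> \<bar>v p\<bar> \<le> 1"
    and lim_v: "\<And>e. 0 < e \<Longrightarrow> \<exists>N. \<forall>x\<ge>N. \<forall>y. \<bar>v (x, y)\<bar> \<le> e"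
    and lim_u: "\<And>e. 0 < e \<Longrightarrow> \<exists>N. \<forall>x\<ge>N. \<forall>y. \<bar>u (x, y) - 1\<bar> \<le> e"
begin

definition E :: "plane \<Rightarrow> real" where "E p = exp (- \<tau> * fst p)"
definition step :: "real \<Rightarrow> plane \<Rightarrow> bool" where
  "step h e \<longleftrightarrow> 0 < h \<and> h \<le> 1 \<and> (\<exists>i\<in>Basis. e = h *\<^sub>R i)"
definition par :: "real \<Rightarrow> (plane \<Rightarrow> real) \<Rightarrow> bool" where
  "par s f \<longleftrightarrow> \<bar>s\<bar> = 1 \<and> (\<forall>x y. f (x, - y) = s * f (x, y) \<and> f (x, y + 2 * b) = - f (x, y))"
text \<open>The factor by which \<open>E\<close> can grow under a shift of length at most
  one.\<close>

definition L where "L = exp \<tau>"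
text \<open>\<open>K0\<close>, \<open>K1\<close> and \<open>K2\<close> are the decay constants of
  \<open>v\<close>, of first and of second differences. They involve only \<open>\<tau>\<close>,
  \<open>c0\<close>, \<open>X\<close>, \<open>M\<close> and \<open>\<kappa>\<close>, neither the
  solution nor the width \<open>b\<close>, and this is what makes the decay uniform along the
  branch.\<close>

definition K0 where "K0 = exp (\<tau> * X) / c0"
definition K1 where "K1 = max (2 * M * exp (\<tau> * (X + 1)) / c0) (8 * M * K0 * L / (\<kappa> * c0))"
definition Q2 where "Q2 = 32 * K1 * L * M + 16 * M * K0 * L\<^sup>2 + 4 * K0 * K1\<^sup>2 * L ^ 4 + 8 * K1\<^sup>2 * L\<^sup>2"
definition K2 where "K2 = max (4 * M * exp (\<tau> * (X + 2)) / c0) (Q2 / (\<kappa> * c0))"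

lemma M0: "0 \<le> M"
proof -
  have "(1, 0) \<in> (Basis :: plane set)" by (simp add: Basis_plane)
  from Mu[OF this, of 0] show ?thesis by (rule order_trans[OF abs_ge_zero])
qed

lemma c01: "c0 \<le> 1"
  using c0(2)[of 0] b by simp

lemma E_pos: "0 < E p" by (simp add: E_def)

lemma E_le_1: "X \<le> fst p \<Longrightarrow> E p \<le> 1"
  using X \<tau> by (simp add: E_def)

lemma L1: "1 \<le> L" using \<tau> by (simp add: L_def)

lemma K_nonneg: "0 \<le> K0" "0 \<le> K1" "0 \<le> Q2" "0 \<le> K2"
proof -
  show 0: "0 \<le> K0" using c0 by (simp add: K0_def)
  show 1: "0 \<le> K1" using c0 M0 by (simp add: K1_def le_max_iff_disj)
  show "0 \<le> Q2" using 0 1 M0 L1 by (simp add: Q2_def)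
  show "0 \<le> K2" using c0 M0 by (simp add: K2_def le_max_iff_disj)
qed

lemma step_fst: "step h e \<Longrightarrow> \<bar>fst e\<bar> \<le> 1"
  by (auto simp: step_def Basis_plane)

lemma E_shift: "step h e \<Longrightarrow> E (p + e) \<le> L * E p" "step h e \<Longrightarrow> E (p - e) \<le> L * E p"
proof -
  assume "step h e"
  then have "- 1 \<le> fst e" "fst e \<le> 1" using step_fst by (auto simp: abs_le_iff)
  then have "\<tau> * - 1 \<le> \<tau> * fst e" "\<tau> * fst e \<le> \<tau> * 1" using \<tau> by (intro mult_left_mono; simp)+
  then show "E (p + e) \<le> L * E p" "E (p - e) \<le> L * E p"
    by (simp_all add: E_def L_def algebra_simps flip: exp_add)
qed

lemma fst_shift:
  assumes "step h e" "Y + 1 \<le> fst p"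
  shows "Y \<le> fst (p + e)" "Y \<le> fst (p - e)"
  using step_fst[OF assms(1)] assms(2) by (auto simp: abs_le_iff)

lemma avg_decay:
  assumes "step h e" "\<And>q. Y \<le> fst q \<Longrightarrow> \<bar>f q\<bar> \<le> A * E q" "0 \<le> A" "Y + 1 \<le> fst p"
  shows "\<bar>avg e f p\<bar> \<le> A * L * E p"
proof -
  have "\<bar>f (p + e)\<bar> \<le> A * (L * E p)" "\<bar>f (p - e)\<bar> \<le> A * (L * E p)"
    using assms(2)[OF fst_shift(1)[OF assms(1,4)]] assms(2)[OF fst_shift(2)[OF assms(1,4)]]
      mult_left_mono[OF E_shift(1)[OF assms(1), of p] assms(3)]
      mult_left_mono[OF E_shift(2)[OF assms(1), of p] assms(3)] by linarith+
  then show ?thesis by (simp add: avg_def)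
qed

lemma avg_bounds:
  assumes "step h e" "Y + 1 \<le> fst p"
  shows "(\<And>q. Y \<le> fst q \<Longrightarrow> \<bar>f q\<bar> \<le> A) \<Longrightarrow> \<bar>avg e f p\<bar> \<le> A"
    "(\<And>q. Y \<le> fst q \<Longrightarrow> A \<le> f q) \<Longrightarrow> A \<le> avg e f p"
    "(\<And>q. Y \<le> fst q \<Longrightarrow> f q \<le> A) \<Longrightarrow> avg e f p \<le> A"
proof -
  note s = fst_shift[OF assms]
  show "\<bar>avg e f p\<bar> \<le> A" if "\<And>q. Y \<le> fst q \<Longrightarrow> \<bar>f q\<bar> \<le> A"
    using that[OF s(1)] that[OF s(2)] by (simp add: avg_def)
  show "A \<le> avg e f p" if "\<And>q. Y \<le> fst q \<Longrightarrow> A \<le> f q"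
    using that[OF s(1)] that[OF s(2)] by (simp add: avg_def)
  show "avg e f p \<le> A" if "\<And>q. Y \<le> fst q \<Longrightarrow> f q \<le> A"
    using that[OF s(1)] that[OF s(2)] by (simp add: avg_def)
qed

lemma par_v: "par 1 v"
  by (simp add: par_def v_even v_anti)

text \<open>A horizontal difference keeps the parity in y, a vertical one reverses it;
  antiperiodicity survives both.\<close>

lemma par_dif:
  assumes "par s f" "step h e"
  shows "\<exists>s'. par s' (dif e f)"
proof -
  have f: "\<bar>s\<bar> = 1" "\<And>x y. f (x, - y) = s * f (x, y)" "\<And>x y. f (x, y + 2 * b) = - f (x, y)"
    using assms(1) by (auto simp: par_def)
  from assms(2) consider "e = (h, 0)" | "e = (0, h)" by (auto simp: step_def Basis_plane)
  then show ?thesis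
  proof cases
    case 1
    then have "par s (dif e f)" using f by (simp add: par_def dif_def algebra_simps)
    then show ?thesis ..
  next
    case 2
    have D: "dif e f (x, y) = f (x, y + h) - f (x, y - h)" for x y by (simp add: dif_def 2)
    have "dif e f (x, - y) = f (x, - (y - h)) - f (x, - (y + h))" for x y
      unfolding D by simp
    then have 3: "dif e f (x, - y) = - s * dif e f (x, y)" for x y
      unfolding D[of x y] f(2) by (simp add: right_diff_distrib)
    have "dif e f (x, y + 2 * b) = f (x, (y + h) + 2 * b) - f (x, (y - h) + 2 * b)" for x y
      unfolding D by (simp add: algebra_simps)
    then have 4: "dif e f (x, y + 2 * b) = - dif e f (x, y)" for x y
      unfolding D f(3) by simp
    have "par (- s) (dif e f)" unfolding par_def using f(1) 3 4 by simp
    then show ?thesis ..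
  qed
qed

text \<open>An even antiperiodic function vanishes at height \<open>b\<close>, an odd one at height
  \<open>2 * b\<close>. Whatever the parity after taking differences, some line of zeros remains for
  the Dirichlet comparison.\<close>

lemma par_zero:
  assumes "par s f"
  obtains y0 where "\<And>x. f (x, y0 + b) = 0" "\<And>x y. \<bar>f (x, y + 2 * b)\<bar> = \<bar>f (x, y)\<bar>"
proof -
  have f: "\<bar>s\<bar> = 1" "\<And>x y. f (x, - y) = s * f (x, y)" "\<And>x y. f (x, y + 2 * b) = - f (x, y)"
    using assms by (auto simp: par_def)
  from f(1) consider "s = 1" | "s = -1" by linarith
  then show thesis
  proof cases
    case 1
    have "f (x, 0 + b) = 0" for x using f(2)[of x b] f(3)[of x "- b"] 1 by simp
    then show thesis using f(3) by (intro that[of 0]) auto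
  next
    case 2
    have "f (x, b + b) = 0" for x using f(2)[of x 0] f(3)[of x 0] 2 by simp
    then show thesis using f(3) by (intro that[of b]) auto
  qed
qed

lemma dirichlet_decay:
  assumes "C2_on UNIV z" "par s z" "\<And>e. 0 < e \<Longrightarrow> \<exists>N. \<forall>x\<ge>N. \<forall>y. \<bar>z (x, y)\<bar> \<le> e"
    and "\<And>p. Y \<le> fst p \<Longrightarrow> \<bar>laplacian z p + c p * z p\<bar> \<le> Q * E p" "\<And>p. Y \<le> fst p \<Longrightarrow> c p \<le> \<theta>"
    and "\<And>y. \<bar>z (Y, y)\<bar> \<le> Q0" "0 \<le> Q" "0 \<le> Q0" "Y \<le> fst p"
  shows "\<bar>z p\<bar> \<le> max (Q0 * exp (\<tau> * Y) / c0) (Q / (\<kappa> * c0)) * E p"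
proof -
  obtain y0 where y0: "\<And>x. z (x, y0 + b) = 0" "\<And>x y. \<bar>z (x, y + 2 * b)\<bar> = \<bar>z (x, y)\<bar>"
    using par_zero[OF assms(2)] by blast
  have "\<bar>z (fst p, snd p)\<bar> \<le> max (Q0 * exp (\<tau> * Y) / c0) (Q / (\<kappa> * c0)) * exp (- \<tau> * fst p)"
  proof (rule half_plane_decay_dirichlet[OF assms(1) b c0 y0(2,1) assms(3) _ _ \<kappa> assms(6-9)])
    show "\<bar>laplacian z q + c q * z q\<bar> \<le> Q * exp (- \<tau> * fst q)" if "Y < fst q" for q
      using assms(4)[of q] that by (simp add: E_def)
    show "\<tau>\<^sup>2 - a\<^sup>2 + c q \<le> - \<kappa>" if "Y < fst q" for q
      using assms(5)[of q] that \<kappa>1 by simp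
  qed
  then show ?thesis by (simp add: E_def)
qed

text \<open>The bound is weakened by \<open>c0 \<le> 1\<close> so that the constant is that of
  \<open>dirichlet_decay\<close>; thus \<open>K1\<close> and \<open>K2\<close> serve both
  components.\<close>

lemma periodic_decay:
  assumes "C2_on UNIV z" "\<And>x y. z (x, y + 2 * b) = z (x, y)" "\<And>e. 0 < e \<Longrightarrow> \<exists>N. \<forall>x\<ge>N. \<forall>y. \<bar>z (x, y)\<bar> \<le> e"
    and "\<And>p. Y \<le> fst p \<Longrightarrow> \<bar>laplacian z p + c p * z p\<bar> \<le> Q * E p" "\<And>p. Y \<le> fst p \<Longrightarrow> c p \<le> \<theta> - 81 / 50"
    and "\<And>y. \<bar>z (Y, y)\<bar> \<le> Q0" "0 \<le> Q" "0 \<le> Q0" "Y \<le> fst p"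
  shows "\<bar>z p\<bar> \<le> max (Q0 * exp (\<tau> * Y) / c0) (Q / (\<kappa> * c0)) * E p"
proof -
  have "\<bar>z (fst p, snd p)\<bar> \<le> max (Q0 * exp (\<tau> * Y)) (Q / \<kappa>) * exp (- \<tau> * fst p)"
  proof (rule half_plane_decay_periodic[OF assms(1) _ assms(2,3) _ _ \<kappa> assms(6-9)])
    show "\<bar>laplacian z q + c q * z q\<bar> \<le> Q * exp (- \<tau> * fst q)" if "Y < fst q" for q
      using assms(4)[of q] that by (simp add: E_def)
    show "\<tau>\<^sup>2 + c q \<le> - \<kappa>" if "Y < fst q" for q
      using assms(5)[of q] that \<kappa>2 by simp
  qed (use b in simp)
  also have "\<dots> \<le> max (Q0 * exp (\<tau> * Y) / c0) (Q / (\<kappa> * c0)) * exp (- \<tau> * fst p)"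
  proof (intro mult_right_mono max.mono)
    have *: "r \<le> r / c0" if "0 \<le> r" for r
      using c0(1) c01 that by (simp add: pos_le_divide_eq mult_left_le)
    show "Q0 * exp (\<tau> * Y) \<le> Q0 * exp (\<tau> * Y) / c0" using assms(8) by (intro *) simp
    show "Q / \<kappa> \<le> Q / (\<kappa> * c0)" using *[of "Q / \<kappa>"] assms(7) \<kappa> by simp
  qed simp
  finally show ?thesis by (simp add: E_def)
qed

lemma lim_dif:
  assumes f: "\<And>e. 0 < e \<Longrightarrow> \<exists>N. \<forall>x\<ge>N. \<forall>y. \<bar>f (x, y) - c\<bar> \<le> e" and st: "step h e" and r: "0 < r"
  shows "\<exists>N. \<forall>x\<ge>N. \<forall>y. \<bar>dif e f (x, y)\<bar> \<le> r"
proof -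
  obtain N where N: "\<And>x y. x \<ge> N \<Longrightarrow> \<bar>f (x, y) - c\<bar> \<le> r / 2" using f[of "r / 2"] r by auto
  have "\<bar>dif e f (x, y)\<bar> \<le> r" if "x \<ge> N + 1" for x y
  proof -
    have s: "N \<le> fst ((x, y) + e)" "N \<le> fst ((x, y) - e)" using fst_shift[OF st] that by auto
    show ?thesis
      using N[OF s(1), of "snd ((x, y) + e)"] N[OF s(2), of "snd ((x, y) - e)"]
      unfolding dif_def prod.collapse by linarith
  qed
  then show ?thesis by blast
qed

lemma v_decay: "X \<le> fst p \<Longrightarrow> \<bar>v p\<bar> \<le> K0 * E p"
proof -
  assume p: "X \<le> fst p"
  have "\<bar>v p\<bar> \<le> max (1 * exp (\<tau> * X) / c0) (0 / (\<kappa> * c0)) * E p"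
  proof (rule dirichlet_decay[OF C2v par_v lim_v, where c=w])
    show "w q \<le> \<theta>" if "X \<le> fst q" for q using far(1)[OF that] by simp
    show "\<bar>v (X, y)\<bar> \<le> 1" for y using far(4)[of "(X, y)"] by simp
  qed (use p eqv in simp_all)
  also have "max (1 * exp (\<tau> * X) / c0) (0 / (\<kappa> * c0)) = K0" using c0 by (simp add: K0_def)
  finally show ?thesis .
qed

lemma u_abs: "X \<le> fst p \<Longrightarrow> \<bar>u p\<bar> \<le> 2"
  using far(2,3)[of p] by simp

lemma dif_small:
  assumes "step h e"
  shows "\<bar>dif e u p\<bar> \<le> 2 * h * M" "\<bar>dif e v p\<bar> \<le> 2 * h * M"
proof -
  obtain i where i: "i \<in> Basis" "e = h *\<^sub>R i" "0 < h" using assms unfolding step_def by blast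
  show "\<bar>dif e u p\<bar> \<le> 2 * h * M" "\<bar>dif e v p\<bar> \<le> 2 * h * M"
    unfolding i(2) using i(3) dif_le[OF C2_on_differentiable[OF C2u UNIV_I] Mu[OF i(1)]]
      dif_le[OF C2_on_differentiable[OF C2v UNIV_I] Mv[OF i(1)]] by blast+
qed

text \<open>The source is a product containing \<open>avg e v\<close>, which decays by
  \<open>v_decay\<close>, and the difference of the other component, for which a bound without decay
  is enough. So neither estimate presupposes the other. Each order of differences costs one unit of
  x because averages look one unit ahead and back.\<close>

lemma dif_decay:
  assumes st: "step h e" and p: "X + 1 \<le> fst p"
  shows "\<bar>dif e u p\<bar> \<le> K1 * h * E p" "\<bar>dif e v p\<bar> \<le> K1 * h * E p"
proof -
  have h: "0 < h" using st by (simp add: step_def)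
  have w': "w = (\<lambda>p. 1 - (v p)\<^sup>2 - (u p)\<^sup>2)" by (simp add: w_def fun_eq_iff)
  have K: "max (2 * h * M * exp (\<tau> * (X + 1)) / c0) (8 * h * M * K0 * L / (\<kappa> * c0)) = K1 * h"
  proof -
    have "K1 * h = max (2 * M * exp (\<tau> * (X + 1)) / c0 * h) (8 * M * K0 * L / (\<kappa> * c0) * h)"
      using h by (simp add: K1_def max_mult_distrib_right)
    moreover have "2 * M * exp (\<tau> * (X + 1)) / c0 * h = 2 * h * M * exp (\<tau> * (X + 1)) / c0"
      "8 * M * K0 * L / (\<kappa> * c0) * h = 8 * h * M * K0 * L / (\<kappa> * c0)" by simp_all
    ultimately show ?thesis by (simp only:)
  qed
  have av: "\<bar>avg e v q\<bar> \<le> K0 * L * E q" and au: "\<bar>avg e u q\<bar> \<le> 2" if "X + 1 \<le> fst q" for q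
    using avg_decay[OF st v_decay K_nonneg(1) that] avg_bounds(1)[OF st that u_abs] by auto
  have src: "\<bar>2 * (r * s * t)\<bar> \<le> 8 * h * M * K0 * L * E q"
    if "\<bar>r\<bar> \<le> 2" "\<bar>s\<bar> \<le> K0 * L * E q" "\<bar>t\<bar> \<le> 2 * h * M" for r s t q
  proof -
    have "\<bar>r\<bar> * \<bar>s\<bar> * \<bar>t\<bar> \<le> 2 * (K0 * L * E q) * (2 * h * M)"
      using that K_nonneg L1 E_pos[of q] by (intro mult_mono) auto
    then show ?thesis by (simp add: abs_mult mult_ac)
  qed
  have Q: "0 \<le> 8 * h * M * K0 * L" using h M0 K_nonneg L1 by simp
  have Q0: "0 \<le> 2 * h * M" using h M0 by simp
  have aw: "avg e w q \<le> \<theta>" if "X + 1 \<le> fst q" for q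
    by (rule avg_bounds(3)[OF st that]) (use far(1) in fastforce)
  have "\<bar>dif e v p\<bar> \<le> max (2 * h * M * exp (\<tau> * (X + 1)) / c0) (8 * h * M * K0 * L / (\<kappa> * c0)) * E p"
  proof -
    obtain s where s: "par s (dif e v)" using par_dif[OF par_v st] by blast
    show ?thesis
    proof (rule dirichlet_decay[OF C2_dif[OF C2v] s lim_dif[OF _ st, of v 0], where c="\<lambda>q. avg e w q - 2 * (avg e v q)\<^sup>2"])
      fix q :: plane assume q: "X + 1 \<le> fst q"
      show "\<bar>laplacian (dif e v) q + (avg e w q - 2 * (avg e v q)\<^sup>2) * dif e v q\<bar> \<le> 8 * h * M * K0 * L * E q"
        unfolding gl_dif_eq(2)[OF C2v eqv w']
        using src[OF au[OF q] av[OF q] dif_small(1)[OF st]] by (simp add: mult.commute mult.left_commute)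
      show "avg e w q - 2 * (avg e v q)\<^sup>2 \<le> \<theta>" using aw[OF q] zero_le_power2[of "avg e v q"] by linarith
    qed (use lim_v dif_small[OF st] Q Q0 p in simp_all)
  qed
  then show "\<bar>dif e v p\<bar> \<le> K1 * h * E p" by (simp only: K)
  have "\<bar>dif e u p\<bar> \<le> max (2 * h * M * exp (\<tau> * (X + 1)) / c0) (8 * h * M * K0 * L / (\<kappa> * c0)) * E p"
  proof (rule periodic_decay[OF C2_dif[OF C2u] _ lim_dif[OF lim_u st], where c="\<lambda>q. avg e w q - 2 * (avg e u q)\<^sup>2"])
    fix q :: plane assume q: "X + 1 \<le> fst q"
    show "\<bar>laplacian (dif e u) q + (avg e w q - 2 * (avg e u q)\<^sup>2) * dif e u q\<bar> \<le> 8 * h * M * K0 * L * E q"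
      unfolding gl_dif_eq(2)[OF C2u equ w_def]
      using src[OF au[OF q] av[OF q] dif_small(2)[OF st]] by (simp add: mult.commute mult.left_commute)
    have "9 / 10 \<le> avg e u q" by (rule avg_bounds(2)[OF st q far(2)])
    then have "(9 / 10)\<^sup>2 \<le> (avg e u q)\<^sup>2" by (rule power_mono) simp
    then show "avg e w q - 2 * (avg e u q)\<^sup>2 \<le> \<theta> - 81 / 50" using aw[OF q] by (simp add: power_divide)
  next
    fix x y
    have "u (x + fst e, y + snd e + 2 * b) = u (x + fst e, y + snd e)"
      "u (x - fst e, y - snd e + 2 * b) = u (x - fst e, y - snd e)" by (rule u_per)+
    then show "dif e u (x, y + 2 * b) = dif e u (x, y)"
      by (cases e) (simp add: dif_def algebra_simps)
  qed (use dif_small[OF st] Q Q0 p in simp_all)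
  then show "\<bar>dif e u p\<bar> \<le> K1 * h * E p" by (simp only: K)
qed

lemma dif_w:
  assumes st: "step h e" and q: "X + 1 \<le> fst q"
  shows "\<bar>dif e w q\<bar> \<le> 16 * h * M"
proof -
  have h: "0 < h" using st by (simp add: step_def)
  have "\<bar>avg e u q\<bar> * \<bar>dif e u q\<bar> \<le> 2 * (2 * h * M)" "\<bar>avg e v q\<bar> * \<bar>dif e v q\<bar> \<le> 1 * (2 * h * M)"
    using avg_bounds(1)[OF st q u_abs] avg_bounds(1)[OF st q far(4)] dif_small[OF st] by (intro mult_mono; simp)+
  moreover have "\<bar>dif e w q\<bar> \<le> 2 * (\<bar>avg e u q\<bar> * \<bar>dif e u q\<bar>) + 2 * (\<bar>avg e v q\<bar> * \<bar>dif e v q\<bar>)"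
    unfolding gl_dif_eq(1)[OF C2u equ w_def] abs_minus
    by (rule order_trans[OF abs_triangle_ineq]) (simp add: abs_mult)
  moreover have "0 \<le> h * M" using h M0 by simp
  ultimately show ?thesis by linarith
qed

lemma dif_dif_small:
  assumes st: "step h e" and st': "step h' e'"
  shows "\<bar>dif e (dif e' u) q\<bar> \<le> 4 * h * h' * M" "\<bar>dif e (dif e' v) q\<bar> \<le> 4 * h * h' * M"
proof -
  obtain i where i: "i \<in> Basis" "e = h *\<^sub>R i" "0 < h" using st unfolding step_def by blast
  obtain j where j: "j \<in> Basis" "e' = h' *\<^sub>R j" "0 < h'" using st' unfolding step_def by blast
  have main: "\<bar>dif e (dif e' f) q\<bar> \<le> 4 * h * h' * M"
    if f: "C2_on UNIV f" and Mf: "\<And>p. \<bar>partial j (partial i f) p\<bar> \<le> M" for f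
  proof -
    note d = C2_on_differentiable[OF f UNIV_I]
    note d' = C1_on_differentiable[OF C2_on_C1_partial[OF f i(1)] UNIV_I]
    have "\<bar>partial i (dif e' f) p\<bar> \<le> 2 * h' * M" for p
      unfolding partial_dif(1)[OF d i(1)] j(2) using d' Mf j(3) by (rule dif_le)
    from dif_le[OF C2_on_differentiable[OF C2_dif[OF f] UNIV_I] this i(3), of q]
    show ?thesis unfolding i(2) by simp
  qed
  show "\<bar>dif e (dif e' u) q\<bar> \<le> 4 * h * h' * M" "\<bar>dif e (dif e' v) q\<bar> \<le> 4 * h * h' * M"
    using main[OF C2u Mu2[OF j(1) i(1)]] main[OF C2v Mv2[OF j(1) i(1)]] by auto
qed

text \<open>Every term of the source has a factor already known to decay: an averaged first
  difference, or the iterated average of \<open>v\<close>. The second difference of the other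
  component again needs only a bound, so the components decouple.\<close>

lemma dif_dif_decay:
  assumes st: "step h e" and st': "step h' e'" and p: "X + 2 \<le> fst p"
  shows "\<bar>dif e (dif e' u) p\<bar> \<le> K2 * (h * h') * E p" "\<bar>dif e (dif e' v) p\<bar> \<le> K2 * (h * h') * E p"
proof -
  have h: "0 < h" "0 < h'" using st st' by (auto simp: step_def)
  have w': "w = (\<lambda>p. 1 - (v p)\<^sup>2 - (u p)\<^sup>2)" by (simp add: w_def fun_eq_iff)
  have K: "max (4 * h * h' * M * exp (\<tau> * (X + 2)) / c0) (Q2 * (h * h') / (\<kappa> * c0)) = K2 * (h * h')"
  proof -
    have "K2 * (h * h') = max (4 * M * exp (\<tau> * (X + 2)) / c0 * (h * h')) (Q2 / (\<kappa> * c0) * (h * h'))"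
      using h by (simp add: K2_def max_mult_distrib_right)
    moreover have "4 * M * exp (\<tau> * (X + 2)) / c0 * (h * h') = 4 * h * h' * M * exp (\<tau> * (X + 2)) / c0"
      "Q2 / (\<kappa> * c0) * (h * h') = Q2 * (h * h') / (\<kappa> * c0)" by simp_all
    ultimately show ?thesis by (simp only:)
  qed
  have shift1: "X + 1 \<le> fst q" "X + 1 + 1 \<le> fst q" if "X + 2 \<le> fst q" for q using that by simp_all
  have a1: "\<bar>avg e (dif e' f) q\<bar> \<le> K1 * h' * L * E q" and a2: "\<bar>avg e' (dif e f) q\<bar> \<le> K1 * h * L * E q"
    if "X + 2 \<le> fst q" "f = u \<or> f = v" for f q
  proof -
    have 1: "\<bar>dif e' f r\<bar> \<le> K1 * h' * E r" "\<bar>dif e f r\<bar> \<le> K1 * h * E r" if "X + 1 \<le> fst r" for r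
      using \<open>f = u \<or> f = v\<close> dif_decay[OF st' that] dif_decay[OF st that] by auto
    show "\<bar>avg e (dif e' f) q\<bar> \<le> K1 * h' * L * E q"
      by (rule avg_decay[OF st 1(1) _ shift1(2)[OF that(1)]]) (use K_nonneg h in auto)
    show "\<bar>avg e' (dif e f) q\<bar> \<le> K1 * h * L * E q"
      by (rule avg_decay[OF st' 1(2) _ shift1(2)[OF that(1)]]) (use K_nonneg h in auto)
  qed
  have dw: "\<bar>avg e' (dif e w) q\<bar> \<le> 16 * h * M" "\<bar>avg e (dif e' w) q\<bar> \<le> 16 * h' * M" if "X + 2 \<le> fst q" for q
    by (rule avg_bounds(1)[OF st' shift1(2)[OF that] dif_w[OF st]], assumption)
      (rule avg_bounds(1)[OF st shift1(2)[OF that] dif_w[OF st']], assumption)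
  have aav: "\<bar>avg e (avg e' v) q\<bar> \<le> K0 * L\<^sup>2 * E q" if "X + 2 \<le> fst q" for q
  proof -
    have "\<bar>avg e' v r\<bar> \<le> K0 * L * E r" if "X + 1 \<le> fst r" for r
      by (rule avg_decay[OF st' v_decay K_nonneg(1) that])
    from avg_decay[OF st this _ shift1(2)[OF that]] show ?thesis
      using K_nonneg L1 by (simp add: power2_eq_square mult.assoc)
  qed
  have aau: "\<bar>avg e (avg e' u) q\<bar> \<le> 2" "9 / 10 \<le> avg e (avg e' u) q" if "X + 2 \<le> fst q" for q
    using avg_bounds(1)[OF st shift1(2)[OF that] avg_bounds(1)[OF st' _ u_abs]]
      avg_bounds(2)[OF st shift1(2)[OF that] avg_bounds(2)[OF st' _ far(2)]] by auto
  have aaw: "avg e (avg e' w) q \<le> \<theta>" if "X + 2 \<le> fst q" for q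
    by (rule avg_bounds(3)[OF st shift1(2)[OF that] avg_bounds(3)[OF st']]) (use far(1) in fastforce)+
  define P where "P = K1\<^sup>2 * L\<^sup>2 * (h * h')"
  have P0: "0 \<le> P" using h by (simp add: P_def)
  have tri: "\<bar>- (x1 * y1) - x2 * y2 + z * (2 * x1 * x2 + 2 * d * m + 2 * g1 * g2)\<bar>
      \<le> 32 * K1 * L * M * (h * h') * E q + \<bar>z\<bar> * (4 * (P * E q) + 2 * (\<bar>d\<bar> * \<bar>m\<bar>))"
    if x: "\<bar>x1\<bar> \<le> K1 * h' * L * E q" "\<bar>x2\<bar> \<le> K1 * h * L * E q"
      and g: "\<bar>g1\<bar> \<le> K1 * h' * L * E q" "\<bar>g2\<bar> \<le> K1 * h * L * E q"
      and y: "\<bar>y1\<bar> \<le> 16 * h * M" "\<bar>y2\<bar> \<le> 16 * h' * M" and q: "X + 2 \<le> fst q"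
    for x1 x2 g1 g2 y1 y2 d m z q
  proof -
    have nn: "0 \<le> K1 * h' * L * E q" "0 \<le> K1 * h * L * E q" "0 \<le> 16 * h * M" "0 \<le> 16 * h' * M"
      using K_nonneg L1 h M0 E_pos[of q] by auto
    \<comment> \<open>A product of two decaying factors decays twice as fast; since
      \<open>E q \<le> 1\<close>, only one factor \<open>E q\<close> is kept.\<close>
    have PE: "(K1 * h' * L * E q) * (K1 * h * L * E q) \<le> P * E q"
    proof -
      have "(K1 * h' * L * E q) * (K1 * h * L * E q) = P * E q * E q"
        by (simp add: P_def power2_eq_square mult_ac)
      also have "\<dots> \<le> P * E q * 1"
        using P0 E_pos[of q] E_le_1[of q] q by (intro mult_left_mono) auto
      finally show ?thesis by simp
    qed
    have "\<bar>x1 * y1\<bar> \<le> (K1 * h' * L * E q) * (16 * h * M)" "\<bar>x2 * y2\<bar> \<le> (K1 * h * L * E q) * (16 * h' * M)"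
      unfolding abs_mult by (rule mult_mono; use x y nn in simp)+
    moreover have "\<bar>x1 * x2\<bar> \<le> P * E q" "\<bar>g1 * g2\<bar> \<le> P * E q"
      unfolding abs_mult by (rule order_trans[OF mult_mono PE]; use x g nn in simp)+
    moreover have "\<bar>2 * x1 * x2 + 2 * d * m + 2 * g1 * g2\<bar> \<le> 2 * \<bar>x1 * x2\<bar> + 2 * (\<bar>d\<bar> * \<bar>m\<bar>) + 2 * \<bar>g1 * g2\<bar>"
      by (simp add: abs_mult[symmetric] mult.assoc)
    ultimately have "\<bar>2 * x1 * x2 + 2 * d * m + 2 * g1 * g2\<bar> \<le> 4 * (P * E q) + 2 * (\<bar>d\<bar> * \<bar>m\<bar>)"
      and xy: "\<bar>x1 * y1\<bar> + \<bar>x2 * y2\<bar> \<le> 32 * K1 * L * M * (h * h') * E q"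
      by (simp_all add: mult_ac)
    then have "\<bar>z * (2 * x1 * x2 + 2 * d * m + 2 * g1 * g2)\<bar> \<le> \<bar>z\<bar> * (4 * (P * E q) + 2 * (\<bar>d\<bar> * \<bar>m\<bar>))"
      unfolding abs_mult by (intro mult_left_mono) auto
    with xy show ?thesis by linarith
  qed
  have Q: "0 \<le> Q2 * (h * h')" "0 \<le> 4 * h * h' * M" using h M0 K_nonneg by auto
  have hh: "0 \<le> h * h'" using h by simp
  have lim0: "\<exists>N. \<forall>x\<ge>N. \<forall>y. \<bar>dif e (dif e' f) (x, y)\<bar> \<le> r"
    if "\<And>e. 0 < e \<Longrightarrow> \<exists>N. \<forall>x\<ge>N. \<forall>y. \<bar>f (x, y) - c\<bar> \<le> e" "0 < r" for f c r
    by (rule lim_dif[where c=0, OF _ st that(2)]) (use lim_dif[OF that(1) st'] in simp)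
  have "\<bar>dif e (dif e' v) p\<bar> \<le> max (4 * h * h' * M * exp (\<tau> * (X + 2)) / c0) (Q2 * (h * h') / (\<kappa> * c0)) * E p"
  proof -
    obtain s' where s': "par s' (dif e' v)" using par_dif[OF par_v st'] by blast
    obtain s where s: "par s (dif e (dif e' v))" using par_dif[OF s' st] by blast
    show ?thesis
    proof (rule dirichlet_decay[OF C2_dif[OF C2_dif[OF C2v]] s lim0[of v 0],
          where c="\<lambda>q. avg e (avg e' w) q - 2 * (avg e (avg e' v) q)\<^sup>2"])
      fix q :: plane assume q: "X + 2 \<le> fst q"
      show "avg e (avg e' w) q - 2 * (avg e (avg e' v) q)\<^sup>2 \<le> \<theta>"
        using aaw[OF q] zero_le_power2[of "avg e (avg e' v) q"] by linarith
      have "\<bar>dif e (dif e' u) q\<bar> * \<bar>avg e (avg e' u) q\<bar> \<le> (4 * h * h' * M) * 2"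
        using dif_dif_small[OF st st'] aau[OF q] Q by (intro mult_mono) auto
      moreover have "P * E q \<le> P * 1"
        using P0 E_le_1[of q] q by (intro mult_left_mono) auto
      ultimately have "\<bar>avg e (avg e' v) q\<bar> * (4 * (P * E q) + 2 * (\<bar>dif e (dif e' u) q\<bar> * \<bar>avg e (avg e' u) q\<bar>))
          \<le> (K0 * L\<^sup>2 * E q) * (4 * P + 16 * (h * h') * M)"
        using aav[OF q] P0 E_pos[of q] K_nonneg by (intro mult_mono) auto
      moreover have "32 * K1 * L * M * (h * h') * E q + (K0 * L\<^sup>2 * E q) * (4 * P + 16 * (h * h') * M)
          = (32 * K1 * L * M + 16 * M * K0 * L\<^sup>2 + 4 * K0 * K1\<^sup>2 * L ^ 4) * (h * h') * E q"
        by (simp add: P_def power2_eq_square power4_eq_xxxx algebra_simps)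
      moreover have "\<dots> \<le> Q2 * (h * h') * E q"
        using hh E_pos[of q] by (intro mult_right_mono) (auto simp: Q2_def)
      ultimately show "\<bar>laplacian (dif e (dif e' v)) q + (avg e (avg e' w) q - 2 * (avg e (avg e' v) q)\<^sup>2) * dif e (dif e' v) q\<bar>
          \<le> Q2 * (h * h') * E q"
        unfolding gl_dif_dif_eq[OF C2v eqv w']
        using tri[OF a1[OF q, of v] a2[OF q, of v] a1[OF q, of u] a2[OF q, of u] dw[OF q] q,
            of "avg e (avg e' v) q" "dif e (dif e' u) q" "avg e (avg e' u) q"] by simp
    qed (use lim_v dif_dif_small[OF st st'] Q p in simp_all)
  qed
  then show "\<bar>dif e (dif e' v) p\<bar> \<le> K2 * (h * h') * E p" by (simp only: K)
  have "\<bar>dif e (dif e' u) p\<bar> \<le> max (4 * h * h' * M * exp (\<tau> * (X + 2)) / c0) (Q2 * (h * h') / (\<kappa> * c0)) * E p"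
  proof (rule periodic_decay[OF C2_dif[OF C2_dif[OF C2u]] _ lim0[OF lim_u],
        where c="\<lambda>q. avg e (avg e' w) q - 2 * (avg e (avg e' u) q)\<^sup>2"])
    fix q :: plane assume q: "X + 2 \<le> fst q"
    have "(9 / 10)\<^sup>2 \<le> (avg e (avg e' u) q)\<^sup>2" using aau(2)[OF q] by (rule power_mono) simp
    then show "avg e (avg e' w) q - 2 * (avg e (avg e' u) q)\<^sup>2 \<le> \<theta> - 81 / 50"
      using aaw[OF q] by (simp add: power_divide)
    have "\<bar>dif e (dif e' v) q\<bar> * \<bar>avg e (avg e' v) q\<bar> \<le> (4 * h * h' * M) * (K0 * L\<^sup>2 * E q)"
      using dif_dif_small[OF st st'] aav[OF q] Q by (intro mult_mono) auto
    then have "4 * (P * E q) + 2 * (\<bar>dif e (dif e' v) q\<bar> * \<bar>avg e (avg e' v) q\<bar>)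
        \<le> 4 * (P * E q) + 2 * ((4 * h * h' * M) * (K0 * L\<^sup>2 * E q))"
      by (intro add_left_mono mult_left_mono) simp_all
    then have "\<bar>avg e (avg e' u) q\<bar> * (4 * (P * E q) + 2 * (\<bar>dif e (dif e' v) q\<bar> * \<bar>avg e (avg e' v) q\<bar>))
        \<le> 2 * (4 * (P * E q) + 2 * ((4 * h * h' * M) * (K0 * L\<^sup>2 * E q)))"
      using P0 E_pos[of q] by (intro mult_mono[OF aau(1)[OF q]]) auto
    moreover have "32 * K1 * L * M * (h * h') * E q + 2 * (4 * (P * E q) + 2 * ((4 * h * h' * M) * (K0 * L\<^sup>2 * E q)))
        = (32 * K1 * L * M + 16 * M * K0 * L\<^sup>2 + 8 * K1\<^sup>2 * L\<^sup>2) * (h * h') * E q"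
      by (simp add: P_def algebra_simps)
    moreover have "\<dots> \<le> Q2 * (h * h') * E q"
      using hh E_pos[of q] K_nonneg L1 by (intro mult_right_mono) (auto simp: Q2_def)
    ultimately show "\<bar>laplacian (dif e (dif e' u)) q + (avg e (avg e' w) q - 2 * (avg e (avg e' u) q)\<^sup>2) * dif e (dif e' u) q\<bar>
        \<le> Q2 * (h * h') * E q"
      unfolding gl_dif_dif_eq[OF C2u equ w_def]
      using tri[OF a1[OF q, of u] a2[OF q, of u] a1[OF q, of v] a2[OF q, of v] dw[OF q] q,
          of "avg e (avg e' u) q" "dif e (dif e' v) q" "avg e (avg e' v) q"] by simp
  next
    have per: "dif e0 f (x, y + 2 * b) = dif e0 f (x, y)"
      if "\<And>x y. f (x, y + 2 * b) = f (x, y)" for f e0 x y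
      using that[of "x + fst e0" "y + snd e0"] that[of "x - fst e0" "y - snd e0"]
      by (cases e0) (simp add: dif_def algebra_simps)
    show "dif e (dif e' u) (x, y + 2 * b) = dif e (dif e' u) (x, y)" for x y
      by (intro per u_per)
  qed (use dif_dif_small[OF st st'] Q p in simp_all)
  then show "\<bar>dif e (dif e' u) p\<bar> \<le> K2 * (h * h') * E p" by (simp only: K)
qed

text \<open>The bounds for differences are proportional to the steps \<open>h\<close> and
  \<open>h'\<close>, so they survive division by the steps and the limits of the steps to
  zero.\<close>

lemma derivative_decay:
  assumes p: "X + 2 \<le> fst p" and i: "i \<in> Basis" and j: "j \<in> Basis" and f: "f = u \<or> f = v"
  shows "\<bar>partial i f p\<bar> \<le> K1 * E p" "\<bar>partial j (partial i f) p\<bar> \<le> K2 * E p"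
proof -
  have C: "C2_on UNIV f" using f C2u C2v by auto
  note d = C2_on_differentiable[OF C UNIV_I]
  have st: "step h (h *\<^sub>R k)" if "0 < h" "h \<le> 1" "k \<in> Basis" for h k
    using that by (auto simp: step_def)
  have "\<bar>dif (h *\<^sub>R i) f p\<bar> \<le> K1 * E p * h" if "0 < h" "h \<le> 1" for h
    using dif_decay[OF st[OF that i], of p] p f by (auto simp: mult_ac)
  then show "\<bar>partial i f p\<bar> \<le> K1 * E p" by (rule partial_le_of_dif_le[OF d])
  have "\<bar>dif (h' *\<^sub>R j) (partial i f) p\<bar> \<le> K2 * E p * h'" if h': "0 < h'" "h' \<le> 1" for h'
  proof -
    have "\<bar>dif (h *\<^sub>R i) (dif (h' *\<^sub>R j) f) p\<bar> \<le> K2 * E p * h' * h" if "0 < h" "h \<le> 1" for h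
      using dif_dif_decay[OF st[OF that i] st[OF h' j] p] f by (auto simp: mult_ac)
    then have "\<bar>partial i (dif (h' *\<^sub>R j) f) p\<bar> \<le> K2 * E p * h'"
      by (rule partial_le_of_dif_le[OF C2_on_differentiable[OF C2_dif[OF C] UNIV_I]])
    then show ?thesis unfolding partial_dif(1)[OF d i] .
  qed
  then show "\<bar>partial j (partial i f) p\<bar> \<le> K2 * E p"
    by (rule partial_le_of_dif_le[OF C1_on_differentiable[OF C2_on_C1_partial[OF C i] UNIV_I]])
qed

end

subsection \<open>The kink and the first mode\<close>

definition kink :: "real \<Rightarrow> real" where "kink x = tanh (x / sqrt 2)"

lemma kink_deriv:
  "(kink has_real_derivative (1 - (kink x)\<^sup>2) / sqrt 2) (at x)"
  "((\<lambda>x. (1 - (kink x)\<^sup>2) / sqrt 2) has_real_derivative - (kink x * (1 - (kink x)\<^sup>2))) (at x)"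
proof -
  show 1: "(kink has_real_derivative (1 - (kink x)\<^sup>2) / sqrt 2) (at x)" for x
    unfolding kink_def[abs_def] by (auto intro!: derivative_eq_intros simp: field_simps)
  have "((\<lambda>x. (1 - (kink x)\<^sup>2) / sqrt 2) has_real_derivative
      (- (2 * kink x * ((1 - (kink x)\<^sup>2) / sqrt 2))) / sqrt 2) (at x)"
    by (auto intro!: derivative_eq_intros 1)
  moreover have "(- (2 * kink x * ((1 - (kink x)\<^sup>2) / sqrt 2))) / sqrt 2 = - (kink x * (1 - (kink x)\<^sup>2))"
    by simp
  ultimately show "((\<lambda>x. (1 - (kink x)\<^sup>2) / sqrt 2) has_real_derivative - (kink x * (1 - (kink x)\<^sup>2))) (at x)"
    by simp
qed

lemma chi0_deriv:
  "(chi0 has_real_derivative - (chi0 x * kink x / sqrt 2)) (at x)"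
  "((\<lambda>x. - (chi0 x * kink x / sqrt 2)) has_real_derivative - (chi0 x * (1 - 2 * (kink x)\<^sup>2) / 2)) (at x)"
proof -
  show 1: "(chi0 has_real_derivative - (chi0 x * kink x / sqrt 2)) (at x)" for x
    unfolding chi0_def[abs_def] kink_def tanh_def
    by (auto intro!: derivative_eq_intros simp: power2_eq_square field_simps)
  have "((\<lambda>x. - (chi0 x * kink x / sqrt 2)) has_real_derivative
      - (((- (chi0 x * kink x / sqrt 2)) * kink x + (1 - (kink x)\<^sup>2) / sqrt 2 * chi0 x) / sqrt 2)) (at x)"
    by (intro DERIV_minus DERIV_cdivide DERIV_mult 1 kink_deriv)
  moreover have "- (((- (chi0 x * kink x / sqrt 2)) * kink x + (1 - (kink x)\<^sup>2) / sqrt 2 * chi0 x) / sqrt 2)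
      = - (chi0 x * (1 - 2 * (kink x)\<^sup>2) / 2)"
    by (simp add: field_simps power2_eq_square)
  ultimately show "((\<lambda>x. - (chi0 x * kink x / sqrt 2)) has_real_derivative - (chi0 x * (1 - 2 * (kink x)\<^sup>2) / 2)) (at x)"
    by (simp only:)
qed

lemma kink_bounds: "\<bar>kink x\<bar> < 1"
  by (simp add: kink_def abs_less_iff tanh_real_lt_1 tanh_real_gt_neg1 minus_less_iff)

lemma kink_sq_le: "(kink x)\<^sup>2 \<le> 1"
  using kink_bounds[of x] by (simp add: abs_square_le_1 less_imp_le)

lemma chi0_bounds: "0 < chi0 x" "chi0 x \<le> 1" "chi0 0 = 1" "chi0 x \<le> 2 * exp (- \<bar>x\<bar> / sqrt 2)" "exp (- \<bar>x\<bar> / sqrt 2) \<le> chi0 x"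
proof -
  show "0 < chi0 x" "chi0 x \<le> 1" "chi0 0 = 1"
    using cosh_real_ge_1[of "x / sqrt 2"] by (simp_all add: chi0_def cosh_real_pos divide_le_eq_1)
  have c: "cosh (x / sqrt 2) = (exp (\<bar>x\<bar> / sqrt 2) + exp (- (\<bar>x\<bar> / sqrt 2))) / 2"
    by (cases "0 \<le> x") (auto simp: cosh_def)
  have "exp (\<bar>x\<bar> / sqrt 2) / 2 \<le> cosh (x / sqrt 2)" unfolding c by simp
  then show "chi0 x \<le> 2 * exp (- \<bar>x\<bar> / sqrt 2)"
    using cosh_real_pos[of "x / sqrt 2"] by (simp add: chi0_def exp_minus field_simps)
  have "exp (- (\<bar>x\<bar> / sqrt 2)) \<le> exp (\<bar>x\<bar> / sqrt 2)" by simp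
  then have "cosh (x / sqrt 2) \<le> exp (\<bar>x\<bar> / sqrt 2)" unfolding c by simp
  then show "exp (- \<bar>x\<bar> / sqrt 2) \<le> chi0 x"
    using cosh_real_pos[of "x / sqrt 2"] by (simp add: chi0_def exp_minus field_simps)
qed

lemma kink_chi0: "1 - (kink x)\<^sup>2 = (chi0 x)\<^sup>2"
proof -
  have "1 - (kink x)\<^sup>2 = ((cosh (x / sqrt 2))\<^sup>2 - (sinh (x / sqrt 2))\<^sup>2) / (cosh (x / sqrt 2))\<^sup>2"
    by (simp add: kink_def tanh_def power_divide diff_divide_distrib)
  then show ?thesis by (simp add: hyperbolic_pythagoras chi0_def power_divide)
qed

lemma continuous_kink_chi0: "continuous_on S kink" "continuous_on S chi0"
  using DERIV_isCont[OF kink_deriv(1)] DERIV_isCont[OF chi0_deriv(1)] by (auto intro: continuous_at_imp_continuous_on)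

lemma S0_eq: "S0 p = complex_of_real (kink (fst p))"
  by (cases p) (simp add: S0_def kink_def)

lemma S0_C2:
  shows "C2_on UNIV S0"
    and "partial (1, 0) S0 p = complex_of_real ((1 - (kink (fst p))\<^sup>2) / sqrt 2)"
    and "partial (0, 1) S0 p = 0"
    and "partial (1, 0) (partial (1, 0) S0) p = complex_of_real (- (kink (fst p) * (1 - (kink (fst p))\<^sup>2)))"
    and "partial (0, 1) (partial (1, 0) S0) p = 0"
    and "partial v (partial (0, 1) S0) p = 0"
proof -
  have c: "continuous_on UNIV (\<lambda>x. - (kink x * (1 - (kink x)\<^sup>2)))" by (intro continuous_intros continuous_kink_chi0)
  have 1: "((\<lambda>y. 1) has_real_derivative 0) (at y)" "((\<lambda>y. 0) has_real_derivative 0) (at y)" for y :: real by simp_all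
  note D = C2_on_separable[OF kink_deriv(1) 1(1) kink_deriv(2) 1(2) c continuous_on_const, simplified]
  have S: "S0 = (\<lambda>p. complex_of_real (kink (fst p)))" by (rule ext) (rule S0_eq)
  show "C2_on UNIV S0" unfolding S by (rule C2_on_linear[OF bounded_linear_of_real open_UNIV D(1)])
  note d = partial_linear(1)[OF bounded_linear_of_real C2_on_differentiable[OF D(1) UNIV_I]]
  have P1: "partial (1, 0) S0 = (\<lambda>p. complex_of_real ((1 - (kink (fst p))\<^sup>2) / sqrt 2))"
    and P2: "partial (0, 1) S0 = (\<lambda>p. 0)"
    unfolding S by (rule ext, simp add: d D)+
  then show "partial (1, 0) S0 p = complex_of_real ((1 - (kink (fst p))\<^sup>2) / sqrt 2)" "partial (0, 1) S0 p = 0" by auto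
  have B: "(1, 0) \<in> (Basis :: plane set)" by (simp add: Basis_plane)
  note d2 = partial2_linear[OF bounded_linear_of_real open_UNIV D(1) UNIV_I B]
  show "partial (1, 0) (partial (1, 0) S0) p = complex_of_real (- (kink (fst p) * (1 - (kink (fst p))\<^sup>2)))"
    "partial (0, 1) (partial (1, 0) S0) p = 0"
    unfolding S d2 D(4,5) by simp_all
  show "partial v (partial (0, 1) S0) p = 0" unfolding P2 by (rule partial_const)
qed

lemma S0_bounds:
  assumes "v \<in> Basis" "w \<in> Basis"
  shows "cmod (partial v S0 p) \<le> (chi0 (fst p))\<^sup>2" "cmod (partial w (partial v S0) p) \<le> (chi0 (fst p))\<^sup>2"
proof -
  have "(chi0 (fst p))\<^sup>2 / sqrt 2 \<le> (chi0 (fst p))\<^sup>2" by (simp add: divide_le_eq mult_le_cancel_left1)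
  moreover have "\<bar>kink (fst p)\<bar> * (chi0 (fst p))\<^sup>2 \<le> 1 * (chi0 (fst p))\<^sup>2"
    using kink_bounds[of "fst p"] by (intro mult_right_mono) auto
  ultimately show "cmod (partial v S0 p) \<le> (chi0 (fst p))\<^sup>2" "cmod (partial w (partial v S0) p) \<le> (chi0 (fst p))\<^sup>2"
    using assms by (auto simp: Basis_plane S0_C2 kink_chi0 norm_divide norm_mult norm_power abs_mult simp flip: of_real_diff of_real_mult of_real_divide of_real_power)
qed

text \<open>Satisfies \<open>\<Delta> m + (1 - kink\<^sup>2) m = (1 / 2 - \<mu>\<^sup>2) m\<close>.
  Hence for \<open>\<mu> = 1 / sqrt 2\<close>, that is at the critical width, it is in the kernel of
  the linearisation at \<open>S0\<close> for imaginary perturbations.\<close>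

definition mode :: "real \<Rightarrow> plane \<Rightarrow> real" where
  "mode \<mu> p = chi0 (fst p) * cos (\<mu> * snd p)"

lemma mode_C2:
  shows "C2_on UNIV (mode \<mu>)"
    and "partial (1, 0) (mode \<mu>) = (\<lambda>p. - (chi0 (fst p) * kink (fst p) / sqrt 2) * cos (\<mu> * snd p))"
    and "partial (0, 1) (mode \<mu>) = (\<lambda>p. chi0 (fst p) * (- \<mu> * sin (\<mu> * snd p)))"
    and "v \<in> Basis \<Longrightarrow> \<bar>\<mu>\<bar> \<le> 1 \<Longrightarrow> \<bar>partial v (mode \<mu>) p\<bar> \<le> 1"
    and "v \<in> Basis \<Longrightarrow> w \<in> Basis \<Longrightarrow> \<bar>\<mu>\<bar> \<le> 1 \<Longrightarrow> \<bar>partial w (partial v (mode \<mu>)) p\<bar> \<le> 1"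
proof -
  have c: "continuous_on UNIV (\<lambda>x. - (chi0 x * (1 - 2 * (kink x)\<^sup>2) / 2))"
    by (intro continuous_intros continuous_kink_chi0) simp
  have 3: "((\<lambda>y. cos (\<mu> * y)) has_real_derivative - \<mu> * sin (\<mu> * y)) (at y)" for y
    by (auto intro!: derivative_eq_intros)
  have 4: "((\<lambda>y. - \<mu> * sin (\<mu> * y)) has_real_derivative - \<mu>\<^sup>2 * cos (\<mu> * y)) (at y)" for y
    by (auto intro!: derivative_eq_intros simp: power2_eq_square)
  have 5: "continuous_on UNIV (\<lambda>y. - \<mu>\<^sup>2 * cos (\<mu> * y))" by (intro continuous_intros)
  have m: "mode \<mu> = (\<lambda>p. chi0 (fst p) * cos (\<mu> * snd p))" by (rule ext) (rule mode_def)
  note D = C2_on_separable[OF chi0_deriv(1) 3 chi0_deriv(2) 4 c 5, folded m]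
  show "C2_on UNIV (mode \<mu>)" "partial (1, 0) (mode \<mu>) = (\<lambda>p. - (chi0 (fst p) * kink (fst p) / sqrt 2) * cos (\<mu> * snd p))"
    "partial (0, 1) (mode \<mu>) = (\<lambda>p. chi0 (fst p) * (- \<mu> * sin (\<mu> * snd p)))" by (rule D)+
  have m1: "\<bar>r * s\<bar> \<le> 1" if "\<bar>r\<bar> \<le> 1" "\<bar>s\<bar> \<le> 1" for r s :: real
    unfolding abs_mult using mult_mono[OF that] by simp
  have k: "\<bar>kink (fst p)\<bar> \<le> 1" "\<bar>chi0 (fst p)\<bar> \<le> 1" using kink_bounds[of "fst p"] chi0_bounds(1,2)[of "fst p"] by auto
  have s2: "\<bar>1 / sqrt 2\<bar> \<le> 1" by simp
  have k1: "\<bar>- (chi0 (fst p) * kink (fst p) / sqrt 2)\<bar> \<le> 1"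
    using m1[OF m1[OF k(2,1)] s2] by simp
  have "\<bar>1 - 2 * (kink (fst p))\<^sup>2\<bar> \<le> 1" using kink_sq_le[of "fst p"] by (auto simp: abs_le_iff)
  from m1[OF k(2) this] have k2: "\<bar>- (chi0 (fst p) * (1 - 2 * (kink (fst p))\<^sup>2) / 2)\<bar> \<le> 1" by simp
  show "\<bar>partial v (mode \<mu>) p\<bar> \<le> 1" if "v \<in> Basis" "\<bar>\<mu>\<bar> \<le> 1"
  proof -
    have "\<bar>- \<mu> * sin (\<mu> * snd p)\<bar> \<le> 1" by (rule m1) (use that in auto)
    then show ?thesis using that(1) unfolding Basis_plane by (auto simp only: D insert_iff empty_iff intro!: m1 k k1 abs_cos_le_one)
  qed
  show "\<bar>partial w (partial v (mode \<mu>)) p\<bar> \<le> 1" if "v \<in> Basis" "w \<in> Basis" "\<bar>\<mu>\<bar> \<le> 1"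
  proof -
    have 1: "\<bar>- \<mu> * sin (\<mu> * snd p)\<bar> \<le> 1" by (rule m1) (use that in auto)
    have "\<bar>- \<mu>\<^sup>2\<bar> \<le> 1" using that(3) by (simp add: abs_square_le_1)
    then have 2: "\<bar>- \<mu>\<^sup>2 * cos (\<mu> * snd p)\<bar> \<le> 1" by (rule m1) simp
    show ?thesis using that(1,2) unfolding Basis_plane
      by (auto simp only: D(4-7) insert_iff empty_iff intro!: m1 k k1 k2 1 2 abs_cos_le_one)
  qed
qed

definition amp :: "real \<Rightarrow> nat \<Rightarrow> real \<Rightarrow> real" where
  "amp \<Lambda> k d = \<Lambda> * sqrt ((d - dcrit k) / dcrit k)"

lemma leading_part_eq:
  "leading_part \<Lambda> k d = (\<lambda>p. S0 p + \<i> * complex_of_real (amp \<Lambda> k d * mode (pi * real k / d) p))"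
  by (rule ext) (simp add: leading_part_def amp_def mode_def case_prod_beta' mult_ac)

lemma bounded_linear_i_times_of_real: "bounded_linear (\<lambda>r. \<i> * complex_of_real (A * r))"
  by (intro bounded_linear_intros bounded_linear_const_mult bounded_linear_compose[OF bounded_linear_of_real] bounded_linear_mult_right)

lemma leading_C2:
  shows "C2_on UNIV (leading_part \<Lambda> k d)"
    and "v \<in> Basis \<Longrightarrow> partial v (leading_part \<Lambda> k d) p
      = partial v S0 p + \<i> * complex_of_real (amp \<Lambda> k d * partial v (mode (pi * real k / d)) p)"
    and "v \<in> Basis \<Longrightarrow> w \<in> Basis \<Longrightarrow> partial w (partial v (leading_part \<Lambda> k d)) p
      = partial w (partial v S0) p + \<i> * complex_of_real (amp \<Lambda> k d * partial w (partial v (mode (pi * real k / d))) p)"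
proof -
  let ?m = "mode (pi * real k / d)"
  note bl = bounded_linear_i_times_of_real[of "amp \<Lambda> k d"]
  have m: "C2_on UNIV (\<lambda>p. \<i> * complex_of_real (amp \<Lambda> k d * ?m p))"
    by (rule C2_on_linear[OF bl open_UNIV mode_C2(1)])
  show "C2_on UNIV (leading_part \<Lambda> k d)"
    unfolding leading_part_eq by (rule C2_on_add[OF open_UNIV S0_C2(1) m])
  show "partial v (leading_part \<Lambda> k d) p
      = partial v S0 p + \<i> * complex_of_real (amp \<Lambda> k d * partial v ?m p)"
    unfolding leading_part_eq
    using partial_add(1)[OF C2_on_differentiable[OF S0_C2(1) UNIV_I] C2_on_differentiable[OF m UNIV_I]]
      partial_linear(1)[OF bl C2_on_differentiable[OF mode_C2(1) UNIV_I]] by simp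
  show "partial w (partial v (leading_part \<Lambda> k d)) p
      = partial w (partial v S0) p + \<i> * complex_of_real (amp \<Lambda> k d * partial w (partial v ?m) p)" if "v \<in> Basis"
    unfolding leading_part_eq
    using partial2_add[OF open_UNIV S0_C2(1) m UNIV_I that] partial2_linear[OF bl open_UNIV mode_C2(1) UNIV_I that] by simp
qed

subsection \<open>Pointwise consequences of the asymptotic expansion\<close>

lemma dcrit_pos: "1 \<le> k \<Longrightarrow> 0 < dcrit k"
  by (simp add: dcrit_def)

lemma admissible_C2: "admissible_solution \<sigma> d \<psi> \<Longrightarrow> C2_on (strip d) \<psi>"
  by (simp add: admissible_solution_def neumann_solution_def GL_solution_def)

lemma C2_on_strip: "C2_on UNIV f \<Longrightarrow> C2_on (strip d) f"
  using C2_on_subset by blast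

lemma wave_number_bounds:
  assumes "1 \<le> k" "dcrit k < d"
  shows "0 < pi * real k / d" "pi * real k / d < 1 / sqrt 2" "pi * real k / d \<le> 1"
proof -
  have d: "0 < d" using dcrit_pos[OF assms(1)] assms(2) by simp
  show "0 < pi * real k / d" using d assms(1) by simp
  have "pi * real k * sqrt 2 < d" using assms(2) by (simp add: dcrit_def mult_ac)
  then show 1: "pi * real k / d < 1 / sqrt 2" using d by (simp add: field_simps)
  have "1 / sqrt 2 \<le> (1::real)" by simp
  with 1 show "pi * real k / d \<le> 1" by linarith
qed

locale branch =
  fixes \<Lambda> :: real and k :: nat and l \<sigma> :: real and \<Psi> :: "real \<Rightarrow> plane \<Rightarrow> complex"
  assumes \<Lambda>: "0 < \<Lambda>" and k: "1 \<le> k" and B: "bifurcation_branch \<Lambda> k l \<sigma> \<Psi>"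
begin

lemma l_pos: "0 < l" and \<sigma>_pos: "0 < \<sigma>"
  using B by (auto simp: bifurcation_branch_def)

lemma admissible: "dcrit k < d \<Longrightarrow> d < dcrit k + l \<Longrightarrow> admissible_solution \<sigma> d (\<Psi> d)"
  using B by (auto simp: bifurcation_branch_def)

lemma eventually_range: "\<forall>\<^sub>F d in at_right (dcrit k). dcrit k < d \<and> d < dcrit k + e" if "0 < e"
  unfolding eventually_at_right_field using that by (intro exI[of _ "dcrit k + e"]) auto

lemma asymptotics:
  obtains C where "0 \<le> C" "\<forall>\<^sub>F d in at_right (dcrit k). dcrit k < d \<and> d < dcrit k + l \<and>
    wbound 0 d (\<lambda>p. \<Psi> d p - leading_part \<Lambda> k d p) (C * (d - dcrit k))"
proof -
  obtain C0 where C0: "\<forall>\<^sub>F d in at_right (dcrit k).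
      W2inf_norm 0 d (\<lambda>p. \<Psi> d p - leading_part \<Lambda> k d p) \<le> ennreal (C0 * (d - dcrit k))"
    using B unfolding bifurcation_branch_def by blast
  define C where "C = max C0 0"
  have "\<forall>\<^sub>F d in at_right (dcrit k). dcrit k < d \<and> d < dcrit k + l \<and>
    wbound 0 d (\<lambda>p. \<Psi> d p - leading_part \<Lambda> k d p) (C * (d - dcrit k))"
    using eventually_range[OF l_pos] C0
  proof eventually_elim
    case (elim d)
    have "C0 * (d - dcrit k) \<le> C * (d - dcrit k)" using elim(1) by (intro mult_right_mono) (auto simp: C_def)
    then have "W2inf_norm 0 d (\<lambda>p. \<Psi> d p - leading_part \<Lambda> k d p) \<le> ennreal (C * (d - dcrit k))"
      using elim(2) by (meson ennreal_leI order_trans)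
    moreover have "C2_on (strip d) (\<lambda>p. \<Psi> d p - leading_part \<Lambda> k d p)"
      using elim(1) by (intro C2_on_diff open_strip C2_on_strip leading_C2(1) admissible_C2[OF admissible]) auto
    moreover have "0 \<le> C * (d - dcrit k)" using elim(1) by (simp add: C_def)
    ultimately show ?case using elim(1) wbound_of_W2inf_norm by blast
  qed
  then show thesis by (intro that[of C]) (auto simp: C_def)
qed

lemma amp_pos: "dcrit k < d \<Longrightarrow> 0 < amp \<Lambda> k d"
  using \<Lambda> dcrit_pos[OF k] by (simp add: amp_def)

lemma amp_tendsto: "((\<lambda>d. amp \<Lambda> k d) \<longlongrightarrow> 0) (at_right (dcrit k))"
proof -
  have "((\<lambda>d. amp \<Lambda> k d) \<longlongrightarrow> \<Lambda> * sqrt ((dcrit k - dcrit k) / dcrit k)) (at_right (dcrit k))"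
    unfolding amp_def using dcrit_pos[OF k] by (intro tendsto_intros) auto
  then show ?thesis by simp
qed

lemma eventually_amp_small: "0 < e \<Longrightarrow> \<forall>\<^sub>F d in at_right (dcrit k). amp \<Lambda> k d < e"
  using order_tendstoD(2)[OF amp_tendsto] .

lemma dist_eq_amp: "dcrit k < d \<Longrightarrow> d - dcrit k = dcrit k / \<Lambda>\<^sup>2 * (amp \<Lambda> k d)\<^sup>2"
  using \<Lambda> dcrit_pos[OF k] by (simp add: amp_def power_mult_distrib)

text \<open>By \<open>dist_eq_amp\<close> the error term is quadratic in the amplitude, hence below
  any fixed fraction of the leading term.\<close>

lemma eventually_dist_small:
  assumes "0 < e"
  shows "\<forall>\<^sub>F d in at_right (dcrit k). C * (d - dcrit k) < e * amp \<Lambda> k d"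
proof -
  have "((\<lambda>d. C * (dcrit k / \<Lambda>\<^sup>2) * amp \<Lambda> k d) \<longlongrightarrow> C * (dcrit k / \<Lambda>\<^sup>2) * 0) (at_right (dcrit k))"
    by (intro tendsto_intros amp_tendsto)
  then have "\<forall>\<^sub>F d in at_right (dcrit k). C * (dcrit k / \<Lambda>\<^sup>2) * amp \<Lambda> k d < e"
    using assms by (intro order_tendstoD(2)) auto
  with eventually_range[OF l_pos] show ?thesis
  proof eventually_elim
    case (elim d)
    then have "C * (dcrit k / \<Lambda>\<^sup>2) * amp \<Lambda> k d * amp \<Lambda> k d < e * amp \<Lambda> k d"
      using amp_pos by (intro mult_strict_right_mono) auto
    then show ?case using dist_eq_amp elim(1) by (simp add: power2_eq_square mult_ac)
  qed
qed

text \<open>Only with weight zero: the expansion holds in the unweighted norm and carries no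
  information on decay.\<close>

lemma close_to_S0:
  assumes "0 < e"
  shows "\<forall>\<^sub>F d in at_right (dcrit k). wbound 0 d (\<lambda>p. \<Psi> d p - S0 p) e"
proof -
  obtain C where C: "0 \<le> C" "\<forall>\<^sub>F d in at_right (dcrit k). dcrit k < d \<and> d < dcrit k + l \<and>
    wbound 0 d (\<lambda>p. \<Psi> d p - leading_part \<Lambda> k d p) (C * (d - dcrit k))"
    by (rule asymptotics)
  show ?thesis
    using C(2) eventually_dist_small[OF zero_less_one, of C] eventually_amp_small[OF half_gt_zero[OF assms]]
  proof eventually_elim
    case (elim d)
    let ?m = "mode (pi * real k / d)"
    have d: "dcrit k < d" using elim by auto
    have mu: "\<bar>pi * real k / d\<bar> \<le> 1" using wave_number_bounds[OF k d] by simp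
    have A: "0 < amp \<Lambda> k d" "C * (d - dcrit k) + amp \<Lambda> k d \<le> e" using elim amp_pos by auto
    have add: "cmod z \<le> e" if "cmod (z - \<i> * complex_of_real (amp \<Lambda> k d * t)) \<le> C * (d - dcrit k)" "\<bar>t\<bar> \<le> 1" for z t
    proof -
      have "cmod (\<i> * complex_of_real (amp \<Lambda> k d * t)) \<le> amp \<Lambda> k d"
        using that(2) A(1) by (simp add: norm_mult mult_left_le)
      moreover have "cmod z \<le> cmod (z - \<i> * complex_of_real (amp \<Lambda> k d * t)) + cmod (\<i> * complex_of_real (amp \<Lambda> k d * t))"
        by norm
      ultimately show ?thesis using that(1) A(2) by linarith
    qed
    have c\<Psi>: "C2_on (strip d) (\<Psi> d)" using elim by (intro admissible_C2[OF admissible]) auto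
    note cS = C2_on_strip[OF S0_C2(1), of d] and cL = C2_on_strip[OF leading_C2(1)[of \<Lambda> k d], of d]
    show ?case
      unfolding wbound_def
    proof (intro ballI conjI)
      fix p assume p: "p \<in> strip d"
      note dd = C2_on_differentiable[OF c\<Psi> p] C2_on_differentiable[OF cS p] C2_on_differentiable[OF cL p]
      have W: "wbound 0 d (\<lambda>p. \<Psi> d p - leading_part \<Lambda> k d p) (C * (d - dcrit k))" using elim by auto
      have "\<bar>?m p\<bar> \<le> 1"
        unfolding mode_def abs_mult using chi0_bounds(1,2)[of "fst p"] by (intro mult_le_one) auto
      then show "cmod (\<Psi> d p - S0 p) \<le> e"
        using W p by (intro add[of _ "?m p"]) (auto simp: wbound_def leading_part_eq diff_diff_eq)
      fix v :: plane assume v: "v \<in> Basis"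
      have "cmod (partial v (\<lambda>p. \<Psi> d p - leading_part \<Lambda> k d p) p) \<le> C * (d - dcrit k)"
        using W p v by (simp add: wbound_def)
      then have "cmod (partial v (\<lambda>p. \<Psi> d p - S0 p) p) \<le> e"
        using mode_C2(4)[OF v mu, of p]
        by (intro add[of _ "partial v ?m p"]) (simp_all add: partial_diff dd leading_C2(2)[OF v] diff_diff_eq)
      then show "exp (0 * \<bar>fst p\<bar>) * cmod (partial v (\<lambda>p. \<Psi> d p - S0 p) p) \<le> e" by simp
      fix w :: plane assume w: "w \<in> Basis"
      have "cmod (partial w (partial v (\<lambda>p. \<Psi> d p - leading_part \<Lambda> k d p)) p) \<le> C * (d - dcrit k)"
        using W p v w by (simp add: wbound_def)
      then have "cmod (partial w (partial v (\<lambda>p. \<Psi> d p - S0 p)) p) \<le> e"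
        using mode_C2(5)[OF v w mu, of p]
        by (intro add[of _ "partial w (partial v ?m) p"])
          (simp_all add: partial2_diff[OF open_strip c\<Psi> cS p v] partial2_diff[OF open_strip c\<Psi> cL p v]
            leading_C2(3)[OF v w] diff_diff_eq)
      then show "exp (0 * \<bar>fst p\<bar>) * cmod (partial w (partial v (\<lambda>p. \<Psi> d p - S0 p)) p) \<le> e" by simp
    qed
  qed
qed

lemma pointwise_expansion:
  obtains C where "0 \<le> C" "\<forall>\<^sub>F d in at_right (dcrit k). dcrit k < d \<and> d < dcrit k + l \<and>
    (\<forall>p\<in>strip d. \<bar>Re (\<Psi> d p) - kink (fst p)\<bar> \<le> C * (d - dcrit k)
      \<and> \<bar>Im (\<Psi> d p) - amp \<Lambda> k d * mode (pi * real k / d) p\<bar> \<le> C * (d - dcrit k)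
      \<and> \<bar>Re (partial (1, 0) (\<Psi> d) p) - (1 - (kink (fst p))\<^sup>2) / sqrt 2\<bar> \<le> C * (d - dcrit k)
      \<and> \<bar>Im (partial (1, 0) (\<Psi> d) p) - amp \<Lambda> k d * partial (1, 0) (mode (pi * real k / d)) p\<bar> \<le> C * (d - dcrit k)
      \<and> \<bar>Im (partial (0, 1) (\<Psi> d) p) - amp \<Lambda> k d * partial (0, 1) (mode (pi * real k / d)) p\<bar> \<le> C * (d - dcrit k))"
proof -
  obtain C where C: "0 \<le> C" "\<forall>\<^sub>F d in at_right (dcrit k). dcrit k < d \<and> d < dcrit k + l \<and>
    wbound 0 d (\<lambda>p. \<Psi> d p - leading_part \<Lambda> k d p) (C * (d - dcrit k))"
    by (rule asymptotics)
  show thesis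
  proof (rule that[OF C(1)], rule eventually_mono[OF C(2)], intro conjI ballI)
    fix d p assume d: "dcrit k < d \<and> d < dcrit k + l \<and>
      wbound 0 d (\<lambda>p. \<Psi> d p - leading_part \<Lambda> k d p) (C * (d - dcrit k))"
    then show "dcrit k < d" "d < dcrit k + l" by auto
    assume p: "p \<in> strip d"
    have B: "(1, 0) \<in> (Basis :: plane set)" "(0, 1) \<in> (Basis :: plane set)" by (auto simp: Basis_plane)
    have c\<Psi>: "C2_on (strip d) (\<Psi> d)" using d by (intro admissible_C2[OF admissible]) auto
    note dd = C2_on_differentiable[OF c\<Psi> p] C2_on_differentiable[OF leading_C2(1)[of \<Lambda> k d] UNIV_I]
    have 0: "cmod (\<Psi> d p - leading_part \<Lambda> k d p) \<le> C * (d - dcrit k)"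
      and v: "v \<in> Basis \<Longrightarrow> cmod (partial v (\<Psi> d) p - partial v (leading_part \<Lambda> k d) p) \<le> C * (d - dcrit k)" for v
      using d p by (auto simp: wbound_def partial_diff(1)[OF dd, symmetric])
    note R = order_trans[OF abs_Re_le_cmod] and I = order_trans[OF abs_Im_le_cmod]
    show "\<bar>Re (\<Psi> d p) - kink (fst p)\<bar> \<le> C * (d - dcrit k)"
      using R[OF 0] by (simp add: leading_part_eq S0_eq)
    show "\<bar>Im (\<Psi> d p) - amp \<Lambda> k d * mode (pi * real k / d) p\<bar> \<le> C * (d - dcrit k)"
      using I[OF 0] by (simp add: leading_part_eq S0_eq)
    show "\<bar>Re (partial (1, 0) (\<Psi> d) p) - (1 - (kink (fst p))\<^sup>2) / sqrt 2\<bar> \<le> C * (d - dcrit k)"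
      using R[OF v[OF B(1)]] unfolding leading_C2(2)[OF B(1)] S0_C2 by simp
    show "\<bar>Im (partial (1, 0) (\<Psi> d) p) - amp \<Lambda> k d * partial (1, 0) (mode (pi * real k / d)) p\<bar> \<le> C * (d - dcrit k)"
      using I[OF v[OF B(1)]] unfolding leading_C2(2)[OF B(1)] S0_C2 by simp
    show "\<bar>Im (partial (0, 1) (\<Psi> d) p) - amp \<Lambda> k d * partial (0, 1) (mode (pi * real k / d)) p\<bar> \<le> C * (d - dcrit k)"
      using I[OF v[OF B(2)]] unfolding leading_C2(2)[OF B(2)] S0_C2 by simp
  qed
qed

end

subsection \<open>Zeros and degrees\<close>

text \<open>The sign conditions prevent \<open>\<psi>\<close> from pointing opposite to \<open>x + i n y\<close>, so that the
  straight-line homotopy between the two avoids \<open>0\<close>.\<close>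

lemma has_degree_of_signs:
  fixes n :: int
  assumes r0: "0 < r0" and n: "\<bar>n\<bar> = 1" and cont: "continuous_on (ball z r0) \<psi>"
    and pos: "\<And>x y. z + (x, y) \<in> ball z r0 \<Longrightarrow> 0 < x \<Longrightarrow> 0 < Re (\<psi> (z + (x, y)))"
    and neg: "\<And>x y. z + (x, y) \<in> ball z r0 \<Longrightarrow> x < 0 \<Longrightarrow> Re (\<psi> (z + (x, y))) < 0"
    and im: "\<And>y. z + (0, y) \<in> ball z r0 \<Longrightarrow> y \<noteq> 0 \<Longrightarrow> 0 < of_int n * y * Im (\<psi> (z + (0, y)))"
  shows "has_degree \<psi> z n"
  unfolding has_degree_def eventually_at_right_field
proof (intro exI[of _ r0] conjI allI impI r0)
  fix r assume r: "0 < r" "r < r0"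
  define e where "e t = (cos (2 * pi * t), sin (2 * pi * t))" for t :: real
  define g where "g t = sgn (\<psi> (z + r *\<^sub>R e t))" for t
  define h where "h t = Complex (cos (2 * pi * t)) (of_int n * sin (2 * pi * t))" for t
  have ball: "z + r *\<^sub>R e t \<in> ball z r0" for t
    using r by (simp add: e_def dist_norm norm_Pair flip: power_mult_distrib distrib_left)
      (simp add: power_mult_distrib flip: distrib_left)
  have ne: "\<psi> (z + r *\<^sub>R e t) \<noteq> 0" and seg: "(1 - u) *\<^sub>R g t + u *\<^sub>R h t \<noteq> 0"
    if "0 \<le> u" "u \<le> 1" for t u
  proof -
    let ?c = "cos (2 * pi * t)" and ?s = "sin (2 * pi * t)" and ?w = "\<psi> (z + r *\<^sub>R e t)"
    have er: "r *\<^sub>R e t = (r * ?c, r * ?s)" by (simp add: e_def)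
    \<comment> \<open>A convex combination of two nonzero reals of the same sign is not zero; this
      is used for the real or for the imaginary parts of the two ends of the segment.\<close>
    have comb: "(1 - u) * a + u * b \<noteq> 0" if "0 < a * b" for a b :: real
    proof -
      have "0 < a * ((1 - u) * a + u * b) \<or> a = 0"
      proof (cases "a = 0")
        case False
        then have aa: "0 < a * a" by (auto simp: zero_less_mult_iff linorder_neq_iff)
        have "a * ((1 - u) * a + u * b) = (1 - u) * (a * a) + u * (a * b)" by (simp add: algebra_simps)
        moreover have "0 \<le> (1 - u) * (a * a)" "0 \<le> u * (a * b)"
          using \<open>0 \<le> u\<close> \<open>u \<le> 1\<close> \<open>0 < a * b\<close> by auto
        moreover have "0 < (1 - u) * (a * a) \<or> 0 < u * (a * b)"
          using \<open>0 \<le> u\<close> \<open>0 < a * b\<close> aa by (cases "u = 0") auto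
        ultimately show ?thesis by linarith
      qed simp
      then show ?thesis using that by auto
    qed
    \<comment> \<open>Off the vertical diameter the real part of the value has the sign of the
      cosine; on it the imaginary part has the sign of \<open>n\<close> times the sine.\<close>
    have "?w \<noteq> 0 \<and> (0 < Re ?w * ?c \<or> 0 < Im ?w * (of_int n * ?s))"
    proof (cases "?c = 0")
      case True
      then have s: "?s \<noteq> 0" using sin_cos_squared_add[of "2 * pi * t"] by auto
      have "0 < of_int n * (r * ?s) * Im (\<psi> (z + (0, r * ?s)))"
        by (rule im) (use ball[of t] s r in \<open>auto simp: er True\<close>)
      moreover have "z + (0, r * ?s) = z + r *\<^sub>R e t" by (simp add: er True)
      ultimately have "0 < r * (Im ?w * (of_int n * ?s))" by (simp add: mult_ac)
      then have "0 < Im ?w * (of_int n * ?s)" using r by (simp add: zero_less_mult_iff)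
      then show ?thesis by auto
    next
      case False
      then have "r * ?c \<noteq> 0" using r by simp
      then consider "0 < r * ?c" | "r * ?c < 0" by linarith
      then have "0 < Re ?w * ?c"
      proof cases
        case 1
        have "0 < Re ?w" unfolding er by (rule pos) (use ball[of t] 1 in \<open>auto simp: er\<close>)
        then show ?thesis using 1 r by (simp add: zero_less_mult_iff)
      next
        case 2
        have "Re ?w < 0" unfolding er by (rule neg) (use ball[of t] 2 in \<open>auto simp: er\<close>)
        then show ?thesis using 2 r by (simp add: zero_less_mult_iff mult_less_0_iff)
      qed
      then show ?thesis by auto
    qed
    then have w: "?w \<noteq> 0" and "0 < Re ?w * ?c \<or> 0 < Im ?w * (of_int n * ?s)" by auto
    moreover have "Re (g t) * Re (h t) = inverse (cmod ?w) * (Re ?w * ?c)"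
      "Im (g t) * Im (h t) = inverse (cmod ?w) * (Im ?w * (of_int n * ?s))"
      by (simp_all add: g_def h_def sgn_div_norm)
    moreover have "0 < inverse (cmod ?w)" using w by simp
    ultimately have "0 < Re (g t) * Re (h t) \<or> 0 < Im (g t) * Im (h t)"
      by (metis mult_pos_pos)
    then have "Re ((1 - u) *\<^sub>R g t + u *\<^sub>R h t) \<noteq> 0 \<or> Im ((1 - u) *\<^sub>R g t + u *\<^sub>R h t) \<noteq> 0"
      using comb[of "Re (g t)" "Re (h t)"] comb[of "Im (g t)" "Im (h t)"] by auto
    then show "(1 - u) *\<^sub>R g t + u *\<^sub>R h t \<noteq> 0"
      by (metis zero_complex.sel(1) zero_complex.sel(2))
    show "?w \<noteq> 0" by fact
  qed
  have per: "e 1 = e 0" "h 1 = h 0" by (simp_all add: e_def h_def)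
  have pe: "continuous_on {0..1} (\<lambda>t. z + r *\<^sub>R e t)" unfolding e_def by (intro continuous_intros)
  have "continuous_on {0..1} (\<lambda>t. \<psi> (z + r *\<^sub>R e t))"
    by (rule continuous_on_compose2[OF cont pe]) (use ball in auto)
  then have "path g"
    unfolding path_def g_def[abs_def] using ne[of 0] by (intro continuous_intros) auto
  moreover have "path h" unfolding path_def h_def by (intro continuous_intros)
  moreover have "closed_segment (g t) (h t) \<subseteq> - {0}" for t
    using seg[of _ t] by (auto simp: closed_segment_def)
  ultimately have "homotopic_loops (- {0}) g h"
    using per by (intro homotopic_loops_linear) (auto simp: pathfinish_def pathstart_def g_def)
  then have "winding_number g 0 = winding_number h 0" by (rule winding_number_homotopic_loops)
  also have "\<dots> = of_int n"
  proof -
    have circ: "circlepath 0 1 = (\<lambda>t. Complex (cos (2 * pi * t)) (sin (2 * pi * t)))"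
      by (rule ext) (simp add: circlepath complex_eq_iff Re_exp Im_exp mult_ac)
    have w1: "winding_number (circlepath 0 1) 0 = 1" by (rule winding_number_circlepath_centre) simp
    from n consider "n = 1" | "n = -1" by linarith
    then show ?thesis
    proof cases
      case 1
      then have "h = circlepath 0 1" by (simp add: h_def circ fun_eq_iff)
      then show ?thesis using w1 1 by simp
    next
      case 2
      then have "h = cnj \<circ> circlepath 0 1" by (simp add: h_def circ fun_eq_iff complex_eq_iff)
      moreover have "0 \<notin> path_image (circlepath 0 1)" by simp
      ultimately show ?thesis
        using winding_number_cnj[of "circlepath 0 1" 0] w1 2 by simp
    qed
  qed
  finally show "winding_number (\<lambda>t. sgn (\<psi> (z + r *\<^sub>R (cos (2 * pi * t), sin (2 * pi * t))))) 0 = of_int n"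
    by (simp add: g_def[abs_def] e_def)
qed

text \<open>The part of the expansion that determines zeros and degrees. Away from the zeros of the
  cosine the sign of the imaginary part is prescribed, near them the sign of its derivative. The two
  cases cover every \<open>y\<close>, since cosine and sine cannot both be below 1 / 2 in absolute
  value.\<close>

definition sign_pattern :: "nat \<Rightarrow> real \<Rightarrow> (plane \<Rightarrow> complex) \<Rightarrow> bool" where
  "sign_pattern k d \<psi> \<longleftrightarrow>
     (\<forall>x y. (x, y) \<in> strip d \<longrightarrow> (0 < x \<longrightarrow> 0 < Re (\<psi> (x, y))) \<and> (x < 0 \<longrightarrow> Re (\<psi> (x, y)) < 0)) \<and>
     (\<forall>y\<in>{0<..<d}.
        (1 / 2 \<le> \<bar>cos (pi * real k / d * y)\<bar> \<longrightarrow> 0 < cos (pi * real k / d * y) * Im (\<psi> (0, y))) \<and>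
        (1 / 2 \<le> \<bar>sin (pi * real k / d * y)\<bar> \<longrightarrow> sin (pi * real k / d * y) * Im (partial (0, 1) \<psi> (0, y)) < 0))"

text \<open>The zeros of cos (pi k y / d) in the strip, which are the midpoints of the
  \<open>k\<close> intervals of length \<open>d / k\<close>.\<close>

definition node :: "nat \<Rightarrow> real \<Rightarrow> nat \<Rightarrow> real" where
  "node k d j = d * (2 * real j + 1) / (2 * real k)"

context
  fixes k :: nat and d :: real and \<psi> :: "plane \<Rightarrow> complex"
  assumes k: "1 \<le> k" and d: "0 < d" and C1: "C1_on (strip d) \<psi>" and pat: "sign_pattern k d \<psi>"
    and zero: "\<And>j. j < k \<Longrightarrow> \<psi> (0, node k d j) = 0"
begin

lemma node_trig:
  "sin (pi * real k / d * (node k d j + s)) = (- 1) ^ j * cos (pi * real k / d * s)"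
  "cos (pi * real k / d * (node k d j + s)) = - ((- 1) ^ j * sin (pi * real k / d * s))"
proof -
  have "pi * real k / d * (node k d j + s) = (pi / 2 + pi * real k / d * s) + real j * pi"
    using k d by (simp add: node_def field_simps)
  then show "sin (pi * real k / d * (node k d j + s)) = (- 1) ^ j * cos (pi * real k / d * s)"
    "cos (pi * real k / d * (node k d j + s)) = - ((- 1) ^ j * sin (pi * real k / d * s))"
    by (simp_all only: sin_add[of "pi / 2 + _"] cos_add[of "pi / 2 + _"] sin_npi cos_npi sin_add[of "pi / 2"] cos_add[of "pi / 2"])
      simp_all
qed

lemma node_in: "j < k \<Longrightarrow> 0 < node k d j \<and> node k d j < d"
proof -
  assume "j < k"
  then have "(2 * real j + 1) / (2 * real k) < 1" by simp
  moreover have "0 < (2 * real j + 1) / (2 * real k)" using k by simp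
  moreover have "node k d j = d * ((2 * real j + 1) / (2 * real k))" by (simp add: node_def)
  ultimately show ?thesis using d by (simp only: mult_pos_pos mult_less_cancel_left2) simp
qed

text \<open>The imaginary part vanishes at the node and its derivative keeps one sign as long as the
  cosine of the phase shift stays above 1 / 2, so the mean value theorem decides the sign.\<close>

lemma sign_near_node:
  assumes j: "j < k" and s: "s \<noteq> 0" "0 < node k d j + s" "node k d j + s < d"
    and c: "\<And>t. \<bar>t\<bar> \<le> \<bar>s\<bar> \<Longrightarrow> 1 / 2 \<le> cos (pi * real k / d * t)"
  shows "(- 1) ^ j * s * Im (\<psi> (0, node k d j + s)) < 0"
proof -
  define f where "f t = (- 1) ^ j * Im (\<psi> (0, node k d j + t))" for t
  define f' where "f' t = (- 1) ^ j * Im (partial (0, 1) \<psi> (0, node k d j + t))" for t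
  have in_s: "0 < node k d j + t \<and> node k d j + t < d" if "min 0 s \<le> t" "t \<le> max 0 s" for t
    using that s node_in[OF j] by (auto simp: min_def max_def split: if_splits)
  have df: "(f has_real_derivative f' t) (at t)" if "min 0 s \<le> t" "t \<le> max 0 s" for t
  proof -
    have "\<psi> differentiable at (0, node k d j + t)"
      by (rule C1_on_differentiable[OF C1]) (use in_s[OF that] in \<open>simp add: mem_strip\<close>)
    from has_vector_derivative_snd[OF this, of UNIV]
    have "((\<lambda>y. Im (\<psi> (0, y))) has_vector_derivative Im (partial (0, 1) \<psi> (0, node k d j + t))) (at (node k d j + t))"
      by (rule bounded_linear.has_vector_derivative[OF bounded_linear_Im])
    then have "((\<lambda>y. Im (\<psi> (0, y))) has_real_derivative Im (partial (0, 1) \<psi> (0, node k d j + t))) (at (t + node k d j))"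
      by (simp add: has_real_derivative_iff_has_vector_derivative add.commute)
    then have "((\<lambda>t. Im (\<psi> (0, t + node k d j))) has_real_derivative Im (partial (0, 1) \<psi> (0, node k d j + t))) (at t)"
      by (simp add: DERIV_shift)
    then show ?thesis
      unfolding f_def f'_def by (intro DERIV_cmult) (simp add: add.commute)
  qed
  have f'neg: "f' t < 0" if "min 0 s \<le> t" "t \<le> max 0 s" for t
  proof -
    have ct: "1 / 2 \<le> cos (pi * real k / d * t)" using that by (intro c) (auto simp: min_def max_def split: if_splits)
    have abs: "\<bar>sin (pi * real k / d * (node k d j + t))\<bar> = cos (pi * real k / d * t)"
      unfolding node_trig using ct by (simp add: abs_mult power_abs)
    have "sin (pi * real k / d * (node k d j + t)) * Im (partial (0, 1) \<psi> (0, node k d j + t)) < 0"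
      using pat in_s[OF that] ct abs unfolding sign_pattern_def by auto
    then have "cos (pi * real k / d * t) * f' t < 0" unfolding node_trig f'_def by (simp add: mult_ac)
    then show ?thesis using ct by (simp add: mult_less_0_iff)
  qed
  have f0: "f 0 = 0" using zero[OF j] by (simp add: f_def)
  have "s * f s < 0"
  proof (cases "0 < s")
    case True
    obtain x where "0 < x" "x < s" "f s - f 0 = (s - 0) * f' x"
      using MVT2[OF True, of f f'] df True by auto
    then show ?thesis using f'neg[of x] True f0 by (simp add: mult_pos_neg zero_less_mult_iff mult_less_0_iff)
  next
    case False
    then have neg: "s < 0" using s by simp
    obtain x where "s < x" "x < 0" "f 0 - f s = (0 - s) * f' x"
      using MVT2[OF neg, of f f'] df neg by auto
    then show ?thesis using f'neg[of x] neg f0 by (simp add: mult_pos_neg zero_less_mult_iff mult_less_0_iff)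
  qed
  then show ?thesis by (simp add: f_def mult_ac)
qed

lemma cos_ge_half:
  assumes "\<bar>t\<bar> \<le> d / (3 * real k)"
  shows "1 / 2 \<le> cos (pi * real k / d * t)"
proof -
  have "pi * real k / d * \<bar>t\<bar> \<le> pi * real k / d * (d / (3 * real k))"
    using assms d by (intro mult_left_mono) auto
  also have "\<dots> = pi / 3" using k d by simp
  finally have "pi * real k / d * \<bar>t\<bar> \<le> pi / 3" .
  then have "cos (pi / 3) \<le> cos (pi * real k / d * \<bar>t\<bar>)"
    using d by (intro cos_monotone_0_pi_le) auto
  moreover have "cos (pi * real k / d * \<bar>t\<bar>) = cos (pi * real k / d * t)"
    by (cases "0 \<le> t") auto
  ultimately show ?thesis by (simp add: cos_60)
qed

lemma zeros_eq: "{p \<in> strip d. \<psi> p = 0} = (\<lambda>j. (0, node k d j)) ` {..<k}"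
proof (intro equalityI subsetI)
  fix p :: plane assume "p \<in> (\<lambda>j. (0, node k d j)) ` {..<k}"
  then show "p \<in> {p \<in> strip d. \<psi> p = 0}" using zero node_in by (auto simp: mem_strip)
next
  fix p :: plane assume "p \<in> {p \<in> strip d. \<psi> p = 0}"
  then obtain x y where p: "p = (x, y)" "(x, y) \<in> strip d" "\<psi> (x, y) = 0" by (cases p) auto
  have "\<not> 0 < x" "\<not> x < 0" using pat p(2,3) unfolding sign_pattern_def by force+
  then have x: "x = 0" by simp
  have y: "0 < y" "y < d" using p(2) by (auto simp: mem_strip)
  \<comment> \<open>Selects the interval of length \<open>d / k\<close> that contains
    \<open>y\<close>, whose midpoint is then at distance at most
    \<open>d / (2 * real k)\<close>.\<close>
  define j where "j = nat \<lfloor>real k * y / d\<rfloor>"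
  have "0 \<le> real k * y / d" "real k * y / d < real k" using y d k by (auto simp: field_simps)
  then have j: "j < k" "real j \<le> real k * y / d" "real k * y / d < real j + 1"
    unfolding j_def by (auto simp: nat_less_iff floor_less_iff)
  define s where "s = y - node k d j"
  have ys: "y = node k d j + s" by (simp add: s_def)
  have s: "\<bar>s\<bar> \<le> d / (2 * real k)"
    using j(2,3) k d by (auto simp: s_def node_def abs_le_iff field_simps)
  have mono: "cos (pi * real k / d * s) \<le> cos (pi * real k / d * t)" if "\<bar>t\<bar> \<le> \<bar>s\<bar>" for t
  proof -
    have "pi * real k / d * \<bar>t\<bar> \<le> pi * real k / d * \<bar>s\<bar>" using that d by (intro mult_left_mono) auto
    moreover have "pi * real k / d * \<bar>s\<bar> \<le> pi * real k / d * (d / (2 * real k))" using s d by (intro mult_left_mono) auto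
    moreover have "pi * real k / d * (d / (2 * real k)) \<le> pi" using k d by simp
    ultimately have "cos (pi * real k / d * \<bar>s\<bar>) \<le> cos (pi * real k / d * \<bar>t\<bar>)"
      using d by (intro cos_monotone_0_pi_le) auto
    moreover have "cos (pi * real k / d * \<bar>r\<bar>) = cos (pi * real k / d * r)" for r
      by (cases "0 \<le> r") auto
    ultimately show ?thesis by simp
  qed
  \<comment> \<open>A zero is excluded by the pattern where the cosine is at least 1 / 2. So the
    phase shift \<open>s\<close> has small sine, hence large cosine, and
    \<open>sign_near_node\<close> leaves only \<open>s = 0\<close>.\<close>
  have "\<bar>cos (pi * real k / d * y)\<bar> < 1 / 2"
    using pat y p(3) x unfolding sign_pattern_def by force
  then have sin_s: "\<bar>sin (pi * real k / d * s)\<bar> < 1 / 2"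
    unfolding ys node_trig by (simp add: abs_mult power_abs)
  have "pi * real k / d * \<bar>s\<bar> \<le> pi * real k / d * (d / (2 * real k))" using s d by (intro mult_left_mono) auto
  also have "\<dots> = pi / 2" using k d by simp
  finally have "\<bar>pi * real k / d * s\<bar> \<le> pi / 2" using d by (simp add: abs_mult)
  then have "- (pi / 2) \<le> pi * real k / d * s" "pi * real k / d * s \<le> pi / 2"
    unfolding abs_le_iff by linarith+
  then have c0: "0 \<le> cos (pi * real k / d * s)" by (rule cos_ge_zero)
  have "(sin (pi * real k / d * s))\<^sup>2 < (1 / 2)\<^sup>2" using sin_s by (metis abs_ge_zero power2_abs power_strict_mono zero_less_numeral)
  then have "(1 / 2)\<^sup>2 \<le> (cos (pi * real k / d * s))\<^sup>2" unfolding cos_squared_eq by (simp add: power2_eq_square)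
  then have "1 / 2 \<le> cos (pi * real k / d * s)" using c0 by (rule power2_le_imp_le)
  then have half: "1 / 2 \<le> cos (pi * real k / d * t)" if "\<bar>t\<bar> \<le> \<bar>s\<bar>" for t using mono[OF that] by simp
  have "s = 0"
  proof (rule ccontr)
    assume "s \<noteq> 0"
    from sign_near_node[OF j(1) this _ _ half] y p(3) show False by (simp add: x flip: ys)
  qed
  then show "p \<in> (\<lambda>j. (0, node k d j)) ` {..<k}" using j(1) by (auto simp: p(1) x ys)
qed

lemma node_local:
  assumes j: "j < k"
  obtains r where "0 < r" "ball (0, node k d j) r \<subseteq> strip d"
    "\<And>s. \<bar>s\<bar> < r \<Longrightarrow> s \<noteq> 0 \<Longrightarrow> (- 1) ^ j * s * Im (\<psi> (0, node k d j + s)) < 0"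
proof -
  have "(0, node k d j) \<in> strip d" using node_in[OF j] by (simp add: mem_strip)
  then obtain r1 where r1: "0 < r1" "ball (0, node k d j) r1 \<subseteq> strip d"
    using open_strip open_contains_ball by blast
  \<comment> \<open>A shift of at most \<open>d / (3 * real k)\<close> changes the phase by at most
    pi / 3, whose cosine is 1 / 2.\<close>
  define r where "r = min r1 (d / (3 * real k))"
  show thesis
  proof (rule that[of r])
    show "0 < r" using r1(1) d k by (simp add: r_def)
    show sub: "ball (0, node k d j) r \<subseteq> strip d" using r1(2) by (auto simp: r_def)
    fix s assume s: "\<bar>s\<bar> < r" "s \<noteq> 0"
    have "(0, node k d j + s) \<in> ball (0, node k d j) r" using s(1) by (simp add: dist_Pair_Pair dist_real_def)
    then have "(0, node k d j + s) \<in> strip d" using sub by blast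
    then show "(- 1) ^ j * s * Im (\<psi> (0, node k d j + s)) < 0"
      using s by (intro sign_near_node[OF j s(2)] cos_ge_half) (auto simp: mem_strip r_def)
  qed
qed

lemma node_vortex:
  assumes j: "j < k"
  shows "vortex \<psi> (0, node k d j)"
proof -
  obtain r where r: "0 < r" "ball (0, node k d j) r \<subseteq> strip d"
    "\<And>s. \<bar>s\<bar> < r \<Longrightarrow> s \<noteq> 0 \<Longrightarrow> (- 1) ^ j * s * Im (\<psi> (0, node k d j + s)) < 0"
    using node_local[OF j] by blast
  have "\<psi> (x, y) \<noteq> 0" if "(x, y) \<noteq> (0, node k d j)" "dist (x, y) (0, node k d j) < r" for x y
  proof (cases "x = 0")
    case True
    have "\<bar>y - node k d j\<bar> < r" using that(2) True by (simp add: dist_Pair_Pair dist_real_def)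
    from r(3)[OF this] show ?thesis using that(1) True by auto
  next
    case False
    have "(x, y) \<in> strip d" using r(2) that(2) by (auto simp: dist_commute)
    then show ?thesis using pat False unfolding sign_pattern_def by (cases "0 < x") force+
  qed
  then have "\<forall>\<^sub>F p in at (0, node k d j). \<psi> p \<noteq> 0"
    unfolding eventually_at using r(1) by (intro exI[of _ r]) auto
  then show ?thesis using zero[OF j] by (simp add: vortex_def)
qed

text \<open>The real part increases through zero with x, while the imaginary part crosses zero in y
  with the sign opposite to \<open>(- 1) ^ j\<close>; hence the exponent
  \<open>j + 1\<close>.\<close>

lemma node_degree:
  assumes j: "j < k"
  shows "has_degree \<psi> (0, node k d j) ((- 1) ^ (j + 1))"
proof -
  obtain r where r: "0 < r" "ball (0, node k d j) r \<subseteq> strip d"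
    "\<And>s. \<bar>s\<bar> < r \<Longrightarrow> s \<noteq> 0 \<Longrightarrow> (- 1) ^ j * s * Im (\<psi> (0, node k d j + s)) < 0"
    using node_local[OF j] by blast
  show ?thesis
  proof (rule has_degree_of_signs[OF r(1)])
    show "\<bar>(- 1) ^ (j + 1) :: int\<bar> = 1" by (simp add: power_abs)
    show "continuous_on (ball (0, node k d j) r) \<psi>"
      by (rule continuous_on_subset[OF C1_on_continuous[OF C1] r(2)])
    fix x y
    show "0 < Re (\<psi> ((0, node k d j) + (x, y)))" if "(0, node k d j) + (x, y) \<in> ball (0, node k d j) r" "0 < x"
      using that r(2) pat unfolding sign_pattern_def by auto
    show "Re (\<psi> ((0, node k d j) + (x, y))) < 0" if "(0, node k d j) + (x, y) \<in> ball (0, node k d j) r" "x < 0"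
      using that r(2) pat unfolding sign_pattern_def by auto
  next
    fix y :: real assume y: "(0 :: real, node k d j) + (0, y) \<in> ball (0, node k d j) r" "y \<noteq> 0"
    have "dist (0 :: real, node k d j) ((0, node k d j) + (0, y)) = \<bar>y\<bar>" by (simp add: dist_norm norm_Pair)
    then have "(- 1) ^ j * y * Im (\<psi> (0, node k d j + y)) < 0"
      using y by (intro r(3)) auto
    then show "0 < real_of_int ((- 1) ^ (j + 1)) * y * Im (\<psi> ((0, node k d j) + (0, y)))" by simp
  qed
qed

lemma vortices_eq: "{p \<in> strip d. vortex \<psi> p} = (\<lambda>j. (0, node k d j)) ` {..<k}"
  using zeros_eq node_vortex by (auto simp: vortex_def)

lemma card_vortices: "card {p \<in> strip d. vortex \<psi> p} = k"
proof -
  have "inj_on (\<lambda>j. (0 :: real, node k d j)) {..<k}"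
    using k d by (auto simp: inj_on_def node_def)
  then show ?thesis unfolding vortices_eq by (simp add: card_image)
qed

end

section \<open>The sign pattern along the branch\<close>

context branch
begin

lemma symmetric:
  assumes "dcrit k < d" "d < dcrit k + l" "(x, y) \<in> strip d"
  shows "\<Psi> d (- x, y) = - cnj (\<Psi> d (x, y))"
  using admissible[OF assms(1,2)] assms(3) unfolding admissible_solution_def X_space_def by blast

lemma eventually_sign_pattern: "\<forall>\<^sub>F d in at_right (dcrit k). sign_pattern k d (\<Psi> d)"
proof -
  obtain C where C: "0 \<le> C" "\<forall>\<^sub>F d in at_right (dcrit k). dcrit k < d \<and> d < dcrit k + l \<and>
    (\<forall>p\<in>strip d. \<bar>Re (\<Psi> d p) - kink (fst p)\<bar> \<le> C * (d - dcrit k)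
      \<and> \<bar>Im (\<Psi> d p) - amp \<Lambda> k d * mode (pi * real k / d) p\<bar> \<le> C * (d - dcrit k)
      \<and> \<bar>Re (partial (1, 0) (\<Psi> d) p) - (1 - (kink (fst p))\<^sup>2) / sqrt 2\<bar> \<le> C * (d - dcrit k)
      \<and> \<bar>Im (partial (1, 0) (\<Psi> d) p) - amp \<Lambda> k d * partial (1, 0) (mode (pi * real k / d)) p\<bar> \<le> C * (d - dcrit k)
      \<and> \<bar>Im (partial (0, 1) (\<Psi> d) p) - amp \<Lambda> k d * partial (0, 1) (mode (pi * real k / d)) p\<bar> \<le> C * (d - dcrit k))"
    by (rule pointwise_expansion)
  have kpos: "0 < kink 1" by (simp add: kink_def)
  have cpos: "0 < (1 - (kink 1)\<^sup>2) / sqrt 2" using chi0_bounds(1)[of 1] by (simp add: kink_chi0)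
  show ?thesis
    using C(2) eventually_dist_small[of "1 / 8" C, simplified] eventually_amp_small[OF kpos] eventually_amp_small[OF cpos]
      eventually_range[OF dcrit_pos[OF k]]
  proof eventually_elim
    case (elim d)
    let ?\<mu> = "pi * real k / d" and ?A = "amp \<Lambda> k d" and ?\<delta> = "C * (d - dcrit k)"
    have d: "dcrit k < d" "d < dcrit k + l" using elim by auto
    have A: "0 < ?A" "?\<delta> < ?A / 8" using elim amp_pos by auto
    have d0: "0 < d" using dcrit_pos[OF k] d by simp
    \<comment> \<open>For \<open>d\<close> below twice the critical width the wave number exceeds 1
      / (2 sqrt 2). The bound keeps the amplitude \<open>?A * ?\<mu>\<close> of the y-derivative
      above \<open>?A / 4\<close>.\<close>
    have \<mu>: "1 / 4 < ?\<mu>"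
    proof -
      have "d < dcrit k + dcrit k" using elim by blast
      also have "\<dots> = 2 * sqrt 2 * pi * real k" by (simp add: dcrit_def)
      also have "\<dots> \<le> 4 * pi * real k"
      proof -
        have "sqrt 2 \<le> 2" by (rule real_le_lsqrt) auto
        then show ?thesis by (intro mult_right_mono) auto
      qed
      finally show ?thesis using d0 by (simp add: field_simps)
    qed
    have E: "\<bar>Re (\<Psi> d p) - kink (fst p)\<bar> \<le> ?\<delta>"
      "\<bar>Im (\<Psi> d p) - ?A * mode ?\<mu> p\<bar> \<le> ?\<delta>"
      "\<bar>Re (partial (1, 0) (\<Psi> d) p) - (1 - (kink (fst p))\<^sup>2) / sqrt 2\<bar> \<le> ?\<delta>"
      "\<bar>Im (partial (0, 1) (\<Psi> d) p) - ?A * partial (0, 1) (mode ?\<mu>) p\<bar> \<le> ?\<delta>" if "p \<in> strip d" for p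
      using elim that by blast+
    \<comment> \<open>For x at least 1 the expansion decides, as \<open>kink\<close> is then at
      least \<open>kink 1\<close>. Closer to the axis \<open>kink\<close> may be smaller than the
      error; there the real part vanishes on x = 0 by symmetry and has positive
      x-derivative.\<close>
    have Re_pos: "0 < Re (\<Psi> d (x, y))" if xy: "(x, y) \<in> strip d" and x: "0 < x" for x y
    proof (cases "1 \<le> x")
      case True
      then have "kink 1 \<le> kink x" by (simp add: kink_def divide_right_mono)
      then show ?thesis using E(1)[OF xy] elim A by auto
    next
      case False
      have S: "(t, y) \<in> strip d" for t using xy by (simp add: mem_strip)
      have C2: "C2_on (strip d) (\<Psi> d)" by (rule admissible_C2[OF admissible[OF d]])
      have D: "((\<lambda>t. Re (\<Psi> d (t, y))) has_real_derivative Re (partial (1, 0) (\<Psi> d) (t, y))) (at t)" for t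
        using bounded_linear.has_vector_derivative[OF bounded_linear_Re
            has_vector_derivative_fst[OF C2_on_differentiable[OF C2 S], where S=UNIV]]
        by (simp add: has_real_derivative_iff_has_vector_derivative)
      obtain z where z: "0 < z" "z < x" "Re (\<Psi> d (x, y)) - Re (\<Psi> d (0, y)) = (x - 0) * Re (partial (1, 0) (\<Psi> d) (z, y))"
        using MVT2[OF x D] by auto
      have "\<Psi> d (0, y) = - cnj (\<Psi> d (0, y))" using symmetric[OF d S, of 0] by simp
      then have R0: "Re (\<Psi> d (0, y)) = 0" by (simp add: complex_eq_iff)
      have "0 \<le> kink z" "kink z \<le> kink 1" using z False by (auto simp: kink_def divide_right_mono)
      then have "(kink z)\<^sup>2 \<le> (kink 1)\<^sup>2" by (intro power_mono)
      then have "(1 - (kink 1)\<^sup>2) / sqrt 2 \<le> (1 - (kink z)\<^sup>2) / sqrt 2" by (intro divide_right_mono) auto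
      then have "0 < Re (partial (1, 0) (\<Psi> d) (z, y))" using E(3)[OF S, of z] elim A by auto
      then show ?thesis using z R0 x by simp
    qed
    show ?case
      unfolding sign_pattern_def
    proof (intro conjI allI impI ballI)
      fix x y assume xy: "(x, y) \<in> strip d"
      show "0 < Re (\<Psi> d (x, y))" if "0 < x" using Re_pos[OF xy that] .
      show "Re (\<Psi> d (x, y)) < 0" if "x < 0"
      proof -
        have S: "(- x, y) \<in> strip d" using xy by (simp add: mem_strip)
        have "\<Psi> d (x, y) = - cnj (\<Psi> d (- x, y))" using symmetric[OF d S] by simp
        then show ?thesis using Re_pos[OF S] that by simp
      qed
    next
      fix y assume y: "y \<in> {0<..<d}"
      then have S: "(0, y) \<in> strip d" by (simp add: mem_strip)
      \<comment> \<open>The leading term \<open>B * t\<close> is at least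
        \<open>?A / 4 * (1 / 2)\<close> in absolute value, which is why the error was made smaller
        than \<open>?A / 8\<close>.\<close>
      have main: "0 < t * w" if "1 / 2 \<le> \<bar>t\<bar>" "\<bar>w - B * t\<bar> \<le> ?\<delta>" "?A / 4 \<le> B" for t w B :: real
      proof -
        have B0: "0 < B" using that(3) A by simp
        have "?A / 4 * (1 / 2) \<le> B * \<bar>t\<bar>" using that A by (intro mult_mono) auto
        then have *: "?\<delta> < B * \<bar>t\<bar>" using A by linarith
        show ?thesis
        proof (cases "0 \<le> t")
          case True
          then have "0 < w" using * that(2) by (auto simp: abs_le_iff)
          then show ?thesis using True that(1) by simp
        next
          case False
          then have "w < 0" using * that(2) by (auto simp: abs_le_iff)
          then show ?thesis using False by (simp add: mult_neg_neg)
        qed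
      qed
      show "0 < cos (?\<mu> * y) * Im (\<Psi> d (0, y))" if "1 / 2 \<le> \<bar>cos (?\<mu> * y)\<bar>"
        using E(2)[OF S] A by (intro main[OF that, of _ ?A]) (auto simp: mode_def chi0_bounds(3))
      have "?A * (1 / 4) \<le> ?A * ?\<mu>" using A \<mu> by (intro mult_left_mono) auto
      then have "0 < sin (?\<mu> * y) * - Im (partial (0, 1) (\<Psi> d) (0, y))" if "1 / 2 \<le> \<bar>sin (?\<mu> * y)\<bar>"
        using E(4)[OF S] by (intro main[OF that, of _ "?A * ?\<mu>"])
          (auto simp: mode_C2(3) chi0_bounds(3) abs_le_iff algebra_simps)
      then show "sin (?\<mu> * y) * Im (partial (0, 1) (\<Psi> d) (0, y)) < 0" if "1 / 2 \<le> \<bar>sin (?\<mu> * y)\<bar>"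
        using that by simp
    qed
  qed
qed

end

subsection \<open>A criterion for admissibility\<close>

lemma exp_decay_integrable:
  assumes a: "0 < a"
  shows "integrable lborel (\<lambda>x :: real. indicator {0..} x * exp (- a * x) + indicator {0..} (- x) * exp (- a * - x))"
proof -
  have "(\<lambda>x. exp (- a * x)) absolutely_integrable_on {0..}"
    using integrable_on_exp_minus_to_infinity[OF a, of 0] by (intro nonnegative_absolutely_integrable_1) auto
  then have "integrable lebesgue (\<lambda>x :: real. indicator {0..} x * exp (- a * x))"
    by (simp add: set_integrable_def)
  then have i: "integrable lborel (\<lambda>x :: real. indicator {0..} x * exp (- a * x))"
    by (subst (asm) integrable_completion) (auto intro!: borel_measurable_times borel_measurable_continuous_onI continuous_intros)
  from lborel_integrable_real_affine[OF i, of "-1" 0]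
  have "integrable lborel (\<lambda>x :: real. indicator {0..} (- x) * exp (- a * - x))" by simp
  with i show ?thesis by (rule Bochner_Integration.integrable_add)
qed

lemma exp_decay_integrable_strip:
  assumes a: "0 < a"
  shows "(\<lambda>p. exp (- a * \<bar>fst p\<bar>)) integrable_on strip d"
proof -
  define h where "h x = indicator {0..} x * exp (- a * x) + indicator {0..} (- x) * exp (- a * - x)" for x :: real
  have hi: "integrable lborel h" unfolding h_def by (rule exp_decay_integrable[OF a])
  have hm: "h \<in> borel_measurable borel" using borel_measurable_integrable[OF hi] by simp
  define G where "G p = h (fst p) * indicator {0<..<d} (snd p)" for p :: plane
  have h0: "0 \<le> h x" for x by (simp add: h_def)
  have "integrable (lborel \<Otimes>\<^sub>M lborel) G"
  proof (rule lborel_pair.Fubini_integrable)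
    show "G \<in> borel_measurable (lborel \<Otimes>\<^sub>M lborel)"
      unfolding G_def using hm by measurable
    have "(\<integral>y. norm (G (x, y)) \<partial>lborel) = h x * measure lborel {0<..<d}" for x
      using h0[of x] by (simp add: G_def abs_mult)
    then show "integrable lborel (\<lambda>x. \<integral>y. norm (G (x, y)) \<partial>lborel)" using hi by simp
    show "AE x in lborel. integrable lborel (\<lambda>y. G (x, y))"
      by (cases "0 \<le> d") (auto simp: G_def)
  qed
  then have "G integrable_on UNIV" unfolding lborel_prod by (rule integrable_on_lborel)
  moreover have "G = (\<lambda>p. if p \<in> strip d then h (fst p) else 0)"
    by (rule ext) (auto simp: G_def mem_strip)
  ultimately have hs: "(\<lambda>p. h (fst p)) integrable_on strip d"
    by (simp only: integrable_restrict_UNIV)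
  have S: "strip d \<in> sets lebesgue" using open_strip[of d] by auto
  have "(\<lambda>p :: plane. exp (- a * \<bar>fst p\<bar>)) \<in> borel_measurable (lebesgue_on (strip d))"
    by (intro continuous_imp_measurable_on_sets_lebesgue S continuous_intros)
  then show ?thesis
    by (rule measurable_bounded_by_integrable_imp_integrable[OF _ hs _ S]) (auto simp: h_def indicator_def)
qed

lemma L2_on_of_decay:
  assumes f: "continuous_on (strip d) f" and \<sigma>: "0 < \<sigma>"
    and K: "\<And>p. p \<in> strip d \<Longrightarrow> exp (\<sigma> * \<bar>fst p\<bar>) * cmod (f p) \<le> K"
  shows "L2_on (strip d) f"
proof -
  have S: "strip d \<in> sets lebesgue" using open_strip[of d] by auto
  have i: "(\<lambda>p. K\<^sup>2 * exp (- (2 * \<sigma>) * \<bar>fst p\<bar>)) integrable_on strip d"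
    using exp_decay_integrable_strip[of "2 * \<sigma>" d] \<sigma> by (intro integrable_on_mult_right) auto
  have "(\<lambda>p. (cmod (f p))\<^sup>2) integrable_on strip d"
  proof (rule measurable_bounded_by_integrable_imp_integrable[OF _ i _ S])
    show "(\<lambda>p. (cmod (f p))\<^sup>2) \<in> borel_measurable (lebesgue_on (strip d))"
      by (intro continuous_imp_measurable_on_sets_lebesgue S continuous_intros f)
    fix p assume p: "p \<in> strip d"
    have "(exp (\<sigma> * \<bar>fst p\<bar>) * cmod (f p))\<^sup>2 \<le> K\<^sup>2"
      using K[OF p] by (intro power_mono) auto
    then have "exp (- (2 * \<sigma>) * \<bar>fst p\<bar>) * (exp (\<sigma> * \<bar>fst p\<bar>) * cmod (f p))\<^sup>2 \<le> exp (- (2 * \<sigma>) * \<bar>fst p\<bar>) * K\<^sup>2"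
      by (intro mult_left_mono) auto
    moreover have "exp (- (2 * \<sigma>) * \<bar>fst p\<bar>) * (exp (\<sigma> * \<bar>fst p\<bar>))\<^sup>2 = 1"
      by (simp add: power2_eq_square algebra_simps flip: exp_add)
    then have "exp (- (2 * \<sigma>) * \<bar>fst p\<bar>) * (exp (\<sigma> * \<bar>fst p\<bar>) * cmod (f p))\<^sup>2 = (cmod (f p))\<^sup>2"
      by (simp only: power_mult_distrib mult.assoc[symmetric] mult_1)
    ultimately have "(cmod (f p))\<^sup>2 \<le> exp (- (2 * \<sigma>) * \<bar>fst p\<bar>) * K\<^sup>2" by (simp only:)
    then show "norm ((cmod (f p))\<^sup>2) \<le> K\<^sup>2 * exp (- (2 * \<sigma>) * \<bar>fst p\<bar>)"
      by (simp only: real_norm_def abs_power2 mult.commute)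
  qed
  then show ?thesis using continuous_imp_measurable_on_sets_lebesgue[OF f S] by (simp add: L2_on_def)
qed

text \<open>The equation gives cmod psi times the defect as the modulus of the Laplacian, so where
  the modulus of psi is at least 1 / 2 the defect inherits the decay of the second
  derivatives.\<close>

lemma GL_defect_le:
  assumes GL: "GL_solution \<Omega> \<psi>" and p: "p \<in> \<Omega>" and half: "1 / 2 \<le> cmod (\<psi> p)"
    and K: "\<And>v w. v \<in> Basis \<Longrightarrow> w \<in> Basis \<Longrightarrow> exp s * cmod (partial w (partial v \<psi>) p) \<le> K"
  shows "exp s * \<bar>1 - (cmod (\<psi> p))\<^sup>2\<bar> \<le> 4 * K"
proof -
  have "laplacian \<psi> p = - (\<psi> p * complex_of_real (1 - (cmod (\<psi> p))\<^sup>2))"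
    using GL p by (simp add: GL_solution_def eq_neg_iff_add_eq_0)
  then have "cmod (laplacian \<psi> p) = cmod (\<psi> p) * \<bar>1 - (cmod (\<psi> p))\<^sup>2\<bar>"
    by (simp add: norm_mult del: of_real_diff of_real_power)
  moreover have "1 / 2 * \<bar>1 - (cmod (\<psi> p))\<^sup>2\<bar> \<le> cmod (\<psi> p) * \<bar>1 - (cmod (\<psi> p))\<^sup>2\<bar>"
    using half by (intro mult_right_mono) auto
  ultimately have "1 / 2 * \<bar>1 - (cmod (\<psi> p))\<^sup>2\<bar> \<le> cmod (laplacian \<psi> p)" by (simp only:)
  moreover have "cmod (laplacian \<psi> p) \<le> cmod (partial (1, 0) (partial (1, 0) \<psi>) p) + cmod (partial (0, 1) (partial (0, 1) \<psi>) p)"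
    unfolding laplacian_def sum_Basis_plane by (rule norm_triangle_ineq)
  ultimately have "1 / 2 * \<bar>1 - (cmod (\<psi> p))\<^sup>2\<bar> \<le> cmod (partial (1, 0) (partial (1, 0) \<psi>) p) + cmod (partial (0, 1) (partial (0, 1) \<psi>) p)"
    by (rule order_trans)
  then have "\<bar>1 - (cmod (\<psi> p))\<^sup>2\<bar> \<le> 2 * (cmod (partial (1, 0) (partial (1, 0) \<psi>) p) + cmod (partial (0, 1) (partial (0, 1) \<psi>) p))"
    by simp
  then have "exp s * \<bar>1 - (cmod (\<psi> p))\<^sup>2\<bar> \<le> exp s * (2 * (cmod (partial (1, 0) (partial (1, 0) \<psi>) p) + cmod (partial (0, 1) (partial (0, 1) \<psi>) p)))"
    by (rule mult_left_mono) simp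
  also have "\<dots> = 2 * (exp s * cmod (partial (1, 0) (partial (1, 0) \<psi>) p)) + 2 * (exp s * cmod (partial (0, 1) (partial (0, 1) \<psi>) p))"
    by (simp add: algebra_simps)
  also have "\<dots> \<le> 4 * K"
    using K[of "(1, 0)" "(1, 0)"] K[of "(0, 1)" "(0, 1)"] by (simp add: Basis_plane)
  finally show ?thesis .
qed

text \<open>The L2 conditions of \<open>X_space\<close> follow from the weighted bounds, because
  exponential decay is square integrable on a strip. The defect is handled by
  \<open>GL_defect_le\<close> far out and by boundedness elsewhere.\<close>

lemma admissibleI:
  assumes \<sigma>: "0 < \<sigma>" and N: "neumann_solution d \<psi>"
    and sym: "\<And>x y. (x, y) \<in> strip d \<Longrightarrow> \<psi> (- x, y) = - cnj (\<psi> (x, y))"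
    and b: "wbound \<sigma> d \<psi> K" and K: "0 \<le> K"
    and far: "\<And>p. p \<in> strip d \<Longrightarrow> X \<le> \<bar>fst p\<bar> \<Longrightarrow> 1 / 2 \<le> cmod (\<psi> p)"
  shows "admissible_solution \<sigma> d \<psi>"
proof -
  have GL: "GL_solution (strip d) \<psi>" using N by (simp add: neumann_solution_def)
  then have C2: "C2_on (strip d) \<psi>" by (simp add: GL_solution_def)
  have "W2inf_norm \<sigma> d \<psi> \<le> ennreal (7 * K)" by (rule W2inf_norm_le_of_wbound[OF C2 b K])
  then have W: "\<psi> \<in> W2inf \<sigma> d" unfolding W2inf_C2_iff[OF C2] by (rule le_less_trans) simp
  have c: "continuous_on (strip d) \<psi>" by (rule C2_on_continuous[OF C2])
  have "L2_on (strip d) (partial v \<psi>)" if v: "v \<in> Basis" for v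
    using b v by (intro L2_on_of_decay[OF C1_on_continuous[OF C2_on_C1_partial[OF C2 v]] \<sigma>, of K]) (simp add: wbound_def)
  then have "\<exists>g. has_weak_partial v (strip d) \<psi> g \<and> L2_on (strip d) g" if "v \<in> Basis" for v
    using has_weak_partial_C1[OF open_strip C2_on_C1[OF C2] that] that by blast
  moreover have "L2_on (strip d) (\<lambda>p. complex_of_real (1 - (cmod (\<psi> p))\<^sup>2))"
  proof (rule L2_on_of_decay[OF _ \<sigma>])
    show "continuous_on (strip d) (\<lambda>p. complex_of_real (1 - (cmod (\<psi> p))\<^sup>2))"
      by (intro continuous_intros c)
    fix p assume p: "p \<in> strip d"
    show "exp (\<sigma> * \<bar>fst p\<bar>) * cmod (complex_of_real (1 - (cmod (\<psi> p))\<^sup>2)) \<le> max (4 * K) (exp (\<sigma> * X) * (1 + K\<^sup>2))"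
    proof (cases "X \<le> \<bar>fst p\<bar>")
      case True
      have "exp (\<sigma> * \<bar>fst p\<bar>) * \<bar>1 - (cmod (\<psi> p))\<^sup>2\<bar> \<le> 4 * K"
        using b p by (intro GL_defect_le[OF GL p far[OF p True]]) (simp add: wbound_def)
      then show ?thesis unfolding norm_of_real by (simp add: le_max_iff_disj)
    next
      case False
      have "(cmod (\<psi> p))\<^sup>2 \<le> K\<^sup>2" using b p by (intro power_mono) (auto simp: wbound_def)
      then have "\<bar>1 - (cmod (\<psi> p))\<^sup>2\<bar> \<le> 1 + K\<^sup>2" using zero_le_power2[of "cmod (\<psi> p)"] by linarith
      moreover have "exp (\<sigma> * \<bar>fst p\<bar>) \<le> exp (\<sigma> * X)" using False \<sigma> by simp
      ultimately have "exp (\<sigma> * \<bar>fst p\<bar>) * \<bar>1 - (cmod (\<psi> p))\<^sup>2\<bar> \<le> exp (\<sigma> * X) * (1 + K\<^sup>2)"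
        by (intro mult_mono) auto
      then show ?thesis unfolding norm_of_real by (simp add: le_max_iff_disj)
    qed
  qed
  ultimately have "\<psi> \<in> X_space d" using sym unfolding X_space_def by blast
  then show ?thesis using W N by (simp add: admissible_solution_def)
qed

lemma admissibleD:
  assumes "admissible_solution \<sigma> d \<psi>"
  obtains K where "0 \<le> K" "wbound \<sigma> d \<psi> K"
proof -
  have C2: "C2_on (strip d) \<psi>" by (rule admissible_C2[OF assms])
  have "W2inf_norm \<sigma> d \<psi> < \<infinity>" using assms W2inf_C2_iff[OF C2] by (simp add: admissible_solution_def)
  then obtain K where K: "0 \<le> K" "W2inf_norm \<sigma> d \<psi> = ennreal K" by (cases "W2inf_norm \<sigma> d \<psi>") auto
  then show thesis using that[OF K(1)] wbound_of_W2inf_norm[OF C2 _ K(1)] by simp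
qed

lemma wbound_cong:
  assumes "\<And>p. p \<in> strip d \<Longrightarrow> f p = g p" "wbound \<sigma> d f c"
  shows "wbound \<sigma> d g c"
proof -
  have 1: "partial v f p = partial v g p" if "p \<in> strip d" for v p
    by (rule partial_cong(1)[OF open_strip that assms(1)])
  have 2: "partial w (partial v f) p = partial w (partial v g) p" if "p \<in> strip d" for v w p
    by (rule partial_cong(1)[OF open_strip that 1])
  show ?thesis using assms(2) unfolding wbound_def by (simp add: assms(1)[symmetric] 1[symmetric] 2[symmetric])
qed

lemma partial_snd_zero_of_even:
  assumes f: "C2_on UNIV f" and even: "\<And>x y. f (x, 2 * b - y) = f (x, y)"
  shows "partial (0, 1) f (x, b) = (0 :: complex)"
proof -
  have "(\<lambda>p. f (diag_map 1 (- 1) (0, 2 * b) p)) = f"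
    using even by (auto simp: diag_map_def fun_eq_iff)
  then have "partial (0, 1) f (x, b) = (- 1) *\<^sub>R partial (0, 1) f (diag_map 1 (- 1) (0, 2 * b) (x, b))"
    using partial_diag_map(2)[of f 1 "- 1" "(0, 2 * b)" "(x, b)"] C2_on_differentiable[OF f UNIV_I] by simp
  then have "partial (0, 1) f (x, b) = - partial (0, 1) f (x, b)" by (simp add: diag_map_def)
  then show ?thesis by simp
qed

lemma neumann_of_plane:
  assumes GL: "GL_solution UNIV f"
    and even: "\<And>x y. f (x, - y) = f (x, y)" "\<And>x y. f (x, 2 * d - y) = f (x, y)"
  shows "neumann_solution d f"
proof -
  have C2: "C2_on UNIV f" using GL by (simp add: GL_solution_def)
  have c1: "continuous_on UNIV (partial v f)" if "v \<in> Basis" for v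
    by (rule C1_on_continuous[OF C2_on_C1_partial[OF C2 that]])
  have c2: "continuous_on UNIV (partial w (partial v f))" if "v \<in> Basis" "w \<in> Basis" for v w
    by (rule C1_on_continuous_partial[OF C2_on_C1_partial[OF C2 that(1)] that(2)])
  have ext: "extends_to_closed_strip d g" if "continuous_on UNIV g" for g :: "plane \<Rightarrow> complex"
    unfolding extends_to_closed_strip_def using continuous_on_subset[OF that subset_UNIV] by blast
  have B: "(0, 1) \<in> (Basis :: plane set)" by (simp add: Basis_plane)
  have "(partial (0, 1) f \<longlongrightarrow> 0) (at (x, b) within strip d)" if "b \<in> {0, d}" for x b
  proof -
    have "partial (0, 1) f (x, b) = 0"
      using that even by (intro partial_snd_zero_of_even[OF C2]) auto
    moreover have "(partial (0, 1) f \<longlongrightarrow> partial (0, 1) f (x, b)) (at (x, b))"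
      using isCont_of_continuous_on_UNIV[OF c1[OF B]] unfolding isCont_def .
    ultimately have "(partial (0, 1) f \<longlongrightarrow> 0) (at (x, b))" by simp
    then show ?thesis by (rule tendsto_within_subset) simp
  qed
  moreover have "GL_solution (strip d) f"
    using GL C2_on_strip by (auto simp: GL_solution_def)
  ultimately show ?thesis
    unfolding neumann_solution_def using ext c1 c2 by blast
qed

subsection \<open>Reflection\<close>

lemma W2inf_norm_reflect:
  fixes f :: "plane \<Rightarrow> complex"
  assumes f: "C2_on UNIV f"
  shows "W2inf_norm \<sigma> d (\<lambda>p. cnj (f (diag_map 1 (- 1) (0, d) p))) = W2inf_norm \<sigma> d f"
proof -
  let ?\<rho> = "diag_map 1 (- 1) (0, d)"
  let ?F = "\<lambda>p. cnj (f (?\<rho> p))"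
  have cnj: "bounded_linear cnj" by (rule bounded_linear_cnj)
  have f\<rho>: "C2_on UNIV (\<lambda>p. f (?\<rho> p))" by (rule C2_on_diag_map[OF open_UNIV f UNIV_I])
  have F: "C2_on UNIV ?F" by (rule C2_on_linear[OF cnj open_UNIV f\<rho>])
  note d0 = C2_on_differentiable[OF f UNIV_I] and d1 = C2_on_differentiable[OF f\<rho> UNIV_I]
  have p1: "cmod (partial v ?F p) = cmod (partial v f (?\<rho> p))" if "v \<in> Basis" for v p
  proof -
    have "v = (1, 0) \<or> v = (0, 1)" using that by (simp add: Basis_plane)
    then show ?thesis
      by (elim disjE) (simp_all add: partial_linear(1)[OF cnj d1] partial_diag_map(1,2)[OF d0])
  qed
  have p2: "cmod (partial w (partial v ?F) p) = cmod (partial w (partial v f) (?\<rho> p))" if "v \<in> Basis" "w \<in> Basis" for v w p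
  proof -
    have "v = (1, 0) \<or> v = (0, 1)" "w = (1, 0) \<or> w = (0, 1)" using that by (simp_all add: Basis_plane)
    then show ?thesis
      unfolding partial2_linear[OF cnj open_UNIV f\<rho> UNIV_I that(1)]
      by (elim disjE) (simp_all add: partial2_diag_map[OF open_UNIV f UNIV_I])
  qed
  have im: "?\<rho> ` strip d = strip d"
  proof -
    have "?\<rho> (?\<rho> p) = p" "p \<in> strip d \<Longrightarrow> ?\<rho> p \<in> strip d" for p by (auto simp: diag_map_def mem_strip)
    then show ?thesis by (metis (no_types, opaque_lifting) image_iff subsetI subset_antisym image_subset_iff)
  qed
  have SUP: "(SUP p\<in>strip d. h (?\<rho> p)) = (SUP p\<in>strip d. h p)" for h :: "plane \<Rightarrow> ennreal"
    by (subst (2) im[symmetric]) (simp add: image_image)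
  have fst\<rho>: "\<bar>fst p\<bar> = \<bar>fst (?\<rho> p)\<bar>" for p by (simp add: diag_map_def)
  show ?thesis
    unfolding W2inf_norm_C2[OF C2_on_strip[OF F]] W2inf_norm_C2[OF C2_on_strip[OF f]]
  proof (intro arg_cong2[where f="(+)"] sum.cong refl)
    show "(SUP p\<in>strip d. ennreal (cmod (?F p))) = (SUP p\<in>strip d. ennreal (cmod (f p)))"
      using SUP[of "\<lambda>p. ennreal (cmod (f p))"] by simp
    show "(SUP p\<in>strip d. ennreal (exp (\<sigma> * \<bar>fst p\<bar>) * cmod (partial v ?F p)))
        = (SUP p\<in>strip d. ennreal (exp (\<sigma> * \<bar>fst p\<bar>) * cmod (partial v f p)))" if "v \<in> Basis" for v
      using SUP[of "\<lambda>p. ennreal (exp (\<sigma> * \<bar>fst p\<bar>) * cmod (partial v f p))"] by (simp only: p1[OF that] fst\<rho>[symmetric])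
    show "(SUP p\<in>strip d. ennreal (exp (\<sigma> * \<bar>fst p\<bar>) * cmod (partial w (partial v ?F) p)))
        = (SUP p\<in>strip d. ennreal (exp (\<sigma> * \<bar>fst p\<bar>) * cmod (partial w (partial v f) p)))" if "v \<in> Basis" "w \<in> Basis" for v w
      using SUP[of "\<lambda>p. ennreal (exp (\<sigma> * \<bar>fst p\<bar>) * cmod (partial w (partial v f) p))"] by (simp only: p2[OF that] fst\<rho>[symmetric])
  qed
qed

lemma W2inf_norm_cong:
  assumes "C2_on (strip d) f" "\<And>p. p \<in> strip d \<Longrightarrow> f p = g p"
  shows "W2inf_norm \<sigma> d f = W2inf_norm \<sigma> d g"
proof -
  have 1: "partial v f p = partial v g p" if "p \<in> strip d" for v p
    by (rule partial_cong(1)[OF open_strip that assms(2)])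
  have 2: "partial w (partial v f) p = partial w (partial v g) p" if "p \<in> strip d" for v w p
    by (rule partial_cong(1)[OF open_strip that 1])
  have g: "C2_on (strip d) g" by (rule C2_on_cong[OF open_strip assms(2,1)])
  show ?thesis
    unfolding W2inf_norm_C2[OF assms(1)] W2inf_norm_C2[OF g] by (simp add: assms(2) 1 2)
qed

lemma wbound_reflect:
  fixes f :: "plane \<Rightarrow> complex"
  assumes f: "C2_on UNIV f" and b: "wbound \<sigma> d f K" and K: "0 \<le> K"
  shows "wbound \<sigma> d (\<lambda>p. cnj (f (diag_map 1 (- 1) (0, d) p))) (7 * K)"
proof (rule wbound_of_W2inf_norm)
  show "C2_on (strip d) (\<lambda>p. cnj (f (diag_map 1 (- 1) (0, d) p)))"
    by (intro C2_on_strip C2_on_linear[OF bounded_linear_cnj open_UNIV] C2_on_diag_map[OF open_UNIV f UNIV_I])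
  show "W2inf_norm \<sigma> d (\<lambda>p. cnj (f (diag_map 1 (- 1) (0, d) p))) \<le> ennreal (7 * K)"
    unfolding W2inf_norm_reflect[OF f] by (rule W2inf_norm_le_of_wbound[OF C2_on_strip[OF f] b K])
qed (use K in simp)

lemma GL_solution_reflect:
  assumes "GL_solution UNIV f" "\<bar>s\<bar> = 1"
  shows "GL_solution UNIV (\<lambda>p. cnj (f (diag_map 1 s c p)))"
proof -
  have f: "C2_on UNIV f" using assms by (simp add: GL_solution_def)
  have f\<rho>: "C2_on UNIV (\<lambda>p. f (diag_map 1 s c p))" by (rule C2_on_diag_map[OF open_UNIV f UNIV_I])
  have "laplacian (\<lambda>p. cnj (f (diag_map 1 s c p))) p = cnj (laplacian f (diag_map 1 s c p))" for p
    unfolding laplacian_linear[OF bounded_linear_cnj open_UNIV f\<rho> UNIV_I]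
    using assms(2) by (simp add: laplacian_diag_map[OF open_UNIV f UNIV_I])
  moreover have "laplacian f q + f q * complex_of_real (1 - (cmod (f q))\<^sup>2) = 0" for q
    using assms(1) unfolding GL_solution_def by blast
  then have "cnj (laplacian f q) + cnj (f q) * complex_of_real (1 - (cmod (f q))\<^sup>2) = 0" for q
    by (metis complex_cnj_add complex_cnj_complex_of_real complex_cnj_mult complex_cnj_zero)
  ultimately show ?thesis
    using C2_on_linear[OF bounded_linear_cnj open_UNIV f\<rho>] by (simp add: GL_solution_def)
qed

context branch
begin

text \<open>The equivalence in \<open>bifurcation_branch\<close> is also read from right to left:
  the kink is admissible, and the branch itself lies in the ball in the norm with weight
  \<open>\<sigma>\<close> for every \<open>d\<close> of the range. This is a uniform weighted bound
  that the expansion does not give.\<close>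

lemma uniqueness:
  "\<exists>r>0. \<forall>d. dcrit k < d \<and> d < dcrit k + l \<longrightarrow>
     admissible_solution \<sigma> d S0 \<and> W2inf_norm \<sigma> d (\<lambda>p. \<Psi> d p - S0 p) < ennreal r \<and>
     (\<forall>\<psi>. admissible_solution \<sigma> d \<psi> \<and> W2inf_norm \<sigma> d (\<lambda>p. \<psi> p - S0 p) < ennreal r \<longrightarrow>
        (\<forall>p\<in>strip d. \<psi> p = S0 p) \<or> (\<forall>p\<in>strip d. \<psi> p = \<Psi> d p) \<or> (\<forall>p\<in>strip d. \<psi> p = cnj (\<Psi> d p)))"
proof -
  obtain r where r: "0 < r" and u: "\<And>d \<psi>. 0 < d \<Longrightarrow> \<bar>d - dcrit k\<bar> < l \<Longrightarrow>
      admissible_solution \<sigma> d \<psi> \<and> W2inf_norm \<sigma> d (\<lambda>p. \<psi> p - S0 p) < ennreal r \<longleftrightarrow>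
           (\<forall>p\<in>strip d. \<psi> p = S0 p) \<or>
           dcrit k < d \<and>
             ((\<forall>p\<in>strip d. \<psi> p = \<Psi> d p) \<or> (\<forall>p\<in>strip d. \<psi> p = cnj (\<Psi> d p)))"
    using B unfolding bifurcation_branch_def by blast
  show ?thesis
  proof (intro exI[of _ r] conjI allI impI r)
    fix d assume "dcrit k < d \<and> d < dcrit k + l"
    then have d: "0 < d" "\<bar>d - dcrit k\<bar> < l" "dcrit k < d" using dcrit_pos[OF k] by auto
    show "admissible_solution \<sigma> d S0" using u[OF d(1,2), of S0] by blast
    show "W2inf_norm \<sigma> d (\<lambda>p. \<Psi> d p - S0 p) < ennreal r" using u[OF d(1,2), of "\<Psi> d"] d(3) by blast
    show "(\<forall>p\<in>strip d. \<psi> p = S0 p) \<or> (\<forall>p\<in>strip d. \<psi> p = \<Psi> d p) \<or> (\<forall>p\<in>strip d. \<psi> p = cnj (\<Psi> d p))"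
      if "admissible_solution \<sigma> d \<psi> \<and> W2inf_norm \<sigma> d (\<lambda>p. \<psi> p - S0 p) < ennreal r" for \<psi>
      using u[OF d(1,2), of \<psi>] that by blast
  qed
qed

lemma C2_branch: "dcrit k < d \<Longrightarrow> d < dcrit k + l \<Longrightarrow> C2_on (strip d) (\<Psi> d)"
  by (rule admissible_C2[OF admissible])

lemma d_pos: "dcrit k < d \<Longrightarrow> 0 < d"
  using dcrit_pos[OF k] by simp

lemma sym_extension:
  assumes "dcrit k < d" "d < dcrit k + l"
  shows "\<exists>\<Upsilon>. C2_on UNIV \<Upsilon> \<and> GL_solution UNIV \<Upsilon> \<and> (\<forall>p\<in>strip d. \<Upsilon> p = \<Psi> d p) \<and>
    (\<forall>x y. \<Upsilon> (x, - y) = \<Upsilon> (x, y)) \<and> (\<forall>x y m. \<Upsilon> (x, y + 2 * d * of_int m) = \<Upsilon> (x, y))"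
proof -
  have "neumann_solution d (\<Psi> d)" using admissible[OF assms] by (simp add: admissible_solution_def)
  with d_pos[OF assms(1)] show ?thesis
  proof (rule neumann_extension)
    fix \<Upsilon> assume Y: "C2_on UNIV \<Upsilon>" "GL_solution UNIV \<Upsilon>" "\<And>p. p \<in> strip d \<Longrightarrow> \<Upsilon> p = \<Psi> d p"
      "\<And>x y. \<Upsilon> (x, - y) = \<Upsilon> (x, y)" "\<And>x y m. \<Upsilon> (x, y + 2 * d * of_int m) = \<Upsilon> (x, y)"
    show ?thesis by (intro exI[of _ \<Upsilon>] conjI allI ballI Y)
  qed
qed

lemma eventually_far:
  obtains X where "0 < X" "\<forall>\<^sub>F d in at_right (dcrit k). \<forall>p\<in>strip d. X \<le> \<bar>fst p\<bar> \<longrightarrow> 1 / 2 \<le> cmod (\<Psi> d p)"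
proof -
  have "\<forall>\<^sub>F y :: real in at_top. 3 / 4 < tanh y"
    using tanh_real_at_top by (rule order_tendstoD) simp
  then obtain Y0 :: real where Y0: "\<And>y. Y0 \<le> y \<Longrightarrow> 3 / 4 < tanh y" unfolding eventually_at_top_linorder by blast
  define X0 where "X0 = Y0 * sqrt 2"
  have X0: "3 / 4 < kink x" if "X0 \<le> x" for x
    unfolding kink_def using that by (intro Y0) (simp add: X0_def pos_le_divide_eq)
  define X where "X = max X0 1"
  have kX: "3 / 4 < \<bar>kink x\<bar>" if "X \<le> \<bar>x\<bar>" for x
  proof -
    have "\<bar>x\<bar> / sqrt 2 = \<bar>x / sqrt 2\<bar>" by simp
    then have "\<bar>kink x\<bar> = kink \<bar>x\<bar>" by (simp only: kink_def tanh_real_abs)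
    then show ?thesis using X0[of "\<bar>x\<bar>"] that by (simp add: X_def)
  qed
  show thesis
  proof (rule that[of X])
    show "0 < X" by (simp add: X_def)
    have q: "0 < (1 / 4 :: real)" by simp
    show "\<forall>\<^sub>F d in at_right (dcrit k). \<forall>p\<in>strip d. X \<le> \<bar>fst p\<bar> \<longrightarrow> 1 / 2 \<le> cmod (\<Psi> d p)"
      using close_to_S0[OF q]
    proof eventually_elim
      case (elim d)
      show ?case
      proof (intro ballI impI)
        fix p assume p: "p \<in> strip d" "X \<le> \<bar>fst p\<bar>"
        have "cmod (\<Psi> d p - S0 p) \<le> 1 / 4" using elim p(1) by (simp add: wbound_def)
        moreover have "3 / 4 < cmod (S0 p)" using kX[OF p(2)] by (simp add: S0_eq)
        moreover have "cmod (S0 p) \<le> cmod (\<Psi> d p) + cmod (\<Psi> d p - S0 p)" by norm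
        ultimately show "1 / 2 \<le> cmod (\<Psi> d p)" by linarith
      qed
    qed
  qed
qed

text \<open>Reflection fixes \<open>S0\<close> and preserves the weighted norm, so it maps the ball
  to itself. It is carried out on the extension to the plane, where regularity up to the boundary
  and the Neumann condition come from the symmetries.\<close>

lemma eventually_reflection_cases:
  "\<forall>\<^sub>F d in at_right (dcrit k).
     (\<forall>p\<in>strip d. reflection d (\<Psi> d) p = S0 p) \<or> (\<forall>p\<in>strip d. reflection d (\<Psi> d) p = \<Psi> d p)
     \<or> (\<forall>p\<in>strip d. reflection d (\<Psi> d) p = cnj (\<Psi> d p))"
proof -
  obtain r where r: "0 < r" and u: "\<forall>d. dcrit k < d \<and> d < dcrit k + l \<longrightarrow>
     admissible_solution \<sigma> d S0 \<and> W2inf_norm \<sigma> d (\<lambda>p. \<Psi> d p - S0 p) < ennreal r \<and>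
     (\<forall>\<psi>. admissible_solution \<sigma> d \<psi> \<and> W2inf_norm \<sigma> d (\<lambda>p. \<psi> p - S0 p) < ennreal r \<longrightarrow>
        (\<forall>p\<in>strip d. \<psi> p = S0 p) \<or> (\<forall>p\<in>strip d. \<psi> p = \<Psi> d p) \<or> (\<forall>p\<in>strip d. \<psi> p = cnj (\<Psi> d p)))"
    using uniqueness by blast
  obtain X where X: "0 < X" "\<forall>\<^sub>F d in at_right (dcrit k). \<forall>p\<in>strip d. X \<le> \<bar>fst p\<bar> \<longrightarrow> 1 / 2 \<le> cmod (\<Psi> d p)"
    by (rule eventually_far)
  show ?thesis
    using X(2) eventually_range[OF l_pos]
  proof eventually_elim
    case (elim d)
    then have d: "dcrit k < d" "d < dcrit k + l" by auto
    obtain \<Upsilon> where Y: "C2_on UNIV \<Upsilon>" "GL_solution UNIV \<Upsilon>" "\<And>p. p \<in> strip d \<Longrightarrow> \<Upsilon> p = \<Psi> d p"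
      "\<And>x y. \<Upsilon> (x, - y) = \<Upsilon> (x, y)" "\<And>x y m. \<Upsilon> (x, y + 2 * d * of_int m) = \<Upsilon> (x, y)"
      using sym_extension[OF d] by blast
    define \<zeta> where "\<zeta> p = cnj (\<Upsilon> (diag_map 1 (- 1) (0, d) p))" for p
    have \<rho>: "diag_map 1 (- 1) (0, d) p \<in> strip d" if "p \<in> strip d" for p
      using that by (simp add: diag_map_def mem_strip)
    have \<zeta>: "\<zeta> (x, y) = cnj (\<Upsilon> (x, d - y))" for x y by (simp add: \<zeta>_def diag_map_def)
    have R: "reflection d (\<Psi> d) p = \<zeta> p" if "p \<in> strip d" for p
      using that Y(3)[of "(fst p, d - snd p)"] by (cases p) (simp add: reflection_def \<zeta> mem_strip)
    have neumann: "neumann_solution d \<zeta>"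
    proof (rule neumann_of_plane)
      show "GL_solution UNIV \<zeta>" unfolding \<zeta>_def[abs_def] by (rule GL_solution_reflect[OF Y(2)]) simp
      show "\<zeta> (x, - y) = \<zeta> (x, y)" for x y
        using Y(5)[of x "y - d" 1] Y(4)[of x "d - y"] unfolding \<zeta> by (simp add: algebra_simps)
      show "\<zeta> (x, 2 * d - y) = \<zeta> (x, y)" for x y
        using Y(4)[of x "d - y"] unfolding \<zeta> by (simp add: algebra_simps)
    qed
    obtain K where K: "0 \<le> K" "wbound \<sigma> d (\<Psi> d) K" using admissibleD[OF admissible[OF d]] by blast
    have "wbound \<sigma> d \<Upsilon> K" by (rule wbound_cong[OF _ K(2)]) (simp add: Y(3))
    then have wb: "wbound \<sigma> d \<zeta> (7 * K)" unfolding \<zeta>_def[abs_def] by (rule wbound_reflect[OF Y(1) _ K(1)])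
    have "admissible_solution \<sigma> d \<zeta>"
    proof (rule admissibleI[OF \<sigma>_pos neumann _ wb])
      show "\<zeta> (- x, y) = - cnj (\<zeta> (x, y))" if "(x, y) \<in> strip d" for x y
        using symmetric[OF d, of x "d - y"] Y(3)[of "(x, d - y)"] Y(3)[of "(- x, d - y)"] that
        by (simp add: \<zeta> mem_strip)
      show "1 / 2 \<le> cmod (\<zeta> p)" if "p \<in> strip d" "X \<le> \<bar>fst p\<bar>" for p
        using elim that \<rho>[OF that(1)] Y(3)[OF \<rho>[OF that(1)]] by (simp add: \<zeta>_def diag_map_def)
    qed (use K in simp)
    moreover have "W2inf_norm \<sigma> d (\<lambda>p. \<zeta> p - S0 p) < ennreal r"
    proof -
      have c: "C2_on UNIV (\<lambda>p. \<Upsilon> p - S0 p)" by (rule C2_on_diff[OF open_UNIV Y(1) S0_C2(1)])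
      have "(\<lambda>p. \<zeta> p - S0 p) = (\<lambda>p. cnj ((\<lambda>p. \<Upsilon> p - S0 p) (diag_map 1 (- 1) (0, d) p)))"
        by (rule ext) (simp add: \<zeta>_def S0_eq diag_map_def)
      then have "W2inf_norm \<sigma> d (\<lambda>p. \<zeta> p - S0 p) = W2inf_norm \<sigma> d (\<lambda>p. \<Upsilon> p - S0 p)"
        using W2inf_norm_reflect[OF c, of \<sigma> d] by simp
      also have "\<dots> = W2inf_norm \<sigma> d (\<lambda>p. \<Psi> d p - S0 p)"
        by (rule W2inf_norm_cong[OF C2_on_strip[OF c]]) (simp add: Y(3))
      finally show ?thesis using u d by simp
    qed
    ultimately have "(\<forall>p\<in>strip d. \<zeta> p = S0 p) \<or> (\<forall>p\<in>strip d. \<zeta> p = \<Psi> d p) \<or> (\<forall>p\<in>strip d. \<zeta> p = cnj (\<Psi> d p))"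
      using u d by blast
    then show ?case using R by simp
  qed
qed

end

lemma sign_pattern_cos:
  assumes "sign_pattern k d \<psi>" "0 < y" "y < d" "1 / 2 \<le> \<bar>cos (pi * real k / d * y)\<bar>"
  shows "0 < cos (pi * real k / d * y) * Im (\<psi> (0, y))"
  using assms unfolding sign_pattern_def by simp

text \<open>For k = 1 the leading mode is antisymmetric about the middle line and conjugation undoes
  the sign. The signs of the imaginary part at heights \<open>d / 4\<close> and
  \<open>3 * d / 4\<close> exclude the kink and the conjugate branch.\<close>

lemma (in branch) eventually_reflection_invariant:
  assumes k1: "k = 1"
  shows "\<forall>\<^sub>F d in at_right (dcrit k). \<forall>p\<in>strip d. reflection d (\<Psi> d) p = \<Psi> d p"
  using eventually_reflection_cases eventually_sign_pattern eventually_range[OF l_pos]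
proof eventually_elim
  case (elim d)
  have d: "0 < d" using elim d_pos by blast
  have S: "(0, d / 4) \<in> strip d" "(0, 3 * d / 4) \<in> strip d" using d by (auto simp: mem_strip)
  have c: "cos (pi * real k / d * (d / 4)) = sqrt 2 / 2" "cos (pi * real k / d * (3 * d / 4)) = - (sqrt 2 / 2)"
  proof -
    have e: "pi * real k / d * (d / 4) = pi / 4" "pi * real k / d * (3 * d / 4) = pi - pi / 4"
      using d k1 by (simp_all add: field_simps)
    show "cos (pi * real k / d * (d / 4)) = sqrt 2 / 2" "cos (pi * real k / d * (3 * d / 4)) = - (sqrt 2 / 2)"
      unfolding e cos_pi_minus cos_45 by simp_all
  qed
  have h: "1 / 2 \<le> sqrt 2 / 2" by simp
  have pat: "sign_pattern k d (\<Psi> d)" using elim by blast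
  have "0 < cos (pi * real k / d * (d / 4)) * Im (\<Psi> d (0, d / 4))"
    "0 < cos (pi * real k / d * (3 * d / 4)) * Im (\<Psi> d (0, 3 * d / 4))"
    by (rule sign_pattern_cos[OF pat]; use d h in \<open>simp only: c; simp\<close>)+
  then have I: "0 < Im (\<Psi> d (0, d / 4))" "Im (\<Psi> d (0, 3 * d / 4)) < 0"
    unfolding c by (auto simp: zero_less_mult_iff mult_less_0_iff)
  have r: "reflection d (\<Psi> d) (0, d / 4) = cnj (\<Psi> d (0, 3 * d / 4))"
    by (simp add: reflection_def)
  have "\<not> (\<forall>p\<in>strip d. reflection d (\<Psi> d) p = S0 p)"
  proof
    assume "\<forall>p\<in>strip d. reflection d (\<Psi> d) p = S0 p"
    then have "Im (reflection d (\<Psi> d) (0, d / 4)) = 0" using S by (simp add: S0_eq)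
    then show False using I by (simp add: r)
  qed
  moreover have "\<not> (\<forall>p\<in>strip d. reflection d (\<Psi> d) p = cnj (\<Psi> d p))"
  proof
    assume "\<forall>p\<in>strip d. reflection d (\<Psi> d) p = cnj (\<Psi> d p)"
    then have "reflection d (\<Psi> d) (0, d / 4) = cnj (\<Psi> d (0, d / 4))" using S by blast
    then have "cnj (\<Psi> d (0, 3 * d / 4)) = cnj (\<Psi> d (0, d / 4))" by (simp only: r)
    then have "\<Psi> d (0, 3 * d / 4) = \<Psi> d (0, d / 4)" by (simp only: complex_cnj_cancel_iff)
    then show False using I by simp
  qed
  ultimately show ?case using elim by blast
qed

subsection \<open>The weight is below the decay rate of the mode\<close>

lemma exp_decay_increment:
  fixes f :: "real \<Rightarrow> 'a::real_normed_vector"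
  assumes a: "0 < a" and f: "\<And>x. x0 \<le> x \<Longrightarrow> (f has_vector_derivative f' x) (at x)"
    and K: "\<And>x. x0 \<le> x \<Longrightarrow> norm (f' x) \<le> K * exp (- a * x)" and xy: "x0 \<le> x" "x \<le> y"
  shows "norm (f y - f x) \<le> K / a * exp (- a * x) - K / a * exp (- a * y)"
proof (cases "x = y")
  case False
  then have "x < y" using xy by simp
  then have "norm (f y - f x) \<le> - (K / a) * exp (- a * y) - - (K / a) * exp (- a * x)"
  proof (rule differentiable_bound_general)
    show "continuous_on {x..y} f"
    proof (rule continuous_at_imp_continuous_on, rule ballI)
      fix z assume "z \<in> {x..y}"
      then have "x0 \<le> z" using xy by simp
      then show "isCont f z" by (rule has_vector_derivative_continuous[OF f])
    qed
    show "continuous_on {x..y} (\<lambda>x. - (K / a) * exp (- a * x))" by (intro continuous_intros)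
    show "(f has_vector_derivative f' z) (at z)" if "x < z" for z using f xy that by simp
    show "norm (f' z) \<le> K * exp (- a * z)" if "x < z" for z using K xy that by simp
    have "((\<lambda>x. - (K / a) * exp (- a * x)) has_real_derivative - (K / a) * (exp (- a * z) * - a)) (at z)" for z
      by (auto intro!: derivative_eq_intros)
    then show "((\<lambda>x. - (K / a) * exp (- a * x)) has_vector_derivative K * exp (- a * z)) (at z)" for z
      using a by (simp add: has_real_derivative_iff_has_vector_derivative)
  qed
  then show ?thesis by simp
qed simp

lemma exp_neg_tendsto_0:
  assumes "0 < (a::real)"
  shows "((\<lambda>x. exp (- a * x)) \<longlongrightarrow> 0) at_top"
proof (rule filterlim_compose[OF exp_at_bot])
  have "filterlim (\<lambda>x. a * x) at_top at_top"
    using assms by (intro filterlim_tendsto_pos_mult_at_top[OF tendsto_const] filterlim_ident)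
  then show "filterlim (\<lambda>x. - a * x) at_bot at_top" by (simp add: filterlim_uminus_at_top)
qed

lemma exp_decay_limit:
  fixes f :: "real \<Rightarrow> complex"
  assumes a: "0 < a" and f: "\<And>x. (f has_vector_derivative f' x) (at x)"
    and K: "\<And>x. 0 \<le> x \<Longrightarrow> norm (f' x) \<le> K * exp (- a * x)"
  shows "\<exists>L. \<forall>x\<ge>0. norm (f x - L) \<le> K / a * exp (- a * x)"
proof -
  have K0: "0 \<le> K" using order_trans[OF norm_ge_zero K[of 0]] by simp
  have inc: "norm (f y - f x) \<le> K / a * exp (- a * x)" if "0 \<le> x" "x \<le> y" for x y
  proof -
    have "0 \<le> K / a * exp (- a * y)" using K0 a by simp
    then show ?thesis using exp_decay_increment[OF a f K that] by linarith
  qed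
  have "((\<lambda>x. K / a * exp (- a * x)) \<longlongrightarrow> K / a * 0) at_top"
    by (intro tendsto_intros exp_neg_tendsto_0[OF a])
  then have l0: "(\<lambda>n. K / a * exp (- a * real n)) \<longlonglongrightarrow> 0"
    using filterlim_compose[OF _ filterlim_real_sequentially] by fastforce
  have "Cauchy (\<lambda>n. f (real n))"
  proof (rule metric_CauchyI)
    fix e :: real assume e: "0 < e"
    have "\<forall>\<^sub>F n in sequentially. K / a * exp (- a * real n) < e / 2"
      using e by (intro order_tendstoD(2)[OF l0]) simp
    then obtain N where N: "K / a * exp (- a * real N) < e / 2" unfolding eventually_sequentially by blast
    have near: "dist (f (real n)) (f (real N)) < e / 2" if "n \<ge> N" for n
    proof -
      have "norm (f (real n) - f (real N)) \<le> K / a * exp (- a * real N)" using that by (intro inc) auto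
      then show ?thesis using N unfolding dist_norm by (rule le_less_trans)
    qed
    have "dist (f (real m)) (f (real n)) < e" if "m \<ge> N" "n \<ge> N" for m n
      using near[OF that(1)] near[OF that(2)] by (rule dist_triangle_half_l)
    then show "\<exists>M. \<forall>m\<ge>M. \<forall>n\<ge>M. dist (f (real m)) (f (real n)) < e" by blast
  qed
  then obtain L where L: "(\<lambda>n. f (real n)) \<longlonglongrightarrow> L" using Cauchy_convergent_iff convergent_def by blast
  have "norm (f x - L) \<le> K / a * exp (- a * x)" if "0 \<le> x" for x
  proof -
    have "(\<lambda>n. norm (f (real n) - f x)) \<longlonglongrightarrow> norm (L - f x)"
      by (intro tendsto_intros L)
    moreover have "\<forall>\<^sub>F n in sequentially. norm (f (real n) - f x) \<le> K / a * exp (- a * x)"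
    proof (rule eventually_mono[OF eventually_ge_at_top[of "nat \<lceil>x\<rceil>"]])
      fix n assume "nat \<lceil>x\<rceil> \<le> n"
      then have "x \<le> real n" by linarith
      then show "norm (f (real n) - f x) \<le> K / a * exp (- a * x)" by (rule inc[OF that])
    qed
    ultimately have "norm (L - f x) \<le> K / a * exp (- a * x)" by (rule tendsto_upperbound) simp
    then show ?thesis by (simp add: norm_minus_commute)
  qed
  then show ?thesis by blast
qed

lemma kink_ge: "0 \<le> x \<Longrightarrow> 1 - kink x \<le> 2 * exp (- x / sqrt 2)" "0 \<le> x \<Longrightarrow> kink x \<le> 1"
proof -
  assume x: "0 \<le> x"
  have k: "0 \<le> kink x" "kink x \<le> 1" using x kink_bounds[of x] by (auto simp: kink_def)
  then show "kink x \<le> 1" by simp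
  have "(1 - kink x) * 1 \<le> (1 - kink x) * (1 + kink x)" using k by (intro mult_left_mono) auto
  also have "\<dots> = 1 - (kink x)\<^sup>2" by (simp add: power2_eq_square algebra_simps)
  also have "\<dots> = (chi0 x)\<^sup>2" by (rule kink_chi0)
  also have "\<dots> \<le> chi0 x * 1" unfolding power2_eq_square using chi0_bounds(1,2)[of x] by (intro mult_left_mono) auto
  finally show "1 - kink x \<le> 2 * exp (- x / sqrt 2)" using chi0_bounds(4)[of x] x by simp
qed

lemma integral_cos_sq:
  fixes d \<mu> :: real
  assumes "0 < d" "sin (\<mu> * d) = 0" "0 < \<mu>"
  shows "((\<lambda>y. cos (\<mu> * y) * cos (\<mu> * y)) has_integral d / 2) {0..d}"
proof -
  have "((\<lambda>y. cos (\<mu> * y) * cos (\<mu> * y)) has_integral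
      (d / 2 + sin (\<mu> * d) * cos (\<mu> * d) / (2 * \<mu>)) - (0 / 2 + sin (\<mu> * 0) * cos (\<mu> * 0) / (2 * \<mu>))) {0..d}"
  proof (rule fundamental_theorem_of_calculus)
    fix y
    have "((\<lambda>y. y / 2 + sin (\<mu> * y) * cos (\<mu> * y) / (2 * \<mu>)) has_real_derivative
        1 / 2 + (cos (\<mu> * y) * \<mu> * cos (\<mu> * y) + - sin (\<mu> * y) * \<mu> * sin (\<mu> * y)) / (2 * \<mu>)) (at y within {0..d})"
      using assms(3) by (auto intro!: derivative_eq_intros simp: divide_simps algebra_simps)
    moreover have "1 / 2 + (cos (\<mu> * y) * \<mu> * cos (\<mu> * y) + - sin (\<mu> * y) * \<mu> * sin (\<mu> * y)) / (2 * \<mu>)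
        = (1 + (cos (\<mu> * y))\<^sup>2 - (sin (\<mu> * y))\<^sup>2) / 2"
      using assms(3) by (simp add: field_simps power2_eq_square)
    moreover have "\<dots> = cos (\<mu> * y) * cos (\<mu> * y)"
      unfolding sin_squared_eq by (simp add: power2_eq_square)
    ultimately show "((\<lambda>y. y / 2 + sin (\<mu> * y) * cos (\<mu> * y) / (2 * \<mu>)) has_vector_derivative cos (\<mu> * y) * cos (\<mu> * y)) (at y within {0..d})"
      by (simp add: has_real_derivative_iff_has_vector_derivative)
  qed (use assms in simp)
  then show ?thesis using assms(2) by simp
qed

text \<open>If \<open>\<Upsilon>\<close> decays at the rate \<open>1 / \<surd>2 > \<mu>\<close>, the Fourier coefficient \<open>s\<close> below satisfies
  \<open>s' + \<mu> s = - F\<close> with \<open>F\<close> quadratically small, so that \<open>e\<^bsup>\<mu>x\<^esup> s(x)\<close>, which vanishes at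
  infinity, is too small for the expansion \<open>s(x) \<approx> - A \<mu> e\<^bsup>-x/\<surd>2\<^esup> d / 2\<close>. Multiplying by the
  conjugate of the limit \<open>L\<close> at infinity makes the imaginary part decay.\<close>

lemma mode_decay_estimate:
  fixes \<Upsilon> :: "plane \<Rightarrow> complex" and a :: real
  defines "a \<equiv> 1 / sqrt 2"
  assumes GL: "GL_solution UNIV \<Upsilon>"
    and even: "\<And>x y. \<Upsilon> (x, - y) = \<Upsilon> (x, y)" "\<And>x y. \<Upsilon> (x, 2 * d - y) = \<Upsilon> (x, y)"
    and d: "0 < d" and \<mu>: "0 < \<mu>" "\<mu> < a" "sin (\<mu> * d) = 0"
    and K1: "\<And>p v. p \<in> closed_strip d \<Longrightarrow> v \<in> Basis \<Longrightarrow> exp (a * \<bar>fst p\<bar>) * cmod (partial v \<Upsilon> p) \<le> K"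
    and K2: "\<And>p v w. p \<in> closed_strip d \<Longrightarrow> v \<in> Basis \<Longrightarrow> w \<in> Basis \<Longrightarrow>
      exp (a * \<bar>fst p\<bar>) * cmod (partial w (partial v \<Upsilon>) p) \<le> K"
    and K0: "\<And>p. p \<in> closed_strip d \<Longrightarrow> cmod (\<Upsilon> p) \<le> K"
    and far: "\<And>p. p \<in> closed_strip d \<Longrightarrow> X \<le> fst p \<Longrightarrow> 1 / 2 \<le> cmod (\<Upsilon> p)"
    and ex: "\<And>p. p \<in> closed_strip d \<Longrightarrow> \<bar>Re (\<Upsilon> p) - kink (fst p)\<bar> \<le> \<eta>"
      "\<And>p. p \<in> closed_strip d \<Longrightarrow> \<bar>Im (\<Upsilon> p) - A * mode \<mu> p\<bar> \<le> \<eta>"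
      "\<And>p. p \<in> closed_strip d \<Longrightarrow> \<bar>Im (partial (1, 0) \<Upsilon> p) - A * partial (1, 0) (mode \<mu>) p\<bar> \<le> \<eta>"
    and A: "0 < A" and \<eta>: "0 \<le> \<eta>" "\<eta> \<le> 1" and X: "0 \<le> X" "X \<le> x0"
  shows "exp (\<mu> * x0) * (A * \<mu> * exp (- a * x0) / 2 - (4 + 4 * K) * \<eta>)
    \<le> 4 * K * (2 * A / a * exp (- a * x0) + 2 / a * sqrt (3 * (4 + 4 * K) * (K / a + d * K) * \<eta>) * exp (- (a / 2) * x0))"
proof -
  define N where "N = 4 + 4 * K"
  define M where "M = K / a + d * K"
  have a0: "0 < a" "a \<le> 1" by (simp_all add: a_def)
  have \<mu>1: "\<mu> \<le> 1" using \<mu> a0 by simp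
  have Kn: "0 \<le> K" using order_trans[OF norm_ge_zero K0[of "(0, 0)"]] d by (simp add: mem_closed_strip)
  have Mn: "0 \<le> M" "0 \<le> N" using Kn a0 d by (simp_all add: M_def N_def)
  have B: "(1, 0) \<in> (Basis :: plane set)" "(0, 1) \<in> (Basis :: plane set)" by (auto simp: Basis_plane)
  have C2: "C2_on UNIV \<Upsilon>" using GL by (simp add: GL_solution_def)
  note dY = C2_on_differentiable[OF C2 UNIV_I]
  have CS: "(x, y) \<in> closed_strip d" if "y \<in> {0..d}" for x y using that by (simp add: mem_closed_strip)
  have exp_div: "r \<le> t * exp (- a * x)" if "exp (a * \<bar>x\<bar>) * r \<le> t" "0 \<le> x" for r t x :: real
  proof -
    have "exp (- a * x) * (exp (a * x) * r) \<le> exp (- a * x) * t" using that by (intro mult_left_mono) auto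
    moreover have "exp (- a * x) * (exp (a * x) * r) = exp (- a * x + a * x) * r" by (simp only: exp_add mult.assoc)
    moreover have "exp (- a * x + a * x) = 1" by simp
    ultimately show ?thesis by (simp only: mult_1 mult.commute[of t])
  qed
  have k1: "cmod (partial v \<Upsilon> (x, y)) \<le> K * exp (- a * x)" if "v \<in> Basis" "y \<in> {0..d}" "0 \<le> x" for v x y
    by (rule exp_div[OF _ that(3)]) (use K1[OF CS[OF that(2)] that(1), of x] in simp)
  obtain L where L: "\<And>x. 0 \<le> x \<Longrightarrow> cmod (\<Upsilon> (x, d / 2) - L) \<le> K / a * exp (- a * x)"
  proof -
    have "d / 2 \<in> {0..d}" using d by simp
    then have "\<exists>L. \<forall>x\<ge>0. cmod (\<Upsilon> (x, d / 2) - L) \<le> K / a * exp (- a * x)"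
      by (rule exp_decay_limit[OF a0(1) has_vector_derivative_fst[OF dY] k1[OF B(1)]])
    then show thesis using that by blast
  qed
  have LM: "cmod (\<Upsilon> (x, y) - L) \<le> M * exp (- a * x)" if x: "0 \<le> x" and y: "y \<in> {0..d}" for x y
  proof -
    have "norm (\<Upsilon> (x, y) - \<Upsilon> (x, d / 2)) \<le> (K * exp (- a * x)) * norm (y - d / 2)"
    proof (rule differentiable_bound[of "{0..d}"])
      show "((\<lambda>y. \<Upsilon> (x, y)) has_derivative (\<lambda>h. h *\<^sub>R partial (0, 1) \<Upsilon> (x, z))) (at z within {0..d})" for z
        using has_vector_derivative_snd[OF dY] by (simp add: has_vector_derivative_def)
      show "onorm (\<lambda>h. h *\<^sub>R partial (0, 1) \<Upsilon> (x, z)) \<le> K * exp (- a * x)" if "z \<in> {0..d}" for z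
        using k1[OF B(2) that x] by (simp add: onorm_scaleR_left[OF bounded_linear_ident] onorm_id)
    qed (use y d in auto)
    also have "\<dots> \<le> (K * exp (- a * x)) * d" using y Kn by (intro mult_left_mono) auto
    finally have 1: "cmod (\<Upsilon> (x, y) - \<Upsilon> (x, d / 2)) \<le> d * K * exp (- a * x)" by (simp add: mult_ac)
    have "cmod (\<Upsilon> (x, y) - L) \<le> cmod (\<Upsilon> (x, y) - \<Upsilon> (x, d / 2)) + cmod (\<Upsilon> (x, d / 2) - L)" by norm
    with 1 L[OF x] show ?thesis by (simp add: M_def distrib_right)
  qed
  \<comment> \<open>The error \<open>\<eta>\<close> does not decay, so the limit x to infinity
    leaves \<open>\<eta>\<close> from the real part and \<open>\<eta>\<close> from the imaginary
    part.\<close>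
  have L1: "cmod (L - 1) \<le> 2 * \<eta>"
  proof -
    have "cmod (L - 1) \<le> 2 * \<eta> + (K / a + 2 + 2 * A) * exp (- a * x)" if x: "0 \<le> x" for x
    proof -
      have p: "(x, d / 2) \<in> closed_strip d" using d by (simp add: mem_closed_strip)
      have e: "exp (- \<bar>x\<bar> / sqrt 2) = exp (- a * x)" "exp (- x / sqrt 2) = exp (- a * x)" using x by (simp_all add: a_def)
      have "\<bar>Re (\<Upsilon> (x, d / 2)) - 1\<bar> \<le> \<eta> + 2 * exp (- a * x)"
        using ex(1)[OF p] kink_ge[OF x] e by simp
      moreover have "\<bar>mode \<mu> (x, d / 2)\<bar> \<le> 2 * exp (- a * x) * 1"
        unfolding mode_def abs_mult using chi0_bounds(1,4)[of x] e by (intro mult_mono) auto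
      then have "A * \<bar>mode \<mu> (x, d / 2)\<bar> \<le> 2 * A * exp (- a * x)"
        using mult_left_mono[of "\<bar>mode \<mu> (x, d / 2)\<bar>" "2 * exp (- a * x)" A] A by simp
      then have "\<bar>A * mode \<mu> (x, d / 2)\<bar> \<le> 2 * A * exp (- a * x)" using A by (simp add: abs_mult)
      then have "\<bar>Im (\<Upsilon> (x, d / 2))\<bar> \<le> \<eta> + 2 * A * exp (- a * x)" using ex(2)[OF p] by linarith
      ultimately have "cmod (\<Upsilon> (x, d / 2) - 1) \<le> 2 * \<eta> + (2 + 2 * A) * exp (- a * x)"
        using cmod_le[of "\<Upsilon> (x, d / 2) - 1"] by (simp add: algebra_simps)
      moreover have "cmod (L - 1) \<le> cmod (\<Upsilon> (x, d / 2) - L) + cmod (\<Upsilon> (x, d / 2) - 1)" by norm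
      ultimately show ?thesis using L[OF x] by (simp add: algebra_simps)
    qed
    then have ev: "\<forall>\<^sub>F x in at_top. cmod (L - 1) \<le> 2 * \<eta> + (K / a + 2 + 2 * A) * exp (- a * x)"
      unfolding eventually_at_top_linorder by blast
    have "((\<lambda>x. 2 * \<eta> + (K / a + 2 + 2 * A) * exp (- a * x)) \<longlongrightarrow> 2 * \<eta> + (K / a + 2 + 2 * A) * 0) at_top"
      by (intro tendsto_intros exp_neg_tendsto_0 a0)
    from tendsto_lowerbound[OF this ev] show ?thesis by simp
  qed
  have L3: "cmod L \<le> 3" 
  proof -
    have "cmod L \<le> cmod (L - 1) + cmod 1" by norm
    then show ?thesis using L1 \<eta> by simp
  qed
  \<comment> \<open>\<open>I L = 0\<close>, so that \<open>I\<close> applied to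
    \<open>\<Upsilon>\<close> tends to zero at the rate \<open>a\<close>; it differs from the
    imaginary part only by a multiple of \<open>\<eta>\<close>.\<close>
  define I where "I z = Im (cnj L * z)" for z
  have bl: "bounded_linear I"
    unfolding I_def by (rule bounded_linear_compose[OF bounded_linear_Im bounded_linear_mult_right])
  have I_near: "\<bar>I z - Im z\<bar> \<le> 2 * \<eta> * cmod z" for z
  proof -
    have "\<bar>I z - Im z\<bar> = \<bar>Im (cnj (L - 1) * z)\<bar>" by (simp add: I_def algebra_simps)
    also have "\<dots> \<le> cmod (cnj (L - 1) * z)" by (rule abs_Im_le_cmod)
    also have "\<dots> = cmod (L - 1) * cmod z" by (simp only: norm_mult complex_mod_cnj)
    also have "\<dots> \<le> 2 * \<eta> * cmod z" using L1 by (intro mult_right_mono) auto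
    finally show ?thesis .
  qed
  have I_abs: "\<bar>I z\<bar> \<le> 3 * cmod z" for z
  proof -
    have "\<bar>I z\<bar> \<le> cmod L * cmod z" using abs_Im_le_cmod[of "cnj L * z"] by (simp add: I_def norm_mult)
    also have "\<dots> \<le> 3 * cmod z" using L3 by (intro mult_right_mono) auto
    finally show ?thesis .
  qed
  define V where "V p = I (\<Upsilon> p)" for p
  have V2: "C2_on UNIV V" unfolding V_def[abs_def] by (rule C2_on_linear[OF bl open_UNIV C2])
  note dV = C2_on_differentiable[OF V2 UNIV_I]
  have V1': "partial v V p = I (partial v \<Upsilon> p)" for v p
    unfolding V_def[abs_def] by (rule partial_linear(1)[OF bl dY])
  have VM: "\<bar>V (x, y)\<bar> \<le> 3 * M * exp (- a * x)" if "0 \<le> x" "y \<in> {0..d}" for x y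
  proof -
    have "V (x, y) = I (\<Upsilon> (x, y) - L)" by (simp add: V_def I_def algebra_simps)
    then show ?thesis using I_abs[of "\<Upsilon> (x, y) - L"] LM[OF that] by simp
  qed
  have Vx: "\<bar>V (x, y) - A * mode \<mu> (x, y)\<bar> \<le> (1 + 2 * K) * \<eta>"
    "\<bar>partial (1, 0) V (x, y) - A * partial (1, 0) (mode \<mu>) (x, y)\<bar> \<le> (1 + 2 * K) * \<eta>"
    if x: "0 \<le> x" and y: "y \<in> {0..d}" for x y
  proof -
    have "cmod (partial (1, 0) \<Upsilon> (x, y)) \<le> K * exp (- a * x)" by (rule k1[OF B(1) y x])
    also have "\<dots> \<le> K * 1" using Kn a0 x by (intro mult_left_mono) auto
    finally have "2 * \<eta> * cmod (partial (1, 0) \<Upsilon> (x, y)) \<le> 2 * \<eta> * K" using \<eta> by (intro mult_left_mono) auto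
    then show "\<bar>partial (1, 0) V (x, y) - A * partial (1, 0) (mode \<mu>) (x, y)\<bar> \<le> (1 + 2 * K) * \<eta>"
      using I_near[of "partial (1, 0) \<Upsilon> (x, y)"] ex(3)[OF CS[OF y], of x] unfolding V1' by (simp add: algebra_simps)
    have "2 * \<eta> * cmod (\<Upsilon> (x, y)) \<le> 2 * \<eta> * K" using \<eta> K0[OF CS[OF y]] by (intro mult_left_mono) auto
    then show "\<bar>V (x, y) - A * mode \<mu> (x, y)\<bar> \<le> (1 + 2 * K) * \<eta>"
      using I_near[of "\<Upsilon> (x, y)"] ex(2)[OF CS[OF y], of x] unfolding V_def by (simp add: algebra_simps)
  qed
  define W where "W p = 1 - (cmod (\<Upsilon> p))\<^sup>2" for p
  have lapV: "laplacian V p = - (V p * W p)" for p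
  proof -
    have "laplacian \<Upsilon> p = - (\<Upsilon> p * complex_of_real (W p))"
      using GL unfolding GL_solution_def W_def eq_neg_iff_add_eq_0 by blast
    then have "laplacian V p = I (- (\<Upsilon> p * complex_of_real (W p)))"
      unfolding V_def[abs_def] laplacian_linear[OF bl open_UNIV C2 UNIV_I] by simp
    also have "\<dots> = - (V p * W p)" by (simp add: V_def I_def algebra_simps)
    finally show ?thesis .
  qed
  \<comment> \<open>On the Fourier coefficient of cos (mu y) the operator is
    \<open>\<partial>\<^sub>x\<^sup>2 - \<mu>\<^sup>2 = (\<partial>\<^sub>x + \<mu>)
    (\<partial>\<^sub>x - \<mu>)\<close>; \<open>G\<close> carries the second factor, which leaves a
    first order equation for \<open>s\<close>.\<close>
  define G where "G p = partial (1, 0) V p - \<mu> * V p" for p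
  have C1V: "C1_on UNIV (partial (1, 0) V)" "C1_on UNIV (partial (0, 1) V)"
    using C2_on_C1_partial[OF V2] B by auto
  have GC: "C1_on UNIV G"
    unfolding G_def[abs_def] by (intro C1_on_diff C1V C1_on_linear[OF bounded_linear_mult_right] C2_on_C1[OF V2])
  have Gx: "partial (1, 0) G p = partial (1, 0) (partial (1, 0) V) p - \<mu> * partial (1, 0) V p" for p
    unfolding G_def[abs_def]
    using partial_diff(1)[OF C1_on_differentiable[OF C1V(1) UNIV_I] partial_linear(2)[OF bounded_linear_mult_right dV]]
      partial_linear(1)[OF bounded_linear_mult_right dV] by simp
  have cont: "continuous_on S (\<lambda>y. h (x, y))" if "continuous_on UNIV h" for S x and h :: "plane \<Rightarrow> real"
    by (rule continuous_on_compose2[OF that]) (auto intro!: continuous_intros)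
  have int: "(\<lambda>y. h (x, y) * cos (\<mu> * y)) integrable_on {0..d}" if "continuous_on UNIV h" for x and h :: "plane \<Rightarrow> real"
    by (intro integrable_continuous_real continuous_intros cont[OF that])
  have cV: "continuous_on UNIV V" "continuous_on UNIV (partial (1, 0) V)" "continuous_on UNIV G"
    "continuous_on UNIV (partial (1, 0) G)" "continuous_on UNIV (partial (1, 0) (partial (1, 0) V))"
    "continuous_on UNIV (partial (0, 1) (partial (0, 1) V))"
    using C2_on_continuous[OF V2] C1_on_continuous[OF C1V(1)] C1_on_continuous[OF GC] C1_on_continuous_partial[OF GC B(1)]
      C1_on_continuous_partial[OF C1V(1) B(1)] C1_on_continuous_partial[OF C1V(2) B(2)] by auto
  have cW: "continuous_on UNIV W" unfolding W_def by (intro continuous_intros C2_on_continuous[OF C2])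
  define s where "s x = integral {0..d} (\<lambda>y. G (x, y) * cos (\<mu> * y))" for x
  define F where "F x = integral {0..d} (\<lambda>y. V (x, y) * W (x, y) * cos (\<mu> * y))" for x
  have s': "(s has_real_derivative integral {0..d} (\<lambda>y. partial (1, 0) G (x, y) * cos (\<mu> * y))) (at x)" for x
  proof -
    have "((\<lambda>x. integral (cbox 0 d) (\<lambda>y. G (x, y) * cos (\<mu> * y))) has_vector_derivative
        integral (cbox 0 d) (\<lambda>y. partial (1, 0) G (x, y) * cos (\<mu> * y))) (at x within UNIV)"
    proof (rule leibniz_rule_vector_derivative)
      fix x y
      have "((\<lambda>x. G (x, y)) has_real_derivative partial (1, 0) G (x, y)) (at x)"
        using has_vector_derivative_fst[OF C1_on_differentiable[OF GC UNIV_I]]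
        by (simp add: has_real_derivative_iff_has_vector_derivative)
      then have "((\<lambda>x. G (x, y) * cos (\<mu> * y)) has_real_derivative partial (1, 0) G (x, y) * cos (\<mu> * y)) (at x)"
        by (rule DERIV_cmult_right)
      then show "((\<lambda>x. G (x, y) * cos (\<mu> * y)) has_vector_derivative partial (1, 0) G (x, y) * cos (\<mu> * y)) (at x within UNIV)"
        by (simp add: has_real_derivative_iff_has_vector_derivative)
      show "(\<lambda>y. G (x, y) * cos (\<mu> * y)) integrable_on cbox 0 d"
        using int[OF cV(3)] by simp
      have "continuous_on (UNIV \<times> cbox 0 d) (\<lambda>p. partial (1, 0) G p * cos (\<mu> * snd p))"
        by (intro continuous_intros continuous_on_subset[OF cV(4)]) simp
      then show "continuous_on (UNIV \<times> cbox 0 d) (\<lambda>(x, y). partial (1, 0) G (x, y) * cos (\<mu> * y))"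
        by (simp add: case_prod_beta')
    qed auto
    then show ?thesis by (simp add: s_def[abs_def] has_real_derivative_iff_has_vector_derivative)
  qed
  have ode: "integral {0..d} (\<lambda>y. partial (1, 0) G (x, y) * cos (\<mu> * y)) + \<mu> * s x = - F x" for x
  proof -
    have y0: "partial (0, 1) V (x, 0) = 0" "partial (0, 1) V (x, d) = 0"
      using partial_snd_zero_of_even[OF C2, of 0 x] partial_snd_zero_of_even[OF C2, of d x] even
      by (simp_all add: V1' I_def)
    have "((\<lambda>y. (partial (0, 1) (partial (0, 1) V) (x, y) + \<mu>\<^sup>2 * V (x, y)) * cos (\<mu> * y)) has_integral
       (partial (0, 1) V (x, d) * cos (\<mu> * d) + \<mu> * V (x, d) * sin (\<mu> * d))
       - (partial (0, 1) V (x, 0) * cos (\<mu> * 0) + \<mu> * V (x, 0) * sin (\<mu> * 0))) {0..d}"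
    proof (rule fundamental_theorem_of_calculus)
      fix y
      have 1: "((\<lambda>y. partial (0, 1) V (x, y)) has_real_derivative partial (0, 1) (partial (0, 1) V) (x, y)) (at y within {0..d})"
        "((\<lambda>y. V (x, y)) has_real_derivative partial (0, 1) V (x, y)) (at y within {0..d})"
        using has_vector_derivative_snd[OF C1_on_differentiable[OF C1V(2) UNIV_I]] has_vector_derivative_snd[OF dV]
        by (simp_all add: has_real_derivative_iff_has_vector_derivative)
      have "((\<lambda>y. partial (0, 1) V (x, y) * cos (\<mu> * y) + \<mu> * V (x, y) * sin (\<mu> * y)) has_real_derivative
          (partial (0, 1) (partial (0, 1) V) (x, y) + \<mu>\<^sup>2 * V (x, y)) * cos (\<mu> * y)) (at y within {0..d})"
        by (rule derivative_eq_intros 1 refl)+ (simp add: algebra_simps power2_eq_square)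
      then show "((\<lambda>y. partial (0, 1) V (x, y) * cos (\<mu> * y) + \<mu> * V (x, y) * sin (\<mu> * y)) has_vector_derivative
          (partial (0, 1) (partial (0, 1) V) (x, y) + \<mu>\<^sup>2 * V (x, y)) * cos (\<mu> * y)) (at y within {0..d})"
        by (simp add: has_real_derivative_iff_has_vector_derivative)
    qed (use d in simp)
    then have 0: "((\<lambda>y. (partial (0, 1) (partial (0, 1) V) (x, y) + \<mu>\<^sup>2 * V (x, y)) * cos (\<mu> * y)) has_integral 0) {0..d}"
      using y0 \<mu>(3) by simp
    have 1: "((\<lambda>y. V (x, y) * W (x, y) * cos (\<mu> * y)) has_integral F x) {0..d}"
      unfolding F_def by (intro integrable_integral integrable_continuous_real continuous_intros cont[OF cV(1)] cont[OF cW])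
    have 2: "((\<lambda>y. partial (1, 0) G (x, y) * cos (\<mu> * y)) has_integral integral {0..d} (\<lambda>y. partial (1, 0) G (x, y) * cos (\<mu> * y))) {0..d}"
      by (intro integrable_integral int cV)
    have 3: "((\<lambda>y. \<mu> * (G (x, y) * cos (\<mu> * y))) has_integral \<mu> * s x) {0..d}"
      unfolding s_def by (intro has_integral_mult_right integrable_integral int cV)
    have "((\<lambda>y. (partial (1, 0) G (x, y) * cos (\<mu> * y) + \<mu> * (G (x, y) * cos (\<mu> * y)))) has_integral
        integral {0..d} (\<lambda>y. partial (1, 0) G (x, y) * cos (\<mu> * y)) + \<mu> * s x) {0..d}"
      by (rule has_integral_add[OF 2 3])
    moreover have "((\<lambda>y. - (V (x, y) * W (x, y) * cos (\<mu> * y)) -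
        (partial (0, 1) (partial (0, 1) V) (x, y) + \<mu>\<^sup>2 * V (x, y)) * cos (\<mu> * y)) has_integral - F x - 0) {0..d}"
      by (intro has_integral_diff has_integral_neg 0 1)
    moreover have "partial (1, 0) G (x, y) * cos (\<mu> * y) + \<mu> * (G (x, y) * cos (\<mu> * y))
      = - (V (x, y) * W (x, y) * cos (\<mu> * y)) - (partial (0, 1) (partial (0, 1) V) (x, y) + \<mu>\<^sup>2 * V (x, y)) * cos (\<mu> * y)" for y
    proof -
      have e: "partial (1, 0) (partial (1, 0) V) (x, y) = - (V (x, y) * W (x, y)) - partial (0, 1) (partial (0, 1) V) (x, y)"
        using lapV[of "(x, y)"] by (simp add: laplacian_def sum_Basis_plane)
      show ?thesis unfolding Gx G_def e by (simp add: algebra_simps power2_eq_square)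
    qed
    ultimately show ?thesis using has_integral_unique by (simp only: diff_0_right) blast
  qed
  define H where "H x = exp (\<mu> * x) * s x" for x
  have H': "(H has_vector_derivative - (exp (\<mu> * x) * F x)) (at x)" for x
  proof -
    have "(H has_real_derivative exp (\<mu> * x) * \<mu> * s x + integral {0..d} (\<lambda>y. partial (1, 0) G (x, y) * cos (\<mu> * y)) * exp (\<mu> * x)) (at x)"
      unfolding H_def[abs_def] by (rule derivative_eq_intros s' refl)+ simp
    moreover have "exp (\<mu> * x) * \<mu> * s x + integral {0..d} (\<lambda>y. partial (1, 0) G (x, y) * cos (\<mu> * y)) * exp (\<mu> * x)
        = exp (\<mu> * x) * (integral {0..d} (\<lambda>y. partial (1, 0) G (x, y) * cos (\<mu> * y)) + \<mu> * s x)"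
      by (simp add: algebra_simps)
    ultimately show ?thesis unfolding ode by (simp add: has_real_derivative_iff_has_vector_derivative)
  qed
  have int_le: "\<bar>integral {0..d} (\<lambda>y. h y * cos (\<mu> * y))\<bar> \<le> d * c"
    if "(\<lambda>y. h y * cos (\<mu> * y)) integrable_on {0..d}" "\<And>y. y \<in> {0..d} \<Longrightarrow> \<bar>h y\<bar> \<le> c" for h c
  proof -
    have b: "norm (h y * cos (\<mu> * y)) \<le> c" if "y \<in> {0..d}" for y
    proof -
      have "\<bar>h y\<bar> * \<bar>cos (\<mu> * y)\<bar> \<le> c * 1" using \<open>\<And>y. y \<in> {0..d} \<Longrightarrow> \<bar>h y\<bar> \<le> c\<close>[OF that]
        by (intro mult_mono) auto
      then show ?thesis by (simp add: abs_mult)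
    qed
    have "norm (integral {0..d} (\<lambda>y. h y * cos (\<mu> * y))) \<le> integral {0..d} (\<lambda>y. c)"
      using that(1) b by (intro integral_norm_bound_integral) auto
    then show ?thesis using d by simp
  qed
  \<comment> \<open>The deviation from the leading term is bounded by \<open>N * \<eta>\<close>,
    small without decay, while the function is bounded by a multiple of exp (- a x), decaying
    without smallness. Their geometric mean has both properties, at half the rate.\<close>
  define R where "R x = 2 * A * exp (- a * x) + sqrt (3 * N * M * \<eta>) * exp (- (a / 2) * x)" for x
  have VR: "\<bar>V (x, y)\<bar> \<le> R x" if x: "0 \<le> x" and y: "y \<in> {0..d}" for x y
  proof -
    have "\<bar>mode \<mu> (x, y)\<bar> \<le> 2 * exp (- a * x) * 1"
      unfolding mode_def abs_mult using chi0_bounds(1,4)[of x] x by (intro mult_mono) (auto simp: a_def)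
    then have "A * \<bar>mode \<mu> (x, y)\<bar> \<le> A * (2 * exp (- a * x))" using A by (intro mult_left_mono) auto
    then have Am: "\<bar>A * mode \<mu> (x, y)\<bar> \<le> 2 * A * exp (- a * x)" using A by (simp add: abs_mult mult_ac)
    have "(1 + 2 * K) * \<eta> \<le> N * \<eta>" using \<eta> Kn by (intro mult_right_mono) (auto simp: N_def)
    then have v1: "\<bar>V (x, y)\<bar> \<le> 2 * A * exp (- a * x) + N * \<eta>" using Vx(1)[OF x y] Am by linarith
    show ?thesis
    proof (cases "N * \<eta> \<le> 3 * M * exp (- a * x)")
      case True
      have "(N * \<eta>)\<^sup>2 \<le> (N * \<eta>) * (3 * M * exp (- a * x))"
        unfolding power2_eq_square using True Mn \<eta> by (intro mult_left_mono) auto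
      also have "\<dots> = (3 * N * M * \<eta>) * (exp (- (a / 2) * x))\<^sup>2"
        by (simp add: power2_eq_square flip: exp_add)
      finally have "N * \<eta> \<le> sqrt ((3 * N * M * \<eta>) * (exp (- (a / 2) * x))\<^sup>2)" by (rule real_le_rsqrt)
      then show ?thesis using v1 by (simp add: R_def real_sqrt_mult)
    next
      case False
      have "(3 * M * exp (- a * x))\<^sup>2 \<le> (N * \<eta>) * (3 * M * exp (- a * x))"
        unfolding power2_eq_square using False Mn \<eta> by (intro mult_right_mono) auto
      also have "\<dots> = (3 * N * M * \<eta>) * (exp (- (a / 2) * x))\<^sup>2"
        by (simp add: power2_eq_square flip: exp_add)
      finally have "3 * M * exp (- a * x) \<le> sqrt ((3 * N * M * \<eta>) * (exp (- (a / 2) * x))\<^sup>2)" by (rule real_le_rsqrt)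
      moreover have "0 \<le> 2 * A * exp (- a * x)" using A by simp
      ultimately show ?thesis using VM[OF x y] by (simp add: R_def real_sqrt_mult)
    qed
  qed
  have WK: "\<bar>W (x, y)\<bar> \<le> 4 * K * exp (- a * x)" if "X \<le> x" "y \<in> {0..d}" for x y
  proof (rule exp_div)
    show "exp (a * \<bar>x\<bar>) * \<bar>W (x, y)\<bar> \<le> 4 * K"
      unfolding W_def
      by (rule GL_defect_le[OF GL UNIV_I far[OF CS[OF that(2)]]]) (use that K2[OF CS[OF that(2)], of _ _ x] in auto)
  qed (use that X in simp)
  have FR: "\<bar>exp (\<mu> * x) * F x\<bar> \<le> d * (4 * K * R x)" if x: "X \<le> x" for x
  proof -
    have R0: "0 \<le> R x" using A Mn \<eta> by (simp add: R_def)
    have "\<bar>F x\<bar> \<le> d * (R x * (4 * K * exp (- a * x)))"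
      unfolding F_def
    proof (rule int_le)
      show "(\<lambda>y. V (x, y) * W (x, y) * cos (\<mu> * y)) integrable_on {0..d}"
        by (intro integrable_continuous_real continuous_intros cont[OF cV(1)] cont[OF cW])
      show "\<bar>V (x, y) * W (x, y)\<bar> \<le> R x * (4 * K * exp (- a * x))" if "y \<in> {0..d}" for y
        unfolding abs_mult using VR[OF _ that] WK[OF x that] R0 x X by (intro mult_mono) auto
    qed
    moreover have "\<mu> * x \<le> a * x" using \<mu> x X by (intro mult_right_mono) auto
    ultimately have "exp (\<mu> * x) * \<bar>F x\<bar> \<le> exp (a * x) * (d * (R x * (4 * K * exp (- a * x))))"
      by (intro mult_mono'[of "exp (\<mu> * x)" "exp (a * x)"]) simp_all
    also have "\<dots> = d * (4 * K * R x) * (exp (a * x) * exp (- a * x))" by (simp add: mult_ac)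
    also have "\<dots> = d * (4 * K * R x)" by (simp flip: exp_add)
    finally show ?thesis by (simp add: abs_mult)
  qed
  \<comment> \<open>The integral over the half-line from \<open>x\<close> of the bound in
    \<open>FR\<close>.\<close>
  define \<Phi> where "\<Phi> x = d * (4 * K * (2 * A / a * exp (- a * x) + 2 / a * sqrt (3 * N * M * \<eta>) * exp (- (a / 2) * x)))" for x
  have \<Phi>': "((\<lambda>x. - \<Phi> x) has_vector_derivative d * (4 * K * R x)) (at x)" for x
  proof -
    have D: "((\<lambda>x. - (m * (n * (c1 * exp (- a * x) + c2 * exp (- b * x))))) has_real_derivative
      m * (n * (c1 * a * exp (- a * x) + c2 * b * exp (- b * x)))) (at x)" for m n c1 c2 b :: real
      by (rule derivative_eq_intros refl)+ (simp add: algebra_simps)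
    have c: "2 * A / a * a = 2 * A" "2 / a * sqrt (3 * N * M * \<eta>) * (a / 2) = sqrt (3 * N * M * \<eta>)" using a0 by simp_all
    show ?thesis
      using D[of d "4 * K" "2 * A / a" "2 / a * sqrt (3 * N * M * \<eta>)" "a / 2"]
      unfolding \<Phi>_def[abs_def] R_def c by (simp only: has_real_derivative_iff_has_vector_derivative)
  qed
  have HH: "\<bar>H x0\<bar> \<le> \<Phi> x0 + \<bar>H y\<bar>" if y: "x0 < y" for y
  proof -
    have "norm (H y - H x0) \<le> - \<Phi> y - - \<Phi> x0"
    proof (rule differentiable_bound_general[OF y])
      show "continuous_on {x0..y} H" "continuous_on {x0..y} (\<lambda>x. - \<Phi> x)"
        by (intro continuous_at_imp_continuous_on ballI has_vector_derivative_continuous[OF H']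
          has_vector_derivative_continuous[OF \<Phi>'])+
      show "norm (- (exp (\<mu> * x) * F x)) \<le> d * (4 * K * R x)" if "x0 < x" for x
        using FR[of x] that X by simp
    qed (rule H' \<Phi>')+
    moreover have "0 \<le> \<Phi> y" using d Kn A a0 Mn \<eta> by (simp add: \<Phi>_def)
    ultimately show ?thesis by (simp add: abs_le_iff) linarith
  qed
  \<comment> \<open>\<open>s\<close> decays at the rate \<open>a\<close> and
    \<open>\<mu> < a\<close>, so \<open>H\<close> tends to zero and contributes nothing at
    infinity.\<close>
  have "((\<lambda>y. \<Phi> x0 + d * (K * 3 + \<mu> * (3 * M)) * exp (- (a - \<mu>) * y)) \<longlongrightarrow> \<Phi> x0 + d * (K * 3 + \<mu> * (3 * M)) * 0) at_top"
    using \<mu> by (intro tendsto_intros exp_neg_tendsto_0) auto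
  moreover have "\<forall>\<^sub>F y in at_top. \<bar>H x0\<bar> \<le> \<Phi> x0 + d * (K * 3 + \<mu> * (3 * M)) * exp (- (a - \<mu>) * y)"
  proof (rule eventually_mono[OF eventually_gt_at_top[of x0]])
    fix x assume x: "x0 < x"
    then have xx: "0 \<le> x" using X by simp
    have "\<bar>s x\<bar> \<le> d * ((K * 3 + \<mu> * (3 * M)) * exp (- a * x))"
      unfolding s_def
    proof (rule int_le[OF int[OF cV(3)]])
      fix y assume y: "y \<in> {0..d}"
      have "\<bar>partial (1, 0) V (x, y)\<bar> \<le> 3 * (K * exp (- a * x))"
        unfolding V1' using I_abs[of "partial (1, 0) \<Upsilon> (x, y)"] k1[OF B(1) y xx] by linarith
      moreover have "\<mu> * \<bar>V (x, y)\<bar> \<le> \<mu> * (3 * M * exp (- a * x))"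
        using VM[OF xx y] \<mu> by (intro mult_left_mono) auto
      moreover have "\<bar>G (x, y)\<bar> \<le> \<bar>partial (1, 0) V (x, y)\<bar> + \<mu> * \<bar>V (x, y)\<bar>"
        unfolding G_def using \<mu> by (simp add: abs_mult order_trans[OF abs_triangle_ineq4])
      ultimately show "\<bar>G (x, y)\<bar> \<le> (K * 3 + \<mu> * (3 * M)) * exp (- a * x)" by (simp add: algebra_simps)
    qed
    then have "exp (\<mu> * x) * \<bar>s x\<bar> \<le> exp (\<mu> * x) * (d * ((K * 3 + \<mu> * (3 * M)) * exp (- a * x)))"
      by (rule mult_left_mono) simp
    also have "\<dots> = d * (K * 3 + \<mu> * (3 * M)) * (exp (\<mu> * x) * exp (- a * x))" by (simp add: mult_ac)
    also have "exp (\<mu> * x) * exp (- a * x) = exp (- (a - \<mu>) * x)" by (simp add: algebra_simps flip: exp_add)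
    finally have "\<bar>H x\<bar> \<le> d * (K * 3 + \<mu> * (3 * M)) * exp (- (a - \<mu>) * x)" by (simp add: H_def abs_mult)
    then show "\<bar>H x0\<bar> \<le> \<Phi> x0 + d * (K * 3 + \<mu> * (3 * M)) * exp (- (a - \<mu>) * x)" using HH[OF x] by linarith
  qed
  ultimately have "\<bar>H x0\<bar> \<le> \<Phi> x0 + d * (K * 3 + \<mu> * (3 * M)) * 0" by (rule tendsto_lowerbound) simp
  then have upper: "exp (\<mu> * x0) * \<bar>s x0\<bar> \<le> \<Phi> x0" by (simp add: H_def abs_mult)
  have x00: "0 \<le> x0" using X by simp
  \<comment> \<open>\<open>- A * q\<close> is the coefficient of cos (mu y) in the leading part of
    \<open>G\<close> at \<open>x0\<close>; the integral of the squared cosine over the width is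
    \<open>d / 2\<close>.\<close>
  define q where "q = chi0 x0 * (kink x0 / sqrt 2 + \<mu>)"
  have lower: "A * q * (d / 2) - d * (N * \<eta>) \<le> \<bar>s x0\<bar>"
  proof -
    have e: "\<bar>G (x0, y) + A * q * cos (\<mu> * y)\<bar> \<le> N * \<eta>" if y: "y \<in> {0..d}" for y
    proof -
      have "\<mu> * \<bar>V (x0, y) - A * mode \<mu> (x0, y)\<bar> \<le> 1 * ((1 + 2 * K) * \<eta>)"
        using Vx(1)[OF x00 y] \<mu> \<mu>1 by (intro mult_mono) auto
      then have 1: "\<bar>\<mu> * (V (x0, y) - A * mode \<mu> (x0, y))\<bar> \<le> (1 + 2 * K) * \<eta>" using \<mu> by (simp add: abs_mult)
      have "G (x0, y) + A * q * cos (\<mu> * y) = (partial (1, 0) V (x0, y) - A * partial (1, 0) (mode \<mu>) (x0, y))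
          - \<mu> * (V (x0, y) - A * mode \<mu> (x0, y))"
        by (simp add: G_def q_def mode_C2(2) mode_def algebra_simps)
      then have "\<bar>G (x0, y) + A * q * cos (\<mu> * y)\<bar> \<le> 2 * ((1 + 2 * K) * \<eta>)"
        using 1 Vx(2)[OF x00 y] abs_triangle_ineq4[of "partial (1, 0) V (x0, y) - A * partial (1, 0) (mode \<mu>) (x0, y)" "\<mu> * (V (x0, y) - A * mode \<mu> (x0, y))"]
        by linarith
      also have "\<dots> \<le> N * \<eta>" using \<eta> by (simp add: N_def algebra_simps)
      finally show ?thesis .
    qed
    have 1: "((\<lambda>y. A * q * (cos (\<mu> * y) * cos (\<mu> * y))) has_integral A * q * (d / 2)) {0..d}"
      by (rule has_integral_mult_right[OF integral_cos_sq[OF d \<mu>(3,1)]])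
    have 2: "((\<lambda>y. G (x0, y) * cos (\<mu> * y)) has_integral s x0) {0..d}"
      unfolding s_def by (intro integrable_integral int cV)
    have 3: "((\<lambda>y. (G (x0, y) + A * q * cos (\<mu> * y)) * cos (\<mu> * y)) has_integral s x0 + A * q * (d / 2)) {0..d}"
      using has_integral_add[OF 2 1] by (simp add: algebra_simps)
    have "\<bar>integral {0..d} (\<lambda>y. (G (x0, y) + A * q * cos (\<mu> * y)) * cos (\<mu> * y))\<bar> \<le> d * (N * \<eta>)"
      by (rule int_le[OF has_integral_integrable[OF 3] e])
    then have "\<bar>s x0 + A * q * (d / 2)\<bar> \<le> d * (N * \<eta>)" by (simp only: integral_unique[OF 3])
    then show ?thesis by linarith
  qed
  have "\<mu> * exp (- a * x0) \<le> q"
  proof -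
    have k0: "0 \<le> kink x0" using x00 by (simp add: kink_def)
    have c: "exp (- a * x0) \<le> chi0 x0" using chi0_bounds(5)[of x0] x00 by (simp add: a_def)
    have "exp (- a * x0) * \<mu> \<le> chi0 x0 * (kink x0 / sqrt 2 + \<mu>)"
      using c k0 \<mu> chi0_bounds(1)[of x0] by (intro mult_mono) auto
    then show ?thesis by (simp add: q_def mult.commute)
  qed
  then have "A * (\<mu> * exp (- a * x0)) * (d / 2) \<le> A * q * (d / 2)"
    using A d by (intro mult_right_mono mult_left_mono) auto
  then have "d * (A * \<mu> * exp (- a * x0) / 2 - N * \<eta>) \<le> \<bar>s x0\<bar>" using lower by (simp add: algebra_simps)
  then have "exp (\<mu> * x0) * (d * (A * \<mu> * exp (- a * x0) / 2 - N * \<eta>)) \<le> exp (\<mu> * x0) * \<bar>s x0\<bar>"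
    by (rule mult_left_mono) simp
  also note upper
  finally have "d * (exp (\<mu> * x0) * (A * \<mu> * exp (- a * x0) / 2 - N * \<eta>))
      \<le> d * (4 * K * (2 * A / a * exp (- a * x0) + 2 / a * sqrt (3 * N * M * \<eta>) * exp (- (a / 2) * x0)))"
    by (simp only: \<Phi>_def mult.left_commute)
  then show ?thesis using d unfolding N_def M_def by simp
qed

subsection \<open>Pointwise bounds under symmetries\<close>

text \<open>The bound at a single point, so that it can be moved between the strip and the plane by
  symmetries and closure.\<close>

definition pbound :: "real \<Rightarrow> (plane \<Rightarrow> complex) \<Rightarrow> real \<Rightarrow> plane \<Rightarrow> bool" where
  "pbound \<sigma> f c p \<longleftrightarrow> cmod (f p) \<le> c \<and>
     (\<forall>v\<in>Basis. exp (\<sigma> * \<bar>fst p\<bar>) * cmod (partial v f p) \<le> c \<and>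
       (\<forall>w\<in>Basis. exp (\<sigma> * \<bar>fst p\<bar>) * cmod (partial w (partial v f) p) \<le> c))"

lemma wbound_iff: "wbound \<sigma> d f c \<longleftrightarrow> (\<forall>p\<in>strip d. pbound \<sigma> f c p)"
  by (simp only: wbound_def pbound_def)

lemma pboundD:
  assumes "pbound \<sigma> f c p"
  shows "cmod (f p) \<le> c"
    and "v \<in> Basis \<Longrightarrow> exp (\<sigma> * \<bar>fst p\<bar>) * cmod (partial v f p) \<le> c"
    and "v \<in> Basis \<Longrightarrow> w \<in> Basis \<Longrightarrow> exp (\<sigma> * \<bar>fst p\<bar>) * cmod (partial w (partial v f) p) \<le> c"
  using assms unfolding pbound_def by blast+

lemma pbound_add:
  assumes S: "open S" "C2_on S f" "C2_on S g" "p \<in> S" and b: "pbound \<sigma> f c p" "pbound \<sigma> g c' p"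
  shows "pbound \<sigma> (\<lambda>p. f p + g p) (c + c') p"
proof -
  have add: "e * cmod (z + z') \<le> c + c'" if "0 \<le> e" "e * cmod z \<le> c" "e * cmod z' \<le> c'" for e z z'
  proof -
    have "e * cmod (z + z') \<le> e * (cmod z + cmod z')" using that(1) by (intro mult_left_mono norm_triangle_ineq)
    also have "\<dots> \<le> c + c'" unfolding distrib_left using that(2,3) by (rule add_mono)
    finally show ?thesis .
  qed
  note d = C2_on_differentiable[OF S(2,4)] C2_on_differentiable[OF S(3,4)]
  show ?thesis
    unfolding pbound_def
  proof (intro conjI ballI)
    show "cmod (f p + g p) \<le> c + c'" using add[of 1] pboundD(1)[OF b(1)] pboundD(1)[OF b(2)] by simp
    fix v :: plane assume v: "v \<in> Basis"
    show "exp (\<sigma> * \<bar>fst p\<bar>) * cmod (partial v (\<lambda>p. f p + g p) p) \<le> c + c'"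
      unfolding partial_add(1)[OF d] by (intro add pboundD(2)[OF b(1) v] pboundD(2)[OF b(2) v]) simp
    fix w :: plane assume w: "w \<in> Basis"
    show "exp (\<sigma> * \<bar>fst p\<bar>) * cmod (partial w (partial v (\<lambda>p. f p + g p)) p) \<le> c + c'"
      unfolding partial2_add[OF S v] by (intro add pboundD(3)[OF b(1) v w] pboundD(3)[OF b(2) v w]) simp
  qed
qed

text \<open>Such a symmetry changes derivatives only by signs and by \<open>L\<close>. The cases
  used are shifts and reflections in y, with \<open>L\<close> the identity, and the reflection in x,
  with \<open>L z = - cnj z\<close>.\<close>

lemma pbound_isometry:
  assumes f: "C2_on UNIV f" and L: "bounded_linear L" "\<And>z. cmod (L z) = cmod z"
    and st: "\<bar>s\<bar> = 1" "\<bar>t\<bar> = 1" and eq: "\<And>p. f (diag_map s t (0, h) p) = L (f p)"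
  shows "pbound \<sigma> f c (diag_map s t (0, h) p) \<longleftrightarrow> pbound \<sigma> f c p"
proof -
  let ?q = "diag_map s t (0, h)"
  have q: "(\<lambda>p. f (?q p)) = (\<lambda>p. L (f p))" by (rule ext) (rule eq)
  have x: "\<bar>fst (?q p)\<bar> = \<bar>fst p\<bar>" using st by (simp add: diag_map_def abs_mult)
  note d = C2_on_differentiable[OF f UNIV_I]
  have sq: "\<bar>s * t\<bar> = 1" "\<bar>s\<^sup>2\<bar> = 1" "\<bar>t\<^sup>2\<bar> = 1" using st by (simp_all add: abs_mult power_abs)
  have 0: "cmod (f (?q p)) = cmod (f p)" by (simp only: eq L(2))
  have 1: "cmod (partial v f (?q p)) = cmod (partial v f p)" if "v \<in> Basis" for v
  proof -
    have "v = (1, 0) \<or> v = (0, 1)" using that by (simp add: Basis_plane)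
    then have "cmod (partial v (\<lambda>p. f (?q p)) p) = cmod (partial v f (?q p))"
      using st by (elim disjE) (simp_all add: partial_diag_map(1,2)[OF d])
    then show ?thesis unfolding q partial_linear(1)[OF L(1) d] L(2) by simp
  qed
  have 2: "cmod (partial w (partial v f) (?q p)) = cmod (partial w (partial v f) p)" if v: "v \<in> Basis" and w: "w \<in> Basis" for v w
  proof -
    have "v = (1, 0) \<or> v = (0, 1)" "w = (1, 0) \<or> w = (0, 1)" using v w by (simp_all add: Basis_plane)
    then have "cmod (partial w (partial v (\<lambda>p. f (?q p))) p) = cmod (partial w (partial v f) (?q p))"
      using sq by (elim disjE) (simp_all add: partial2_diag_map[OF open_UNIV f UNIV_I])
    then show ?thesis unfolding q partial2_linear[OF L(1) open_UNIV f UNIV_I v] L(2) by simp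
  qed
  show ?thesis unfolding pbound_def x 0 using 1 2 by simp
qed

lemma pbound_cong:
  assumes "\<And>p. p \<in> strip d \<Longrightarrow> f p = g p" "p \<in> strip d"
  shows "pbound \<sigma> f c p \<longleftrightarrow> pbound \<sigma> g c p"
proof -
  have 1: "partial v f p = partial v g p" if "p \<in> strip d" for v p
    using assms(1) by (intro partial_cong(1)[OF open_strip that])
  have 2: "partial w (partial v f) p = partial w (partial v g) p" for v w
    by (intro partial_cong(1)[OF open_strip assms(2)] 1)
  show ?thesis unfolding pbound_def by (simp only: assms(1)[OF assms(2)] 1[OF assms(2)] 2)
qed

lemma pbound_S0:
  assumes "\<tau> \<le> 1 / sqrt 2"
  shows "pbound \<tau> S0 2 p"
proof -
  have e: "exp (\<tau> * \<bar>fst p\<bar>) * r \<le> 2" if "r \<le> (chi0 (fst p))\<^sup>2" for r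
  proof -
    have "(chi0 (fst p))\<^sup>2 \<le> chi0 (fst p) * 1"
      unfolding power2_eq_square using chi0_bounds(1,2)[of "fst p"] by (intro mult_left_mono) auto
    then have "r \<le> 2 * exp (- \<bar>fst p\<bar> / sqrt 2)" using that chi0_bounds(4)[of "fst p"] by linarith
    then have "exp (\<tau> * \<bar>fst p\<bar>) * r \<le> exp (\<tau> * \<bar>fst p\<bar>) * (2 * exp (- \<bar>fst p\<bar> / sqrt 2))" by (rule mult_left_mono) simp
    also have "\<dots> = 2 * exp ((\<tau> - 1 / sqrt 2) * \<bar>fst p\<bar>)" by (simp add: algebra_simps flip: exp_add)
    also have "\<dots> \<le> 2 * 1" using assms by (intro mult_left_mono) (auto simp: mult_le_0_iff)
    finally show ?thesis by simp
  qed
  have "cmod (S0 p) \<le> 2" using kink_bounds[of "fst p"] by (simp add: S0_eq)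
  then show ?thesis unfolding pbound_def by (intro conjI ballI e S0_bounds) auto
qed

text \<open>Only what every Neumann solution provides. The alternation with the conjugate required
  by \<open>is_extension\<close> needs the invariance under \<open>reflection\<close> in
  addition.\<close>

definition even_extension :: "real \<Rightarrow> (plane \<Rightarrow> complex) \<Rightarrow> (plane \<Rightarrow> complex) \<Rightarrow> bool" where
  "even_extension d \<psi> \<Upsilon> \<longleftrightarrow> GL_solution UNIV \<Upsilon> \<and> (\<forall>p\<in>strip d. \<Upsilon> p = \<psi> p) \<and>
    (\<forall>x y. \<Upsilon> (x, - y) = \<Upsilon> (x, y)) \<and> (\<forall>x y m. \<Upsilon> (x, y + 2 * d * of_int m) = \<Upsilon> (x, y))"

lemma even_extensionD:
  assumes "even_extension d \<psi> \<Upsilon>"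
  shows "GL_solution UNIV \<Upsilon>" "C2_on UNIV \<Upsilon>" "p \<in> strip d \<Longrightarrow> \<Upsilon> p = \<psi> p" "\<Upsilon> (x, - y) = \<Upsilon> (x, y)"
    "\<Upsilon> (x, y + 2 * d * of_int m) = \<Upsilon> (x, y)" "\<Upsilon> (x, 2 * d * of_int m - y) = \<Upsilon> (x, y)" "\<Upsilon> (x, 2 * d - y) = \<Upsilon> (x, y)"
proof -
  show 1: "GL_solution UNIV \<Upsilon>" "C2_on UNIV \<Upsilon>" "p \<in> strip d \<Longrightarrow> \<Upsilon> p = \<psi> p"
    using assms by (auto simp: even_extension_def GL_solution_def)
  have e: "\<Upsilon> (x, - y) = \<Upsilon> (x, y)" "\<Upsilon> (x, y + 2 * d * of_int m) = \<Upsilon> (x, y)" for x y m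
    using assms unfolding even_extension_def by blast+
  then show "\<Upsilon> (x, - y) = \<Upsilon> (x, y)" "\<Upsilon> (x, y + 2 * d * of_int m) = \<Upsilon> (x, y)" by blast+
  show 2: "\<Upsilon> (x, 2 * d * of_int m - y) = \<Upsilon> (x, y)" for x y m
    using e(2)[of x "- y" m] e(1)[of x y] by (simp add: add.commute)
  show "\<Upsilon> (x, 2 * d - y) = \<Upsilon> (x, y)" using 2[of x 1] by simp
qed

lemma closed_strip_le:
  fixes f :: "plane \<Rightarrow> real"
  assumes "0 < d" "continuous_on UNIV f" "\<And>p. p \<in> strip d \<Longrightarrow> f p \<le> c" "p \<in> closed_strip d"
  shows "f p \<le> c"
proof -
  have "closed {p. f p \<le> c}" using assms(2) by (intro closed_Collect_le continuous_intros)
  then have "closure (strip d) \<subseteq> {p. f p \<le> c}" by (intro closure_minimal) (use assms(3) in blast)+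
  then show ?thesis using assms(1,4) by (auto simp: closure_strip)
qed

lemma closed_strip_far:
  fixes f :: "plane \<Rightarrow> complex"
  assumes d: "0 < d" and f: "continuous_on UNIV f"
    and far: "\<And>p. p \<in> strip d \<Longrightarrow> X \<le> fst p \<Longrightarrow> c \<le> cmod (f p)"
    and p: "p \<in> closed_strip d" "X \<le> fst p"
  shows "c \<le> cmod (f p)"
proof -
  \<comment> \<open>Clamping the first coordinate at \<open>X\<close> turns the conditional bound
    into one on the whole strip, which passes to the closure.\<close>
  have "- cmod (f (max X (fst p), snd p)) \<le> - c"
  proof (rule closed_strip_le[OF d _ _ p(1), where f = "\<lambda>p. - cmod (f (max X (fst p), snd p))"])
    show "continuous_on UNIV (\<lambda>p. - cmod (f (max X (fst p), snd p)))"
      by (intro continuous_intros continuous_on_compose2[OF f]) simp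
    fix q assume "q \<in> strip d"
    then have "(max X (fst q), snd q) \<in> strip d" by (simp add: strip_def mem_Times_iff)
    then show "- cmod (f (max X (fst q), snd q)) \<le> - c" using far by simp
  qed
  then show ?thesis using p(2) by (simp add: max_def)
qed

lemma pbound_closed_strip:
  assumes d: "0 < d" and f: "C2_on UNIV f" and b: "\<And>p. p \<in> strip d \<Longrightarrow> pbound \<sigma> f c p" and p: "p \<in> closed_strip d"
  shows "pbound \<sigma> f c p"
  unfolding pbound_def
proof (intro conjI ballI)
  show "cmod (f p) \<le> c"
    by (rule closed_strip_le[OF d _ pboundD(1)[OF b] p]) (intro continuous_intros C2_on_continuous[OF f])
  fix v :: plane assume v: "v \<in> Basis"
  have c1: "continuous_on UNIV (partial v f)"
    by (rule C1_on_continuous[OF C2_on_C1_partial[OF f v]])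
  show "exp (\<sigma> * \<bar>fst p\<bar>) * cmod (partial v f p) \<le> c"
    by (rule closed_strip_le[OF d _ pboundD(2)[OF b v] p]) (intro continuous_intros c1)
  fix w :: plane assume w: "w \<in> Basis"
  have c2: "continuous_on UNIV (partial w (partial v f))"
    by (rule C1_on_continuous_partial[OF C2_on_C1_partial[OF f v] w])
  show "exp (\<sigma> * \<bar>fst p\<bar>) * cmod (partial w (partial v f) p) \<le> c"
    by (rule closed_strip_le[OF d _ pboundD(3)[OF b v w] p]) (intro continuous_intros c2)
qed

lemma pbound_plane:
  assumes d: "0 < d" and f: "C2_on UNIV f" and b: "\<And>p. p \<in> strip d \<Longrightarrow> pbound \<sigma> f c p"
    and even: "\<And>x y. f (x, - y) = f (x, y)" "\<And>x y m. f (x, y + 2 * d * of_int m) = f (x, y)"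
  shows "pbound \<sigma> f c p"
proof -
  obtain x y where p: "p = (x, y)" by (cases p)
  obtain m :: int where m: "- d \<le> y + of_int m * (2 * d)" "y + of_int m * (2 * d) \<le> - d + 2 * d"
    using reduce_mod_period[of "2 * d" "- d" y] d by auto
  have 1: "pbound \<sigma> f c (diag_map 1 1 (0, 2 * d * of_int m) p) \<longleftrightarrow> pbound \<sigma> f c p"
    by (rule pbound_isometry[OF f bounded_linear_ident]) (simp_all add: diag_map_def add.commute[of "2 * d * of_int m"] even(2))
  have 2: "pbound \<sigma> f c (diag_map 1 (- 1) (0, 0) q) \<longleftrightarrow> pbound \<sigma> f c q" for q
    by (rule pbound_isometry[OF f bounded_linear_ident]) (simp_all add: diag_map_def even(1))
  define z where "z = y + of_int m * (2 * d)"
  have 3: "pbound \<sigma> f c (x, z) \<longleftrightarrow> pbound \<sigma> f c p"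
    using 1 by (simp add: diag_map_def p z_def algebra_simps)
  have z: "(x, \<bar>z\<bar>) \<in> closed_strip d" using m by (simp add: mem_closed_strip z_def abs_le_iff)
  have "pbound \<sigma> f c (x, \<bar>z\<bar>)" by (rule pbound_closed_strip[OF d f _ z]) (rule b)
  moreover have "pbound \<sigma> f c (x, - z) \<longleftrightarrow> pbound \<sigma> f c (x, z)" using 2[of "(x, z)"] by (simp add: diag_map_def)
  ultimately show ?thesis using 3 by (cases "0 \<le> z") auto
qed

context branch
begin

lemma even_extension_exists:
  assumes "dcrit k < d" "d < dcrit k + l"
  shows "\<exists>\<Upsilon>. even_extension d (\<Psi> d) \<Upsilon>"
  using sym_extension[OF assms] unfolding even_extension_def by blast

lemma pbound_branch:
  assumes d: "dcrit k < d" "d < dcrit k + l" and Y: "even_extension d (\<Psi> d) \<Upsilon>"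
    and b: "wbound \<sigma>' d (\<lambda>p. \<Psi> d p - S0 p) r" and p: "p \<in> strip d" and \<tau>: "\<tau> \<le> \<sigma>'" "\<tau> \<le> 1 / sqrt 2"
  shows "pbound \<tau> \<Upsilon> (r + 2) p"
proof -
  have m: "exp (\<tau> * \<bar>x\<bar>) * cmod z \<le> exp (\<sigma>' * \<bar>x\<bar>) * cmod z" for x z
    using \<tau>(1) by (intro mult_right_mono) (auto intro: mult_right_mono)
  have "pbound \<sigma>' (\<lambda>p. \<Psi> d p - S0 p) r p" using b p by (simp add: wbound_iff)
  then have "pbound \<tau> (\<lambda>p. \<Psi> d p - S0 p) r p"
    unfolding pbound_def using order_trans[OF m] by blast
  then have "pbound \<tau> (\<lambda>p. (\<Psi> d p - S0 p) + S0 p) (r + 2) p"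
    by (intro pbound_add[OF open_strip C2_on_diff[OF open_strip C2_branch[OF d] C2_on_strip] C2_on_strip p] S0_C2(1) pbound_S0 \<tau>(2))
  then show ?thesis using pbound_cong[of d \<Upsilon> "\<Psi> d", OF even_extensionD(3)[OF Y] p] by simp
qed

text \<open>With weight at least 1 / sqrt 2, the uniform bound from the ball of
  \<open>uniqueness\<close> feeds \<open>mode_decay_estimate\<close>. At a fixed \<open>x0\<close>
  both sides of that estimate are of first order in the amplitude, but the factor on the right can
  be made as small as desired by the choice of \<open>x0\<close>.\<close>

lemma weight_less_decay: "\<sigma> < 1 / sqrt 2"
proof (rule ccontr)
  assume "\<not> \<sigma> < 1 / sqrt 2"
  define a :: real where "a = 1 / sqrt 2"
  have a\<sigma>: "a \<le> \<sigma>" using \<open>\<not> \<sigma> < 1 / sqrt 2\<close> by (simp add: a_def)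
  have a0: "0 < a" "a \<le> 1" by (simp_all add: a_def)
  have a4: "1 / 2 < a"
  proof -
    have "sqrt 2 < sqrt 4" by (rule real_sqrt_less_mono) simp
    then show ?thesis by (simp add: a_def)
  qed
  obtain r where r: "0 < r" and u: "\<forall>d. dcrit k < d \<and> d < dcrit k + l \<longrightarrow>
     admissible_solution \<sigma> d S0 \<and> W2inf_norm \<sigma> d (\<lambda>p. \<Psi> d p - S0 p) < ennreal r \<and>
     (\<forall>\<psi>. admissible_solution \<sigma> d \<psi> \<and> W2inf_norm \<sigma> d (\<lambda>p. \<psi> p - S0 p) < ennreal r \<longrightarrow>
        (\<forall>p\<in>strip d. \<psi> p = S0 p) \<or> (\<forall>p\<in>strip d. \<psi> p = \<Psi> d p) \<or> (\<forall>p\<in>strip d. \<psi> p = cnj (\<Psi> d p)))"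
    using uniqueness by blast
  obtain X where X: "0 < X" "\<forall>\<^sub>F d in at_right (dcrit k). \<forall>p\<in>strip d. X \<le> \<bar>fst p\<bar> \<longrightarrow> 1 / 2 \<le> cmod (\<Psi> d p)"
    by (rule eventually_far)
  obtain C where C: "0 \<le> C" "\<forall>\<^sub>F d in at_right (dcrit k). dcrit k < d \<and> d < dcrit k + l \<and>
    (\<forall>p\<in>strip d. \<bar>Re (\<Psi> d p) - kink (fst p)\<bar> \<le> C * (d - dcrit k)
      \<and> \<bar>Im (\<Psi> d p) - amp \<Lambda> k d * mode (pi * real k / d) p\<bar> \<le> C * (d - dcrit k)
      \<and> \<bar>Re (partial (1, 0) (\<Psi> d) p) - (1 - (kink (fst p))\<^sup>2) / sqrt 2\<bar> \<le> C * (d - dcrit k)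
      \<and> \<bar>Im (partial (1, 0) (\<Psi> d) p) - amp \<Lambda> k d * partial (1, 0) (mode (pi * real k / d)) p\<bar> \<le> C * (d - dcrit k)
      \<and> \<bar>Im (partial (0, 1) (\<Psi> d) p) - amp \<Lambda> k d * partial (0, 1) (mode (pi * real k / d)) p\<bar> \<le> C * (d - dcrit k))"
    by (rule pointwise_expansion)
  \<comment> \<open>\<open>r\<close> bounds the distance to \<open>S0\<close> for all
    \<open>d\<close>, 2 bounds \<open>S0\<close> itself as in \<open>pbound_S0\<close>, and
    \<open>D\<close> bounds the widths considered.\<close>
  define K N D where "K = r + 2" and "N = 4 + 4 * K" and "D = 2 * dcrit k"
  define c where "c = C * (dcrit k / \<Lambda>\<^sup>2)"
  define b where "b = sqrt (3 * N * (K / a + D * K) * c)"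
  have dk: "0 < dcrit k" by (rule dcrit_pos[OF k])
  have pos: "0 < K" "0 < N" "0 < D" "0 \<le> c" "0 \<le> b" using r dk C(1) a0 by (simp_all add: K_def N_def D_def c_def b_def)
  \<comment> \<open>\<open>x0\<close> is fixed before \<open>d\<close>: the right-hand side per unit
    of amplitude becomes smaller than 1 / 64. Afterwards \<open>d\<close> is brought so close to
    \<open>dcrit k\<close> that exp ((mu - a) x0) is near 1 and the errors at \<open>x0\<close> are
    negligible.\<close>
  have "((\<lambda>x. 4 * K * (2 / a * exp (- a * x) + 2 / a * b * exp (- (a / 2) * x))) \<longlongrightarrow> 4 * K * (2 / a * 0 + 2 / a * b * 0)) at_top"
    using a0 by (intro tendsto_intros exp_neg_tendsto_0) auto
  then have "\<forall>\<^sub>F x in at_top. 4 * K * (2 / a * exp (- a * x) + 2 / a * b * exp (- (a / 2) * x)) < 1 / 64"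
    by (rule order_tendstoD) simp
  with eventually_ge_at_top[of X]
  have "\<forall>\<^sub>F x in at_top. X \<le> x \<and> 4 * K * (2 / a * exp (- a * x) + 2 / a * b * exp (- (a / 2) * x)) < 1 / 64"
    by (rule eventually_conj)
  then obtain x0 where x0: "X \<le> x0" "4 * K * (2 / a * exp (- a * x0) + 2 / a * b * exp (- (a / 2) * x0)) < 1 / 64"
    using eventually_happens'[OF trivial_limit_at_top_linorder] by blast
  have "((\<lambda>d. pi * real k / d) \<longlongrightarrow> pi * real k / dcrit k) (at_right (dcrit k))"
    using dk by (intro tendsto_intros) auto
  moreover have "pi * real k / dcrit k = a" using k by (simp add: dcrit_def a_def)
  ultimately have \<mu>t: "((\<lambda>d. pi * real k / d) \<longlongrightarrow> a) (at_right (dcrit k))" by simp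
  have "((\<lambda>d. exp ((pi * real k / d - a) * x0)) \<longlongrightarrow> exp ((a - a) * x0)) (at_right (dcrit k))"
    by (intro tendsto_intros \<mu>t)
  then have ev1: "\<forall>\<^sub>F d in at_right (dcrit k). 1 / 2 < exp ((pi * real k / d - a) * x0)"
    by (rule order_tendstoD) simp
  have ev2: "\<forall>\<^sub>F d in at_right (dcrit k). 1 / 4 < pi * real k / d"
    using \<mu>t by (rule order_tendstoD) (use a4 in simp)
  have ev3: "\<forall>\<^sub>F d in at_right (dcrit k). exp x0 * N * C * (d - dcrit k) < 1 / 64 * amp \<Lambda> k d"
    by (rule eventually_dist_small) simp
  have ev4: "\<forall>\<^sub>F d in at_right (dcrit k). C * (d - dcrit k) < 1 * amp \<Lambda> k d"
    by (rule eventually_dist_small) simp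
  have ev5: "\<forall>\<^sub>F d in at_right (dcrit k). amp \<Lambda> k d < 1" by (rule eventually_amp_small) simp
  have ev6: "\<forall>\<^sub>F d in at_right (dcrit k). dcrit k < d \<and> d < dcrit k + dcrit k" by (rule eventually_range[OF dk])
  obtain d where d: "dcrit k < d" "d < dcrit k + l" "d < dcrit k + dcrit k"
    and e1: "1 / 2 < exp ((pi * real k / d - a) * x0)" and e2: "1 / 4 < pi * real k / d"
    and e3: "exp x0 * N * C * (d - dcrit k) < 1 / 64 * amp \<Lambda> k d" and e4: "C * (d - dcrit k) < 1 * amp \<Lambda> k d" "amp \<Lambda> k d < 1"
    and ex: "\<And>p. p \<in> strip d \<Longrightarrow> \<bar>Re (\<Psi> d p) - kink (fst p)\<bar> \<le> C * (d - dcrit k)"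
      "\<And>p. p \<in> strip d \<Longrightarrow> \<bar>Im (\<Psi> d p) - amp \<Lambda> k d * mode (pi * real k / d) p\<bar> \<le> C * (d - dcrit k)"
      "\<And>p. p \<in> strip d \<Longrightarrow> \<bar>Im (partial (1, 0) (\<Psi> d) p) - amp \<Lambda> k d * partial (1, 0) (mode (pi * real k / d)) p\<bar> \<le> C * (d - dcrit k)"
    and far: "\<And>p. p \<in> strip d \<Longrightarrow> X \<le> \<bar>fst p\<bar> \<Longrightarrow> 1 / 2 \<le> cmod (\<Psi> d p)"
    using eventually_happens'[OF trivial_limit_at_right_real eventually_conj[OF ev1 eventually_conj[OF ev2 eventually_conj[OF ev3
      eventually_conj[OF ev4 eventually_conj[OF ev5 eventually_conj[OF ev6 eventually_conj[OF X(2) C(2)]]]]]]]] by blast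
  define A \<eta> \<mu> where "A = amp \<Lambda> k d" and "\<eta> = C * (d - dcrit k)" and "\<mu> = pi * real k / d"
  have d0: "0 < d" by (rule d_pos[OF d(1)])
  have A: "0 < A" using amp_pos[OF d(1)] by (simp add: A_def)
  have \<eta>: "0 \<le> \<eta>" "\<eta> \<le> 1" using C(1) d(1) e4 by (simp_all add: \<eta>_def)
  have \<mu>: "0 < \<mu>" "\<mu> < a" "\<mu> \<le> 1" using wave_number_bounds[OF k d(1)] by (simp_all add: \<mu>_def a_def)
  have sin: "sin (\<mu> * d) = 0" using d0 by (simp add: \<mu>_def mult.commute)
  obtain \<Upsilon> where Y: "even_extension d (\<Psi> d) \<Upsilon>" using even_extension_exists[OF d(1,2)] by blast
  note Y2 = even_extensionD(2)[OF Y] and YE = even_extensionD(3)[OF Y]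
  have "W2inf_norm \<sigma> d (\<lambda>p. \<Psi> d p - S0 p) \<le> ennreal r" using u d by (simp add: less_imp_le)
  then have "wbound \<sigma> d (\<lambda>p. \<Psi> d p - S0 p) r"
    using r by (intro wbound_of_W2inf_norm C2_on_diff open_strip C2_branch d C2_on_strip S0_C2(1)) auto
  then have pb: "pbound a \<Upsilon> K p" if "p \<in> closed_strip d" for p
    unfolding K_def using a\<sigma> by (intro pbound_closed_strip[OF d0 Y2 _ that] pbound_branch[OF d(1,2) Y]) (auto simp: a_def)
  have cont: "continuous_on UNIV (\<lambda>p. \<bar>Re (\<Upsilon> p) - kink (fst p)\<bar>)"
    "continuous_on UNIV (\<lambda>p. \<bar>Im (\<Upsilon> p) - A * mode \<mu> p\<bar>)"
    "continuous_on UNIV (\<lambda>p. \<bar>Im (partial (1, 0) \<Upsilon> p) - A * partial (1, 0) (mode \<mu>) p\<bar>)"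
    "continuous_on UNIV (\<lambda>p. - cmod (\<Upsilon> p))"
  proof -
    have B: "(1, 0) \<in> (Basis :: plane set)" by (simp add: Basis_plane)
    have k: "continuous_on UNIV (\<lambda>p. Re (S0 p))" by (intro continuous_intros C2_on_continuous[OF S0_C2(1)])
    then show "continuous_on UNIV (\<lambda>p. \<bar>Re (\<Upsilon> p) - kink (fst p)\<bar>)"
      by (intro continuous_intros C2_on_continuous[OF Y2]) (simp add: S0_eq)
    show "continuous_on UNIV (\<lambda>p. \<bar>Im (\<Upsilon> p) - A * mode \<mu> p\<bar>)"
      by (intro continuous_intros C2_on_continuous[OF Y2] C2_on_continuous[OF mode_C2(1)])
    show "continuous_on UNIV (\<lambda>p. \<bar>Im (partial (1, 0) \<Upsilon> p) - A * partial (1, 0) (mode \<mu>) p\<bar>)"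
      by (intro continuous_intros C1_on_continuous[OF C2_on_C1_partial[OF _ B]] Y2 mode_C2(1))
    show "continuous_on UNIV (\<lambda>p. - cmod (\<Upsilon> p))" by (intro continuous_intros C2_on_continuous[OF Y2])
  qed
  have p1: "partial (1, 0) \<Upsilon> p = partial (1, 0) (\<Psi> d) p" if "p \<in> strip d" for p
    using YE by (intro partial_cong(1)[OF open_strip that])
  have est: "exp (\<mu> * x0) * (A * \<mu> * exp (- a * x0) / 2 - N * \<eta>)
    \<le> 4 * K * (2 * A / a * exp (- a * x0) + 2 / a * sqrt (3 * N * (K / a + d * K) * \<eta>) * exp (- (a / 2) * x0))"
    unfolding N_def a_def
  proof (rule mode_decay_estimate[OF even_extensionD(1)[OF Y] even_extensionD(4,7)[OF Y] d0 \<mu>(1) \<mu>(2)[unfolded a_def] sin])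
    fix p assume p: "p \<in> closed_strip d"
    show "exp (1 / sqrt 2 * \<bar>fst p\<bar>) * cmod (partial v \<Upsilon> p) \<le> K" if "v \<in> Basis" for v
      using pboundD(2)[OF pb[OF p] that] by (simp add: a_def)
    show "exp (1 / sqrt 2 * \<bar>fst p\<bar>) * cmod (partial w (partial v \<Upsilon>) p) \<le> K" if "v \<in> Basis" "w \<in> Basis" for v w
      using pboundD(3)[OF pb[OF p] that] by (simp add: a_def)
    show "cmod (\<Upsilon> p) \<le> K" by (rule pboundD(1)[OF pb[OF p]])
    show "\<bar>Re (\<Upsilon> p) - kink (fst p)\<bar> \<le> \<eta>"
      by (rule closed_strip_le[OF d0 cont(1) _ p]) (simp add: YE ex \<eta>_def)
    show "\<bar>Im (\<Upsilon> p) - A * mode \<mu> p\<bar> \<le> \<eta>"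
      by (rule closed_strip_le[OF d0 cont(2) _ p]) (simp add: YE ex \<eta>_def A_def \<mu>_def)
    show "\<bar>Im (partial (1, 0) \<Upsilon> p) - A * partial (1, 0) (mode \<mu>) p\<bar> \<le> \<eta>"
      by (rule closed_strip_le[OF d0 cont(3) _ p]) (simp add: p1 ex \<eta>_def A_def \<mu>_def)
  next
    fix p assume p: "p \<in> closed_strip d" "X \<le> fst p"
    show "1 / 2 \<le> cmod (\<Upsilon> p)"
      by (rule closed_strip_far[OF d0 C2_on_continuous[OF Y2] _ p], subst YE, assumption, rule far) simp_all
  qed (use A \<eta> X x0 in auto)
  define E1 E2 where "E1 = exp (- a * x0)" and "E2 = exp (- (a / 2) * x0)"
  have E: "0 < E1" "0 < E2" by (simp_all add: E1_def E2_def)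
  \<comment> \<open>\<open>\<eta>\<close> is quadratic in the amplitude, so its square root is
    linear and the amplitude cancels.\<close>
  have "sqrt (3 * N * (K / a + d * K) * \<eta>) \<le> b * A"
  proof -
    have \<eta>A: "\<eta> = c * A\<^sup>2" unfolding \<eta>_def c_def A_def dist_eq_amp[OF d(1)] by simp
    have "3 * N * (K / a + d * K) * \<eta> \<le> 3 * N * (K / a + D * K) * \<eta>"
      using pos d(3) \<eta> by (intro mult_right_mono mult_left_mono add_left_mono) (auto simp: D_def)
    also have "\<dots> = 3 * N * (K / a + D * K) * c * A\<^sup>2" by (simp add: \<eta>A)
    finally have "sqrt (3 * N * (K / a + d * K) * \<eta>) \<le> sqrt (3 * N * (K / a + D * K) * c * A\<^sup>2)"
      by (rule real_sqrt_le_mono)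
    also have "\<dots> = b * A" unfolding real_sqrt_mult[of _ "A\<^sup>2"] b_def using A by simp
    finally show ?thesis .
  qed
  then have "2 / a * sqrt (3 * N * (K / a + d * K) * \<eta>) * E2 \<le> 2 / a * (b * A) * E2"
    using a0 E by (intro mult_right_mono mult_left_mono) auto
  then have "2 * A / a * E1 + 2 / a * sqrt (3 * N * (K / a + d * K) * \<eta>) * E2 \<le> 2 * A / a * E1 + 2 / a * (b * A) * E2"
    by (rule add_left_mono)
  then have "4 * K * (2 * A / a * E1 + 2 / a * sqrt (3 * N * (K / a + d * K) * \<eta>) * E2)
      \<le> 4 * K * (2 * A / a * E1 + 2 / a * (b * A) * E2)"
    using pos by (intro mult_left_mono) auto
  also have "\<dots> = A * (4 * K * (2 / a * E1 + 2 / a * b * E2))" by (simp add: algebra_simps)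
  also have "\<dots> \<le> A * (1 / 64)" using x0(2) A by (intro mult_left_mono) (auto simp: E1_def E2_def)
  finally have rhs: "exp (\<mu> * x0) * (A * \<mu> * E1 / 2 - N * \<eta>) \<le> A / 64" using est by (simp add: E1_def E2_def)
  have "exp (\<mu> * x0) * (N * \<eta>) \<le> exp x0 * (N * \<eta>)"
    using \<mu> X x0(1) pos \<eta> by (intro mult_right_mono) (auto simp: mult_le_cancel_right1)
  also have "\<dots> \<le> A / 64" using e3 by (simp add: \<eta>_def A_def mult_ac)
  finally have small: "exp (\<mu> * x0) * (N * \<eta>) \<le> A / 64" .
  have "exp (\<mu> * x0) * E1 = exp ((\<mu> - a) * x0)" by (simp add: E1_def algebra_simps flip: exp_add)
  then have "1 / 2 \<le> exp (\<mu> * x0) * E1" using e1 by (simp add: \<mu>_def)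
  then have "1 / 4 * (1 / 2) \<le> \<mu> * (exp (\<mu> * x0) * E1)" using e2 \<mu>(1) E(1) by (intro mult_mono) (auto simp flip: \<mu>_def)
  then have "A * (1 / 8) \<le> A * (\<mu> * (exp (\<mu> * x0) * E1))" using A by (intro mult_left_mono) auto
  moreover have "exp (\<mu> * x0) * (A * \<mu> * E1 / 2 - N * \<eta>)
      = A * (\<mu> * (exp (\<mu> * x0) * E1)) / 2 - exp (\<mu> * x0) * (N * \<eta>)" by (simp add: algebra_simps)
  \<comment> \<open>The left side is at least A / 16 - A / 64, the right side at most A /
    64.\<close>
  ultimately show False using rhs small A by linarith
qed

end

subsection \<open>Uniform decay of the extended branch\<close>

lemma pbound_uminus:
  assumes "C2_on UNIV f"
  shows "pbound \<sigma> (\<lambda>p. - f p) c p \<longleftrightarrow> pbound \<sigma> f c p"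
proof -
  have L: "bounded_linear (\<lambda>z :: complex. - z)" by (intro bounded_linear_minus bounded_linear_ident)
  have 1: "partial v (\<lambda>p. - f p) p = - partial v f p" for v
    by (rule partial_linear(1)[OF L C2_on_differentiable[OF assms UNIV_I]])
  have 2: "partial w (partial v (\<lambda>p. - f p)) p = - partial w (partial v f) p" if "v \<in> Basis" for v w
    by (rule partial2_linear[OF L open_UNIV assms UNIV_I that])
  show ?thesis unfolding pbound_def 1 norm_minus_cancel by (simp add: 2)
qed

lemma pbound_diff:
  assumes f: "C2_on UNIV f" and g: "C2_on UNIV g" and b: "pbound \<sigma> f c p" "pbound \<sigma> g c' p"
  shows "pbound \<sigma> (\<lambda>p. f p - g p) (c + c') p"
proof -
  have g': "C2_on UNIV (\<lambda>p. - g p)" by (rule C2_on_minus[OF open_UNIV g])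
  have "pbound \<sigma> (\<lambda>p. - g p) c' p" using b(2) by (simp only: pbound_uminus[OF g])
  then have "pbound \<sigma> (\<lambda>p. f p + - g p) (c + c') p" by (rule pbound_add[OF open_UNIV f g' UNIV_I b(1)])
  then show ?thesis by simp
qed

lemma period_fold:
  assumes "0 < (d::real)"
  obtains z and m :: int where "0 \<le> z" "z \<le> d" "y = z + 2 * d * of_int m \<or> y = - z + 2 * d * of_int m"
proof -
  obtain m :: int where m: "- d \<le> y + of_int m * (2 * d)" "y + of_int m * (2 * d) \<le> - d + 2 * d"
    using reduce_mod_period[of "2 * d" "- d" y] assms by auto
  show thesis
    by (rule that[of "\<bar>y + of_int m * (2 * d)\<bar>" "- m"]) (use m in \<open>auto simp: algebra_simps abs_if\<close>)
qed

lemma even_extension_fold: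
  assumes "even_extension d \<psi> \<Upsilon>" "y = z + 2 * d * of_int m \<or> y = - z + 2 * d * of_int m"
  shows "\<Upsilon> (x, y) = \<Upsilon> (x, z)"
  using assms(2) even_extensionD(4,5)[OF assms(1)] by (elim disjE) (simp_all only:)

lemma even_extension_symmetric:
  assumes Y: "even_extension d \<psi> \<Upsilon>" and d: "0 < d"
    and sym: "\<And>x y. (x, y) \<in> strip d \<Longrightarrow> \<psi> (- x, y) = - cnj (\<psi> (x, y))"
  shows "\<Upsilon> (- x, y) = - cnj (\<Upsilon> (x, y))"
proof -
  note c = C2_on_continuous[OF even_extensionD(2)[OF Y]]
  have "continuous_on UNIV (\<lambda>p. \<Upsilon> (- fst p, snd p) + cnj (\<Upsilon> p))"
    by (intro continuous_intros continuous_on_compose2[OF c] c) simp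
  then have cc: "continuous_on (closed_strip d) (\<lambda>p. \<Upsilon> (- fst p, snd p) + cnj (\<Upsilon> p))"
    by (rule continuous_on_subset) simp
  have 0: "\<Upsilon> (- fst p, snd p) + cnj (\<Upsilon> p) = 0" if p: "p \<in> strip d" for p
  proof -
    have q: "(fst p, snd p) \<in> strip d" "(- fst p, snd p) \<in> strip d" using p by (auto simp: strip_def)
    show ?thesis using even_extensionD(3)[OF Y q(1)] even_extensionD(3)[OF Y q(2)] sym[OF q(1)] by simp
  qed
  obtain z m where z: "0 \<le> z" "z \<le> d" "y = z + 2 * d * of_int m \<or> y = - z + 2 * d * of_int m" by (rule period_fold[OF d])
  have "(x, z) \<in> closed_strip d" using z by (simp add: mem_closed_strip)
  from closed_strip_zero[OF d cc 0 this]
  have "\<Upsilon> (- x, z) = - cnj (\<Upsilon> (x, z))" by (simp add: eq_neg_iff_add_eq_0)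
  then show ?thesis by (simp only: even_extension_fold[OF Y z(3)])
qed

text \<open>Modulo the period \<open>2 * d\<close> and evenness, adding \<open>d\<close> to a height
  is the reflection about the middle line of the strip, where the invariance applies.\<close>

lemma even_extension_shift:
  assumes Y: "even_extension d \<psi> \<Upsilon>" and d: "0 < d"
    and R: "\<And>p. p \<in> strip d \<Longrightarrow> reflection d \<psi> p = \<psi> p"
  shows "\<Upsilon> (x, y + d) = cnj (\<Upsilon> (x, y))"
proof -
  note c = C2_on_continuous[OF even_extensionD(2)[OF Y]]
  have "continuous_on UNIV (\<lambda>p. cnj (\<Upsilon> (fst p, d - snd p)) - \<Upsilon> p)"
    by (intro continuous_intros continuous_on_compose2[OF c] c) simp
  then have cc: "continuous_on (closed_strip d) (\<lambda>p. cnj (\<Upsilon> (fst p, d - snd p)) - \<Upsilon> p)"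
    by (rule continuous_on_subset) simp
  have 0: "cnj (\<Upsilon> (fst p, d - snd p)) - \<Upsilon> p = 0" if p: "p \<in> strip d" for p
  proof -
    have q: "(fst p, d - snd p) \<in> strip d" using p by (auto simp: strip_def)
    have "reflection d \<psi> p = cnj (\<psi> (fst p, d - snd p))" by (simp add: reflection_def split_beta)
    then show ?thesis using even_extensionD(3)[OF Y p] even_extensionD(3)[OF Y q] R[OF p] by simp
  qed
  obtain z m where z: "0 \<le> z" "z \<le> d" "y = z + 2 * d * of_int m \<or> y = - z + 2 * d * of_int m" by (rule period_fold[OF d])
  have "(x, z) \<in> closed_strip d" using z by (simp add: mem_closed_strip)
  from closed_strip_zero[OF d cc 0 this]
  have "cnj (\<Upsilon> (x, d - z)) = \<Upsilon> (x, z)" by simp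
  then have r: "\<Upsilon> (x, d - z) = cnj (\<Upsilon> (x, z))" by (metis complex_cnj_cnj)
  have "y + d = - (d - z) + 2 * d * of_int (m + 1) \<or> y + d = (d - z) + 2 * d * of_int m"
    using z(3) by (auto simp: algebra_simps)
  then have "\<Upsilon> (x, y + d) = \<Upsilon> (x, d - z)"
    using even_extension_fold[OF Y, of "y + d" "d - z" "m + 1" x] even_extension_fold[OF Y, of "y + d" "d - z" m x] by blast
  then show ?thesis by (simp only: r even_extension_fold[OF Y z(3)])
qed

lemma kink_far:
  assumes "0 < e"
  shows "\<exists>X\<ge>0. (\<forall>x\<ge>X. 1 - e \<le> kink x) \<and> (\<forall>x. X \<le> \<bar>x\<bar> \<longrightarrow> 1 - e \<le> \<bar>kink x\<bar>)"
proof -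
  have "((\<lambda>x. 2 * exp (- (1 / sqrt 2) * x)) \<longlongrightarrow> 2 * 0) at_top" by (intro tendsto_intros exp_neg_tendsto_0) simp
  then have "\<forall>\<^sub>F x in at_top. 2 * exp (- (1 / sqrt 2) * x) < e" by (rule order_tendstoD) (use assms in simp)
  then obtain X0 where X0: "\<And>x. X0 \<le> x \<Longrightarrow> 2 * exp (- (1 / sqrt 2) * x) < e" unfolding eventually_at_top_linorder by blast
  have 1: "1 - e \<le> kink x" if "max X0 0 \<le> x" for x
    using X0[of x] kink_ge(1)[of x] that by simp
  have "1 - e \<le> \<bar>kink x\<bar>" if "max X0 0 \<le> \<bar>x\<bar>" for x
  proof -
    have "\<bar>x\<bar> / sqrt 2 = \<bar>x / sqrt 2\<bar>" by simp
    then have "\<bar>kink x\<bar> = kink \<bar>x\<bar>" by (simp only: kink_def tanh_real_abs)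
    then show ?thesis using 1[OF that] by simp
  qed
  with 1 show ?thesis by (intro exI[of _ "max X0 0"]) auto
qed

text \<open>The weighted bound with \<open>\<sigma>\<close> and \<open>K\<close> only supplies the
  limits at infinity that the comparison requires; neither number appears in the conclusion. The
  factor 2 combines real and imaginary part.\<close>

lemma right_decay:
  assumes Y: "even_extension d \<psi> \<Upsilon>" and d: "0 < d"
    and anti: "\<And>x y. \<Upsilon> (x, y + d) = cnj (\<Upsilon> (x, y))"
    and near: "\<And>p. X \<le> fst p \<Longrightarrow> cmod (\<Upsilon> p - 1) \<le> \<theta> / 10" and X: "0 \<le> X"
    and M: "\<And>p. pbound 0 \<Upsilon> M p" and dec: "\<And>p. pbound \<sigma> \<Upsilon> K p" and \<sigma>: "0 < \<sigma>"
    and \<tau>: "0 < \<tau>" "\<tau> < a" "a\<^sup>2 \<le> 1 / 2" and \<theta>: "\<theta> = (a\<^sup>2 - \<tau>\<^sup>2) / 2"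
    and \<beta>: "a * (d / 2) \<le> \<beta>" "\<beta> < pi / 2"
    and p: "X + 2 \<le> fst p" and v: "v \<in> Basis"
  shows "exp (\<tau> * fst p) * cmod (partial v \<Upsilon> p) \<le> 2 * gl_decay.K1 \<tau> (cos \<beta>) X M \<theta>"
    "w \<in> Basis \<Longrightarrow> exp (\<tau> * fst p) * cmod (partial w (partial v \<Upsilon>) p) \<le> 2 * gl_decay.K2 \<tau> (cos \<beta>) X M \<theta>"
proof -
  define u1 where "u1 p = Re (\<Upsilon> p)" for p
  define v1 where "v1 p = Im (\<Upsilon> p)" for p
  note C2 = even_extensionD(2)[OF Y] and GL = even_extensionD(1)[OF Y]
  note dY = C2_on_differentiable[OF C2 UNIV_I]
  note Re = bounded_linear_Re and Im = bounded_linear_Im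
  have pu: "partial v u1 p = Re (partial v \<Upsilon> p)" "partial v v1 p = Im (partial v \<Upsilon> p)" for v p
    unfolding u1_def[abs_def] v1_def[abs_def] by (rule partial_linear(1)[OF Re dY] partial_linear(1)[OF Im dY])+
  have pu2: "partial w (partial v u1) p = Re (partial w (partial v \<Upsilon>) p)" "partial w (partial v v1) p = Im (partial w (partial v \<Upsilon>) p)"
    if "v \<in> Basis" for v w p
    unfolding u1_def[abs_def] v1_def[abs_def]
    by (rule partial2_linear[OF Re open_UNIV C2 UNIV_I that] partial2_linear[OF Im open_UNIV C2 UNIV_I that])+
  \<comment> \<open>\<open>\<theta>\<close> is half the gap between \<open>a\<^sup>2\<close> and
    \<open>\<tau>\<^sup>2\<close>: one half absorbs the defect, the other half remains as the
    margin, so \<open>\<kappa> = \<theta>\<close>.\<close>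
  have a0: "0 < a" using \<tau> by linarith
  have "\<tau>\<^sup>2 < a\<^sup>2" using \<tau> by (intro power_strict_mono) auto
  moreover have "0 < (A - T) / 2 \<and> (A - T) / 2 \<le> 1 / 4 \<and> T - A + (A - T) / 2 \<le> - ((A - T) / 2) \<and>
      T + (A - T) / 2 - 81 / 50 \<le> - ((A - T) / 2)" if "T < A" "A \<le> 1 / 2" "0 \<le> T" for A T :: real
    using that by (simp add: field_simps)
  ultimately have "0 < \<theta> \<and> \<theta> \<le> 1 / 4 \<and> \<tau>\<^sup>2 - a\<^sup>2 + \<theta> \<le> - \<theta> \<and> \<tau>\<^sup>2 + \<theta> - 81 / 50 \<le> - \<theta>"
    using \<tau>(3) zero_le_power2[of \<tau>] unfolding \<theta> by blast
  then have \<theta>0: "0 < \<theta>" "\<theta> \<le> 1 / 4" and \<kappa>: "\<tau>\<^sup>2 - a\<^sup>2 + \<theta> \<le> - \<theta>" "\<tau>\<^sup>2 + \<theta> - 81 / 50 \<le> - \<theta>" by blast+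
  have \<beta>0: "0 < \<beta>" using \<beta>(1) a0 d by (meson less_le_trans mult_pos_pos half_gt_zero)
  have sq: "(cmod z)\<^sup>2 = (Re z)\<^sup>2 + (Im z)\<^sup>2" for z by (simp add: cmod_power2)
  have lap: "laplacian \<Upsilon> p = - (\<Upsilon> p * complex_of_real (1 - (u1 p)\<^sup>2 - (v1 p)\<^sup>2))" for p
  proof -
    have "laplacian \<Upsilon> p + \<Upsilon> p * complex_of_real (1 - (cmod (\<Upsilon> p))\<^sup>2) = 0" using GL unfolding GL_solution_def by blast
    then show ?thesis
      unfolding sq by (simp add: eq_neg_iff_add_eq_0 u1_def v1_def diff_diff_eq del: of_real_diff of_real_power of_real_add)
  qed
  have parts: "\<bar>u1 p - 1\<bar> \<le> \<theta> / 10" "\<bar>v1 p\<bar> \<le> \<theta> / 10" if "X \<le> fst p" for p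
    using order_trans[OF abs_Re_le_cmod near[OF that]] order_trans[OF abs_Im_le_cmod near[OF that]] by (simp_all add: u1_def v1_def)
  have wle: "\<bar>1 - (u1 p)\<^sup>2 - (v1 p)\<^sup>2\<bar> \<le> \<theta>" if "X \<le> fst p" for p
  proof -
    note n = parts[OF that]
    have "1 - (u1 p)\<^sup>2 - (v1 p)\<^sup>2 = - (2 * (u1 p - 1) + (u1 p - 1) * (u1 p - 1) + v1 p * v1 p)"
      by (simp add: power2_eq_square algebra_simps)
    moreover have "\<bar>(u1 p - 1) * (u1 p - 1)\<bar> \<le> \<theta> / 10 * 1" "\<bar>v1 p * v1 p\<bar> \<le> \<theta> / 10 * 1"
      unfolding abs_mult using n \<theta>0 by (intro mult_mono'; linarith)+
    moreover have "\<bar>- (2 * A + B + C)\<bar> \<le> \<theta>" if "\<bar>A\<bar> \<le> \<theta> / 10" "\<bar>B\<bar> \<le> \<theta> / 10 * 1" "\<bar>C\<bar> \<le> \<theta> / 10 * 1" for A B C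
      using that \<theta>0 by linarith
    ultimately show ?thesis using n(1) by (simp only:)
  qed
  have dec1: "cmod (partial v \<Upsilon> (x, y)) \<le> K * exp (- \<sigma> * x)" if "v \<in> Basis" "0 \<le> x" for v x y
  proof -
    have "exp (- \<sigma> * x) * (exp (\<sigma> * x) * cmod (partial v \<Upsilon> (x, y))) \<le> exp (- \<sigma> * x) * K"
      using pboundD(2)[OF dec that(1), of "(x, y)"] that by (intro mult_left_mono) auto
    moreover have "exp (- \<sigma> * x) * (exp (\<sigma> * x) * r) = exp (- \<sigma> * x + \<sigma> * x) * r" for r by (simp only: exp_add mult.assoc)
    moreover have "exp (- \<sigma> * x + \<sigma> * x) = 1" by simp
    ultimately show ?thesis by (simp only: mult_1 mult.commute[of K])
  qed
  have K0: "0 \<le> K" using order_trans[OF norm_ge_zero pboundD(1)[OF dec]] .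
  \<comment> \<open>Evenness about \<open>d\<close> combined with the conjugating shift makes the
    value at the middle height real. With the decay of the y-derivative this gives the limit of the
    imaginary part.\<close>
  have mid: "v1 (x, d / 2) = 0" for x
  proof -
    have e: "2 * d - d / 2 = d / 2 + d" by simp
    have "\<Upsilon> (x, d / 2) = cnj (\<Upsilon> (x, d / 2))" using even_extensionD(7)[OF Y, of x "d / 2"] unfolding e anti by simp
    from arg_cong[OF this, of Im] show ?thesis by (simp add: v1_def)
  qed
  have v_le: "\<bar>v1 (x, y)\<bar> \<le> (K * d) * exp (- \<sigma> * x)" if x: "0 \<le> x" for x y
  proof -
    obtain z m where z: "0 \<le> z" "z \<le> d" "y = z + 2 * d * of_int m \<or> y = - z + 2 * d * of_int m" by (rule period_fold[OF d])
    have "norm (\<Upsilon> (x, z) - \<Upsilon> (x, d / 2)) \<le> (K * exp (- \<sigma> * x)) * norm (z - d / 2)"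
    proof (rule differentiable_bound[of UNIV])
      show "((\<lambda>y. \<Upsilon> (x, y)) has_derivative (\<lambda>h. h *\<^sub>R partial (0, 1) \<Upsilon> (x, z))) (at z within UNIV)" for z
        using has_vector_derivative_snd[OF dY] by (simp add: has_vector_derivative_def)
      show "onorm (\<lambda>h. h *\<^sub>R partial (0, 1) \<Upsilon> (x, z)) \<le> K * exp (- \<sigma> * x)" for z
        using dec1[OF _ x] by (simp add: onorm_scaleR_left[OF bounded_linear_ident] onorm_id Basis_plane)
    qed auto
    also have "\<dots> \<le> (K * exp (- \<sigma> * x)) * d" using z K0 by (intro mult_left_mono) auto
    finally have "cmod (\<Upsilon> (x, z) - \<Upsilon> (x, d / 2)) \<le> (K * d) * exp (- \<sigma> * x)" by (simp add: mult_ac)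
    then have "\<bar>Im (\<Upsilon> (x, z) - \<Upsilon> (x, d / 2))\<bar> \<le> (K * d) * exp (- \<sigma> * x)" by (rule order_trans[OF abs_Im_le_cmod])
    then show ?thesis using mid[of x] even_extension_fold[OF Y z(3)] by (simp add: v1_def)
  qed
  have lim_v: "\<exists>N\<ge>X. \<forall>x\<ge>N. \<forall>y. \<bar>v1 (x, y)\<bar> \<le> e" if e: "0 < e" for e
  proof -
    have "((\<lambda>x. (K * d) * exp (- \<sigma> * x)) \<longlongrightarrow> (K * d) * 0) at_top" by (intro tendsto_intros exp_neg_tendsto_0 \<sigma>)
    then have "\<forall>\<^sub>F x in at_top. (K * d) * exp (- \<sigma> * x) < e" by (rule order_tendstoD) (use e in simp)
    then obtain N where N: "\<And>x. N \<le> x \<Longrightarrow> (K * d) * exp (- \<sigma> * x) < e" unfolding eventually_at_top_linorder by blast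
    have "\<bar>v1 (x, y)\<bar> \<le> e" if "max N X \<le> x" for x y
    proof -
      have "0 \<le> x" "N \<le> x" using that X by simp_all
      then show ?thesis using v_le[of x y] N[of x] by linarith
    qed
    then show ?thesis by (intro exI[of _ "max N X"]) auto
  qed
  have lim_w: "\<exists>N\<ge>X. \<forall>x\<ge>N. \<forall>y. \<bar>1 - (cmod (\<Upsilon> (x, y)))\<^sup>2\<bar> \<le> e" if e: "0 < e" for e
  proof -
    have "((\<lambda>x. (4 * K) * exp (- \<sigma> * x)) \<longlongrightarrow> (4 * K) * 0) at_top" by (intro tendsto_intros exp_neg_tendsto_0 \<sigma>)
    then have "\<forall>\<^sub>F x in at_top. (4 * K) * exp (- \<sigma> * x) < e" by (rule order_tendstoD) (use e in simp)
    then obtain N where N: "\<And>x. N \<le> x \<Longrightarrow> (4 * K) * exp (- \<sigma> * x) < e" unfolding eventually_at_top_linorder by blast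
    have "\<bar>1 - (cmod (\<Upsilon> (x, y)))\<^sup>2\<bar> \<le> e" if x: "max N X \<le> x" for x y
    proof -
      have "X \<le> fst (x, y)" using x by simp
      then have "1 / 2 \<le> u1 (x, y)" using parts(1)[of "(x, y)"] \<theta>0 by linarith
      then have half: "1 / 2 \<le> cmod (\<Upsilon> (x, y))" using complex_Re_le_cmod[of "\<Upsilon> (x, y)"] by (simp add: u1_def)
      have "exp (\<sigma> * \<bar>x\<bar>) * \<bar>1 - (cmod (\<Upsilon> (x, y)))\<^sup>2\<bar> \<le> 4 * K"
        by (rule GL_defect_le[OF GL UNIV_I half]) (use pboundD(3)[OF dec, of _ _ "(x, y)"] in simp)
      moreover have "\<bar>x\<bar> = x" using x X by simp
      ultimately have "exp (\<sigma> * x) * \<bar>1 - (cmod (\<Upsilon> (x, y)))\<^sup>2\<bar> \<le> 4 * K" by (simp only:)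
      then have "exp (- \<sigma> * x) * (exp (\<sigma> * x) * \<bar>1 - (cmod (\<Upsilon> (x, y)))\<^sup>2\<bar>) \<le> exp (- \<sigma> * x) * (4 * K)"
        by (rule mult_left_mono) simp
      moreover have "exp (- \<sigma> * x) * (exp (\<sigma> * x) * r) = exp (- \<sigma> * x + \<sigma> * x) * r" for r by (simp only: exp_add mult.assoc)
      moreover have "exp (- \<sigma> * x + \<sigma> * x) = 1" by simp
      ultimately have "\<bar>1 - (cmod (\<Upsilon> (x, y)))\<^sup>2\<bar> \<le> (4 * K) * exp (- \<sigma> * x)" by (simp only: mult_1 mult.commute[of "4 * K"])
      moreover have "N \<le> x" using x by simp
      ultimately show ?thesis by (intro order_trans[OF _ less_imp_le[OF N]])
    qed
    then show ?thesis by (intro exI[of _ "max N X"]) auto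
  qed
  interpret gl_decay u1 v1 "\<lambda>p. 1 - (u1 p)\<^sup>2 - (v1 p)\<^sup>2" "d / 2" \<tau> a "cos \<beta>" X M \<theta> \<theta>
  proof (rule gl_decay.intro)
    show "C2_on UNIV u1" "C2_on UNIV v1"
      unfolding u1_def[abs_def] v1_def[abs_def] by (rule C2_on_linear[OF Re open_UNIV C2] C2_on_linear[OF Im open_UNIV C2])+
    have "laplacian u1 p = Re (laplacian \<Upsilon> p)" "laplacian v1 p = Im (laplacian \<Upsilon> p)" for p
      unfolding u1_def[abs_def] v1_def[abs_def]
      by (rule laplacian_linear[OF Re open_UNIV C2 UNIV_I] laplacian_linear[OF Im open_UNIV C2 UNIV_I])+
    then show "laplacian u1 p = - (u1 p * (1 - (u1 p)\<^sup>2 - (v1 p)\<^sup>2))" "laplacian v1 p = - (v1 p * (1 - (u1 p)\<^sup>2 - (v1 p)\<^sup>2))" for p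
      unfolding lap by (simp_all add: u1_def v1_def del: of_real_diff of_real_power)
    show "0 < cos \<beta>" using \<beta> \<beta>0 by (intro cos_gt_zero_pi) auto
    show "cos \<beta> \<le> cos (a * t)" if "\<bar>t\<bar> \<le> d / 2" for t
    proof -
      have "a * \<bar>t\<bar> \<le> a * (d / 2)" by (rule mult_left_mono[OF that]) (use a0 in simp)
      then have "\<bar>a * t\<bar> \<le> \<beta>" using a0 \<beta>(1) by (simp only: abs_mult abs_of_pos order_trans)
      then have "cos \<beta> \<le> cos \<bar>a * t\<bar>" using \<beta> by (intro cos_monotone_0_pi_le) auto
      then show ?thesis by simp
    qed
    show "\<tau>\<^sup>2 - a\<^sup>2 + \<theta> \<le> - \<theta>" "\<tau>\<^sup>2 + \<theta> - 81 / 50 \<le> - \<theta>" by (fact \<kappa>)+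
    show "v1 (x, - y) = v1 (x, y)" for x y by (simp add: v1_def even_extensionD(4)[OF Y])
    show "v1 (x, y + 2 * (d / 2)) = - v1 (x, y)" "u1 (x, y + 2 * (d / 2)) = u1 (x, y)" for x y
      by (simp_all add: v1_def u1_def anti)
    show "\<bar>partial i u1 p\<bar> \<le> M" "\<bar>partial i v1 p\<bar> \<le> M" if "i \<in> Basis" for i p
      unfolding pu using pboundD(2)[OF M that, of p] abs_Re_le_cmod[of "partial i \<Upsilon> p"] abs_Im_le_cmod[of "partial i \<Upsilon> p"]
      by simp_all
    show "\<bar>partial i (partial j u1) p\<bar> \<le> M" "\<bar>partial i (partial j v1) p\<bar> \<le> M" if "i \<in> Basis" "j \<in> Basis" for i j p
      unfolding pu2[OF that(2)] using pboundD(3)[OF M that(2,1), of p]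
        abs_Re_le_cmod[of "partial i (partial j \<Upsilon>) p"] abs_Im_le_cmod[of "partial i (partial j \<Upsilon>) p"]
      by simp_all
    show "\<bar>1 - (u1 p)\<^sup>2 - (v1 p)\<^sup>2\<bar> \<le> \<theta>" "9 / 10 \<le> u1 p" "u1 p \<le> 2" "\<bar>v1 p\<bar> \<le> 1" if "X \<le> fst p" for p
      using parts[OF that] \<theta>0 by (intro wle[OF that] | linarith)+
    show "\<exists>N. \<forall>x\<ge>N. \<forall>y. \<bar>v1 (x, y)\<bar> \<le> e" if "0 < e" for e using lim_v[OF that] by blast
    \<comment> \<open>From the defect and the imaginary part tending to zero, through (u - 1) (u +
      1) = - (1 - u^2 - v^2) - v^2 with u + 1 at least 1.\<close>
    show "\<exists>N. \<forall>x\<ge>N. \<forall>y. \<bar>u1 (x, y) - 1\<bar> \<le> e" if e: "0 < e" for e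
    proof -
      have "0 < e / 2" using e by simp
      obtain N1 where N1: "X \<le> N1" "\<And>x y. N1 \<le> x \<Longrightarrow> \<bar>v1 (x, y)\<bar> \<le> e / 2" using lim_v[OF \<open>0 < e / 2\<close>] by blast
      obtain N2 where N2: "\<And>x y. N2 \<le> x \<Longrightarrow> \<bar>1 - (cmod (\<Upsilon> (x, y)))\<^sup>2\<bar> \<le> e / 2" using lim_w[OF \<open>0 < e / 2\<close>] by blast
      have "\<bar>u1 (x, y) - 1\<bar> \<le> e" if x: "max N1 N2 \<le> x" for x y
      proof -
        have xX: "X \<le> fst (x, y)" using x N1(1) by simp
        have n: "\<bar>u1 (x, y) - 1\<bar> \<le> \<theta> / 10" "\<bar>v1 (x, y)\<bar> \<le> \<theta> / 10" using parts[OF xX] .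
        have u2: "1 \<le> \<bar>u1 (x, y) + 1\<bar>" and v1: "\<bar>v1 (x, y)\<bar> \<le> 1" using n \<theta>0 by linarith+
        have "\<bar>u1 (x, y) - 1\<bar> * 1 \<le> \<bar>u1 (x, y) - 1\<bar> * \<bar>u1 (x, y) + 1\<bar>" by (rule mult_left_mono[OF u2 abs_ge_zero])
        also have "\<dots> = \<bar>(u1 (x, y) - 1) * (u1 (x, y) + 1)\<bar>" by (simp only: abs_mult)
        also have "(u1 (x, y) - 1) * (u1 (x, y) + 1) = - (1 - (cmod (\<Upsilon> (x, y)))\<^sup>2) - v1 (x, y) * v1 (x, y)"
          unfolding sq by (simp add: u1_def v1_def power2_eq_square algebra_simps)
        also have "\<bar>\<dots>\<bar> \<le> e / 2 + e / 2"
        proof -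
          have "\<bar>v1 (x, y) * v1 (x, y)\<bar> \<le> 1 * (e / 2)" unfolding abs_mult using N1(2)[of x y] x by (intro mult_mono[OF v1]) simp_all
          moreover have "\<bar>1 - (cmod (\<Upsilon> (x, y)))\<^sup>2\<bar> \<le> e / 2" using N2 x by simp
          moreover have "\<bar>- A - B\<bar> \<le> e / 2 + e / 2" if "\<bar>B\<bar> \<le> 1 * (e / 2)" "\<bar>A\<bar> \<le> e / 2" for A B
            using that by linarith
          ultimately show ?thesis by blast
        qed
        finally show ?thesis by simp
      qed
      then show ?thesis by blast
    qed
  qed (use d \<tau> X \<theta>0 in auto)
  have two: "exp (\<tau> * fst p) * cmod z \<le> 2 * k" if "\<bar>Re z\<bar> \<le> k * E p" "\<bar>Im z\<bar> \<le> k * E p" for z k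
  proof -
    have "exp (\<tau> * fst p) * cmod z \<le> exp (\<tau> * fst p) * (2 * k * E p)"
      using that cmod_le[of z] by (intro mult_left_mono) auto
    also have "\<dots> = 2 * k * (exp (\<tau> * fst p) * E p)" by simp
    also have "exp (\<tau> * fst p) * E p = 1" by (simp add: E_def flip: exp_add)
    finally show ?thesis by simp
  qed
  show "exp (\<tau> * fst p) * cmod (partial v \<Upsilon> p) \<le> 2 * K1"
    using derivative_decay(1)[OF p v v, of u1] derivative_decay(1)[OF p v v, of v1] by (intro two) (simp_all add: pu)
  show "exp (\<tau> * fst p) * cmod (partial w (partial v \<Upsilon>) p) \<le> 2 * K2" if w: "w \<in> Basis"
    using derivative_decay(2)[OF p v w, of u1] derivative_decay(2)[OF p v w, of v1] by (intro two) (simp_all add: pu2[OF v])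
qed

lemma even_extension_minus_S0:
  assumes Y: "even_extension d \<psi> \<Upsilon>" and d: "0 < d" and b: "wbound \<sigma> d (\<lambda>p. \<psi> p - S0 p) c"
  shows "pbound \<sigma> (\<lambda>p. \<Upsilon> p - S0 p) c p"
proof (rule pbound_plane[OF d C2_on_diff[OF open_UNIV even_extensionD(2)[OF Y] S0_C2(1)]])
  fix p assume p: "p \<in> strip d"
  have "pbound \<sigma> (\<lambda>p. \<Upsilon> p - S0 p) c p \<longleftrightarrow> pbound \<sigma> (\<lambda>p. \<psi> p - S0 p) c p"
    by (rule pbound_cong[OF _ p]) (simp add: even_extensionD(3)[OF Y])
  then show "pbound \<sigma> (\<lambda>p. \<Upsilon> p - S0 p) c p" using b p by (simp add: wbound_iff)
qed (simp_all add: even_extensionD(4,5)[OF Y] S0_eq)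

lemma even_extension_pbound:
  assumes Y: "even_extension d \<psi> \<Upsilon>" and d: "0 < d" and b: "wbound \<sigma> d \<psi> c"
  shows "pbound \<sigma> \<Upsilon> c p"
proof (rule pbound_plane[OF d even_extensionD(2)[OF Y]])
  fix p assume p: "p \<in> strip d"
  have "pbound \<sigma> \<Upsilon> c p \<longleftrightarrow> pbound \<sigma> \<psi> c p" by (rule pbound_cong[OF even_extensionD(3)[OF Y] p])
  then show "pbound \<sigma> \<Upsilon> c p" using b p by (simp add: wbound_iff)
qed (simp_all add: even_extensionD(4,5)[OF Y])

context branch
begin

text \<open>\<open>K\<close> is chosen before \<open>d\<close>; only the choice of how close
  \<open>d\<close> is to the critical width depends on the decay rate \<open>\<tau>\<close>, which
  must stay below the limit 1 / sqrt 2 of pi / d.\<close>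

lemma eventually_decay:
  assumes k1: "k = 1" and \<tau>: "0 < \<tau>" "\<tau> < 1 / sqrt 2"
  shows "\<exists>K. \<forall>\<^sub>F d in at_right (dcrit k). \<forall>\<Upsilon> p. even_extension d (\<Psi> d) \<Upsilon> \<longrightarrow> pbound \<tau> \<Upsilon> K p"
proof -
  define a where "a = (\<tau> + 1 / sqrt 2) / 2"
  define \<theta> where "\<theta> = (a\<^sup>2 - \<tau>\<^sup>2) / 2"
  define e where "e = \<theta> / 20"
  have a: "\<tau> < a" "a < 1 / sqrt 2" "0 < a" using \<tau> by (simp_all add: a_def)
  have "a\<^sup>2 \<le> (1 / sqrt 2)\<^sup>2" using a by (intro power_mono) auto
  then have a2: "a\<^sup>2 \<le> 1 / 2" by (simp add: power_divide)
  have "\<tau>\<^sup>2 < a\<^sup>2" using \<tau> a by (intro power_strict_mono) auto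
  then have \<theta>: "0 < \<theta>" by (simp add: \<theta>_def)
  then have e: "0 < e" by (simp add: e_def)
  obtain X where X: "0 \<le> X" "\<And>x. X \<le> x \<Longrightarrow> 1 - e \<le> kink x" using kink_far[OF e] by blast
  \<comment> \<open>At the critical width 1 / sqrt 2 times half the width is pi / 2, so
    \<open>a\<close> leaves room below; \<open>\<beta>\<close> is placed in this gap so that cos
    beta bounds the barrier from below for all nearby \<open>d\<close>.\<close>
  define \<beta> where "\<beta> = (a * (dcrit k / 2) + pi / 2) / 2"
  have "a * (dcrit k / 2) < 1 / sqrt 2 * (dcrit k / 2)" using a dcrit_pos[OF k] by (intro mult_strict_right_mono) auto
  also have "\<dots> = pi / 2" by (simp add: dcrit_def k1)
  finally have \<beta>: "a * (dcrit k / 2) < \<beta>" "\<beta> < pi / 2" by (simp_all add: \<beta>_def)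
  have "((\<lambda>d. a * (d / 2)) \<longlongrightarrow> a * (dcrit k / 2)) (at_right (dcrit k))" by (intro tendsto_intros) auto
  then have ev: "\<forall>\<^sub>F d in at_right (dcrit k). a * (d / 2) < \<beta>" by (rule order_tendstoD) (rule \<beta>)
  \<comment> \<open>The bound 3 on the derivatives is 1 for the distance to the kink plus 2 for the
    kink.\<close>
  define K1 K2 where "K1 = 2 * gl_decay.K1 \<tau> (cos \<beta>) X 3 \<theta>" and "K2 = 2 * gl_decay.K2 \<tau> (cos \<beta>) X 3 \<theta>"
  define K where "K = max (max K1 K2) (3 * exp (\<tau> * (X + 2)))"
  show ?thesis
  proof (rule exI[of _ K])
    show "\<forall>\<^sub>F d in at_right (dcrit k). \<forall>\<Upsilon> p. even_extension d (\<Psi> d) \<Upsilon> \<longrightarrow> pbound \<tau> \<Upsilon> K p"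
      using ev close_to_S0[OF e] close_to_S0[OF zero_less_one] eventually_reflection_invariant[OF k1] eventually_range[OF l_pos]
    proof eventually_elim
      case (elim d)
      have d: "dcrit k < d" "d < dcrit k + l" and d0: "0 < d" using elim(5) d_pos by auto
      show ?case
      proof (intro allI impI)
        fix \<Upsilon> p assume Y: "even_extension d (\<Psi> d) \<Upsilon>"
        note C2 = even_extensionD(2)[OF Y]
        have M: "pbound 0 \<Upsilon> 3 p" for p
        proof (rule pbound_plane[OF d0 C2])
          fix p assume "p \<in> strip d"
          then have "pbound 0 \<Upsilon> (1 + 2) p" by (intro pbound_branch[OF d Y elim(3)]) auto
          then show "pbound 0 \<Upsilon> 3 p" by simp
        qed (simp_all add: even_extensionD(4,5)[OF Y])
        have near: "cmod (\<Upsilon> p - 1) \<le> \<theta> / 10" if p: "X \<le> fst p" for p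
        proof -
          have "cmod (\<Upsilon> p - S0 p) \<le> e" by (rule pboundD(1)[OF even_extension_minus_S0[OF Y d0 elim(2)]])
          moreover have "S0 p - 1 = complex_of_real (kink (fst p) - 1)" by (simp add: S0_eq)
          then have "cmod (S0 p - 1) = \<bar>kink (fst p) - 1\<bar>" by (simp only: norm_of_real real_norm_def)
          then have "cmod (S0 p - 1) \<le> e" using X(2)[OF p] kink_bounds[of "fst p"] by linarith
          moreover have "cmod (\<Upsilon> p - 1) \<le> cmod (\<Upsilon> p - S0 p) + cmod (S0 p - 1)" by norm
          ultimately show ?thesis by (simp add: e_def)
        qed
        have R: "reflection d (\<Psi> d) q = \<Psi> d q" if "q \<in> strip d" for q using elim(4) that by blast
        obtain K' where K': "0 \<le> K'" "wbound \<sigma> d (\<Psi> d) K'" using admissibleD[OF admissible[OF d]] by blast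
        have anti: "\<Upsilon> (x, y + d) = cnj (\<Upsilon> (x, y))" for x y by (rule even_extension_shift[OF Y d0 R])
        have sym: "\<Upsilon> (- x, y) = - cnj (\<Upsilon> (x, y))" for x y
          by (rule even_extension_symmetric[OF Y d0 symmetric[OF d]])
        note right = right_decay[OF Y d0 anti _ X(1) M even_extension_pbound[OF Y d0 K'(2)] \<sigma>_pos \<tau>(1) a(1) a2
          \<theta>_def less_imp_le[OF elim(1)] \<beta>(2), folded K1_def K2_def, OF near]
        have 1: "pbound \<tau> \<Upsilon> K p" if p: "0 \<le> fst p" for p
        proof -
          have "(1::real) \<le> exp (\<tau> * (X + 2))" using \<tau>(1) X(1) by simp
          then have "cmod (\<Upsilon> p) \<le> 3 * exp (\<tau> * (X + 2))" using pboundD(1)[OF M, of p] by linarith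
          then have "cmod (\<Upsilon> p) \<le> K" by (simp add: K_def le_max_iff_disj)
          moreover have "exp (\<tau> * \<bar>fst p\<bar>) * cmod (partial v \<Upsilon> p) \<le> K" if v: "v \<in> Basis" for v
          proof (cases "X + 2 \<le> fst p")
            case True
            then show ?thesis using right(1)[of p v] True v p by (simp add: K_def le_max_iff_disj)
          next
            case False
            have "exp (\<tau> * \<bar>fst p\<bar>) * cmod (partial v \<Upsilon> p) \<le> exp (\<tau> * (X + 2)) * 3"
              using False p \<tau>(1) pboundD(2)[OF M v, of p] by (intro mult_mono) auto
            then show ?thesis by (simp add: K_def le_max_iff_disj mult.commute)
          qed
          moreover have "exp (\<tau> * \<bar>fst p\<bar>) * cmod (partial w (partial v \<Upsilon>) p) \<le> K" if v: "v \<in> Basis" and w: "w \<in> Basis" for v w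
          proof (cases "X + 2 \<le> fst p")
            case True
            then show ?thesis using right(2)[of p v w] True v w p by (simp add: K_def le_max_iff_disj)
          next
            case False
            have "exp (\<tau> * \<bar>fst p\<bar>) * cmod (partial w (partial v \<Upsilon>) p) \<le> exp (\<tau> * (X + 2)) * 3"
              using False p \<tau>(1) pboundD(3)[OF M v w, of p] by (intro mult_mono) auto
            then show ?thesis by (simp add: K_def le_max_iff_disj mult.commute)
          qed
          ultimately show ?thesis unfolding pbound_def by blast
        qed
        \<comment> \<open>The comparison concerns only the right half-plane; the symmetry in x
          carries the bound to the left one.\<close>
        have L: "bounded_linear (\<lambda>z. - cnj z)" by (intro bounded_linear_minus bounded_linear_cnj)
        have "pbound \<tau> \<Upsilon> K (diag_map (- 1) 1 (0, 0) p) \<longleftrightarrow> pbound \<tau> \<Upsilon> K p"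
          by (rule pbound_isometry[OF C2 L])
            (simp_all add: diag_map_def sym)
        then show "pbound \<tau> \<Upsilon> K p"
          using 1[of p] 1[of "diag_map (- 1) 1 (0, 0) p"] by (cases "0 \<le> fst p") (auto simp: diag_map_def)
      qed
    qed
  qed
qed

text \<open>The domain is split at a distance \<open>N\<close>: beyond it the faster decay at a rate
  \<open>\<tau> > s\<close> gains the factor exp (- (tau - s) N); within it the weight is at most
  exp (s N), which the unweighted closeness absorbs.\<close>

lemma eventually_weighted_small:
  assumes k1: "k = 1" and s: "0 < s" "s < 1 / sqrt 2" and e: "0 < e"
  shows "\<forall>\<^sub>F d in at_right (dcrit k). \<forall>\<Upsilon> p. even_extension d (\<Psi> d) \<Upsilon> \<longrightarrow> pbound s (\<lambda>p. \<Upsilon> p - S0 p) e p"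
proof -
  define \<tau> where "\<tau> = (s + 1 / sqrt 2) / 2"
  have \<tau>: "s < \<tau>" "\<tau> < 1 / sqrt 2" "0 < \<tau>" using s by (simp_all add: \<tau>_def)
  obtain K where K: "\<forall>\<^sub>F d in at_right (dcrit k). \<forall>\<Upsilon> p. even_extension d (\<Psi> d) \<Upsilon> \<longrightarrow> pbound \<tau> \<Upsilon> K p"
    using eventually_decay[OF k1 \<tau>(3,2)] by blast
  have "((\<lambda>x. exp (- (\<tau> - s) * x) * (K + 2)) \<longlongrightarrow> 0 * (K + 2)) at_top"
    using \<tau> by (intro tendsto_intros exp_neg_tendsto_0) simp
  then have "\<forall>\<^sub>F x in at_top. exp (- (\<tau> - s) * x) * (K + 2) < e" by (rule order_tendstoD) (use e in simp)
  then have "\<forall>\<^sub>F x in at_top. 0 \<le> x \<and> exp (- (\<tau> - s) * x) * (K + 2) < e" by (intro eventually_conj eventually_ge_at_top)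
  then obtain N where N: "0 \<le> N" "exp (- (\<tau> - s) * N) * (K + 2) < e"
    using eventually_happens'[OF trivial_limit_at_top_linorder] by blast
  \<comment> \<open>The unweighted tolerance that becomes \<open>e\<close> after multiplication by
    the largest weight on the inner part.\<close>
  define e1 where "e1 = e * exp (- s * N)"
  have e1: "0 < e1" "e1 \<le> e" "exp (s * N) * e1 = e"
  proof -
    show "0 < e1" using e by (simp add: e1_def)
    have "exp (- s * N) \<le> 1" using s N(1) by simp
    then show "e1 \<le> e" unfolding e1_def using e by (simp only: mult_left_le less_imp_le)
    have "exp (s * N) * e1 = e * exp (s * N + - s * N)" unfolding e1_def exp_add by (simp only: mult.left_commute)
    then show "exp (s * N) * e1 = e" by simp
  qed
  show ?thesis
    using K close_to_S0[OF e1(1)] eventually_range[OF l_pos]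
  proof eventually_elim
    case (elim d)
    have d0: "0 < d" using elim(3) d_pos by auto
    show ?case
    proof (intro allI impI)
      fix \<Upsilon> p assume Y: "even_extension d (\<Psi> d) \<Upsilon>"
      have b0: "pbound 0 (\<lambda>p. \<Upsilon> p - S0 p) e1 p" by (rule even_extension_minus_S0[OF Y d0 elim(2)])
      have "pbound \<tau> \<Upsilon> K p" using elim(1) Y by blast
      then have b1: "pbound \<tau> (\<lambda>p. \<Upsilon> p - S0 p) (K + 2) p"
        using \<tau>(2) by (intro pbound_diff even_extensionD(2)[OF Y] S0_C2(1) pbound_S0) simp_all
      have ip: "exp (s * \<bar>fst p\<bar>) * r \<le> e" if r: "0 \<le> r" "exp (0 * \<bar>fst p\<bar>) * r \<le> e1" "exp (\<tau> * \<bar>fst p\<bar>) * r \<le> K + 2" for r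
      proof (cases "\<bar>fst p\<bar> \<le> N")
        case True
        have "exp (s * \<bar>fst p\<bar>) * r \<le> exp (s * N) * e1" using True r s by (intro mult_mono) auto
        then show ?thesis by (simp only: e1(3))
      next
        case False
        have "exp (s * \<bar>fst p\<bar>) * r = exp (- (\<tau> - s) * \<bar>fst p\<bar> + \<tau> * \<bar>fst p\<bar>) * r" by (simp add: algebra_simps)
        also have "\<dots> = exp (- (\<tau> - s) * \<bar>fst p\<bar>) * (exp (\<tau> * \<bar>fst p\<bar>) * r)" by (simp only: exp_add mult.assoc)
        also have "\<dots> \<le> exp (- (\<tau> - s) * N) * (K + 2)"
        proof (rule mult_mono)
          have "(\<tau> - s) * N \<le> (\<tau> - s) * \<bar>fst p\<bar>" using False \<tau> by (intro mult_left_mono) auto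
          then show "exp (- (\<tau> - s) * \<bar>fst p\<bar>) \<le> exp (- (\<tau> - s) * N)" by (simp only: exp_le_cancel_iff mult_minus_left neg_le_iff_le)
        qed (use r in auto)
        finally show ?thesis using N(2) by linarith
      qed
      show "pbound s (\<lambda>p. \<Upsilon> p - S0 p) e p"
        unfolding pbound_def
      proof (intro conjI ballI)
        show "cmod (\<Upsilon> p - S0 p) \<le> e" using pboundD(1)[OF b0] e1(2) by linarith
        fix v :: plane assume v: "v \<in> Basis"
        show "exp (s * \<bar>fst p\<bar>) * cmod (partial v (\<lambda>p. \<Upsilon> p - S0 p) p) \<le> e"
          by (rule ip[OF norm_ge_zero pboundD(2)[OF b0 v] pboundD(2)[OF b1 v]])
        fix w :: plane assume w: "w \<in> Basis"
        show "exp (s * \<bar>fst p\<bar>) * cmod (partial w (partial v (\<lambda>p. \<Upsilon> p - S0 p)) p) \<le> e"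
          by (rule ip[OF norm_ge_zero pboundD(3)[OF b0 v w] pboundD(3)[OF b1 v w]])
      qed
    qed
  qed
qed

end


subsection \<open>The branches with several vortices\<close>

lemma even_extension_translate:
  assumes Y: "even_extension d \<psi> \<Upsilon>" and anti: "\<And>x y. \<Upsilon> (x, y + d) = cnj (\<Upsilon> (x, y))"
  shows "\<Upsilon> (x, y + of_int j * d) = (if even j then \<Upsilon> (x, y) else cnj (\<Upsilon> (x, y)))"
proof (cases "even j")
  case True
  then obtain m where "j = 2 * m" by blast
  then have "y + of_int j * d = y + 2 * d * of_int m" by simp
  then show ?thesis using True by (simp only: even_extensionD(5)[OF Y] if_True)
next
  case False
  then obtain m where "j = 2 * m + 1" by (rule oddE)
  then have "y + of_int j * d = (y + d) + 2 * d * of_int m" by (simp add: algebra_simps)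
  then show ?thesis using False by (simp only: even_extensionD(5)[OF Y] anti if_False)
qed

text \<open>One eventual statement for each \<open>k\<close>, from which the theorem reads a single
  threshold. For k = 1 it also contains the reflection invariance on the strip of width
  \<open>d\<close>.\<close>

lemma branch_structure:
  assumes b1: "branch \<Lambda> 1 l1 \<sigma>1 \<Psi>1" and bk: "branch \<Lambda> k lk \<sigma>k \<Psi>k"
  shows "\<forall>\<^sub>F d in at_right (dcrit k).
    C1_on (strip d) (\<Psi>k d) \<and> sign_pattern k d (\<Psi>k d) \<and> (\<forall>j<k. \<Psi>k d (0, node k d j) = 0) \<and>
    (\<forall>p\<in>strip (d / real k). reflection (d / real k) (\<Psi>1 (d / real k)) p = \<Psi>1 (d / real k) p) \<and>
    (\<forall>p\<in>strip (d / real k). \<Psi>k d p = \<Psi>1 (d / real k) p) \<and>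
    (\<exists>\<Upsilon>. is_extension (d / real k) (\<Psi>1 (d / real k)) \<Upsilon> \<and> (\<forall>p\<in>strip d. \<Psi>k d p = \<Upsilon> p))"
proof -
  interpret B1: branch \<Lambda> 1 l1 \<sigma>1 \<Psi>1 by (rule b1)
  interpret Bk: branch \<Lambda> k lk \<sigma>k \<Psi>k by (rule bk)
  have k: "0 < real k" using Bk.k by simp
  obtain r where r: "0 < r" and u: "\<forall>d. dcrit k < d \<and> d < dcrit k + lk \<longrightarrow>
     admissible_solution \<sigma>k d S0 \<and> W2inf_norm \<sigma>k d (\<lambda>p. \<Psi>k d p - S0 p) < ennreal r \<and>
     (\<forall>\<psi>. admissible_solution \<sigma>k d \<psi> \<and> W2inf_norm \<sigma>k d (\<lambda>p. \<psi> p - S0 p) < ennreal r \<longrightarrow>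
        (\<forall>p\<in>strip d. \<psi> p = S0 p) \<or> (\<forall>p\<in>strip d. \<psi> p = \<Psi>k d p) \<or> (\<forall>p\<in>strip d. \<psi> p = cnj (\<Psi>k d p)))"
    using Bk.uniqueness by blast
  \<comment> \<open>\<open>r / 14\<close> because passing from pointwise bounds to the norm costs a
    factor 7; 1 / 4 because the kink is at least 3 / 4 far out and the modulus has to remain at
    least 1 / 2.\<close>
  define e where "e = min (r / 14) (1 / 4)"
  have e: "0 < e" "e \<le> 1 / 4" "7 * e < r" using r by (simp_all add: e_def min_def)
  obtain X where X: "\<And>x. X \<le> \<bar>x\<bar> \<Longrightarrow> 1 - 1 / 4 \<le> \<bar>kink x\<bar>" using kink_far[of "1 / 4"] by auto
  \<comment> \<open>As \<open>d\<close> decreases to \<open>dcrit k\<close>, the width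
    \<open>d / k\<close> decreases to \<open>dcrit 1\<close>, so eventual properties of the first
    branch become eventual in \<open>d\<close>.\<close>
  have "filterlim (\<lambda>d. d / real k) (at_right (dcrit 1)) (at_right (dcrit k))"
    unfolding filterlim_at
  proof
    have "((\<lambda>d. d / real k) \<longlongrightarrow> dcrit k / real k) (at_right (dcrit k))" using k by (intro tendsto_intros) simp
    then show "((\<lambda>d. d / real k) \<longlongrightarrow> dcrit 1) (at_right (dcrit k))" using k by (simp add: dcrit_def)
    show "\<forall>\<^sub>F d in at_right (dcrit k). d / real k \<in> {dcrit 1<..} \<and> d / real k \<noteq> dcrit 1"
      using Bk.eventually_range[OF Bk.l_pos]
    proof eventually_elim
      case (elim d)
      have "dcrit 1 < d / real k" using elim k by (simp add: dcrit_def less_divide_eq)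
      then show ?case by simp
    qed
  qed
  note lift = filterlim_iff[THEN iffD1, OF this, rule_format]
  show ?thesis
    using lift[OF B1.eventually_weighted_small[OF refl Bk.\<sigma>_pos Bk.weight_less_decay e(1)]]
      lift[OF B1.eventually_reflection_invariant[OF refl]] lift[OF B1.eventually_sign_pattern]
      lift[OF B1.eventually_range[OF B1.l_pos]] Bk.eventually_sign_pattern Bk.eventually_range[OF Bk.l_pos]
  proof eventually_elim
    case (elim d)
    define d' where "d' = d / real k"
    have d: "dcrit k < d" "d < dcrit k + lk" and d': "dcrit 1 < d'" "d' < dcrit 1 + l1"
      using elim(4,6) by (simp_all add: d'_def)
    have d0: "0 < d" "0 < d'" "d' \<le> d" using Bk.d_pos[OF d(1)] B1.d_pos[OF d'(1)] Bk.k by (simp_all add: d'_def divide_le_eq)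
    have dd': "d = real k * d'" using k by (simp add: d'_def)
    have R: "reflection d' (\<Psi>1 d') p = \<Psi>1 d' p" if "p \<in> strip d'" for p using elim(2) that by (simp add: d'_def)
    obtain \<Upsilon> where Y: "even_extension d' (\<Psi>1 d') \<Upsilon>" using B1.even_extension_exists[OF d'] by blast
    note C2 = even_extensionD(2)[OF Y] and GL = even_extensionD(1)[OF Y]
    have anti: "\<Upsilon> (x, y + d') = cnj (\<Upsilon> (x, y))" for x y by (rule even_extension_shift[OF Y d0(2) R])
    have sym: "\<Upsilon> (- x, y) = - cnj (\<Upsilon> (x, y))" for x y
      by (rule even_extension_symmetric[OF Y d0(2) B1.symmetric[OF d']])
    have small: "pbound \<sigma>k (\<lambda>p. \<Upsilon> p - S0 p) e p" for p using elim(1) Y unfolding d'_def by blast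
    have cD: "C2_on (strip d) (\<lambda>p. \<Upsilon> p - S0 p)" by (intro C2_on_strip C2_on_diff open_UNIV C2 S0_C2(1))
    have "W2inf_norm \<sigma>k d (\<lambda>p. \<Upsilon> p - S0 p) \<le> ennreal (7 * e)"
      using small e(1) by (intro W2inf_norm_le_of_wbound[OF cD]) (simp_all add: wbound_iff)
    also have "\<dots> < ennreal r" using e by (intro ennreal_lessI) auto
    finally have norm: "W2inf_norm \<sigma>k d (\<lambda>p. \<Upsilon> p - S0 p) < ennreal r" .
    have adm: "admissible_solution \<sigma>k d \<Upsilon>"
    proof (rule admissibleI[OF Bk.\<sigma>_pos])
      \<comment> \<open>\<open>d\<close> is \<open>k\<close> times \<open>d'\<close>, and the
        extension is even about every multiple of \<open>d'\<close>.\<close>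
      have "\<Upsilon> (x, 2 * d - y) = \<Upsilon> (x, y)" for x y
        using even_extensionD(6)[OF Y, of x "int k" y] by (simp add: dd' mult_ac)
      then show "neumann_solution d \<Upsilon>" by (rule neumann_of_plane[OF GL even_extensionD(4)[OF Y]])
      show "\<Upsilon> (- x, y) = - cnj (\<Upsilon> (x, y))" for x y by (rule sym)
      have "pbound \<sigma>k (\<lambda>p. (\<Upsilon> p - S0 p) + S0 p) (e + 2) p" for p
        using Bk.weight_less_decay
        by (intro pbound_add[OF open_UNIV C2_on_diff[OF open_UNIV C2 S0_C2(1)] S0_C2(1) UNIV_I small] pbound_S0) simp
      then show "wbound \<sigma>k d \<Upsilon> (e + 2)" by (simp add: wbound_iff)
      show "0 \<le> e + 2" using e by simp
      show "1 / 2 \<le> cmod (\<Upsilon> p)" if "X \<le> \<bar>fst p\<bar>" for p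
      proof -
        have "cmod (\<Upsilon> p - S0 p) \<le> e" by (rule pboundD(1)[OF small])
        moreover have "3 / 4 \<le> cmod (S0 p)" using X[OF that] by (simp add: S0_eq)
        moreover have "cmod (S0 p) \<le> cmod (\<Upsilon> p) + cmod (\<Upsilon> p - S0 p)" by norm
        ultimately show ?thesis using e(2) by linarith
      qed
    qed
    have cases: "(\<forall>p\<in>strip d. \<Upsilon> p = S0 p) \<or> (\<forall>p\<in>strip d. \<Upsilon> p = \<Psi>k d p) \<or> (\<forall>p\<in>strip d. \<Upsilon> p = cnj (\<Psi>k d p))"
      using u d adm norm by blast
    \<comment> \<open>At this height both leading modes have phase pi / 4, so both imaginary parts
      are positive. This rules out the kink and the conjugate branch among the three
      solutions.\<close>
    define y where "y = d' / 4"
    have y: "0 < y" "y < d'" "y < d" using d0 by (simp_all add: y_def)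
    have c: "pi * real 1 / d' * y = pi / 4" "pi * real k / d * y = pi / 4" using d0 k by (simp_all add: y_def d'_def)
    have "(1::real) \<le> sqrt 2" by simp
    then have h: "1 / 2 \<le> \<bar>cos (pi / 4 :: real)\<bar>" "0 < cos (pi / 4 :: real)" by (simp_all add: cos_45)
    have "0 < Im (\<Psi>1 d' (0, y))"
      using sign_pattern_cos[OF elim(3)[folded d'_def] y(1,2)] h unfolding c by (simp add: zero_less_mult_iff)
    then have i1: "0 < Im (\<Upsilon> (0, y))" using even_extensionD(3)[OF Y, of "(0, y)"] y by (simp add: mem_strip)
    have i2: "0 < Im (\<Psi>k d (0, y))"
      using sign_pattern_cos[OF elim(5) y(1,3)] h unfolding c by (simp add: zero_less_mult_iff)
    have yd: "(0, y) \<in> strip d" using y by (simp add: mem_strip)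
    have "\<not> (\<forall>p\<in>strip d. \<Upsilon> p = S0 p)"
    proof
      assume "\<forall>p\<in>strip d. \<Upsilon> p = S0 p"
      then have "\<Upsilon> (0, y) = S0 (0, y)" using yd by blast
      then show False using i1 by (simp add: S0_eq)
    qed
    moreover have "\<not> (\<forall>p\<in>strip d. \<Upsilon> p = cnj (\<Psi>k d p))"
    proof
      assume "\<forall>p\<in>strip d. \<Upsilon> p = cnj (\<Psi>k d p)"
      then have "\<Upsilon> (0, y) = cnj (\<Psi>k d (0, y))" using yd by blast
      then show False using i1 i2 by simp
    qed
    ultimately have eq: "\<Upsilon> p = \<Psi>k d p" if "p \<in> strip d" for p using cases that by blast
    \<comment> \<open>On the middle line the value is real by the y-symmetries; at x = 0 it is
      purely imaginary by the x-symmetry.\<close>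
    have "\<Upsilon> (0, d' / 2) = cnj (\<Upsilon> (0, d' / 2))"
    proof -
      have h: "2 * d' - d' / 2 = d' / 2 + d'" by simp
      show ?thesis using even_extensionD(7)[OF Y, of 0 "d' / 2"] unfolding h anti by simp
    qed
    then have "Im (\<Upsilon> (0, d' / 2)) = 0" by (metis Reals_cnj_iff complex_is_Real_iff)
    moreover have "\<Upsilon> (0, d' / 2) = - cnj (\<Upsilon> (0, d' / 2))" using sym[of 0 "d' / 2"] by simp
    from arg_cong[OF this, of Re] have "Re (\<Upsilon> (0, d' / 2)) = 0" by simp
    ultimately have z: "\<Upsilon> (0, d' / 2) = 0" by (simp add: complex_eq_iff)
    have zero: "\<Psi>k d (0, node k d j) = 0" if j: "j < k" for j
    proof -
      \<comment> \<open>The nodes are the translates of the middle height by multiples of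
        \<open>d'\<close>, so the zero is carried to each of them.\<close>
      have n: "node k d j = d' / 2 + of_int (int j) * d'" using k by (simp add: node_def dd' field_simps)
      have "real j + 1 \<le> real k" using j by linarith
      then have "(real j + 1) * d' \<le> real k * d'" using d0 by (intro mult_right_mono) auto
      then have "d' / 2 + of_int (int j) * d' < real k * d'" using d0(2) by (simp add: algebra_simps)
      then have "node k d j < d" by (simp only: n flip: dd')
      moreover have "0 < node k d j" using d0(2) unfolding n by (simp add: add_pos_nonneg)
      ultimately have "(0, node k d j) \<in> strip d" by (simp add: mem_strip)
      then have "\<Psi>k d (0, node k d j) = \<Upsilon> (0, node k d j)" by (simp only: eq)
      also have "\<dots> = 0" unfolding n even_extension_translate[OF Y anti] by (simp add: z)
      finally show ?thesis .
    qed
    have sub: "p \<in> strip d" if "p \<in> strip d'" for p using that d0(3) by (auto simp: strip_def)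
    have is_ext: "is_extension d' (\<Psi>1 d') \<Upsilon>"
      unfolding is_extension_def
    proof (intro conjI allI impI)
      fix j :: int and x y :: real assume "(x, y) \<in> strip d'"
      then show "\<Upsilon> (x, y + of_int j * d') = (if even j then \<Psi>1 d' (x, y) else cnj (\<Psi>1 d' (x, y)))"
        unfolding even_extension_translate[OF Y anti] by (simp only: even_extensionD(3)[OF Y])
    qed (rule GL)
    have "C1_on (strip d) (\<Psi>k d)" using Bk.C2_branch[OF d] by (rule C2_on_C1)
    moreover have "\<Psi>k d p = \<Psi>1 d' p" if "p \<in> strip d'" for p
      using eq[OF sub[OF that]] even_extensionD(3)[OF Y that] by simp
    moreover have "\<exists>\<Upsilon>. is_extension d' (\<Psi>1 d') \<Upsilon> \<and> (\<forall>p\<in>strip d. \<Psi>k d p = \<Upsilon> p)"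
      using is_ext eq by (intro exI[of _ \<Upsilon>]) simp
    ultimately show ?case unfolding d'_def[symmetric] using elim(5) zero R by blast
  qed
qed

text \<open>The lengths of the bifurcation theorem are existential and understood to be small
  enough. This is expressed by thresholds below the given lengths, the conclusion holding for every
  choice of smaller lengths, the same in all three parts.\<close>

theorem corollary1:
  fixes \<Lambda> :: real and L \<sigma> :: "nat \<Rightarrow> real"
    and \<Psi> :: "nat \<Rightarrow> real \<Rightarrow> real \<times> real \<Rightarrow> complex"
  assumes "0 < \<Lambda>"
    and "\<And>k. 1 \<le> k \<Longrightarrow> bifurcation_branch \<Lambda> k (L k) (\<sigma> k) (\<Psi> k)"
  shows "\<exists>\<epsilon> :: nat \<Rightarrow> real. (\<forall>k\<ge>1. 0 < \<epsilon> k \<and> \<epsilon> k \<le> L k) \<and>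
    (\<forall>l :: nat \<Rightarrow> real. (\<forall>k\<ge>1. 0 < l k \<and> l k \<le> \<epsilon> k) \<longrightarrow>
      (\<forall>d\<in>{dcrit 1<..<dcrit 1 + l 1}.
         {p \<in> strip d. \<Psi> 1 d p = 0} = {(0, d / 2)} \<and>
         vortex (\<Psi> 1 d) (0, d / 2) \<and> has_degree (\<Psi> 1 d) (0, d / 2) (-1) \<and>
         (\<forall>p\<in>strip d. reflection d (\<Psi> 1 d) p = \<Psi> 1 d p)) \<and>
      (\<forall>k\<ge>1. \<forall>d\<in>{dcrit k<..<dcrit k + l k}.
         card {p \<in> strip d. vortex (\<Psi> k d) p} = k \<and>
         {p \<in> strip d. vortex (\<Psi> k d) p} =
           (\<lambda>j. (0, d * (2 * real j + 1) / (2 * real k))) ` {..<k} \<and>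
         (\<forall>j<k. has_degree (\<Psi> k d) (0, d * (2 * real j + 1) / (2 * real k)) ((-1) ^ (j + 1)))) \<and>
      (\<forall>k\<ge>1. \<forall>d\<in>{dcrit k<..<dcrit k + min (real k * l 1) (l k)}.
         (\<forall>p\<in>strip (d / real k). \<Psi> k d p = \<Psi> 1 (d / real k) p) \<and>
         (\<exists>\<Upsilon>. is_extension (d / real k) (\<Psi> 1 (d / real k)) \<Upsilon> \<and>
               (\<forall>p\<in>strip d. \<Psi> k d p = \<Upsilon> p))))"
proof -
  define Q where "Q k d \<longleftrightarrow> C1_on (strip d) (\<Psi> k d) \<and> sign_pattern k d (\<Psi> k d) \<and> (\<forall>j<k. \<Psi> k d (0, node k d j) = 0) \<and>
    (\<forall>p\<in>strip (d / real k). reflection (d / real k) (\<Psi> 1 (d / real k)) p = \<Psi> 1 (d / real k) p) \<and>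
    (\<forall>p\<in>strip (d / real k). \<Psi> k d p = \<Psi> 1 (d / real k) p) \<and>
    (\<exists>\<Upsilon>. is_extension (d / real k) (\<Psi> 1 (d / real k)) \<Upsilon> \<and> (\<forall>p\<in>strip d. \<Psi> k d p = \<Upsilon> p))" for k d
  have br: "branch \<Lambda> k (L k) (\<sigma> k) (\<Psi> k)" if "1 \<le> k" for k
    using assms that by (intro branch.intro) auto
  have "\<exists>\<delta>>0. \<delta> \<le> L k \<and> (\<forall>d. dcrit k < d \<and> d < dcrit k + \<delta> \<longrightarrow> Q k d)" if k: "1 \<le> k" for k
  proof -
    have "\<forall>\<^sub>F d in at_right (dcrit k). Q k d"
      using branch_structure[OF br[OF le_refl] br[OF k]] unfolding Q_def .
    then obtain b where b: "dcrit k < b" "\<And>d. dcrit k < d \<Longrightarrow> d < b \<Longrightarrow> Q k d" unfolding eventually_at_right_field by blast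
    then show ?thesis using branch.l_pos[OF br[OF k]] by (intro exI[of _ "min (b - dcrit k) (L k)"]) auto
  qed
  then obtain \<epsilon> where \<epsilon>: "\<And>k. 1 \<le> k \<Longrightarrow> 0 < \<epsilon> k \<and> \<epsilon> k \<le> L k \<and> (\<forall>d. dcrit k < d \<and> d < dcrit k + \<epsilon> k \<longrightarrow> Q k d)"
    by metis
  show ?thesis
  proof (intro exI[of _ \<epsilon>] conjI allI impI)
    show "0 < \<epsilon> k" "\<epsilon> k \<le> L k" if "1 \<le> k" for k using \<epsilon>[OF that] by blast+
    fix l :: "nat \<Rightarrow> real" assume l: "\<forall>k\<ge>1. 0 < l k \<and> l k \<le> \<epsilon> k"
    have Q: "Q k d" if "1 \<le> k" "dcrit k < d" "d < dcrit k + l k" for k d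
    proof -
      have "d < dcrit k + \<epsilon> k" using l that by force
      then show ?thesis using \<epsilon>[OF that(1)] that(2) by blast
    qed
    have d0: "0 < d" if "1 \<le> k" "dcrit k < d" for k d using dcrit_pos[OF that(1)] that(2) by simp
    have P: "C1_on (strip d) (\<Psi> k d)" "sign_pattern k d (\<Psi> k d)" "j < k \<Longrightarrow> \<Psi> k d (0, node k d j) = 0"
      if "Q k d" for k d j using that unfolding Q_def by blast+
    show "\<forall>d\<in>{dcrit 1<..<dcrit 1 + l 1}. {p \<in> strip d. \<Psi> 1 d p = 0} = {(0, d / 2)} \<and>
         vortex (\<Psi> 1 d) (0, d / 2) \<and> has_degree (\<Psi> 1 d) (0, d / 2) (-1) \<and>
         (\<forall>p\<in>strip d. reflection d (\<Psi> 1 d) p = \<Psi> 1 d p)"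
    proof
      fix d assume "d \<in> {dcrit 1<..<dcrit 1 + l 1}"
      then have d: "dcrit 1 < d" "d < dcrit 1 + l 1" by auto
      note q = Q[OF le_refl d]
      note P' = le_refl d0[OF le_refl d(1)] P[OF q]
      have n: "node 1 d 0 = d / 2" by (simp add: node_def)
      have "{p \<in> strip d. \<Psi> 1 d p = 0} = {(0, d / 2)}" using zeros_eq[OF P'] n by (simp add: lessThan_Suc)
      moreover have "vortex (\<Psi> 1 d) (0, d / 2)" using node_vortex[OF P', of 0] unfolding n by simp
      moreover have "has_degree (\<Psi> 1 d) (0, d / 2) (-1)" using node_degree[OF P', of 0] unfolding n by simp
      moreover have "\<forall>p\<in>strip d. reflection d (\<Psi> 1 d) p = \<Psi> 1 d p"
      proof -
        have e: "d / real 1 = d" by simp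
        show ?thesis using q unfolding Q_def e by blast
      qed
      ultimately show "{p \<in> strip d. \<Psi> 1 d p = 0} = {(0, d / 2)} \<and>
         vortex (\<Psi> 1 d) (0, d / 2) \<and> has_degree (\<Psi> 1 d) (0, d / 2) (-1) \<and>
         (\<forall>p\<in>strip d. reflection d (\<Psi> 1 d) p = \<Psi> 1 d p)" by blast
    qed
    fix k :: nat assume k: "1 \<le> k"
    show "\<forall>d\<in>{dcrit k<..<dcrit k + l k}. card {p \<in> strip d. vortex (\<Psi> k d) p} = k \<and>
         {p \<in> strip d. vortex (\<Psi> k d) p} = (\<lambda>j. (0, d * (2 * real j + 1) / (2 * real k))) ` {..<k} \<and>
         (\<forall>j<k. has_degree (\<Psi> k d) (0, d * (2 * real j + 1) / (2 * real k)) ((-1) ^ (j + 1)))"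
    proof
      fix d assume "d \<in> {dcrit k<..<dcrit k + l k}"
      then have d: "dcrit k < d" "d < dcrit k + l k" by auto
      note P' = k d0[OF k d(1)] P[OF Q[OF k d]]
      show "card {p \<in> strip d. vortex (\<Psi> k d) p} = k \<and>
         {p \<in> strip d. vortex (\<Psi> k d) p} = (\<lambda>j. (0, d * (2 * real j + 1) / (2 * real k))) ` {..<k} \<and>
         (\<forall>j<k. has_degree (\<Psi> k d) (0, d * (2 * real j + 1) / (2 * real k)) ((-1) ^ (j + 1)))"
        using card_vortices[OF P'] vortices_eq[OF P'] node_degree[OF P'] unfolding node_def by blast
    qed
    show "\<forall>d\<in>{dcrit k<..<dcrit k + min (real k * l 1) (l k)}.
         (\<forall>p\<in>strip (d / real k). \<Psi> k d p = \<Psi> 1 (d / real k) p) \<and>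
         (\<exists>\<Upsilon>. is_extension (d / real k) (\<Psi> 1 (d / real k)) \<Upsilon> \<and> (\<forall>p\<in>strip d. \<Psi> k d p = \<Upsilon> p))"
    proof
      fix d assume "d \<in> {dcrit k<..<dcrit k + min (real k * l 1) (l k)}"
      then have "dcrit k < d" "d < dcrit k + l k" by auto
      then have "Q k d" by (rule Q[OF k])
      then show "(\<forall>p\<in>strip (d / real k). \<Psi> k d p = \<Psi> 1 (d / real k) p) \<and>
         (\<exists>\<Upsilon>. is_extension (d / real k) (\<Psi> 1 (d / real k)) \<Upsilon> \<and> (\<forall>p\<in>strip d. \<Psi> k d p = \<Upsilon> p))"
        unfolding Q_def by blast
    qed
  qed
qed

end
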